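(* Let $d\in\mathbb{N}$, let $G:\mathbb{R}^d\times\mathbb{R}^d\to\mathbb{R}^d$ be a smooth vector field, let $M=M(x,v)$ be such that for every $x\in\mathbb{R}^d$ the function $v\mapsto M(x,v)$ is a probability density on $\mathbb{R}^d$, and let $L$ be either the Fokker-Planck operator $L_{\mathrm{FP}}f=\nabla_v\cdot\big(M\,\nabla_v(f/M)\big)$ or the BGK operator $L_{\mathrm{BGK}}f=\langle f\rangle M-f$. Assume the following three conditions. (1) Stationary state. There is a function $f_\infty=f_\infty(x,v)\ge 0$ with $$v\cdot\nabla_x f_\infty+\nabla_v\cdot(Gf_\infty)=Lf_\infty,\qquad \int_{\mathbb{R}^{2d}}f_\infty\,dx\,dv=1,\qquad \inf_{x\in\mathbb{R}^d}\inf_{|v|\le 1}\frac{f_\infty(x,v)}{\langle f_\infty\rangle(x)}=:c_\infty>0.$$ If $L=L_{\mathrm{FP}}$, assume also $\sup_{x}\sup_{|v|\le 1}\frac{|\nabla_v M|}{M}=:c_{\mathrm{MFP}}<\infty$; if $L=L_{\mathrm{BGK}}$, assume also $\sup_x\int_{|v|\le 1}M^2\,\frac{\langle f_\infty\rangle}{f_\infty}\,dv=:c_{\mathrm{MBGK}}<\infty$. (2) Local coercivity. There is $\lambda_1>0$ such that for all $x\in\mathbb{R}^d$ and all $g=g(v)$: if $L=L_{\mathrm{FP}}$, $$\int_{\mathbb{R}^d}\Big|g-\langle g\rangle\frac{f_\infty}{\langle f_\infty\rangle}\Big|^2\frac{dv}{f_\infty}\le\lambda_1\int_{\mathbb{R}^d}\Big|\nabla_v\Big(\frac{g}{f_\infty}\Big)\Big|^2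 f_\infty\,dv,$$ and if $L=L_{\mathrm{BGK}}$, $$\int_{\mathbb{R}^d}\Big|g-\langle g\rangle\frac{f_\infty}{\langle f_\infty\rangle}\Big|^2\frac{dv}{f_\infty}\le\frac{\lambda_1}{2}\int_{\mathbb{R}^{2d}}\Big(\frac{g(v)}{f_\infty(x,v)}-\frac{g(v_* )}{f_\infty(x,v_* )}\Big)^2 f_\infty(x,v)\,M(x,v_* )\,dv\,dv_*.$$ (3) Spatial coercivity. With the weight $$w(x)=1+\frac{\int_{|v|\le 1}f_\infty|G(x,v)|^2\,dv}{\langle f_\infty\rangle}+\Big(\int_{|v|\le 1}\Big|\nabla_x\Big(\frac{f_\infty}{\langle f_\infty\rangle}\Big)\Big|\,dv\Big)^2+\Big|\frac{\nabla_x\langle f_\infty\rangle}{\langle f_\infty\rangle}\Big|^2,$$ there exist a time $T>0$ and a constant $\lambda_2$ such that for every $g=g(t,x)$ on $[0,T]\times\mathbb{R}^d$ with $\int_{[0,T]\times\mathbb{R}^d}g\,dt\,dx=0$ there exists a vector field $\mathbf{F}:[0,T]\times\mathbb{R}^d\to\mathbb{R}^{1+d}$ satisfying $\nabla_{t,x}\cdot\mathbf{F}=g$ in $[0,T]\times\mathbb{R}^d$, $\mathbf{F}(0,x)=\mathbf{F}(T,x)=0$ for $x\in\mathbb{R}^d$, and $$\int_{[0,T]\times\mathbb{R}^d}\big[|\mathbf{F}|^2w+|\nabla\mathbf{F}|^2\big]\frac{dt\,dx}{\langle f_\infty\rangle}\le\lambda_2\int_{[0,T]\times\mathbb{R}^d}|g|^2\,\frac{dt\,dx}{\langle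 f_\infty\rangle}.$$ Then there exist constructive constants $\lambda,C>0$ (independent of $f_{\mathrm{in}}$ and $t$) such that every solution $f=f(t,x,v)$ of $$\partial_t f+v\cdot\nabla_x f+\nabla_v\cdot(Gf)=Lf$$ with initial data $f_{\mathrm{in}}=f_{\mathrm{in}}(x,v)$ of zero average, $\int_{\mathbb{R}^{2d}}f_{\mathrm{in}}\,dx\,dv=0$, satisfies for all $t>0$ $$\|f(t)\|_{\mathcal{L}^2_\infty(\mathbb{R}^{2d})}\le C\,e^{-\lambda t}\,\|f_{\mathrm{in}}\|_{\mathcal{L}^2_\infty(\mathbb{R}^{2d})}.$$
   Context: For a function $g$ depending on $v$ (and possibly on $t,x$), $\langle g\rangle:=\int_{\mathbb{R}^d}g\,dv$ denotes its integral over the velocity variable $v\in\mathbb{R}^d$ (the spatial density). The weighted space $\mathcal{L}^2_\infty(\mathbb{R}^{2d})$ is defined by the norm $\|g\|_{\mathcal{L}^2_\infty(\mathbb{R}^{2d})}^2:=\int_{\mathbb{R}^{2d}}|g(x,v)|^2\,\frac{dx\,dv}{f_\infty(x,v)}$. The functions $f_\infty$, $\langle f_\infty\rangle$ and $M$ are understood to be positive wherever they occur in a denominator, and regular enough for the expressions in the hypotheses to make sense. In the spatial coercivity condition, $g$ ranges over functions for which the right-hand side of the estimate is finite, and $\nabla\mathbf{F}$ is the full gradient in $(t,x)$. Solutions are those given by the semigroup on $\mathcal{L}^2_\infty(\mathbb{R}^{2d})$, with initial data $f_{\mathrm{in}}\in\mathcal{L}^2_\infty(\mathbb{R}^{2d})$,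 whose generator is $Af=-v\cdot\nabla_x f-\nabla_v\cdot(Gf)+Lf$. It is taken as a standard fact (standing assumption) that this semigroup exists and that smooth functions form a core of its generator. "Constructive" means that the constants are explicitly computable from the constants occurring in the hypotheses. *)

theory Defs
  imports "HOL-Analysis.Analysis"
begin

text \<open>Functions of class \<open>C\<^sup>k\<close> on a Euclidean space.\<close>

primrec C_k :: "nat \<Rightarrow> ('a::euclidean_space \<Rightarrow> 'b::euclidean_space) \<Rightarrow> bool" where
  "C_k 0 f \<longleftrightarrow> continuous_on UNIV f"
| "C_k (Suc k) f \<longleftrightarrow>
     (\<exists>f'. (\<forall>x. (f has_derivative f' x) (at x)) \<and> (\<forall>h. C_k k (\<lambda>x. f' x h)))"

definition smooth :: "('a::euclidean_space \<Rightarrow> 'b::euclidean_space) \<Rightarrow> bool" where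
  "smooth f \<longleftrightarrow> (\<forall>k. C_k k f)"

definition test_function :: "'a::euclidean_space set \<Rightarrow> ('a \<Rightarrow> real) \<Rightarrow> bool" where
  "test_function \<Omega> \<phi> \<longleftrightarrow>
     smooth \<phi> \<and> (\<exists>K. compact K \<and> K \<subseteq> \<Omega> \<and> (\<forall>z. z \<notin> K \<longrightarrow> \<phi> z = 0))"

definition grad :: "('a::euclidean_space \<Rightarrow> real) \<Rightarrow> 'a \<Rightarrow> 'a" where
  "grad f x = (\<Sum>b\<in>Basis. frechet_derivative f (at x) b *\<^sub>R b)"

definition divergence :: "('a::euclidean_space \<Rightarrow> 'a) \<Rightarrow> 'a \<Rightarrow> real" where
  "divergence F x = (\<Sum>b\<in>Basis. frechet_derivative F (at x) b \<bullet> b)"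

text \<open>The phase space consists of the pairs \<open>(x, v)\<close> of position and velocity.\<close>

type_synonym 'd phase = "(real ^ 'd) \<times> (real ^ 'd)"

definition vavg :: "('d::finite phase \<Rightarrow> real) \<Rightarrow> real ^ 'd \<Rightarrow> real" where
  "vavg f x = (LINT v|lborel. f (x, v))"

definition grad_x :: "('d::finite phase \<Rightarrow> real) \<Rightarrow> 'd phase \<Rightarrow> real ^ 'd" where
  "grad_x f = (\<lambda>(x, v). grad (\<lambda>y. f (y, v)) x)"

definition grad_v :: "('d::finite phase \<Rightarrow> real) \<Rightarrow> 'd phase \<Rightarrow> real ^ 'd" where
  "grad_v f = (\<lambda>(x, v). grad (\<lambda>u. f (x, u)) v)"

definition div_v :: "('d::finite phase \<Rightarrow> real ^ 'd) \<Rightarrow> 'd phase \<Rightarrow> real" where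
  "div_v F = (\<lambda>(x, v). divergence (\<lambda>u. F (x, u)) v)"

datatype collision = Fokker_Planck | BGK

fun collision_op ::
  "collision \<Rightarrow> ('d::finite phase \<Rightarrow> real) \<Rightarrow> ('d phase \<Rightarrow> real) \<Rightarrow> 'd phase \<Rightarrow> real" where
  "collision_op Fokker_Planck M f = div_v (\<lambda>z. M z *\<^sub>R grad_v (\<lambda>y. f y / M y) z)"
| "collision_op BGK M f = (\<lambda>z. vavg f (fst z) * M z - f z)"

definition transport_op ::
  "('d::finite phase \<Rightarrow> real ^ 'd) \<Rightarrow> ('d phase \<Rightarrow> real) \<Rightarrow> 'd phase \<Rightarrow> real" where
  "transport_op G f = (\<lambda>z. snd z \<bullet> grad_x f z + div_v (\<lambda>y. f y *\<^sub>R G y) z)"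

definition kinetic_op ::
  "collision \<Rightarrow> ('d::finite phase \<Rightarrow> real ^ 'd) \<Rightarrow> ('d phase \<Rightarrow> real) \<Rightarrow>
    ('d phase \<Rightarrow> real) \<Rightarrow> 'd phase \<Rightarrow> real" where
  "kinetic_op L G M f = (\<lambda>z. - transport_op G f z + collision_op L M f z)"

definition velocity_densities :: "('d::finite phase \<Rightarrow> real) \<Rightarrow> bool" where
  "velocity_densities M \<longleftrightarrow>
     M \<in> borel_measurable borel \<and> (\<forall>z. 0 \<le> M z) \<and>
     (\<forall>x. integrable lborel (\<lambda>v. M (x, v)) \<and> vavg M x = 1)"


text \<open>
  Regularity: everything in the hypotheses is differentiated classically. Only the
  Fokker-Planck operator needs second derivatives, and only in \<open>v\<close>; only there does
  \<open>M\<close> occur in a denominator.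
\<close>

definition C2_in_v :: "('d::finite phase \<Rightarrow> real) \<Rightarrow> bool" where
  "C2_in_v f \<longleftrightarrow>
     continuous_on UNIV f \<and>
     (\<exists>f' f''.
        (\<forall>x v. ((\<lambda>u. f (x, u)) has_derivative f' (x, v)) (at v)) \<and>
        (\<forall>x v h. ((\<lambda>u. f' (x, u) h) has_derivative f'' (x, v) h) (at v)) \<and>
        (\<forall>h. continuous_on UNIV (\<lambda>z. f' z h)) \<and>
        (\<forall>h k. continuous_on UNIV (\<lambda>z. f'' z h k)))"

definition regular_data ::
  "collision \<Rightarrow> ('d::finite phase \<Rightarrow> real) \<Rightarrow> ('d phase \<Rightarrow> real) \<Rightarrow> bool" where
  "regular_data L M f_inf \<longleftrightarrow>
     (\<forall>z. 0 < f_inf z) \<and> C_k 1 f_inf \<and>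
     (\<forall>x. integrable lborel (\<lambda>v. f_inf (x, v)) \<and> 0 < vavg f_inf x) \<and> C_k 1 (vavg f_inf) \<and>
     (L = Fokker_Planck \<longrightarrow> (\<forall>z. 0 < M z) \<and> C2_in_v M \<and> C2_in_v f_inf)"


text \<open>
  The constants of the hypotheses; \<open>C_coll\<close> is the bound on \<open>M\<close> that goes with the
  chosen collision operator. A constant depending constructively on them is the value
  of a closed-form expression in them.
\<close>

datatype hyp_const = C_inf | C_coll | Lambda1 | Lambda2 | Time

datatype const_expr =
    Const hyp_const
  | Rational rat
  | Plus const_expr const_expr
  | Minus const_expr const_expr
  | Times const_expr const_expr
  | Divide const_expr const_expr
  | Maximum const_expr const_expr
  | Minimum const_expr const_expr
  | Root const_expr
  | Exponential const_expr
  | Logarithm const_expr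

primrec const_val :: "(hyp_const \<Rightarrow> real) \<Rightarrow> const_expr \<Rightarrow> real" where
  "const_val c (Const k) = c k"
| "const_val c (Rational q) = of_rat q"
| "const_val c (Plus a b) = const_val c a + const_val c b"
| "const_val c (Minus a b) = const_val c a - const_val c b"
| "const_val c (Times a b) = const_val c a * const_val c b"
| "const_val c (Divide a b) = const_val c a / const_val c b"
| "const_val c (Maximum a b) = max (const_val c a) (const_val c b)"
| "const_val c (Minimum a b) = min (const_val c a) (const_val c b)"
| "const_val c (Root a) = sqrt (const_val c a)"
| "const_val c (Exponential a) = exp (const_val c a)"
| "const_val c (Logarithm a) = ln (const_val c a)"


fun collision_bound ::
  "collision \<Rightarrow> ('d::finite phase \<Rightarrow> real) \<Rightarrow> ('d phase \<Rightarrow> real) \<Rightarrow> ennreal" where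
  "collision_bound Fokker_Planck M f_inf =
     (SUP x. SUP v\<in>cball 0 1. ennreal (norm (grad_v M (x, v)) / M (x, v)))"
| "collision_bound BGK M f_inf =
     (SUP x. \<integral>\<^sup>+v\<in>cball 0 1. ennreal ((M (x, v))\<^sup>2 * vavg f_inf x / f_inf (x, v)) \<partial>lborel)"

definition stationary_state ::
  "collision \<Rightarrow> ('d::finite phase \<Rightarrow> real ^ 'd) \<Rightarrow> ('d phase \<Rightarrow> real) \<Rightarrow>
    ('d phase \<Rightarrow> real) \<Rightarrow> real \<Rightarrow> real \<Rightarrow> bool" where
  "stationary_state L G M f_inf c_inf c_coll \<longleftrightarrow>
     (\<forall>z. transport_op G f_inf z = collision_op L M f_inf z) \<and>
     integrable lborel f_inf \<and> (LINT z|lborel. f_inf z) = 1 \<and>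
     (INF x. INF v\<in>cball 0 1. f_inf (x, v) / vavg f_inf x) = c_inf \<and> 0 < c_inf \<and>
     collision_bound L M f_inf = ennreal c_coll \<and> 0 \<le> c_coll"

text \<open>
  The inequalities are between extended nonnegative reals, hence trivial when the
  right-hand side is infinite; \<open>g\<close> is integrable so that its average is defined.
\<close>

definition velocity_defect ::
  "('d::finite phase \<Rightarrow> real) \<Rightarrow> real ^ 'd \<Rightarrow> (real ^ 'd \<Rightarrow> real) \<Rightarrow> ennreal" where
  "velocity_defect f_inf x g =
     (\<integral>\<^sup>+v. ennreal ((g v - (LINT u|lborel. g u) * f_inf (x, v) / vavg f_inf x)\<^sup>2 / f_inf (x, v)) \<partial>lborel)"

fun local_coercivity ::
  "collision \<Rightarrow> ('d::finite phase \<Rightarrow> real) \<Rightarrow> ('d phase \<Rightarrow> real) \<Rightarrow> real \<Rightarrow> bool" where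
  "local_coercivity Fokker_Planck M f_inf lambda1 \<longleftrightarrow>
     0 < lambda1 \<and>
     (\<forall>x g. C_k 1 g \<and> integrable lborel g \<longrightarrow>
        velocity_defect f_inf x g \<le>
          ennreal lambda1 *
          (\<integral>\<^sup>+v. ennreal ((norm (grad (\<lambda>u. g u / f_inf (x, u)) v))\<^sup>2 * f_inf (x, v)) \<partial>lborel))"
| "local_coercivity BGK M f_inf lambda1 \<longleftrightarrow>
     0 < lambda1 \<and>
     (\<forall>x g. g \<in> borel_measurable borel \<and> integrable lborel g \<longrightarrow>
        velocity_defect f_inf x g \<le>
          ennreal (lambda1 / 2) *
          (\<integral>\<^sup>+(v, u). ennreal ((g v / f_inf (x, v) - g u / f_inf (x, u))\<^sup>2 * f_inf (x, v) * M (x, u)) \<partial>lborel))"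


text \<open>
  Weak derivatives: \<open>D z b\<close> is the derivative of \<open>F\<close> at \<open>z\<close> in the direction \<open>b\<close>.
\<close>

definition has_weak_gradient_on ::
  "('a::euclidean_space \<Rightarrow> 'b::euclidean_space) \<Rightarrow> ('a \<Rightarrow> 'a \<Rightarrow> 'b) \<Rightarrow> 'a set \<Rightarrow> bool" where
  "has_weak_gradient_on F D \<Omega> \<longleftrightarrow>
     F \<in> borel_measurable borel \<and> (\<forall>b\<in>Basis. (\<lambda>z. D z b) \<in> borel_measurable borel) \<and>
     (\<forall>K. compact K \<and> K \<subseteq> \<Omega> \<longrightarrow>
        set_integrable lborel K F \<and> (\<forall>b\<in>Basis. set_integrable lborel K (\<lambda>z. D z b))) \<and>
     (\<forall>\<phi>. test_function \<Omega> \<phi> \<longrightarrow> (\<forall>b\<in>Basis.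
        (LINT z:\<Omega>|lborel. frechet_derivative \<phi> (at z) b *\<^sub>R F z) =
        - (LINT z:\<Omega>|lborel. \<phi> z *\<^sub>R D z b)))"

definition slab :: "real \<Rightarrow> (real \<times> (real ^ 'd::finite)) set" where
  "slab T = {0..T} \<times> UNIV"

text \<open>
  The traces \<open>F\<^sub>0\<close> and \<open>F\<^sub>T\<close> of \<open>F\<close> at times \<open>0\<close> and \<open>T\<close> are characterised by
  Green's formula; here the test functions need not vanish on the boundary of the slab.
\<close>

definition has_time_traces ::
  "real \<Rightarrow> (real \<times> (real ^ 'd::finite) \<Rightarrow> 'b::euclidean_space) \<Rightarrow>
    (real \<times> (real ^ 'd) \<Rightarrow> real \<times> (real ^ 'd) \<Rightarrow> 'b) \<Rightarrow>
    (real ^ 'd \<Rightarrow> 'b) \<Rightarrow> (real ^ 'd \<Rightarrow> 'b) \<Rightarrow> bool" where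
  "has_time_traces T F D F\<^sub>0 F\<^sub>T \<longleftrightarrow>
     (\<forall>K. compact K \<and> K \<subseteq> slab T \<longrightarrow>
        set_integrable lborel K F \<and> set_integrable lborel K (\<lambda>z. D z (1, 0))) \<and>
     (\<forall>K. compact K \<longrightarrow> set_integrable lborel K F\<^sub>0 \<and> set_integrable lborel K F\<^sub>T) \<and>
     (\<forall>\<phi>. test_function UNIV \<phi> \<longrightarrow>
        (LINT z:slab T|lborel. frechet_derivative \<phi> (at z) (1, 0) *\<^sub>R F z + \<phi> z *\<^sub>R D z (1, 0)) =
        (LINT x|lborel. \<phi> (T, x) *\<^sub>R F\<^sub>T x) - (LINT x|lborel. \<phi> (0, x) *\<^sub>R F\<^sub>0 x))"

definition spatial_weight ::
  "('d::finite phase \<Rightarrow> real ^ 'd) \<Rightarrow> ('d phase \<Rightarrow> real) \<Rightarrow> real ^ 'd \<Rightarrow> real" where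
  "spatial_weight G f_inf x =
     1 + (LINT v:cball 0 1|lborel. f_inf (x, v) * (norm (G (x, v)))\<^sup>2) / vavg f_inf x
       + (LINT v:cball 0 1|lborel. norm (grad_x (\<lambda>z. f_inf z / vavg f_inf (fst z)) (x, v)))\<^sup>2
       + (norm (grad (vavg f_inf) x /\<^sub>R vavg f_inf x))\<^sup>2"

definition spatial_coercivity ::
  "('d::finite phase \<Rightarrow> real ^ 'd) \<Rightarrow> ('d phase \<Rightarrow> real) \<Rightarrow> real \<Rightarrow> real \<Rightarrow> bool" where
  "spatial_coercivity G f_inf T lambda2 \<longleftrightarrow>
     0 < T \<and>
     (\<forall>g :: real \<times> (real ^ 'd) \<Rightarrow> real.
        g \<in> borel_measurable borel \<and>
        (\<integral>\<^sup>+z\<in>slab T. ennreal ((g z)\<^sup>2 / vavg f_inf (snd z)) \<partial>lborel) < \<infinity> \<and>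
        (LINT z:slab T|lborel. g z) = 0 \<longrightarrow>
        (\<exists>(F :: real \<times> (real ^ 'd) \<Rightarrow> real \<times> (real ^ 'd)) D.
           has_weak_gradient_on F D ({0<..<T} \<times> UNIV) \<and>
           (AE z in lborel. z \<in> slab T \<longrightarrow> (\<Sum>b\<in>Basis. D z b \<bullet> b) = g z) \<and>
           has_time_traces T F D (\<lambda>_. 0) (\<lambda>_. 0) \<and>
           (\<integral>\<^sup>+z\<in>slab T.
              ennreal (((norm (F z))\<^sup>2 * spatial_weight G f_inf (snd z) + (\<Sum>b\<in>Basis. (norm (D z b))\<^sup>2))
                / vavg f_inf (snd z)) \<partial>lborel)
           \<le> ennreal lambda2 *
             (\<integral>\<^sup>+z\<in>slab T. ennreal ((g z)\<^sup>2 / vavg f_inf (snd z)) \<partial>lborel)))"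


text \<open>
  The weighted space consists of functions, not of classes modulo null sets, so the
  laws of a semigroup on it hold almost everywhere.
\<close>

definition L2_inf :: "('d::finite phase \<Rightarrow> real) \<Rightarrow> ('d phase \<Rightarrow> real) set" where
  "L2_inf f_inf =
     {f. f \<in> borel_measurable borel \<and> integrable lborel (\<lambda>z. (f z)\<^sup>2 / f_inf z)}"

definition norm_inf :: "('d::finite phase \<Rightarrow> real) \<Rightarrow> ('d phase \<Rightarrow> real) \<Rightarrow> real" where
  "norm_inf f_inf f = sqrt (LINT z|lborel. (f z)\<^sup>2 / f_inf z)"

definition C0_semigroup ::
  "('d::finite phase \<Rightarrow> real) \<Rightarrow> (real \<Rightarrow> ('d phase \<Rightarrow> real) \<Rightarrow> ('d phase \<Rightarrow> real)) \<Rightarrow> bool" where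
  "C0_semigroup f_inf S \<longleftrightarrow>
     (\<forall>t\<ge>0. \<forall>f\<in>L2_inf f_inf. S t f \<in> L2_inf f_inf) \<and>
     (\<forall>t\<ge>0. \<forall>f\<in>L2_inf f_inf. \<forall>g\<in>L2_inf f_inf. \<forall>a b.
        AE z in lborel. S t (\<lambda>y. a * f y + b * g y) z = a * S t f z + b * S t g z) \<and>
     (\<forall>t\<ge>0. \<exists>B. \<forall>f\<in>L2_inf f_inf. norm_inf f_inf (S t f) \<le> B * norm_inf f_inf f) \<and>
     (\<forall>f\<in>L2_inf f_inf. AE z in lborel. S 0 f z = f z) \<and>
     (\<forall>s\<ge>0. \<forall>t\<ge>0. \<forall>f\<in>L2_inf f_inf. AE z in lborel. S (s + t) f z = S s (S t f) z) \<and>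
     (\<forall>f\<in>L2_inf f_inf. ((\<lambda>t. norm_inf f_inf (\<lambda>z. S t f z - f z)) \<longlongrightarrow> 0) (at_right 0))"

text \<open>\<open>in_generator f_inf S f h\<close>: \<open>f\<close> is in the domain of the generator of \<open>S\<close>, which maps it to \<open>h\<close>.\<close>

definition in_generator ::
  "('d::finite phase \<Rightarrow> real) \<Rightarrow> (real \<Rightarrow> ('d phase \<Rightarrow> real) \<Rightarrow> ('d phase \<Rightarrow> real)) \<Rightarrow>
    ('d phase \<Rightarrow> real) \<Rightarrow> ('d phase \<Rightarrow> real) \<Rightarrow> bool" where
  "in_generator f_inf S f h \<longleftrightarrow>
     f \<in> L2_inf f_inf \<and> h \<in> L2_inf f_inf \<and>
     ((\<lambda>t. norm_inf f_inf (\<lambda>z. (S t f z - f z) / t - h z)) \<longlongrightarrow> 0) (at_right 0)"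

text \<open>
  The generator is \<open>A f = - v \<cdot> \<nabla>\<^sub>x f - \<nabla>\<^sub>v \<cdot> (G f) + L f\<close>, with the smooth
  compactly supported functions as a core. The core determines the generator, and so the
  semigroup: the formula alone leaves open the behaviour at infinity.
\<close>

definition kinetic_semigroup ::
  "collision \<Rightarrow> ('d::finite phase \<Rightarrow> real ^ 'd) \<Rightarrow> ('d phase \<Rightarrow> real) \<Rightarrow> ('d phase \<Rightarrow> real) \<Rightarrow>
    (real \<Rightarrow> ('d phase \<Rightarrow> real) \<Rightarrow> ('d phase \<Rightarrow> real)) \<Rightarrow> bool" where
  "kinetic_semigroup L G M f_inf S \<longleftrightarrow>
     C0_semigroup f_inf S \<and>
     (\<forall>\<phi>. test_function UNIV \<phi> \<longrightarrow> in_generator f_inf S \<phi> (kinetic_op L G M \<phi>)) \<and>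
     (\<forall>f h. in_generator f_inf S f h \<longrightarrow> (\<forall>\<epsilon>>0. \<exists>\<phi>. test_function UNIV \<phi> \<and>
        norm_inf f_inf (\<lambda>z. \<phi> z - f z) < \<epsilon> \<and>
        norm_inf f_inf (\<lambda>z. kinetic_op L G M \<phi> z - h z) < \<epsilon>))"

end

theory Submission imports Defs "HOL-Computational_Algebra.Polynomial"
begin

text \<open>
  By local coercivity the dissipation \<open>- \<langle>A f, f\<rangle>\<close> controls the distance of \<open>f\<close> from its local
  equilibrium \<open>\<langle>f\<rangle> f\<^sub>\<infinity> / \<langle>f\<^sub>\<infinity>\<rangle>\<close>. To control the density \<open>r = \<langle>f\<rangle>\<close> over a time window of length \<open>T\<close>,
  take \<open>F\<close> with \<open>div F = r - m \<langle>f\<^sub>\<infinity>\<rangle>\<close>, where \<open>m\<close> is the mass, and test the equation against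
  a kernel localised in \<open>|v| \<le> 1\<close> which is linear in \<open>F\<close> and whose moments against \<open>(1, v) f\<^sub>\<infinity>\<close>
  reproduce the divergence; the kernel is obtained by inverting the matrix of the localised second
  moments of \<open>f\<^sub>\<infinity>\<close>. This bounds \<open>\<integral> |r - m \<langle>f\<^sub>\<infinity>\<rangle>|\<^sup>2 / \<langle>f\<^sub>\<infinity>\<rangle>\<close> by the dissipation
  and the residual of the equation, so the norm drops by a fixed factor over each window.

  Solutions are only semigroup orbits. As the test functions form a core, an orbit on \<open>[0, T]\<close> can be
  approximated by splines in time with values in the test functions and with small residual in
  \<open>\<partial>\<^sub>t f = A f\<close>, and only for these the estimates are carried out.
\<close>

section \<open>Directional derivatives and compactly supported functions\<close>

text \<open>The lower bound on \<open>f_inf / rho\<close> and the bounds on \<open>G\<close> and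
  \<open>M\<close> are given for |v| \<le> 1 only, so every velocity test function carries the
  factor \<open>eta\<close>, which vanishes outside the unit ball. Inverting the moment matrix uses
  the lower bound \<open>c_inf\<close>; differentiating the inverse in x, and integrating the force
  term by parts in v, produces the terms collected in the weight of spatial coercivity. Numbers that
  depend on the dimension alone are kept apart, so that the final constants are closed expressions
  in those of the hypotheses.

  For zero mass the window estimate has the form T b \<le> K (a - b) / 2, with a and b the squared
  norms at its two ends. Hence b \<le> a / (1 + 2 T / K), and iteration gives the rate.

  The obstacle is regularity: the field \<open>F\<close> has only a weak gradient,
  \<open>f_inf\<close> is only once continuously differentiable in x, and an orbit need not be
  smooth. Splines of test functions make the density side classical; the functions tested against
  \<open>F\<close> then have compact support and one continuous derivative, and mollification admits
  them.\<close>

definition dder :: "('a::euclidean_space \<Rightarrow> real) \<Rightarrow> 'a \<Rightarrow> ('a \<Rightarrow> real) \<Rightarrow> bool" where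
  "dder f b f' \<longleftrightarrow> (\<forall>z. ((\<lambda>s. f (z + s *\<^sub>R b)) has_real_derivative f' z) (at 0))"

text \<open>The functions to be integrated by parts, such as \<open>f / f_inf\<close>, inherit only
  the finite regularity of \<open>f_inf\<close>. Hence compact support and continuity are kept apart
  from smoothness, and derivatives are taken in one direction at a time, since second derivatives of
  \<open>f_inf\<close> are available in v only.\<close>

definition Cc :: "('a::euclidean_space \<Rightarrow> real) \<Rightarrow> bool" where
  "Cc f \<longleftrightarrow> continuous_on UNIV f \<and> (\<exists>r. \<forall>z. r < norm z \<longrightarrow> f z = 0)"

lemma dderD: "dder f b f' \<Longrightarrow> ((\<lambda>s. f (z + s *\<^sub>R b)) has_real_derivative f' z) (at 0)"
  by (simp add: dder_def)

lemma dder_line: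
  assumes "dder f b f'"
  shows "((\<lambda>s. f (z + s *\<^sub>R b)) has_real_derivative f' (z + s *\<^sub>R b)) (at s)"
proof -
  have "((\<lambda>h. f ((z + s *\<^sub>R b) + h *\<^sub>R b)) has_real_derivative f' (z + s *\<^sub>R b)) (at 0)"
    using assms by (rule dderD)
  then have "((\<lambda>h. f (z + (h + s) *\<^sub>R b)) has_real_derivative f' (z + s *\<^sub>R b)) (at 0)"
    by (simp add: algebra_simps)
  then show ?thesis
    using DERIV_shift[of "\<lambda>s. f (z + s *\<^sub>R b)" "f' (z + s *\<^sub>R b)" 0 s] by simp
qed

lemma dder_unique: "dder f b f' \<Longrightarrow> dder f b f'' \<Longrightarrow> f' = f''"
  unfolding dder_def by (auto intro: DERIV_unique)

lemma dder_const: "dder (\<lambda>_. c) b (\<lambda>_. 0)"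
  by (simp add: dder_def)

lemma dder_add: "dder f b f' \<Longrightarrow> dder g b g' \<Longrightarrow> dder (\<lambda>z. f z + g z) b (\<lambda>z. f' z + g' z)"
  by (auto simp: dder_def intro!: derivative_intros)

lemma dder_diff: "dder f b f' \<Longrightarrow> dder g b g' \<Longrightarrow> dder (\<lambda>z. f z - g z) b (\<lambda>z. f' z - g' z)"
  by (auto simp: dder_def intro!: derivative_intros)

lemma dder_cmult: "dder f b f' \<Longrightarrow> dder (\<lambda>z. c * f z) b (\<lambda>z. c * f' z)"
  by (auto simp: dder_def intro!: DERIV_cmult)

lemma dder_sum:
  "(\<And>i. i \<in> I \<Longrightarrow> dder (f i) b (f' i)) \<Longrightarrow> dder (\<lambda>z. \<Sum>i\<in>I. f i z) b (\<lambda>z. \<Sum>i\<in>I. f' i z)"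
  by (auto simp: dder_def intro!: DERIV_sum)

lemma dder_mult:
  "dder f b f' \<Longrightarrow> dder g b g' \<Longrightarrow> dder (\<lambda>z. f z * g z) b (\<lambda>z. f' z * g z + f z * g' z)"
  unfolding dder_def
  by (auto intro!: DERIV_cong[OF DERIV_mult])

lemma dder_divide:
  "dder f b f' \<Longrightarrow> dder g b g' \<Longrightarrow> (\<And>z. g z \<noteq> 0) \<Longrightarrow>
    dder (\<lambda>z. f z / g z) b (\<lambda>z. (f' z * g z - f z * g' z) / (g z)\<^sup>2)"
  unfolding dder_def
  by (auto intro!: DERIV_cong[OF DERIV_divide] simp: power2_eq_square)

lemma dder_inner: "dder (\<lambda>z. z \<bullet> a) b (\<lambda>_. b \<bullet> a)"
  unfolding dder_def by (auto simp: inner_add_left intro!: derivative_eq_intros)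

lemma has_derivative_dder:
  assumes "\<And>z. (f has_derivative f' z) (at z)"
  shows "dder f b (\<lambda>z. f' z b)"
  unfolding dder_def
proof
  fix z
  have lin: "bounded_linear (f' z)" using assms by (rule has_derivative_bounded_linear)
  have g: "((\<lambda>s. z + s *\<^sub>R b) has_derivative (\<lambda>s. s *\<^sub>R b)) (at 0)"
    by (auto intro!: derivative_eq_intros)
  have "((\<lambda>s. f (z + s *\<^sub>R b)) has_derivative (\<lambda>s. f' z (s *\<^sub>R b))) (at 0)"
    by (rule has_derivative_compose[OF g]) (use assms[of z] in simp)
  then show "((\<lambda>s. f (z + s *\<^sub>R b)) has_real_derivative f' z b) (at 0)"
    unfolding has_field_derivative_def
    by (simp add: linear_cmul[OF bounded_linear.linear[OF lin]] mult_commute_abs)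
qed

section \<open>Continuous functions of compact support\<close>

lemma Cc_continuous: "Cc f \<Longrightarrow> continuous_on UNIV f" by (simp add: Cc_def)

lemma Cc_support:
  assumes "Cc f" obtains r where "0 < r" "\<And>z. r < norm z \<Longrightarrow> f z = 0"
proof -
  obtain r where "\<And>z. r < norm z \<Longrightarrow> f z = 0" using assms by (auto simp: Cc_def)
  then show ?thesis by (intro that[of "max r 1"]) auto
qed

lemma CcI: "continuous_on UNIV f \<Longrightarrow> (\<And>z. r < norm z \<Longrightarrow> f z = 0) \<Longrightarrow> Cc f"
  by (auto simp: Cc_def)

lemma Cc_supported_mult:
  assumes "Cc f" "continuous_on UNIV g" shows "Cc (\<lambda>z. f z * g z)" "Cc (\<lambda>z. g z * f z)"
  using assms by (auto simp: Cc_def intro!: continuous_intros)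

lemma Cc_const_mult: "Cc f \<Longrightarrow> Cc (\<lambda>z. c * f z)"
  by (rule Cc_supported_mult) auto

lemma Cc_zero: "Cc (\<lambda>_. 0)" by (auto simp: Cc_def)

lemma Cc_add: assumes "Cc f" "Cc g" shows "Cc (\<lambda>z. f z + g z)"
proof -
  obtain r where r: "\<And>z. r < norm z \<Longrightarrow> f z = 0" using assms by (metis Cc_support)
  obtain r' where r': "\<And>z. r' < norm z \<Longrightarrow> g z = 0" using assms by (metis Cc_support)
  show ?thesis using assms
    by (intro CcI[of _ "max r r'"]) (auto simp: Cc_def r r' intro!: continuous_intros)
qed

lemma Cc_minus: "Cc f \<Longrightarrow> Cc (\<lambda>z. - f z)"
  using Cc_const_mult[of f "-1"] by simp

lemma Cc_diff: "Cc f \<Longrightarrow> Cc g \<Longrightarrow> Cc (\<lambda>z. f z - g z)"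
  using Cc_add[OF _ Cc_minus] by fastforce

lemma Cc_sum: "(\<And>i. i \<in> I \<Longrightarrow> Cc (f i)) \<Longrightarrow> Cc (\<lambda>z. \<Sum>i\<in>I. f i z)"
  by (induction I rule: infinite_finite_induct) (auto intro: Cc_zero Cc_add)

lemma Cc_divide:
  assumes "Cc f" "continuous_on UNIV g" "\<And>z. g z \<noteq> 0" shows "Cc (\<lambda>z. f z / g z)"
proof -
  have "Cc (\<lambda>z. f z * inverse (g z))"
    using assms by (intro Cc_supported_mult) (auto intro!: continuous_intros)
  then show ?thesis by (simp add: field_simps)
qed

lemma Cc_bounded: assumes "Cc f" obtains B where "0 < B" "\<And>z. \<bar>f z\<bar> \<le> B"
proof -
  obtain r where r: "0 < r" "\<And>z. r < norm z \<Longrightarrow> f z = 0" using assms by (metis Cc_support)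
  have "compact (f ` cball 0 r)"
    using assms by (intro compact_continuous_image) (auto simp: Cc_def intro: continuous_on_subset)
  then obtain B where "0 < B" "\<And>y. y \<in> f ` cball 0 r \<Longrightarrow> norm y \<le> B"
    using compact_imp_bounded bounded_pos by metis
  then show ?thesis using r by (intro that[of B]) (force simp: not_less)+
qed

lemma Cc_cbox:
  fixes f :: "'a::euclidean_space \<Rightarrow> real"
  assumes "Cc f" obtains c where "\<And>z. z \<notin> cbox (-c) c \<Longrightarrow> f z = 0"
proof -
  obtain r where r: "0 < r" "\<And>z. r < norm z \<Longrightarrow> f z = 0" using assms by (metis Cc_support)
  obtain c :: 'a where "cball 0 r \<subseteq> cbox (-c) c"
    using bounded_subset_cbox_symmetric[OF bounded_cball] by blast
  then show ?thesis using r by (intro that[of c]) (force simp: not_less)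
qed

lemma Cc_measurable [measurable_dest]: "Cc f \<Longrightarrow> f \<in> borel_measurable borel"
  by (auto simp: Cc_def intro: borel_measurable_continuous_onI)

text \<open>Continuity in a parameter and differentiation under the integral sign are applied to
  integrals over a fixed box; this is the passage there from the Lebesgue integral over the whole
  space.\<close>

lemma integral_eq_cbox:
  fixes f :: "'a::euclidean_space \<Rightarrow> real"
  assumes "continuous_on UNIV f" "\<And>z. z \<notin> cbox a b \<Longrightarrow> f z = 0"
  shows "integrable lborel f" "(LINT z|lborel. f z) = integral (cbox a b) f"
proof -
  have "set_integrable lborel (cbox a b) f"
    by (rule borel_integrable_compact[OF compact_cbox, unfolded set_integrable_def[symmetric]])
      (use assms in \<open>auto intro: continuous_on_subset\<close>)
  moreover have eq: "(\<lambda>z. indicat_real (cbox a b) z *\<^sub>R f z) = f"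
    using assms(2) by (intro ext) (auto simp: indicator_def)
  ultimately show i: "integrable lborel f" by (simp add: set_integrable_def)
  have "(LINT z:cbox a b|lborel. f z) = integral (cbox a b) f"
    by (rule set_borel_integral_eq_integral) (use i eq in \<open>simp add: set_integrable_def\<close>)
  then show "(LINT z|lborel. f z) = integral (cbox a b) f"
    using eq by (simp add: set_lebesgue_integral_def)
qed

lemma Cc_integrable: assumes "Cc f" shows "integrable lborel f"
  by (rule Cc_cbox[OF assms]) (use assms integral_eq_cbox in \<open>auto simp: Cc_def\<close>)

section \<open>Integrals depending on a parameter\<close>

lemma continuous_slice:
  assumes "continuous_on UNIV k" shows "continuous_on UNIV (\<lambda>v. k (x, v))"
  by (rule continuous_on_compose2[OF assms]) (auto intro!: continuous_intros)

lemma Cc_slice: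
  assumes "continuous_on UNIV k" "\<And>x v. r < norm v \<Longrightarrow> k (x, v) = 0"
  shows "Cc (\<lambda>v. k (x, v))"
  using assms by (intro CcI[of _ r]) (auto intro: continuous_slice)

lemma cball_cbox_ex: "\<exists>c::'a::euclidean_space. \<forall>z. z \<notin> cbox (-c) c \<longrightarrow> (r::real) < norm z"
proof -
  obtain c :: 'a where "cball 0 r \<subseteq> cbox (-c) c"
    using bounded_subset_cbox_symmetric[OF bounded_cball] by blast
  then show ?thesis by (intro exI[of _ c]) (force simp: not_less)
qed

text \<open>The radius \<open>r\<close> does not depend on x, so one box in v serves for all
  parameters.\<close>

lemma continuous_param_integral:
  fixes k :: "'a::euclidean_space \<times> 'b::euclidean_space \<Rightarrow> real"
  assumes k: "continuous_on UNIV k" and r: "\<And>x v. r < norm v \<Longrightarrow> k (x, v) = 0"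
  shows "continuous_on UNIV (\<lambda>x. LINT v|lborel. k (x, v))"
proof -
  obtain c :: 'b where c: "\<And>z. z \<notin> cbox (-c) c \<Longrightarrow> r < norm z" using cball_cbox_ex[of r] by blast
  have "(\<lambda>x. LINT v|lborel. k (x, v)) = (\<lambda>x. integral (cbox (-c) c) (\<lambda>v. k (x, v)))"
    using c r by (intro ext integral_eq_cbox continuous_slice[OF k]) blast
  moreover have "continuous_on UNIV (\<lambda>x. integral (cbox (-c) c) (\<lambda>v. k (x, v)))"
    by (rule integral_continuous_on_param) (auto intro: continuous_on_subset[OF k])
  ultimately show ?thesis by metis
qed

lemma dder_param_integral:
  fixes k :: "'a::euclidean_space \<times> 'b::euclidean_space \<Rightarrow> real"
  assumes k: "continuous_on UNIV k" and r: "\<And>x v. r < norm v \<Longrightarrow> k (x, v) = 0"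
    and k': "continuous_on UNIV k'" and d: "dder k (b, 0) k'"
  shows "dder (\<lambda>x. LINT v|lborel. k (x, v)) b (\<lambda>x. LINT v|lborel. k' (x, v))"
proof -
  obtain c :: 'b where c: "\<And>z. z \<notin> cbox (-c) c \<Longrightarrow> r < norm z" using cball_cbox_ex[of r] by blast
  have line: "((\<lambda>s. k (x + s *\<^sub>R b, v)) has_real_derivative k' (x + s *\<^sub>R b, v)) (at s within X)" for x s v X
    using dder_line[OF d, of "(x, v)" s] by (simp add: has_field_derivative_at_within)
  \<comment> \<open>Moving along \<open>(b, 0)\<close> leaves v fixed, so \<open>k\<close> vanishes
    on the whole line and its derivative vanishes too.\<close>
  have r': "k' (x, v) = 0" if "r < norm v" for x v
  proof -
    have "((\<lambda>s. 0) has_real_derivative k' (x, v)) (at 0)"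
      using line[of x v 0 UNIV] r[OF that] by simp
    then show ?thesis by (rule DERIV_unique[OF _ DERIV_const])
  qed
  have eq: "(LINT v|lborel. k (x, v)) = integral (cbox (-c) c) (\<lambda>v. k (x, v))"
    "(LINT v|lborel. k' (x, v)) = integral (cbox (-c) c) (\<lambda>v. k' (x, v))" for x
    by (rule integral_eq_cbox[OF continuous_slice[OF k]], use c r in blast)
      (rule integral_eq_cbox[OF continuous_slice[OF k']], use c r' in blast)
  show ?thesis
    unfolding dder_def eq
  proof
    fix x
    have "((\<lambda>s. integral (cbox (-c) c) (\<lambda>v. k (x + s *\<^sub>R b, v))) has_real_derivative
        integral (cbox (-c) c) (\<lambda>v. k' (x + 0 *\<^sub>R b, v))) (at 0 within UNIV)"
    proof (rule leibniz_rule_field_derivative)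
      show "(\<lambda>v. k (x + s *\<^sub>R b, v)) integrable_on cbox (- c) c" for s
        by (intro integrable_continuous continuous_on_subset[OF continuous_slice[OF k]]) auto
      show "continuous_on (UNIV \<times> cbox (- c) c) (\<lambda>(s, v). k' (x + s *\<^sub>R b, v))"
        unfolding split_beta
        by (rule continuous_on_compose2[OF k']) (auto intro!: continuous_intros)
    qed (use line in auto)
    then show "((\<lambda>s. integral (cbox (-c) c) (\<lambda>v. k (x + s *\<^sub>R b, v))) has_real_derivative
        integral (cbox (-c) c) (\<lambda>v. k' (x, v))) (at 0)" by simp
  qed
qed

lemma dder_const_imp_zero:
  assumes "dder (\<lambda>_. c) b f'" shows "f' z = 0"
  using dder_unique[OF assms dder_const] by simp

text \<open>The exterior of a closed ball is open, so \<open>f\<close> vanishes on the line through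
  z for all small s.\<close>

lemma dder_support:
  assumes "dder f b f'" "\<And>z. r < norm z \<Longrightarrow> f z = 0" "r < norm z"
  shows "f' z = 0"
proof -
  have "((\<lambda>s::real. z + s *\<^sub>R b) \<longlongrightarrow> z + 0 *\<^sub>R b) (at 0)" by (intro tendsto_intros)
  then have "\<forall>\<^sub>F s in at 0. r < norm (z + s *\<^sub>R b)"
    using assms(3) by (intro order_tendstoD(1)[OF tendsto_norm]) auto
  then have "\<forall>\<^sub>F s in nhds 0. f (z + s *\<^sub>R b) = 0"
    using assms unfolding eventually_at_filter by (auto elim!: eventually_mono)
  then have "((\<lambda>s. f (z + s *\<^sub>R b)) has_real_derivative f' z) (at 0) \<longleftrightarrow>
     ((\<lambda>s. 0) has_real_derivative f' z) (at 0)"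
    by (intro DERIV_cong_ev) auto
  then have "((\<lambda>s. 0) has_real_derivative f' z) (at 0)" using dderD[OF assms(1)] by simp
  then show ?thesis by (rule DERIV_unique[OF _ DERIV_const])
qed

lemma dder_Cc: "Cc f \<Longrightarrow> dder f b f' \<Longrightarrow> continuous_on UNIV f' \<Longrightarrow> Cc f'"
  by (erule Cc_support, rule CcI) (auto intro: dder_support)

section \<open>Integration by parts\<close>

lemma integral_translate:
  fixes f :: "'a::euclidean_space \<Rightarrow> real"
  assumes [measurable]: "f \<in> borel_measurable borel"
  shows "(LINT z|lborel. f (c + z)) = (LINT z|lborel. f z)"
proof -
  have "(LINT z|lborel. f z) = (LINT z|distr lborel borel ((+) c). f z)" by (simp add: lborel_distr_plus)
  also have "\<dots> = (LINT z|lborel. f (c + z))" by (rule integral_distr) auto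
  finally show ?thesis by simp
qed

text \<open>Translation invariance: the integral of \<open>f\<close> shifted by s b does not depend
  on s, and its derivative at s = 0 is the integral of \<open>f'\<close>.\<close>

lemma integral_dder_eq_0:
  assumes f: "Cc f" and d: "dder f b f'" and f': "continuous_on UNIV f'"
  shows "(LINT z|lborel. f' z) = 0"
proof -
  obtain r where r: "0 < r" "\<And>z. r < norm z \<Longrightarrow> f z = 0" using f by (metis Cc_support)
  \<comment> \<open>The box has room for all translates with |s| \<le> 1, which move the support by
    at most \<open>norm b\<close>.\<close>
  obtain c where c: "\<And>z::'a. z \<notin> cbox (-c) c \<Longrightarrow> r + norm b < norm z" using cball_cbox_ex[of "r + norm b"] by blast
  have sh: "f (z + s *\<^sub>R b) = 0" "f' (z + s *\<^sub>R b) = 0" if "\<bar>s\<bar> \<le> 1" "r + norm b < norm z" for z s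
  proof -
    have "norm z \<le> norm (z + s *\<^sub>R b) + norm (s *\<^sub>R b)"
      by (metis add_diff_cancel_right' norm_triangle_ineq4)
    also have "norm (s *\<^sub>R b) \<le> norm b" using that(1) by (simp add: mult_left_le_one_le)
    finally have "r < norm (z + s *\<^sub>R b)" using that by simp
    then show "f (z + s *\<^sub>R b) = 0" "f' (z + s *\<^sub>R b) = 0" using r dder_support[OF d r(2)] by auto
  qed
  have cf: "continuous_on X (\<lambda>z. f (z + s *\<^sub>R b))" "continuous_on X (\<lambda>z. f' (z + s *\<^sub>R b))" for s X
    using f f' by (auto intro!: continuous_on_compose2[where f = "\<lambda>z. z + s *\<^sub>R b" and s=X] continuous_intros simp: Cc_def)
  have "((\<lambda>s. integral (cbox (-c) c) (\<lambda>z. f (z + s *\<^sub>R b))) has_real_derivative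
      integral (cbox (-c) c) (\<lambda>z. f' (z + 0 *\<^sub>R b))) (at 0 within {-1..1})"
  proof (rule leibniz_rule_field_derivative)
    show "((\<lambda>s. f (z + s *\<^sub>R b)) has_real_derivative f' (z + s *\<^sub>R b)) (at s within {- 1..1})" for s z
      using dder_line[OF d] by (simp add: has_field_derivative_at_within)
    show "(\<lambda>z. f (z + s *\<^sub>R b)) integrable_on cbox (- c) c" for s
      by (intro integrable_continuous cf)
    show "continuous_on ({- 1..1} \<times> cbox (- c) c) (\<lambda>(s, z). f' (z + s *\<^sub>R b))"
      unfolding split_beta
      by (rule continuous_on_compose2[OF f']) (auto intro!: continuous_intros)
  qed auto
  then have D: "((\<lambda>s. integral (cbox (-c) c) (\<lambda>z. f (z + s *\<^sub>R b))) has_real_derivative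
      integral (cbox (-c) c) f') (at 0)"
    by (simp add: at_within_Icc_at)
  have ev: "\<forall>\<^sub>F s in nhds 0. integral (cbox (-c) c) (\<lambda>z. f (z + s *\<^sub>R b)) = (LINT z|lborel. f z)"
    unfolding eventually_nhds_metric
  proof (intro exI[of _ 1] conjI allI impI)
    fix s :: real assume "dist s 0 < 1"
    then have "\<bar>s\<bar> \<le> 1" by simp
    then have "(LINT z|lborel. f (z + s *\<^sub>R b)) = integral (cbox (-c) c) (\<lambda>z. f (z + s *\<^sub>R b))"
      using sh(1) c by (intro integral_eq_cbox(2)[OF cf(1)]) auto
    moreover have "(LINT z|lborel. f (z + s *\<^sub>R b)) = (LINT z|lborel. f z)"
      using integral_translate[of f "s *\<^sub>R b"] Cc_measurable[OF f] by (simp add: add.commute)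
    ultimately show "integral (cbox (-c) c) (\<lambda>z. f (z + s *\<^sub>R b)) = (LINT z|lborel. f z)" by simp
  qed simp
  have "((\<lambda>s. LINT z|lborel. f z) has_real_derivative integral (cbox (-c) c) f') (at 0)"
    using D DERIV_cong_ev[OF refl ev refl] by simp
  then have "integral (cbox (-c) c) f' = 0" by (rule DERIV_unique[OF _ DERIV_const])
  moreover have "(LINT z|lborel. f' z) = integral (cbox (-c) c) f'"
  proof (rule integral_eq_cbox(2)[OF f'])
    fix z :: 'a assume "z \<notin> cbox (-c) c"
    then show "f' z = 0" using sh(2)[of 0 z] c by simp
  qed
  ultimately show ?thesis by simp
qed

text \<open>Only the factor \<open>f\<close> has compact support, which admits \<open>f_inf\<close>
  and the components of \<open>G\<close> in the other factor.\<close>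

lemma integral_by_parts:
  assumes f: "Cc f" and g: "continuous_on UNIV g" and d: "dder f b f'" "dder g b g'"
    and c: "continuous_on UNIV f'" "continuous_on UNIV g'"
  shows "(LINT z|lborel. f' z * g z) = - (LINT z|lborel. f z * g' z)"
proof -
  have Cf': "Cc f'" using dder_Cc[OF f d(1) c(1)] .
  have "(LINT z|lborel. f' z * g z + f z * g' z) = 0"
    by (rule integral_dder_eq_0[OF Cc_supported_mult(1)[OF f g] dder_mult[OF d]])
      (use f g c in \<open>auto intro!: continuous_intros simp: Cc_def\<close>)
  moreover have "integrable lborel (\<lambda>z. f' z * g z)" "integrable lborel (\<lambda>z. f z * g' z)"
    using Cc_integrable Cc_supported_mult Cf' f g c by blast+
  ultimately show ?thesis by simp
qed

section \<open>Smooth functions and mollification\<close>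

lemma C_k_Suc_imp: "C_k (Suc k) f \<Longrightarrow> C_k k f"
proof (induction k arbitrary: f)
  case 0
  then obtain f' where "\<And>x. (f has_derivative f' x) (at x)" by auto
  then show ?case by (auto intro!: continuous_at_imp_continuous_on has_derivative_continuous)
next
  case (Suc k)
  then obtain f' where "\<And>x. (f has_derivative f' x) (at x)" "\<And>h. C_k (Suc k) (\<lambda>x. f' x h)"
    by (metis C_k.simps(2))
  then show ?case using Suc.IH by (metis C_k.simps(2))
qed

lemma C_k_continuous: "C_k k f \<Longrightarrow> continuous_on UNIV f"
  by (induction k) (use C_k_Suc_imp in auto)

lemma C_k_const: "C_k k (\<lambda>_. c)"
proof (induction k arbitrary: c)
  case (Suc k)
  show ?case unfolding C_k.simps
    by (rule exI[of _ "\<lambda>_ _. 0"]) (use Suc in \<open>auto intro!: derivative_intros\<close>)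
qed auto

lemma C_k_add: "C_k k f \<Longrightarrow> C_k k g \<Longrightarrow> C_k k (\<lambda>z. f z + g z)"
proof (induction k arbitrary: f g)
  case (Suc k)
  obtain f' where f: "\<And>x. (f has_derivative f' x) (at x)" "\<And>h. C_k k (\<lambda>x. f' x h)"
    using Suc.prems by auto
  obtain g' where g: "\<And>x. (g has_derivative g' x) (at x)" "\<And>h. C_k k (\<lambda>x. g' x h)"
    using Suc.prems by auto
  show ?case unfolding C_k.simps
    by (rule exI[of _ "\<lambda>x h. f' x h + g' x h"])
      (use Suc.IH f g in \<open>auto intro!: derivative_intros\<close>)
qed (auto intro: continuous_intros)

lemma C_k_mult:
  fixes f g :: "'a::euclidean_space \<Rightarrow> real"
  shows "C_k k f \<Longrightarrow> C_k k g \<Longrightarrow> C_k k (\<lambda>z. f z * g z)"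
proof (induction k arbitrary: f g)
  case (Suc k)
  obtain f' where f: "\<And>x. (f has_derivative f' x) (at x)" "\<And>h. C_k k (\<lambda>x. f' x h)"
    using Suc.prems by auto
  obtain g' where g: "\<And>x. (g has_derivative g' x) (at x)" "\<And>h. C_k k (\<lambda>x. g' x h)"
    using Suc.prems by auto
  have "C_k k f" "C_k k g" using Suc.prems C_k_Suc_imp by blast+
  then show ?case unfolding C_k.simps
    by (intro exI[of _ "\<lambda>x h. f x * g' x h + f' x h * g x"] conjI allI has_derivative_mult f g
        C_k_add Suc.IH)
qed (auto intro: continuous_intros)

lemma C_k_prod:
  fixes f :: "'i \<Rightarrow> 'a::euclidean_space \<Rightarrow> real"
  shows "(\<And>i. i \<in> I \<Longrightarrow> C_k k (f i)) \<Longrightarrow> C_k k (\<lambda>z. \<Prod>i\<in>I. f i z)"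
  by (induction I rule: infinite_finite_induct) (auto intro: C_k_const C_k_mult)

lemma C_k_affine:
  fixes g :: "'b::euclidean_space \<Rightarrow> real" and l :: "'a::euclidean_space \<Rightarrow> 'b"
  assumes "bounded_linear l"
  shows "C_k k g \<Longrightarrow> C_k k (\<lambda>z. g (l z + c))"
proof (induction k arbitrary: g)
  case 0
  then show ?case using assms
    by (simp add: continuous_on_compose2[of UNIV g "UNIV" "\<lambda>z. l z + c"] continuous_on_add linear_continuous_on)
next
  case (Suc k)
  obtain g' where g: "\<And>x. (g has_derivative g' x) (at x)" "\<And>h. C_k k (\<lambda>x. g' x h)"
    using Suc.prems by auto
  have l: "((\<lambda>z. l z + c) has_derivative l) (at x)" for x
    using assms by (auto intro!: derivative_eq_intros bounded_linear.has_derivative[OF assms])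
  show ?case unfolding C_k.simps
    by (intro exI[of _ "\<lambda>x h. g' (l x + c) (l h)"] conjI allI
        has_derivative_compose[OF l g(1)] Suc.IH g(2))
qed

text \<open>The functions \<open>P(1/t) exp(-1/t)\<close>, with \<open>P\<close> a polynomial, extended by \<open>0\<close> to
  \<open>t \<le> 0\<close>: this class is closed under differentiation.\<close>

definition flat :: "real poly \<Rightarrow> real \<Rightarrow> real" where
  "flat P t = (if 0 < t then poly P (1 / t) * exp (- (1 / t)) else 0)"

lemma poly_exp_tendsto_0: "((\<lambda>s. poly P s * exp (- s)) \<longlongrightarrow> (0::real)) at_top"
proof -
  have "((\<lambda>s. \<Sum>i\<le>degree P. coeff P i * (s ^ i / exp s)) \<longlongrightarrow> (\<Sum>i\<le>degree P. coeff P i * 0)) at_top"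
    by (intro tendsto_intros tendsto_power_div_exp_0)
  then show ?thesis by (simp add: poly_altdef sum_distrib_right exp_minus divide_inverse mult.assoc)
qed

text \<open>With s = 1 / t one has ds/dt = - s^2, so differentiating P(s) exp(-s) gives s^2 (P(s) -
  P'(s)) exp(-s), and \<open>[:0, 0, 1:]\<close> is the polynomial s^2. At t = 0 the right
  difference quotient is s P(s) exp(-s), which tends to 0 as s grows.\<close>

lemma flat_DERIV: "(flat P has_real_derivative flat ([:0, 0, 1:] * (P - pderiv P)) t) (at t)"
proof -
  consider "t < 0" | "t = 0" | "0 < t" by linarith
  then show ?thesis
  proof cases
    case 1
    have "((\<lambda>_. 0) has_real_derivative 0) (at t)" by simp
    moreover have "\<forall>\<^sub>F s in nhds t. flat P s = 0"
      using eventually_nhds_in_open[of "{..<0}" t] 1 by (auto simp: flat_def elim!: eventually_mono)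
    ultimately have "(flat P has_real_derivative 0) (at t)"
      using DERIV_cong_ev[OF refl _ refl, of "flat P" "\<lambda>_. 0" t] by simp
    then show ?thesis using 1 by (simp add: flat_def)
  next
    case 2
    have "((\<lambda>s. poly ([:0, 1:] * P) s * exp (- s)) \<longlongrightarrow> 0) at_top" by (rule poly_exp_tendsto_0)
    from filterlim_compose[OF this filterlim_inverse_at_top_right]
    have "((\<lambda>h. flat P h / h) \<longlongrightarrow> 0) (at_right 0)"
      by (rule Lim_transform_eventually)
        (auto simp: eventually_at_filter flat_def field_simps)
    moreover have "((\<lambda>h. flat P h / h) \<longlongrightarrow> 0) (at_left 0)"
      by (rule tendsto_eventually) (auto simp: eventually_at_filter flat_def)
    ultimately have "((\<lambda>h. flat P h / h) \<longlongrightarrow> 0) (at 0)" by (simp add: filterlim_split_at)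
    then show ?thesis using 2 by (simp add: DERIV_def flat_def)
  next
    case 3
    have "((\<lambda>s. poly P (1 / s) * exp (- (1 / s))) has_real_derivative
      flat ([:0, 0, 1:] * (P - pderiv P)) t) (at t)"
      using 3 by (auto intro!: derivative_eq_intros DERIV_chain'[OF _ poly_DERIV]
        simp: flat_def field_simps power2_eq_square)
    moreover have "\<forall>\<^sub>F s in nhds t. flat P s = poly P (1 / s) * exp (- (1 / s))"
      using eventually_nhds_in_open[of "{0<..}" t] 3 by (auto simp: flat_def elim!: eventually_mono)
    ultimately show ?thesis
      using DERIV_cong_ev[OF refl _ refl, of "flat P" "\<lambda>s. poly P (1 / s) * exp (- (1 / s))" t] by simp
  qed
qed

lemma C_k_flat: "C_k k (flat P)"
proof (induction k arbitrary: P)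
  case 0
  show ?case using DERIV_isCont[OF flat_DERIV] by (auto intro: continuous_at_imp_continuous_on)
next
  case (Suc k)
  show ?case unfolding C_k.simps
    by (rule exI[of _ "\<lambda>t h. flat ([:0, 0, 1:] * (P - pderiv P)) t * h"])
      (use flat_DERIV in \<open>auto simp: has_field_derivative_def intro!: C_k_mult Suc.IH C_k_const\<close>)
qed

definition bump1 :: "real \<Rightarrow> real" where
  "bump1 t = flat [:1:] (1 - t) * flat [:1:] (1 + t)"

lemma C_k_bump1: "C_k k bump1"
  using C_k_mult[OF C_k_affine[of "\<lambda>t. -t" k "flat [:1:]" 1] C_k_affine[of "\<lambda>t. t" k "flat [:1:]" 1]]
  by (simp add: bump1_def[abs_def] C_k_flat bounded_linear_minus bounded_linear_ident add.commute)

lemma bump1_props: "0 \<le> bump1 t" "0 < bump1 0" "1 \<le> \<bar>t\<bar> \<Longrightarrow> bump1 t = 0" "bump1 (- t) = bump1 t"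
  by (auto simp: bump1_def flat_def)

section \<open>Test functions, bumps and mollifiers\<close>

lemma test_functionI:
  "(\<And>k. C_k k f) \<Longrightarrow> (\<And>z. r < norm z \<Longrightarrow> f z = 0) \<Longrightarrow> test_function UNIV f"
  unfolding test_function_def smooth_def
  by (intro conjI exI[of _ "cball 0 r"]) auto

lemma test_function_C_k: "test_function \<Omega> f \<Longrightarrow> C_k k f"
  by (simp add: test_function_def smooth_def)

lemma test_function_Cc: assumes "test_function \<Omega> f" shows "Cc f"
proof -
  obtain K where K: "compact K" "\<And>z. z \<notin> K \<Longrightarrow> f z = 0" using assms by (auto simp: test_function_def)
  then obtain r where "\<And>z. z \<in> K \<Longrightarrow> norm z \<le> r" using compact_imp_bounded bounded_iff by metis
  then show ?thesis using K C_k_continuous[OF test_function_C_k[OF assms]]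
    by (intro CcI[of _ r]) (auto simp: not_le[symmetric])
qed

lemma C_1_differentiable:
  assumes "C_k (Suc k) f" shows "(f has_derivative frechet_derivative f (at z)) (at z)"
    "C_k k (\<lambda>z. frechet_derivative f (at z) h)"
proof -
  obtain f' where f: "\<And>x. (f has_derivative f' x) (at x)" "\<And>h. C_k k (\<lambda>x. f' x h)"
    using assms by auto
  then have "f' = (\<lambda>x. frechet_derivative f (at x))"
    using frechet_derivative_at by blast
  then show "(f has_derivative frechet_derivative f (at z)) (at z)"
    "C_k k (\<lambda>z. frechet_derivative f (at z) h)" using f by auto
qed

lemma C_1_dder:
  assumes "C_k (Suc k) f" shows "dder f b (\<lambda>z. frechet_derivative f (at z) b)"
    "continuous_on UNIV (\<lambda>z. frechet_derivative f (at z) b)"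
  by (rule has_derivative_dder[OF C_1_differentiable(1)[OF assms]])
    (rule C_k_continuous[OF C_1_differentiable(2)[OF assms]])

lemma bump_ex:
  assumes "0 < r"
  shows "\<exists>j :: 'a::euclidean_space \<Rightarrow> real. test_function UNIV j \<and> (\<forall>z. 0 \<le> j z) \<and> 0 < j 0 \<and>
    (\<forall>z. r < norm z \<longrightarrow> j z = 0) \<and> (\<forall>z. j (- z) = j z)"
proof -
  \<comment> \<open>A cube of half-side \<open>e\<close> lies in the ball of radius r, because the
    norm is at most the sum of the absolute values of the coordinates.\<close>
  define e where "e = r / real DIM('a)"
  have e: "0 < e" using assms by (simp add: e_def)
  define j where "j z = (\<Prod>b\<in>Basis. bump1 ((z::'a) \<bullet> b / e))" for z
  have "C_k k j" for k
  proof -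
    have "C_k k (\<lambda>z. bump1 ((z::'a) \<bullet> b / e))" for b
      using C_k_affine[of "\<lambda>z::'a. z \<bullet> b / e" k bump1 0] C_k_bump1
      by (simp add: bounded_linear_inner_left bounded_linear_compose[OF bounded_linear_divide])
    then show ?thesis unfolding j_def by (intro C_k_prod)
  qed
  moreover have z: "j z = 0" if "r < norm z" for z
  proof (rule ccontr)
    assume "j z \<noteq> 0"
    then have "\<bar>z \<bullet> b\<bar> \<le> e" if "b \<in> Basis" for b
      using that bump1_props(3)[of "z \<bullet> b / e"] e by (force simp: j_def)
    then have "(\<Sum>b\<in>Basis. \<bar>z \<bullet> b\<bar>) \<le> (\<Sum>b\<in>(Basis::'a set). e)" by (intro sum_mono)
    then show False using that norm_le_l1[of z] by (simp add: e_def)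
  qed
  ultimately have "test_function UNIV j" by (intro test_functionI)
  moreover have "0 \<le> j z" "0 < j 0" "j (- z) = j z" for z
    by (auto simp: j_def bump1_props intro!: prod_nonneg prod_pos)
  ultimately show ?thesis using z by blast
qed

text \<open>A nonnegative function with integral 0 vanishes almost everywhere, whereas the set where
  a continuous function is nonzero is open and, if nonempty, not negligible.\<close>

lemma Cc_integral_pos:
  assumes j: "Cc j" "\<And>z. 0 \<le> j z" "0 < j a" shows "0 < (LINT z|lborel. j z)"
proof (rule ccontr)
  assume "\<not> 0 < (LINT z|lborel. j z)"
  then have "(LINT z|lborel. j z) = 0" using Bochner_Integration.integral_nonneg[of lborel j, OF j(2)] by linarith
  then have "AE z in lborel. j z = 0"
    using integral_nonneg_eq_0_iff_AE[OF Cc_integrable[OF j(1)]] j by simp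
  then have "{z. j z \<noteq> 0} \<in> null_sets lborel"
    using Cc_measurable[OF j(1)] by (subst (asm) AE_iff_null) auto
  then have "negligible {z. j z \<noteq> 0}"
    by (simp add: negligible_iff_null_sets null_sets_completionI)
  moreover have "open {z. j z \<noteq> 0}"
    using open_Collect_neq[OF Cc_continuous[OF j(1)] continuous_on_const] by simp
  moreover have "a \<in> {z. j z \<noteq> 0}" using j(3) by simp
  ultimately show False using open_not_negligible by blast
qed

lemma mollifier_ex:
  assumes "0 < r"
  shows "\<exists>j :: 'a::euclidean_space \<Rightarrow> real. test_function UNIV j \<and> (\<forall>z. 0 \<le> j z) \<and>
    (LINT z|lborel. j z) = 1 \<and> (\<forall>z. r < norm z \<longrightarrow> j z = 0) \<and> (\<forall>z. j (- z) = j z)"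
proof -
  obtain j :: "'a \<Rightarrow> real" where j: "test_function UNIV j" "\<And>z. 0 \<le> j z" "0 < j 0"
    "\<And>z. r < norm z \<Longrightarrow> j z = 0" "\<And>z. j (- z) = j z"
    using bump_ex[OF assms] by metis
  define I where "I = (LINT z|lborel. j z)"
  have I: "0 < I" unfolding I_def using j by (intro Cc_integral_pos test_function_Cc)
  show ?thesis
  proof (intro exI[of _ "\<lambda>z. 1 / I * j z"] conjI allI impI)
    show "test_function UNIV (\<lambda>z. 1 / I * j z)"
      by (rule test_functionI[of _ r])
        (use C_k_mult[OF C_k_const[of _ "1 / I"] test_function_C_k[OF j(1)]] j in auto)
  qed (use I j in \<open>auto simp: I_def\<close>)
qed

text \<open>Evenness makes j (z - y), as a function of y, a translate of j.\<close>

definition mollifier :: "nat \<Rightarrow> 'a::euclidean_space \<Rightarrow> real" where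
  "mollifier n = (SOME j. test_function UNIV j \<and> (\<forall>z. 0 \<le> j z) \<and> (LINT z|lborel. j z) = 1 \<and>
    (\<forall>z. 1 / real (Suc n) < norm z \<longrightarrow> j z = 0) \<and> (\<forall>z. j (- z) = j z))"

lemma mollifier:
  shows "test_function UNIV (mollifier n :: 'a::euclidean_space \<Rightarrow> real)"
    and "0 \<le> mollifier n (z :: 'a)" and "(LINT z|lborel. mollifier n (z :: 'a)) = 1"
    and "1 / real (Suc n) < norm z \<Longrightarrow> mollifier n z = 0" and "mollifier n (- z) = mollifier n z"
proof -
  have "0 < 1 / real (Suc n)" by simp
  from someI_ex[OF mollifier_ex[OF this, where 'a='a], folded mollifier_def]
  show "test_function UNIV (mollifier n :: 'a \<Rightarrow> real)" "0 \<le> mollifier n z"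
    "(LINT z|lborel. mollifier n (z :: 'a)) = 1"
    "1 / real (Suc n) < norm z \<Longrightarrow> mollifier n z = 0" "mollifier n (- z) = mollifier n z"
    by blast+
qed

section \<open>Convolution\<close>

definition convol :: "('a::euclidean_space \<Rightarrow> real) \<Rightarrow> ('a \<Rightarrow> real) \<Rightarrow> 'a \<Rightarrow> real" where
  "convol j f x = (LINT y|lborel. j (x - y) * f y)"

lemma convol_cbox:
  assumes "continuous_on UNIV j" "Cc f" "\<And>y. y \<notin> cbox a b \<Longrightarrow> f y = 0"
  shows "convol j f x = integral (cbox a b) (\<lambda>y. j (x - y) * f y)"
  unfolding convol_def
  by (rule integral_eq_cbox)
    (use assms in \<open>auto simp: Cc_def intro!: continuous_intros continuous_on_compose2[OF assms(1)]\<close>)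

text \<open>The derivative falls on \<open>j\<close>, so \<open>f\<close> may be merely continuous
  with compact support.\<close>

lemma convol_has_derivative:
  assumes f: "Cc f" and j: "\<And>x. (j has_derivative j' x) (at x)" and c: "\<And>h. continuous_on UNIV (\<lambda>x. j' x h)"
  shows "(convol j f has_derivative (\<lambda>h. convol (\<lambda>x. j' x h) f x)) (at x)"
proof -
  obtain a where a: "\<And>z. z \<notin> cbox (-a) a \<Longrightarrow> f z = 0" using Cc_cbox[OF f] by metis
  have cj: "continuous_on UNIV j"
    using j by (auto intro!: continuous_at_imp_continuous_on has_derivative_continuous)
  have bl: "bounded_linear (\<lambda>h. j' z h * f y)" for z y
    using has_derivative_bounded_linear[OF j] by (rule bounded_linear_mult_const)
  \<comment> \<open>The Leibniz rule over a box takes the derivative as a bounded linear map that is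
    jointly continuous in the parameter and the variable of integration.\<close>
  define B where "B x y = Blinfun (\<lambda>h. j' (x - y) h * f y)" for x y
  have B: "blinfun_apply (B x y) = (\<lambda>h. j' (x - y) h * f y)" for x y
    unfolding B_def using bl by (rule bounded_linear_Blinfun_apply)
  have cB: "continuous_on S (\<lambda>(x, y). B x y)" for S
    unfolding split_beta
    by (rule continuous_on_blinfun_componentwise, unfold B)
      (use f in \<open>auto simp: Cc_def intro!: continuous_intros continuous_on_compose2[OF c]
         continuous_on_compose2[of UNIV f]\<close>)
  have cB': "continuous_on S (B x)" for S x
    using continuous_on_compose2[OF cB[of UNIV], of S "\<lambda>y. (x, y)"] by (simp add: continuous_on_Pair)
  have main: "((\<lambda>x. integral (cbox (-a) a) (\<lambda>y. j (x - y) * f y)) has_derivative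
      blinfun_apply (integral (cbox (-a) a) (B x))) (at x within UNIV)"
  proof (rule leibniz_rule)
    show "((\<lambda>x. j (x - y) * f y) has_derivative blinfun_apply (B x y)) (at x within UNIV)" for x y
      unfolding B
      by (rule has_derivative_mult_left, rule has_derivative_compose[of "\<lambda>x. x - y" "\<lambda>h. h", OF _ j])
        (auto intro!: derivative_eq_intros)
    show "(\<lambda>y. j (x - y) * f y) integrable_on cbox (-a) a" for x
      using f by (intro integrable_continuous)
        (auto simp: Cc_def intro!: continuous_intros continuous_on_compose2[OF cj] continuous_on_compose2[of UNIV f])
  qed (use cB in auto)
  have app: "blinfun_apply (integral (cbox (-a) a) (B x)) h = convol (\<lambda>x. j' x h) f x" for h
  proof -
    have "blinfun_apply (integral (cbox (-a) a) (B x)) h = integral (cbox (-a) a) (\<lambda>y. B x y h)"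
      by (intro blinfun_apply_integral integrable_continuous cB')
    then show ?thesis using convol_cbox[OF c f a] by (simp add: B)
  qed
  have "(\<lambda>x. integral (cbox (-a) a) (\<lambda>y. j (x - y) * f y)) = convol j f"
    by (rule ext) (rule convol_cbox[OF cj f a, symmetric])
  moreover have "blinfun_apply (integral (cbox (-a) a) (B x)) = (\<lambda>h. convol (\<lambda>x. j' x h) f x)"
    using app by (rule ext)
  ultimately show ?thesis using main by (simp only:)
qed

lemma C_k_convol: assumes f: "Cc f" shows "C_k k j \<Longrightarrow> C_k k (convol j f)"
proof (induction k arbitrary: j)
  case 0
  obtain a where a: "\<And>z. z \<notin> cbox (-a) a \<Longrightarrow> f z = 0" using Cc_cbox[OF f] by metis
  have j: "continuous_on UNIV j" using 0 by simp
  have "continuous_on UNIV (\<lambda>x. integral (cbox (-a) a) (\<lambda>y. j (x - y) * f y))"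
    unfolding split_beta
    by (rule integral_continuous_on_param)
      (use f in \<open>auto simp: Cc_def split_beta intro!: continuous_intros continuous_on_compose2[OF j]
         continuous_on_compose2[of UNIV f]\<close>)
  moreover have "convol j f = (\<lambda>x. integral (cbox (-a) a) (\<lambda>y. j (x - y) * f y))"
    using convol_cbox[OF j f a] by blast
  ultimately show ?case by simp
next
  case (Suc k)
  obtain j' where j: "\<And>x. (j has_derivative j' x) (at x)" "\<And>h. C_k k (\<lambda>x. j' x h)"
    using Suc.prems by auto
  have "(convol j f has_derivative (\<lambda>h. convol (\<lambda>x. j' x h) f x)) (at x)" for x
    using convol_has_derivative[OF f j(1) C_k_continuous[OF j(2)]] .
  then show ?case unfolding C_k.simps using Suc.IH[OF j(2)]
    by (intro exI[of _ "\<lambda>x h. convol (\<lambda>x. j' x h) f x"]) auto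
qed

definition mollify :: "('a::euclidean_space \<Rightarrow> real) \<Rightarrow> nat \<Rightarrow> 'a \<Rightarrow> real" where
  "mollify f n = convol (mollifier n) f"

lemma mollify_nonzeroD:
  assumes "mollify f n z \<noteq> 0"
  obtains y where "f y \<noteq> 0" "norm (z - y) \<le> 1 / real (Suc n)"
proof -
  have "\<exists>y. mollifier n (z - y) * f y \<noteq> 0"
  proof (rule ccontr)
    assume "\<nexists>y. mollifier n (z - y) * f y \<noteq> 0"
    then have "(\<lambda>y. mollifier n (z - y) * f y) = (\<lambda>_. 0)" by (intro ext) blast
    then show False using assms unfolding mollify_def convol_def by simp
  qed
  then obtain y where y: "mollifier n (z - y) \<noteq> 0" "f y \<noteq> 0" by auto
  then have "norm (z - y) \<le> 1 / real (Suc n)" using mollifier(4)[of n "z - y"] not_le by blast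
  then show ?thesis using y that by blast
qed

lemma mollify_support:
  assumes r: "\<And>z. r < norm z \<Longrightarrow> f z = 0" and z: "r + 1 / real (Suc n) < norm z"
  shows "mollify f n z = 0"
proof (rule ccontr)
  assume "mollify f n z \<noteq> 0"
  then obtain y where y: "f y \<noteq> 0" "norm (z - y) \<le> 1 / real (Suc n)" by (rule mollify_nonzeroD)
  then have "norm y \<le> r" using r not_le by blast
  moreover have "norm z \<le> norm (z - y) + norm y" by (metis diff_add_cancel norm_triangle_ineq)
  ultimately show False using y(2) z by linarith
qed

lemma mollifier_reflect:
  shows "(LINT y|lborel. mollifier n (z - y)) = 1" "integrable lborel (\<lambda>y. mollifier n (z - y))"
proof -
  have c: "continuous_on UNIV (mollifier n :: 'a \<Rightarrow> real)"
    by (rule C_k_continuous[OF test_function_C_k[OF mollifier(1), of 0]])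
  have sh: "mollifier n (z - y) = mollifier n ((- z) + y)" for y
    using mollifier(5)[of n "y - z"] by (simp add: algebra_simps)
  show int1: "(LINT y|lborel. mollifier n (z - y)) = 1"
    unfolding sh using integral_translate[of "mollifier n" "- z"] mollifier(3)[of n, where 'a='a]
      borel_measurable_continuous_onI[OF c] by simp
  \<comment> \<open>A function that is not integrable has integral 0 by convention, so the value 1
    implies integrability.\<close>
  show "integrable lborel (\<lambda>y. mollifier n (z - y))"
    using int1 not_integrable_integral_eq by fastforce
qed

lemma mollify_test_function: assumes "Cc f" shows "test_function UNIV (mollify f n)"
proof -
  obtain r where "\<And>z. r < norm z \<Longrightarrow> f z = 0" using assms Cc_support by metis
  then show ?thesis unfolding mollify_def
    using mollify_support[of r f] C_k_convol[OF assms test_function_C_k[OF mollifier(1)]]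
    by (intro test_functionI[of _ "r + 1 / real (Suc n)"]) (auto simp: mollify_def)
qed

lemma mollify_uniform:
  assumes f: "Cc f" and e: "0 < e"
  shows "\<exists>N. \<forall>n\<ge>N. \<forall>z. \<bar>mollify f n z - f z\<bar> \<le> e"
proof -
  obtain r where r: "0 < r" "\<And>z. r < norm z \<Longrightarrow> f z = 0" using f Cc_support by metis
  \<comment> \<open>The radius r + 2 leaves room on both sides: if |z| \<le> r + 1, every y within
    distance 1 of z lies in this ball; otherwise \<open>f\<close> vanishes at both points.\<close>
  have "uniformly_continuous_on (cball 0 (r + 2)) f"
    using f by (intro compact_uniformly_continuous) (auto simp: Cc_def intro: continuous_on_subset)
  then obtain d where d: "0 < d"
    "\<And>y z. y \<in> cball 0 (r + 2) \<Longrightarrow> z \<in> cball 0 (r + 2) \<Longrightarrow> dist y z < d \<Longrightarrow> dist (f y) (f z) < e"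
    unfolding uniformly_continuous_on_def using e by metis
  obtain N where N: "1 / real (Suc N) < min d 1" using d(1) nat_approx_posE[of "min d 1"] by (metis min_less_iff_conj zero_less_one)
  have "\<bar>mollify f n z - f z\<bar> \<le> e" if "N \<le> n" for n z
  proof -
    have n: "1 / real (Suc n) < d" "1 / real (Suc n) \<le> 1"
      using N that by (auto intro: order.strict_trans1[of _ "1 / real (Suc N)"] simp: frac_le)
    have c: "continuous_on UNIV (mollifier n :: 'a \<Rightarrow> real)"
      by (rule C_k_continuous[OF test_function_C_k[OF mollifier(1), of 0]])
    note int1 = mollifier_reflect(1)[of n z] and i1 = mollifier_reflect(2)[of n z]
    have i2: "integrable lborel (\<lambda>y. mollifier n (z - y) * f y)"
      by (intro Cc_integrable Cc_supported_mult f) (auto intro!: continuous_intros continuous_on_compose2[OF c])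
    have pt: "\<bar>mollifier n (z - y) * f y - f z * mollifier n (z - y)\<bar> \<le> e * mollifier n (z - y)" for y
    proof (cases "1 / real (Suc n) < norm (z - y)")
      case True
      then have "mollifier n (z - y) = 0" by (rule mollifier(4))
      then show ?thesis by simp
    next
      case False
      then have dy: "dist y z < d" "norm (z - y) \<le> 1" using n unfolding dist_norm norm_minus_commute[of y z] not_less by linarith+
      have "\<bar>f y - f z\<bar> \<le> e"
      proof (cases "norm z \<le> r + 1")
        case True
        have "norm y \<le> norm z + norm (z - y)" by (metis norm_minus_commute norm_triangle_sub add.commute)
        then have "y \<in> cball 0 (r + 2)" using True dy by auto
        then show ?thesis using d(2)[of y z] True dy by (force simp: dist_real_def)
      next
        case False
        have "norm z \<le> norm (z - y) + norm y" by (metis diff_add_cancel norm_triangle_ineq)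
        then show ?thesis using False dy r e by auto
      qed
      then have "\<bar>f y - f z\<bar> * mollifier n (z - y) \<le> e * mollifier n (z - y)"
        by (intro mult_right_mono mollifier)
      moreover have "\<bar>mollifier n (z - y) * f y - f z * mollifier n (z - y)\<bar> = \<bar>f y - f z\<bar> * mollifier n (z - y)"
      proof -
        have "mollifier n (z - y) * f y - f z * mollifier n (z - y) = (f y - f z) * mollifier n (z - y)"
          by (simp add: algebra_simps)
        then show ?thesis using mollifier(2)[of n "z - y"] by (simp add: abs_mult)
      qed
      ultimately show ?thesis by simp
    qed
    have "mollify f n z - f z = (LINT y|lborel. mollifier n (z - y) * f y - f z * mollifier n (z - y))"
      using i1 i2 int1 by (simp add: mollify_def convol_def)
    also have "\<bar>\<dots>\<bar> \<le> (LINT y|lborel. e * mollifier n (z - y))"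
      using i1 i2 pt by (intro integral_abs_bound[THEN order_trans] integral_mono) auto
    also have "\<dots> = e" using int1 by simp
    finally show ?thesis .
  qed
  then show ?thesis by blast
qed

lemma mollify_tendsto: assumes "Cc f" shows "(\<lambda>n. mollify f n z) \<longlonglongrightarrow> f z"
proof (rule LIMSEQ_I)
  fix e :: real assume "0 < e"
  then obtain N where N: "\<And>n. n \<ge> N \<Longrightarrow> \<bar>mollify f n z - f z\<bar> \<le> e / 2"
    using mollify_uniform[OF assms, of "e / 2"] by auto
  have "norm (mollify f n z - f z) < e" if "n \<ge> N" for n
    using N[OF that] \<open>0 < e\<close> by simp
  then show "\<exists>N. \<forall>n\<ge>N. norm (mollify f n z - f z) < e" by blast
qed

lemma mollify_bounded:
  assumes "Cc f" obtains B where "\<And>n z. \<bar>mollify f n z\<bar> \<le> B"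
proof -
  obtain B where B: "0 < B" "\<And>z. \<bar>f z\<bar> \<le> B" using Cc_bounded[OF assms] by metis
  have "\<bar>mollify f n z\<bar> \<le> B" for n z
  proof -
    have c: "continuous_on UNIV (mollifier n :: 'a \<Rightarrow> real)"
      by (rule C_k_continuous[OF test_function_C_k[OF mollifier(1), of 0]])
    have "integrable lborel (\<lambda>y. mollifier n (z - y) * f y)"
      by (intro Cc_integrable Cc_supported_mult assms) (auto intro!: continuous_intros continuous_on_compose2[OF c])
    moreover have "\<bar>mollifier n (z - y) * f y\<bar> \<le> mollifier n (z - y) * B" for y
      using B mollifier(2)[of n "z - y"] by (auto simp: abs_mult intro!: mult_left_mono)
    ultimately have "\<bar>mollify f n z\<bar> \<le> (LINT y|lborel. mollifier n (z - y) * B)"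
      unfolding mollify_def convol_def using mollifier_reflect(2)[of n z]
      by (intro integral_abs_bound[THEN order_trans] integral_mono) auto
    then show ?thesis using mollifier_reflect(1)[of n z] by simp
  qed
  then show ?thesis by (rule that)
qed

text \<open>The derivative of the convolution falls on the mollifier, and integration by parts moves
  it back to \<open>f\<close>. Thus mollification commutes with a directional derivative that is
  merely continuous.\<close>

lemma mollify_dder:
  assumes f: "Cc f" "dder f b f'" "continuous_on UNIV f'"
  shows "frechet_derivative (mollify f n) (at z) b = mollify f' n z"
proof -
  let ?j = "mollifier n"
  have j: "(?j has_derivative frechet_derivative ?j (at x)) (at x)"
    "continuous_on UNIV (\<lambda>x. frechet_derivative ?j (at x) h)" "continuous_on UNIV ?j" for x h
    using C_1_differentiable[OF test_function_C_k[OF mollifier(1)[of n], of 1, unfolded One_nat_def]]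
      C_k_continuous[OF test_function_C_k[OF mollifier(1)[of n], of 0]] by auto
  have "(mollify f n has_derivative (\<lambda>h. convol (\<lambda>x. frechet_derivative ?j (at x) h) f z)) (at z)"
    unfolding mollify_def by (rule convol_has_derivative[OF f(1) j(1,2)])
  then have "frechet_derivative (mollify f n) (at z) b = convol (\<lambda>x. frechet_derivative ?j (at x) b) f z"
    using frechet_derivative_at by (metis (no_types, lifting))
  also have "\<dots> = (LINT y|lborel. f y * frechet_derivative ?j (at (z - y)) b)"
    by (simp add: convol_def mult.commute)
  also have "\<dots> = (LINT y|lborel. f' y * ?j (z - y))"
  proof -
    have "((\<lambda>y. ?j (z - y)) has_derivative (\<lambda>h. frechet_derivative ?j (at (z - y)) (- h))) (at y)" for y
      by (rule has_derivative_compose[of "\<lambda>y. z - y" "\<lambda>h. - h", OF _ j(1)]) (auto intro!: derivative_eq_intros)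
    then have "dder (\<lambda>y. ?j (z - y)) b (\<lambda>y. frechet_derivative ?j (at (z - y)) (- b))"
      by (rule has_derivative_dder)
    moreover have "frechet_derivative ?j (at x) (- b) = - frechet_derivative ?j (at x) b" for x
      using linear_neg[OF has_derivative_linear[OF j(1)]] .
    ultimately have d: "dder (\<lambda>y. ?j (z - y)) b (\<lambda>y. - frechet_derivative ?j (at (z - y)) b)" by simp
    show ?thesis
      by (subst integral_by_parts[OF f(1) _ f(2) d f(3)])
        (auto intro!: continuous_intros continuous_on_compose2[OF j(3)] continuous_on_compose2[OF j(2)])
  qed
  also have "\<dots> = mollify f' n z" by (simp add: mollify_def convol_def mult.commute)
  finally show ?thesis .
qed

section \<open>Weak gradients with vanishing time traces\<close>

lemma set_integral_Cc_tendsto: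
  fixes F :: "'a::euclidean_space \<Rightarrow> 'b::euclidean_space"
  assumes F: "set_integrable lborel A F" and lim: "\<And>z. (\<lambda>n. f n z) \<longlonglongrightarrow> f0 z"
    and B: "\<And>n z. \<bar>f n z\<bar> \<le> B" and m: "\<And>n. f n \<in> borel_measurable borel" "f0 \<in> borel_measurable borel"
  shows "(\<lambda>n. LINT z:A|lborel. f n z *\<^sub>R F z) \<longlonglongrightarrow> (LINT z:A|lborel. f0 z *\<^sub>R F z)"
  unfolding set_lebesgue_integral_def
proof (rule integral_dominated_convergence)
  let ?F = "\<lambda>z. indicator A z *\<^sub>R F z"
  have F': "integrable lborel ?F" using F by (simp add: set_integrable_def)
  have mF: "?F \<in> borel_measurable lborel" using F' by (rule borel_measurable_integrable)
  have eq: "indicator A z *\<^sub>R c *\<^sub>R F z = c *\<^sub>R ?F z" for z c by simp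
  have m': "f n \<in> borel_measurable lborel" "f0 \<in> borel_measurable lborel" for n using m by auto
  show "(\<lambda>z. indicator A z *\<^sub>R f n z *\<^sub>R F z) \<in> borel_measurable lborel" for n
    unfolding eq by (rule borel_measurable_scaleR[OF m'(1) mF])
  show "(\<lambda>z. indicator A z *\<^sub>R f0 z *\<^sub>R F z) \<in> borel_measurable lborel"
    unfolding eq by (rule borel_measurable_scaleR[OF m'(2) mF])
  show "integrable lborel (\<lambda>z. B * norm (?F z))"
    using F' by (intro integrable_mult_right integrable_norm)
  show "AE z in lborel. (\<lambda>n. indicator A z *\<^sub>R f n z *\<^sub>R F z) \<longlonglongrightarrow> indicator A z *\<^sub>R f0 z *\<^sub>R F z"
    using lim by (intro AE_I2 tendsto_intros)
  show "AE z in lborel. norm (indicator A z *\<^sub>R f n z *\<^sub>R F z) \<le> B * norm (?F z)" for n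
    unfolding eq using B by (intro AE_I2) (metis norm_scaleR mult_right_mono norm_ge_zero)
qed

lemma set_integrable_Cc_scaleR:
  fixes F :: "'a::euclidean_space \<Rightarrow> 'b::euclidean_space"
  assumes F: "set_integrable lborel A F" and f: "Cc f"
  shows "set_integrable lborel A (\<lambda>z. f z *\<^sub>R F z)"
proof -
  obtain B where B: "\<And>z. \<bar>f z\<bar> \<le> B" using Cc_bounded[OF f] by metis
  let ?F = "\<lambda>z. indicator A z *\<^sub>R F z"
  have F': "integrable lborel ?F" using F by (simp add: set_integrable_def)
  have "integrable lborel (\<lambda>z. f z *\<^sub>R ?F z)"
  proof (rule Bochner_Integration.integrable_bound[OF integrable_mult_right[OF integrable_norm[OF F'], of B]])
    have "f \<in> borel_measurable lborel" using Cc_measurable[OF f] by simp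
    then show "(\<lambda>z. f z *\<^sub>R ?F z) \<in> borel_measurable lborel"
      by (rule borel_measurable_scaleR[OF _ borel_measurable_integrable[OF F']])
    have "0 \<le> B" using B[of 0] by linarith
    then have "norm (f z *\<^sub>R ?F z) \<le> norm (B * norm (?F z))" for z
    proof -
      have "norm (f z *\<^sub>R ?F z) = \<bar>f z\<bar> * norm (?F z)" by (rule norm_scaleR)
      also have "\<dots> \<le> B * norm (?F z)" using B by (intro mult_right_mono norm_ge_zero)
      also have "\<dots> \<le> norm (B * norm (?F z))" unfolding real_norm_def by (rule abs_ge_self)
      finally show ?thesis .
    qed
    then show "AE z in lborel. norm (f z *\<^sub>R ?F z) \<le> norm (B * norm (?F z))" by (intro AE_I2)
  qed
  then show ?thesis by (simp add: set_integrable_def mult.commute)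
qed

lemma set_integral_cong_support:
  fixes h :: "'a::euclidean_space \<Rightarrow> 'b::euclidean_space"
  assumes "\<And>z. z \<in> B \<Longrightarrow> z \<notin> A \<Longrightarrow> h z = 0" "A \<subseteq> B"
  shows "(LINT z:A|lborel. h z) = (LINT z:B|lborel. h z)"
proof -
  have "(\<lambda>z. indicat_real A z *\<^sub>R h z) = (\<lambda>z. indicat_real B z *\<^sub>R h z)"
    using assms by (intro ext) (auto simp: indicator_def)
  then show ?thesis by (simp add: set_lebesgue_integral_def)
qed

lemma mollify_measurable: "Cc f \<Longrightarrow> mollify f n \<in> borel_measurable borel"
  using Cc_measurable test_function_Cc mollify_test_function by blast

lemma weak_gradient_interior:
  fixes F :: "real \<times> (real ^ 'd::finite) \<Rightarrow> 'b::euclidean_space"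
  assumes W: "has_weak_gradient_on F D ({0<..<T} \<times> UNIV)" and b: "b \<in> Basis"
    and F: "set_integrable lborel (slab T) F" and D: "set_integrable lborel (slab T) (\<lambda>z. D z b)"
    and z: "Cc z" "dder z b z'" "continuous_on UNIV z'"
    and d: "0 < d" "\<And>t x. z (t, x) \<noteq> 0 \<Longrightarrow> d \<le> t \<and> t \<le> T - d"
  shows "(LINT p:slab T|lborel. z' p *\<^sub>R F p) = - (LINT p:slab T|lborel. z p *\<^sub>R D p b)"
proof -
  let ?\<Omega> = "{0<..<T} \<times> (UNIV :: (real ^ 'd) set)"
  have sub: "?\<Omega> \<subseteq> slab T" by (auto simp: slab_def)
  have Cz': "Cc z'" by (rule dder_Cc[OF z])
  obtain N where N: "1 / real (Suc N) < d / 2" using nat_approx_posE[of "d / 2"] d by auto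
  obtain r where r: "\<And>p. r < norm p \<Longrightarrow> z p = 0" using Cc_support[OF z(1)] by metis
  have eq: "(LINT p:slab T|lborel. mollify z' n p *\<^sub>R F p) = - (LINT p:slab T|lborel. mollify z n p *\<^sub>R D p b)"
    if n: "N \<le> n" for n
  proof -
    have n': "1 / real (Suc n) < d / 2"
    proof -
      have "1 / real (Suc n) \<le> 1 / real (Suc N)" using n by (simp add: frac_le)
      then show ?thesis using N by linarith
    qed
    let ?K = "{d / 2 .. T - d / 2} \<times> cball (0 :: real ^ 'd) (r + d / 2)"
    have K: "p \<in> ?K" if nz: "mollify z n p \<noteq> 0" for p
    proof -
      obtain y where y: "z y \<noteq> 0" "norm (p - y) \<le> 1 / real (Suc n)"
        using nz by (rule mollify_nonzeroD)
      have "norm y \<le> r" using r y(1) not_le by blast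
      then have "norm (snd y) \<le> r" using norm_snd_le[of "snd y" "fst y"] by simp
      moreover have "norm (snd p - snd y) \<le> d / 2" "\<bar>fst p - fst y\<bar> \<le> d / 2"
        using y(2) n' norm_snd_le[of "snd p - snd y" "fst p - fst y"] norm_fst_le[of "fst p - fst y" "snd p - snd y"]
        unfolding minus_prod_def[of p y] by (auto simp del: of_nat_Suc)
      moreover have "norm (snd p) \<le> norm (snd p - snd y) + norm (snd y)"
        by (metis diff_add_cancel norm_triangle_ineq)
      moreover have "d \<le> fst y \<and> fst y \<le> T - d" using d(2)[of "fst y" "snd y"] y by simp
      moreover have "- (d / 2) \<le> fst p - fst y" "fst p - fst y \<le> d / 2"
        using \<open>\<bar>fst p - fst y\<bar> \<le> d / 2\<close> unfolding abs_le_iff by linarith+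
      ultimately have "d / 2 \<le> fst p" "fst p \<le> T - d / 2" "norm (snd p) \<le> r + d / 2" by linarith+
      then show ?thesis by (cases p) simp
    qed
    have tf: "test_function ?\<Omega> (mollify z n)"
      unfolding test_function_def
    proof (intro conjI exI[of _ ?K])
      show "smooth (mollify z n)"
        using mollify_test_function[OF z(1)] by (simp add: test_function_def)
      show "compact ?K" by (intro compact_Times) auto
      show "?K \<subseteq> ?\<Omega>" using d by auto
    qed (use K in blast)
    \<comment> \<open>For the derivative: the complement of the compact set \<open>?K\<close> is
      open, so \<open>mollify z n\<close> is zero in a whole neighbourhood of p.\<close>
    have out: "mollify z n p = 0" "mollify z' n p = 0" if "p \<notin> ?\<Omega>" for p
    proof -
      have K\<Omega>: "?K \<subseteq> ?\<Omega>" using d by auto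
      show "mollify z n p = 0" using K K\<Omega> that by blast
      have "closed ?K" by (intro compact_imp_closed compact_Times) auto
      moreover have "p \<notin> ?K" using K\<Omega> that by blast
      ultimately have "\<forall>\<^sub>F q in nhds p. q \<notin> ?K"
        using eventually_nhds_in_open[of "- ?K" p] by (auto elim!: eventually_mono)
      then have ev: "\<forall>\<^sub>F q in nhds p. mollify z n q = 0" using K by (auto elim!: eventually_mono)
      have "((\<lambda>s. p + s *\<^sub>R b) \<longlongrightarrow> p + 0 *\<^sub>R b) (nhds 0)" by (intro tendsto_intros filterlim_ident)
      then have t: "filterlim (\<lambda>s. p + s *\<^sub>R b) (nhds p) (nhds 0)" by simp
      have ev': "\<forall>\<^sub>F s in nhds 0. mollify z n (p + s *\<^sub>R b) = 0"
        using eventually_compose_filterlim[OF ev t] .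
      have "dder (mollify z n) b (\<lambda>p. frechet_derivative (mollify z n) (at p) b)"
        by (rule C_1_dder[OF test_function_C_k[OF tf, of "Suc 0"]])
      then have "((\<lambda>s. mollify z n (p + s *\<^sub>R b)) has_real_derivative mollify z' n p) (at 0)"
        using dderD mollify_dder[OF z] by fastforce
      then have "((\<lambda>s. 0) has_real_derivative mollify z' n p) (at 0)"
        using DERIV_cong_ev[OF refl ev' refl] by simp
      then show "mollify z' n p = 0" by (rule DERIV_unique[OF _ DERIV_const])
    qed
    have "(LINT p:?\<Omega>|lborel. mollify z' n p *\<^sub>R F p) = - (LINT p:?\<Omega>|lborel. mollify z n p *\<^sub>R D p b)"
      using W tf b unfolding has_weak_gradient_on_def mollify_dder[OF z, symmetric] by blast
    moreover have "(LINT p:?\<Omega>|lborel. mollify z' n p *\<^sub>R F p) = (LINT p:slab T|lborel. mollify z' n p *\<^sub>R F p)"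
      using out sub by (intro set_integral_cong_support) auto
    moreover have "(LINT p:?\<Omega>|lborel. mollify z n p *\<^sub>R D p b) = (LINT p:slab T|lborel. mollify z n p *\<^sub>R D p b)"
      using out sub by (intro set_integral_cong_support) auto
    ultimately show ?thesis by simp
  qed
  obtain B where B: "\<And>n p. \<bar>mollify z n p\<bar> \<le> B" using mollify_bounded[OF z(1)] by metis
  obtain B' where B': "\<And>n p. \<bar>mollify z' n p\<bar> \<le> B'" using mollify_bounded[OF Cz'] by metis
  have l1: "(\<lambda>n. LINT p:slab T|lborel. mollify z' n p *\<^sub>R F p) \<longlonglongrightarrow> (LINT p:slab T|lborel. z' p *\<^sub>R F p)"
    by (rule set_integral_Cc_tendsto[OF F mollify_tendsto[OF Cz'] B'])
      (use Cz' in \<open>auto intro: mollify_measurable Cc_measurable\<close>)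
  have l2: "(\<lambda>n. LINT p:slab T|lborel. mollify z n p *\<^sub>R D p b) \<longlonglongrightarrow> (LINT p:slab T|lborel. z p *\<^sub>R D p b)"
    by (rule set_integral_Cc_tendsto[OF D mollify_tendsto[OF z(1)] B])
      (use z in \<open>auto intro: mollify_measurable Cc_measurable\<close>)
  have "\<forall>\<^sub>F n in sequentially. (LINT p:slab T|lborel. mollify z' n p *\<^sub>R F p) = - (LINT p:slab T|lborel. mollify z n p *\<^sub>R D p b)"
    using eq by (auto simp: eventually_sequentially)
  then have "(\<lambda>n. LINT p:slab T|lborel. mollify z' n p *\<^sub>R F p) \<longlonglongrightarrow> - (LINT p:slab T|lborel. z p *\<^sub>R D p b)"
    using tendsto_minus[OF l2] by (simp add: tendsto_cong)
  then show ?thesis using l1 LIMSEQ_unique by blast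
qed

text \<open>For the time direction this is Green's formula with vanishing traces. For a spatial
  direction no boundary term arises, since multiplication by a cutoff in t commutes with the
  derivative; such cutoffs reduce the claim to the interior of the slab.\<close>

lemma weak_gradient_slab:
  fixes F :: "real \<times> (real ^ 'd::finite) \<Rightarrow> 'b::euclidean_space"
  assumes W: "has_weak_gradient_on F D ({0<..<T} \<times> UNIV)"
    and tr: "has_time_traces T F D (\<lambda>_. 0) (\<lambda>_. 0)" and b: "b \<in> Basis" and T: "0 < T"
    and F: "set_integrable lborel (slab T) F" and D: "set_integrable lborel (slab T) (\<lambda>z. D z b)"
    and z: "Cc z" "dder z b z'" "continuous_on UNIV z'"
  shows "(LINT p:slab T|lborel. z' p *\<^sub>R F p) = - (LINT p:slab T|lborel. z p *\<^sub>R D p b)"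
proof -
  have Cz': "Cc z'" by (rule dder_Cc[OF z])
  consider "b = (1, 0)" | e where "b = (0, e)" using b by (auto simp: Basis_prod_def)
  then show ?thesis
  proof cases
    case 1
    have eq1: "(LINT p:slab T|lborel. mollify z' n p *\<^sub>R F p) = - (LINT p:slab T|lborel. mollify z n p *\<^sub>R D p b)" for n
    proof -
      have tf: "test_function UNIV (mollify z n)" by (rule mollify_test_function[OF z(1)])
      have "(LINT p:slab T|lborel. frechet_derivative (mollify z n) (at p) (1, 0) *\<^sub>R F p +
          mollify z n p *\<^sub>R D p (1, 0)) = 0"
        using tr tf unfolding has_time_traces_def by simp
      then have "(LINT p:slab T|lborel. mollify z' n p *\<^sub>R F p + mollify z n p *\<^sub>R D p b) = 0"
        unfolding 1[symmetric] mollify_dder[OF z] .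
      moreover have "Cc (mollify z n)" "Cc (mollify z' n)"
        using test_function_Cc mollify_test_function z(1) Cz' by blast+
      ultimately show ?thesis
        using set_integral_add(2)[OF set_integrable_Cc_scaleR[OF F] set_integrable_Cc_scaleR[OF D]]
        by (simp add: eq_neg_iff_add_eq_0)
    qed
    obtain B where B: "\<And>n p. \<bar>mollify z n p\<bar> \<le> B" using mollify_bounded[OF z(1)] by metis
    obtain B' where B': "\<And>n p. \<bar>mollify z' n p\<bar> \<le> B'" using mollify_bounded[OF Cz'] by metis
    have l1: "(\<lambda>n. LINT p:slab T|lborel. mollify z' n p *\<^sub>R F p) \<longlonglongrightarrow> (LINT p:slab T|lborel. z' p *\<^sub>R F p)"
      by (rule set_integral_Cc_tendsto[OF F mollify_tendsto[OF Cz'] B'])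
        (use Cz' in \<open>auto intro: mollify_measurable Cc_measurable\<close>)
    have l2: "(\<lambda>n. LINT p:slab T|lborel. mollify z n p *\<^sub>R D p b) \<longlonglongrightarrow> (LINT p:slab T|lborel. z p *\<^sub>R D p b)"
      by (rule set_integral_Cc_tendsto[OF D mollify_tendsto[OF z(1)] B])
        (use z in \<open>auto intro: mollify_measurable Cc_measurable\<close>)
    show ?thesis using l1 tendsto_minus[OF l2] unfolding eq1 by (rule LIMSEQ_unique)
  next
    case 2
    \<comment> \<open>The cutoff is 0 within distance 1 / n of the ends of the time interval and 1
      beyond distance 2 / n.\<close>
    define c where "c n t = min 1 (max 0 (real n * min t (T - t) - 1))" for n t
    have cc: "continuous_on UNIV (\<lambda>p::real \<times> (real ^ 'd). c n (fst p))" for n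
      unfolding c_def by (intro continuous_intros)
    have c01: "0 \<le> c n t" "c n t \<le> 1" for n t by (auto simp: c_def)
    have clim: "(\<lambda>n. c n t) \<longlonglongrightarrow> indicator {0<..<T} t" for t
    proof (cases "0 < t \<and> t < T")
      case True
      then have m: "0 < min t (T - t)" by simp
      obtain N where N: "2 / min t (T - t) < real N" using reals_Archimedean2 by blast
      have "c n t = 1" if "N \<le> n" for n
      proof -
        have "2 < real N * min t (T - t)" using N m by (simp add: divide_less_eq)
        also have "\<dots> \<le> real n * min t (T - t)" using that m by (intro mult_right_mono) auto
        finally show ?thesis by (simp add: c_def)
      qed
      then show ?thesis using True by (intro tendsto_eventually) (auto simp: eventually_sequentially)
    next
      case False
      then have "real n * min t (T - t) \<le> 0" for n by (intro mult_nonneg_nonpos) auto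
      then have "c n t = 0" for n unfolding c_def by (smt (verit, best))
      then show ?thesis using False by simp
    qed
    have eq: "(LINT p:slab T|lborel. (c n (fst p) * z' p) *\<^sub>R F p) = - (LINT p:slab T|lborel. (c n (fst p) * z p) *\<^sub>R D p b)" for n
    proof (rule weak_gradient_interior[OF W b F D])
      show "Cc (\<lambda>p. c n (fst p) * z p)" by (rule Cc_supported_mult(2)[OF z(1) cc])
      show "continuous_on UNIV (\<lambda>p. c n (fst p) * z' p)" using cc z(3) by (intro continuous_intros)
      show "dder (\<lambda>p. c n (fst p) * z p) b (\<lambda>p. c n (fst p) * z' p)"
        using z(2) 2 by (auto simp: dder_def intro!: DERIV_cmult)
      show "0 < 1 / real (Suc n)" by simp
      fix t x assume "c n (fst (t, x)) * z (t, x) \<noteq> 0"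
      then have "c n t \<noteq> 0" by auto
      then have "1 < real n * min t (T - t)" by (auto simp: c_def split: if_splits)
      moreover have "0 < n" using calculation by (cases n) auto
      ultimately have "1 / real n < min t (T - t)"
        unfolding divide_less_eq by (simp only: mult.commute of_nat_0_less_iff if_True)
      moreover have "1 / real (Suc n) \<le> 1 / real n" using \<open>0 < n\<close> by (simp add: frac_le)
      ultimately show "1 / real (Suc n) \<le> t \<and> t \<le> T - 1 / real (Suc n)" by simp
    qed
    obtain B where B: "\<And>p. \<bar>z p\<bar> \<le> B" using Cc_bounded[OF z(1)] by metis
    obtain B' where B': "\<And>p. \<bar>z' p\<bar> \<le> B'" using Cc_bounded[OF Cz'] by metis
    have bd: "\<bar>c n t * y\<bar> \<le> B" if "\<bar>y\<bar> \<le> B" for n t y B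
    proof -
      have "\<bar>c n t * y\<bar> \<le> 1 * \<bar>y\<bar>" using c01[of n t] unfolding abs_mult by (intro mult_right_mono) auto
      then show ?thesis using that by simp
    qed
    have ind: "(\<lambda>p::real \<times> (real ^ 'd). indicator {0<..<T} (fst p) * y p) \<in> borel_measurable borel"
      if "Cc y" for y :: "real \<times> (real ^ 'd) \<Rightarrow> real"
    proof -
      have "(\<lambda>p::real \<times> (real ^ 'd). indicator {0<..<T} (fst p) :: real) = indicator ({0<..<T} \<times> UNIV)"
        by (auto simp: indicator_def)
      moreover have "({0<..<T} \<times> UNIV :: (real \<times> (real ^ 'd)) set) \<in> sets borel"
        by (intro borel_open open_Times) auto
      ultimately have "(\<lambda>p::real \<times> (real ^ 'd). indicator {0<..<T} (fst p) :: real) \<in> borel_measurable borel"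
        by (simp only: borel_measurable_indicator)
      then show ?thesis using Cc_measurable[OF that] by (rule borel_measurable_times)
    qed
    have mm: "(\<lambda>p. c n (fst p) * y p) \<in> borel_measurable borel" if "Cc y"
      for y :: "real \<times> (real ^ 'd) \<Rightarrow> real" and n
      using Cc_measurable[OF Cc_supported_mult(2)[OF that cc]] .
    have l1: "(\<lambda>n. LINT p:slab T|lborel. (c n (fst p) * z' p) *\<^sub>R F p) \<longlonglongrightarrow>
        (LINT p:slab T|lborel. (indicator {0<..<T} (fst p) * z' p) *\<^sub>R F p)"
      by (rule set_integral_Cc_tendsto[OF F _ bd[OF B']])
        (use Cz' in \<open>auto intro!: tendsto_intros clim mm ind\<close>)
    have l2: "(\<lambda>n. LINT p:slab T|lborel. (c n (fst p) * z p) *\<^sub>R D p b) \<longlonglongrightarrow>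
        (LINT p:slab T|lborel. (indicator {0<..<T} (fst p) * z p) *\<^sub>R D p b)"
      by (rule set_integral_Cc_tendsto[OF D _ bd[OF B]])
        (use z in \<open>auto intro!: tendsto_intros clim mm ind\<close>)
    \<comment> \<open>The two faces t = 0 and t = T of the slab are hyperplanes, hence null
      sets.\<close>
    have ae: "AE p in (lborel :: (real \<times> (real ^ 'd)) measure). p \<in> slab T \<longrightarrow> indicator {0<..<T} (fst p) = (1::real)"
    proof -
      have "AE p in lborel. p \<bullet> (1::real, 0::real ^ 'd) \<noteq> a" for a
        by (rule AE_lborel_inner_neq) (auto simp: Basis_prod_def)
      then have "AE p in lborel. p \<bullet> (1::real, 0::real ^ 'd) \<noteq> 0" "AE p in lborel. p \<bullet> (1::real, 0::real ^ 'd) \<noteq> T"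
        by blast+
      then show ?thesis by eventually_elim (auto simp: slab_def indicator_def inner_prod_def)
    qed
    have "(LINT p:slab T|lborel. (indicator {0<..<T} (fst p) * z' p) *\<^sub>R F p) =
        - (LINT p:slab T|lborel. (indicator {0<..<T} (fst p) * z p) *\<^sub>R D p b)"
      using l1 tendsto_minus[OF l2] unfolding eq by (rule LIMSEQ_unique)
    moreover have sl: "slab T \<in> sets (lborel :: (real \<times> (real ^ 'd)) measure)"
      by (simp add: slab_def borel_closed closed_Times)
    have me: "(LINT p:slab T|lborel. (indicator {0<..<T} (fst p) * y p) *\<^sub>R G p) = (LINT p:slab T|lborel. y p *\<^sub>R G p)"
      if y: "Cc y" and G: "set_integrable lborel (slab T) G" for y and G :: "real \<times> (real ^ 'd) \<Rightarrow> 'b"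
    proof -
      let ?G = "\<lambda>z. indicator (slab T) z *\<^sub>R G z"
      have "?G \<in> borel_measurable lborel"
        using G by (simp add: set_integrable_def borel_measurable_integrable)
      moreover have r: "indicator (slab T) z *\<^sub>R s *\<^sub>R G z = s *\<^sub>R ?G z" for z s by simp
      moreover have "y \<in> borel_measurable lborel" "(\<lambda>p. indicator {0<..<T} (fst p) * y p) \<in> borel_measurable lborel"
        using Cc_measurable[OF y] ind[OF y] by simp_all
      moreover have "AE p in lborel. (indicator {0<..<T} (fst p) * y p) *\<^sub>R ?G p = y p *\<^sub>R ?G p"
        using ae by eventually_elim (auto simp: indicator_def)
      ultimately show ?thesis unfolding set_lebesgue_integral_def r
        by (intro integral_cong_AE) (assumption | rule borel_measurable_scaleR, assumption, assumption)+
    qed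
    ultimately show ?thesis using me[OF z(1) D] me[OF Cz' F] by simp
  qed
qed

section \<open>The weighted space\<close>

definition ip_inf :: "('d::finite phase \<Rightarrow> real) \<Rightarrow> ('d phase \<Rightarrow> real) \<Rightarrow> ('d phase \<Rightarrow> real) \<Rightarrow> real" where
  "ip_inf w f g = (LINT z|lborel. f z * g z / w z)"

locale weighted =
  fixes w :: "'d::finite phase \<Rightarrow> real"
  assumes w_pos: "\<And>z. 0 < w z" and w_cont: "continuous_on UNIV w"
begin

abbreviation H where "H \<equiv> L2_inf w"
abbreviation nrm where "nrm \<equiv> norm_inf w"
abbreviation ip where "ip \<equiv> ip_inf w"

section \<open>Linear operations, inner product and norm\<close>

lemma w_measurable [measurable]: "w \<in> borel_measurable borel"
  using w_cont by (rule borel_measurable_continuous_onI)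

lemma w_nz: "w z \<noteq> 0" using w_pos[of z] by simp

lemma H_measurable: "f \<in> H \<Longrightarrow> f \<in> borel_measurable borel"
  by (simp add: L2_inf_def)

lemma H_square: "f \<in> H \<Longrightarrow> integrable lborel (\<lambda>z. (f z)\<^sup>2 / w z)"
  by (simp add: L2_inf_def)

lemma H_bound:
  assumes f: "f \<in> borel_measurable borel" and g: "integrable lborel g"
    and le: "AE z in lborel. (f z)\<^sup>2 / w z \<le> g z"
  shows "f \<in> H"
proof -
  note f [measurable]
  have "integrable lborel (\<lambda>z. (f z)\<^sup>2 / w z)"
    by (rule Bochner_Integration.integrable_bound[OF g]) (use le w_pos in \<open>auto simp: less_imp_le elim!: eventually_mono\<close>)
  then show ?thesis using f by (simp add: L2_inf_def)
qed

lemma H_integrable_mult: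
  assumes f: "f \<in> H" and g: "g \<in> H" shows "integrable lborel (\<lambda>z. f z * g z / w z)"
proof (rule Bochner_Integration.integrable_bound[OF Bochner_Integration.integrable_add[OF H_square[OF f] H_square[OF g]]])
  note H_measurable[OF f, measurable] H_measurable[OF g, measurable]
  show "(\<lambda>z. f z * g z / w z) \<in> borel_measurable lborel" by measurable
  have "\<bar>f z * g z\<bar> \<le> (f z)\<^sup>2 + (g z)\<^sup>2" for z
  proof -
    have "2 * (\<bar>f z\<bar> * \<bar>g z\<bar>) \<le> (f z)\<^sup>2 + (g z)\<^sup>2"
      using sum_squares_bound[of "\<bar>f z\<bar>" "\<bar>g z\<bar>"] by simp
    moreover have "0 \<le> \<bar>f z\<bar> * \<bar>g z\<bar>" by simp
    ultimately show ?thesis unfolding abs_mult by linarith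
  qed
  then show "AE z in lborel. norm (f z * g z / w z) \<le> norm ((f z)\<^sup>2 / w z + (g z)\<^sup>2 / w z)"
    using w_pos by (auto simp: abs_divide divide_right_mono less_imp_le simp flip: add_divide_distrib)
qed

lemma H_lin:
  assumes f: "f \<in> H" and g: "g \<in> H" shows "(\<lambda>z. a * f z + b * g z) \<in> H"
proof (rule H_bound[of _ "\<lambda>z. 2 * a\<^sup>2 * ((f z)\<^sup>2 / w z) + 2 * b\<^sup>2 * ((g z)\<^sup>2 / w z)"])
  note H_measurable[OF f, measurable] H_measurable[OF g, measurable]
  show "(\<lambda>z. a * f z + b * g z) \<in> borel_measurable borel" by measurable
  show "integrable lborel (\<lambda>z. 2 * a\<^sup>2 * ((f z)\<^sup>2 / w z) + 2 * b\<^sup>2 * ((g z)\<^sup>2 / w z))"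
    using H_square[OF f] H_square[OF g] by (intro Bochner_Integration.integrable_add integrable_mult_right)
  have "(a * f z + b * g z)\<^sup>2 \<le> 2 * a\<^sup>2 * (f z)\<^sup>2 + 2 * b\<^sup>2 * (g z)\<^sup>2" for z
    using sum_squares_bound[of "a * f z" "b * g z"] by (simp add: power2_sum power_mult_distrib)
  then have "(a * f z + b * g z)\<^sup>2 / w z \<le> (2 * a\<^sup>2 * (f z)\<^sup>2 + 2 * b\<^sup>2 * (g z)\<^sup>2) / w z" for z
    using w_pos by (intro divide_right_mono) (auto simp: less_imp_le)
  then show "AE z in lborel. (a * f z + b * g z)\<^sup>2 / w z \<le> 2 * a\<^sup>2 * ((f z)\<^sup>2 / w z) + 2 * b\<^sup>2 * ((g z)\<^sup>2 / w z)"
    by (intro AE_I2) (simp add: add_divide_distrib)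
qed

lemma H_zero: "(\<lambda>_. 0) \<in> H" by (simp add: L2_inf_def)

lemma H_cmult: "f \<in> H \<Longrightarrow> (\<lambda>z. a * f z) \<in> H" using H_lin[of f f a 0] by simp

lemma H_add: "f \<in> H \<Longrightarrow> g \<in> H \<Longrightarrow> (\<lambda>z. f z + g z) \<in> H" using H_lin[of f g 1 1] by simp

lemma H_diff: "f \<in> H \<Longrightarrow> g \<in> H \<Longrightarrow> (\<lambda>z. f z - g z) \<in> H" using H_lin[of f g 1 "-1"] by simp

lemma H_sum: "(\<And>i. i \<in> I \<Longrightarrow> f i \<in> H) \<Longrightarrow> (\<lambda>z. \<Sum>i\<in>I. f i z) \<in> H"
  by (induction I rule: infinite_finite_induct) (auto intro: H_zero H_add)

lemma ip_commute: "ip f g = ip g f" by (simp add: ip_inf_def mult.commute)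

lemma ip_lin_left:
  assumes "f \<in> H" "g \<in> H" "h \<in> H"
  shows "ip (\<lambda>z. a * f z + b * g z) h = a * ip f h + b * ip g h"
proof -
  have "(\<lambda>z. (a * f z + b * g z) * h z / w z) = (\<lambda>z. a * (f z * h z / w z) + b * (g z * h z / w z))"
    by (auto simp: field_simps add_divide_distrib)
  then show ?thesis unfolding ip_inf_def
    using H_integrable_mult[OF assms(1,3)] H_integrable_mult[OF assms(2,3)]
    by (simp del: times_divide_eq_right)
qed

lemma ip_add_left: "f \<in> H \<Longrightarrow> g \<in> H \<Longrightarrow> h \<in> H \<Longrightarrow> ip (\<lambda>z. f z + g z) h = ip f h + ip g h"
  using ip_lin_left[of f g h 1 1] by simp

lemma ip_diff_left: "f \<in> H \<Longrightarrow> g \<in> H \<Longrightarrow> h \<in> H \<Longrightarrow> ip (\<lambda>z. f z - g z) h = ip f h - ip g h"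
  using ip_lin_left[of f g h 1 "-1"] by simp

lemma ip_zero_left: "ip (\<lambda>_. 0) h = 0" by (simp add: ip_inf_def)

lemma ip_cmult_left: "ip (\<lambda>z. a * f z) h = a * ip f h"
  by (simp add: ip_inf_def mult.assoc times_divide_eq_right[symmetric] del: times_divide_eq_right)

lemma ip_sum_left: "(\<And>i. i \<in> I \<Longrightarrow> f i \<in> H) \<Longrightarrow> h \<in> H \<Longrightarrow> ip (\<lambda>z. \<Sum>i\<in>I. f i z) h = (\<Sum>i\<in>I. ip (f i) h)"
  by (induction I rule: infinite_finite_induct) (auto simp: ip_zero_left ip_add_left H_sum)

lemma ip_self_nonneg: "0 \<le> ip f f"
  unfolding ip_inf_def using w_pos by (intro Bochner_Integration.integral_nonneg) (auto simp: less_imp_le)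

lemma nrm_square: "(nrm f)\<^sup>2 = ip f f"
  using ip_self_nonneg[of f] by (simp add: norm_inf_def ip_inf_def power2_eq_square)

lemma nrm_nonneg: "0 \<le> nrm f"
  unfolding norm_inf_def using w_pos
  by (intro real_sqrt_ge_zero Bochner_Integration.integral_nonneg) (auto simp: less_imp_le)

lemma nrm_square_lin:
  assumes "f \<in> H" "g \<in> H"
  shows "(nrm (\<lambda>z. a * f z + b * g z))\<^sup>2 = a\<^sup>2 * (nrm f)\<^sup>2 + 2 * a * b * ip f g + b\<^sup>2 * (nrm g)\<^sup>2"
proof -
  have l: "(\<lambda>z. a * f z + b * g z) \<in> H" using assms by (rule H_lin)
  have "ip (\<lambda>z. a * f z + b * g z) (\<lambda>z. a * f z + b * g z) =
      a * (a * ip f f + b * ip g f) + b * (a * ip f g + b * ip g g)"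
    unfolding ip_lin_left[OF assms l] ip_commute[of f "\<lambda>z. a * f z + b * g z"]
      ip_commute[of g "\<lambda>z. a * f z + b * g z"] ip_lin_left[OF assms assms(1)] ip_lin_left[OF assms assms(2)] ..
  then show ?thesis unfolding nrm_square ip_commute[of g f] by (simp only: power2_eq_square algebra_simps)
qed

text \<open>The squared norm of |g|^2 f - (f, g) g is |g|^2 (|f|^2 |g|^2 - (f, g)^2). If |g| = 0
  this says nothing, and \<open>g\<close> need not be the zero function, so that case is treated
  apart.\<close>

lemma Cauchy_Schwarz: assumes f: "f \<in> H" and g: "g \<in> H" shows "\<bar>ip f g\<bar> \<le> nrm f * nrm g"
proof -
  have "0 \<le> (nrm g)\<^sup>2 * ((nrm f)\<^sup>2 * (nrm g)\<^sup>2 - (ip f g)\<^sup>2)"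
    using zero_le_power2[of "nrm (\<lambda>z. (nrm g)\<^sup>2 * f z + (- ip f g) * g z)"]
    unfolding nrm_square_lin[OF f g] by (simp add: power2_eq_square algebra_simps)
  moreover have "(ip f g)\<^sup>2 \<le> 0" if "nrm g = 0"
  proof (rule ccontr)
    assume "\<not> (ip f g)\<^sup>2 \<le> 0"
    then have p: "0 < (ip f g)\<^sup>2" by simp
    \<comment> \<open>The squared norm of f + s g is affine in s because |g| = 0, and this
      \<open>s\<close> would give it the value -1.\<close>
    define s where "s = - ((nrm f)\<^sup>2 + 1) / (2 * ip f g)"
    have "0 \<le> (nrm f)\<^sup>2 + 2 * s * ip f g"
      using zero_le_power2[of "nrm (\<lambda>z. 1 * f z + s * g z)"] that unfolding nrm_square_lin[OF f g] by simp
    then show False using p by (simp add: s_def field_simps)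
  qed
  ultimately have "(ip f g)\<^sup>2 \<le> (nrm f * nrm g)\<^sup>2"
    by (cases "nrm g = 0") (auto simp: power_mult_distrib zero_le_mult_iff)
  then have "\<bar>ip f g\<bar> \<le> \<bar>nrm f * nrm g\<bar>" by (simp only: abs_le_square_iff)
  then show ?thesis by (simp add: nrm_nonneg)
qed

lemma nrm_triangle: assumes f: "f \<in> H" and g: "g \<in> H" shows "nrm (\<lambda>z. f z + g z) \<le> nrm f + nrm g"
proof (rule power2_le_imp_le)
  have "(nrm (\<lambda>z. f z + g z))\<^sup>2 = (nrm f)\<^sup>2 + 2 * ip f g + (nrm g)\<^sup>2"
    using nrm_square_lin[OF f g, of 1 1] by (simp only: mult_1 power_one)
  then show "(nrm (\<lambda>z. f z + g z))\<^sup>2 \<le> (nrm f + nrm g)\<^sup>2"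
    using Cauchy_Schwarz[OF f g] by (simp add: power2_sum)
qed (simp add: nrm_nonneg)

lemma nrm_cmult: "nrm (\<lambda>z. a * f z) = \<bar>a\<bar> * nrm f"
proof -
  have "(LINT z|lborel. (a * f z)\<^sup>2 / w z) = a\<^sup>2 * (LINT z|lborel. (f z)\<^sup>2 / w z)"
    by (simp add: power_mult_distrib times_divide_eq_right[symmetric] del: times_divide_eq_right)
  then show ?thesis by (simp add: norm_inf_def real_sqrt_mult)
qed

lemma nrm_zero: "nrm (\<lambda>_. 0) = 0" by (simp add: norm_inf_def)

lemma nrm_minus_commute: "nrm (\<lambda>z. f z - g z) = nrm (\<lambda>z. g z - f z)"
  by (simp add: norm_inf_def power2_commute)

lemma nrm_triangle_diff: assumes f: "f \<in> H" and g: "g \<in> H" shows "nrm (\<lambda>z. f z - g z) \<le> nrm f + nrm g"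
  using nrm_triangle[OF f H_cmult[OF g, of "-1"]] nrm_cmult[of "-1" g] by simp

lemma nrm_le_diff: assumes f: "f \<in> H" and g: "g \<in> H" shows "nrm f \<le> nrm g + nrm (\<lambda>z. f z - g z)"
  using nrm_triangle[OF g H_diff[OF f g]] by simp

lemma nrm_diff_triangle:
  assumes "f \<in> H" "g \<in> H" "h \<in> H"
  shows "nrm (\<lambda>z. f z - h z) \<le> nrm (\<lambda>z. f z - g z) + nrm (\<lambda>z. g z - h z)"
  using nrm_triangle[OF H_diff[OF assms(1,2)] H_diff[OF assms(2,3)]] by simp

lemma nrm_sum: "(\<And>i. i \<in> I \<Longrightarrow> f i \<in> H) \<Longrightarrow> nrm (\<lambda>z. \<Sum>i\<in>I. f i z) \<le> (\<Sum>i\<in>I. nrm (f i))"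
proof (induction I rule: infinite_finite_induct)
  case (insert i I)
  have "nrm (\<lambda>z. f i z + (\<Sum>i\<in>I. f i z)) \<le> nrm (f i) + nrm (\<lambda>z. \<Sum>i\<in>I. f i z)"
    using insert by (intro nrm_triangle H_sum) auto
  then show ?case using insert by simp
qed (auto simp: nrm_zero)

lemma nrm_cong_AE:
  assumes "f \<in> borel_measurable borel" "g \<in> borel_measurable borel" "AE z in lborel. f z = g z"
  shows "nrm f = nrm g"
proof -
  note assms(1,2)[measurable]
  have "(LINT z|lborel. (f z)\<^sup>2 / w z) = (LINT z|lborel. (g z)\<^sup>2 / w z)"
    using assms(3) by (intro integral_cong_AE) auto
  then show ?thesis by (simp add: norm_inf_def)
qed

lemma nn_nrm: assumes "f \<in> H" shows "(\<integral>\<^sup>+z. ennreal ((f z)\<^sup>2 / w z) \<partial>lborel) = ennreal ((nrm f)\<^sup>2)"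
  unfolding nrm_square ip_inf_def using assms w_pos
  by (subst nn_integral_eq_integral) (auto simp: H_square less_imp_le power2_eq_square dest: H_square)

text \<open>Membership and norm bound together, from an integral in the extended reals: the form in
  which Fatou's lemma delivers a limit.\<close>

lemma H_nnI:
  assumes f: "f \<in> borel_measurable borel" and fin: "(\<integral>\<^sup>+z. ennreal ((f z)\<^sup>2 / w z) \<partial>lborel) \<le> ennreal (b\<^sup>2)" and b: "0 \<le> b"
  shows "f \<in> H" "nrm f \<le> b"
proof -
  note f [measurable]
  show H: "f \<in> H" unfolding L2_inf_def
    using f fin w_pos by (auto intro!: integrableI_nonneg simp: less_imp_le order.strict_trans1[OF fin])
  have "(nrm f)\<^sup>2 \<le> b\<^sup>2" using fin unfolding nn_nrm[OF H] by (simp only: ennreal_le_iff zero_le_power2)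
  then show "nrm f \<le> b" using b by (rule power2_le_imp_le)
qed

lemma Cc_H: assumes f: "Cc f" shows "f \<in> H"
proof -
  have "Cc (\<lambda>z. f z * f z / w z)"
    using Cc_divide[OF Cc_supported_mult(1)[OF f Cc_continuous[OF f]] w_cont] w_nz by simp
  then show ?thesis using Cc_measurable[OF f] Cc_integrable by (auto simp: L2_inf_def power2_eq_square)
qed

lemma test_function_H: "test_function UNIV f \<Longrightarrow> f \<in> H"
  by (intro Cc_H test_function_Cc)

text \<open>Completeness in quantitative form. Monotone convergence for the partial sums of |d n|
  gives summability almost everywhere, and Fatou's lemma for the tails gives the rate, which the
  proof of uniform boundedness uses.\<close>

lemma H_complete:
  assumes d: "\<And>n. d n \<in> H" and c: "\<And>n. nrm (d n) \<le> c n" "summable c"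
  obtains x where "x \<in> H" "\<And>N. nrm (\<lambda>z. x z - (\<Sum>n<N. d n z)) \<le> (\<Sum>n. c (n + N))"
proof -
  note H_measurable[OF d, measurable]
  have c0: "0 \<le> c n" for n using c(1)[of n] nrm_nonneg[of "d n"] by simp
  define s where "s N z = (\<Sum>n<N. \<bar>d n z\<bar>)" for N z
  have [measurable]: "s N \<in> borel_measurable borel" for N unfolding s_def by measurable
  have dabs: "(\<lambda>z. \<bar>d n z\<bar>) \<in> H" "nrm (\<lambda>z. \<bar>d n z\<bar>) = nrm (d n)" for n
    using d[of n] by (auto simp: L2_inf_def norm_inf_def)
  have sH: "s N \<in> H" for N unfolding s_def by (intro H_sum dabs)
  have sn: "nrm (s N) \<le> suminf c" for N
  proof -
    have "nrm (s N) \<le> (\<Sum>n<N. c n)"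
      unfolding s_def using dabs c(1) by (intro order_trans[OF nrm_sum] sum_mono) auto
    also have "\<dots> \<le> suminf c" using c c0 by (intro sum_le_suminf) auto
    finally show ?thesis .
  qed
  have smono: "s N z \<le> s (Suc N) z" "0 \<le> s N z" for N z by (auto simp: s_def sum_nonneg)
  have "(\<integral>\<^sup>+z. (SUP N. ennreal ((s N z)\<^sup>2 / w z)) \<partial>lborel) = (SUP N. \<integral>\<^sup>+z. ennreal ((s N z)\<^sup>2 / w z) \<partial>lborel)"
    using smono w_pos by (intro nn_integral_monotone_convergence_SUP incseq_SucI)
      (auto simp: le_fun_def less_imp_le intro!: ennreal_leI divide_right_mono power_mono)
  also have "\<dots> \<le> ennreal ((suminf c)\<^sup>2)"
    unfolding nn_nrm[OF sH] using sn nrm_nonneg by (intro SUP_least ennreal_leI power_mono)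
  finally have "(\<integral>\<^sup>+z. (SUP N. ennreal ((s N z)\<^sup>2 / w z)) \<partial>lborel) \<noteq> \<infinity>"
    by (auto simp: top_unique)
  then have "AE z in lborel. (SUP N. ennreal ((s N z)\<^sup>2 / w z)) \<noteq> \<infinity>"
    by (intro nn_integral_noteq_infinite) auto
  then have sm: "AE z in lborel. summable (\<lambda>n. d n z)"
  proof eventually_elim
    case (elim z)
    then obtain b where b: "0 \<le> b" "(SUP N. ennreal ((s N z)\<^sup>2 / w z)) = ennreal b"
      by (cases "SUP N. ennreal ((s N z)\<^sup>2 / w z)") auto
    have "s N z \<le> sqrt (b * w z)" for N
    proof -
      have "ennreal ((s N z)\<^sup>2 / w z) \<le> ennreal b" unfolding b(2)[symmetric] by (intro SUP_upper) simp
      then have "(s N z)\<^sup>2 \<le> b * w z" using b w_pos[of z] by (simp add: ennreal_le_iff divide_le_eq)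
      then show ?thesis by (rule real_le_rsqrt)
    qed
    then have "summable (\<lambda>n. \<bar>d n z\<bar>)"
      by (intro summableI_nonneg_bounded[where x = "sqrt (b * w z)"]) (auto simp: s_def)
    then show ?case by (rule summable_rabs_cancel)
  qed
  \<comment> \<open>On the null set where the series diverges, the infinite sum has some unspecified
    value.\<close>
  define x where "x z = (\<Sum>n. d n z)" for z
  have [measurable]: "x \<in> borel_measurable borel" unfolding x_def by measurable
  have tail: "(\<integral>\<^sup>+z. ennreal ((x z - (\<Sum>n<N. d n z))\<^sup>2 / w z) \<partial>lborel) \<le> ennreal ((\<Sum>n. c (n + N))\<^sup>2)" for N
  proof -
    have cN: "summable (\<lambda>n. c (n + N))" using c(2) by (subst summable_iff_shift)
    have le: "nrm (\<lambda>z. \<Sum>n<M. d (n + N) z) \<le> (\<Sum>n. c (n + N))" for M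
    proof -
      have "nrm (\<lambda>z. \<Sum>n<M. d (n + N) z) \<le> (\<Sum>n<M. c (n + N))"
        using d c(1) by (intro order_trans[OF nrm_sum] sum_mono) auto
      also have "\<dots> \<le> (\<Sum>n. c (n + N))" using cN c0 by (intro sum_le_suminf) auto
      finally show ?thesis .
    qed
    have "AE z in lborel. ennreal ((x z - (\<Sum>n<N. d n z))\<^sup>2 / w z) =
        liminf (\<lambda>M. ennreal ((\<Sum>n<M. d (n + N) z)\<^sup>2 / w z))"
      using sm
    proof eventually_elim
      case (elim z)
      have "(\<lambda>M. \<Sum>n<M. d (n + N) z) \<longlonglongrightarrow> (\<Sum>n. d (n + N) z)"
        using elim by (intro summable_LIMSEQ) (subst summable_iff_shift)
      moreover have "(\<Sum>n. d (n + N) z) = x z - (\<Sum>n<N. d n z)"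
        unfolding x_def using suminf_minus_initial_segment[OF elim] .
      ultimately have "(\<lambda>M. ennreal ((\<Sum>n<M. d (n + N) z)\<^sup>2 / w z)) \<longlonglongrightarrow> ennreal ((x z - (\<Sum>n<N. d n z))\<^sup>2 / w z)"
        using w_nz[of z] by (auto intro!: tendsto_intros)
      then show ?case using lim_imp_Liminf[OF sequentially_bot] by metis
    qed
    then have "(\<integral>\<^sup>+z. ennreal ((x z - (\<Sum>n<N. d n z))\<^sup>2 / w z) \<partial>lborel) =
        (\<integral>\<^sup>+z. liminf (\<lambda>M. ennreal ((\<Sum>n<M. d (n + N) z)\<^sup>2 / w z)) \<partial>lborel)"
      by (rule nn_integral_cong_AE)
    also have "\<dots> \<le> liminf (\<lambda>M. \<integral>\<^sup>+z. ennreal ((\<Sum>n<M. d (n + N) z)\<^sup>2 / w z) \<partial>lborel)"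
      by (intro nn_integral_liminf) measurable
    also have "\<dots> \<le> ennreal ((\<Sum>n. c (n + N))\<^sup>2)"
    proof (rule Liminf_le)
      have "(\<integral>\<^sup>+z. ennreal ((\<Sum>n<M. d (n + N) z)\<^sup>2 / w z) \<partial>lborel) \<le> ennreal ((\<Sum>n. c (n + N))\<^sup>2)" for M
        using le nrm_nonneg by (subst nn_nrm[OF H_sum[OF d]]) (intro ennreal_leI power_mono)
      then show "\<forall>\<^sub>F M in sequentially. (\<integral>\<^sup>+z. ennreal ((\<Sum>n<M. d (n + N) z)\<^sup>2 / w z) \<partial>lborel) \<le> ennreal ((\<Sum>n. c (n + N))\<^sup>2)"
        by simp
    qed simp
    finally show ?thesis .
  qed
  have nn: "0 \<le> (\<Sum>n. c (n + N))" for N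
    using c(2) c0 by (intro suminf_nonneg) (auto simp: summable_iff_shift)
  show ?thesis
  proof (rule that)
    show "x \<in> H" using H_nnI(1)[OF _ tail[of 0] nn] by simp
    show "nrm (\<lambda>z. x z - (\<Sum>n<N. d n z)) \<le> (\<Sum>n. c (n + N))" for N
      by (rule H_nnI(2)[OF _ tail nn]) measurable
  qed
qed

section \<open>Density of the test functions\<close>

lemma nrm_tendsto_0:
  assumes m: "\<And>n. f n \<in> borel_measurable borel" and g: "integrable lborel g"
    and le: "\<And>n z. (f n z)\<^sup>2 / w z \<le> g z" and lim: "AE z in lborel. (\<lambda>n. f n z) \<longlonglongrightarrow> 0"
  shows "(\<lambda>n. nrm (f n)) \<longlonglongrightarrow> 0"
proof -
  note m[measurable]
  have "(\<lambda>n. LINT z|lborel. (f n z)\<^sup>2 / w z) \<longlonglongrightarrow> (LINT z|(lborel::'d phase measure). (0::real))"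
  proof (rule integral_dominated_convergence[OF _ _ g])
    show "AE z in lborel. (\<lambda>n. (f n z)\<^sup>2 / w z) \<longlonglongrightarrow> 0"
      using lim by eventually_elim (auto intro!: tendsto_eq_intros simp: w_nz)
    show "AE z in lborel. norm ((f n z)\<^sup>2 / w z) \<le> g z" for n
      using le w_pos by (auto simp: less_imp_le)
  qed measurable
  then have "(\<lambda>n. sqrt (LINT z|lborel. (f n z)\<^sup>2 / w z)) \<longlonglongrightarrow> sqrt 0"
    by (intro tendsto_real_sqrt) simp
  then show ?thesis by (simp add: norm_inf_def)
qed

text \<open>\<open>w\<close> is positive and continuous, hence bounded away from 0 on every
  ball.\<close>

lemma integrable_inverse_cball: "integrable lborel (\<lambda>z. indicator (cball 0 r) z * (c / w z))"
proof -
  have "set_integrable lborel (cball 0 r) (\<lambda>z. c / w z)"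
    unfolding set_integrable_def
    by (rule borel_integrable_compact) (use w_cont w_nz in \<open>auto intro!: continuous_intros continuous_on_subset[OF w_cont]\<close>)
  then show ?thesis by (simp add: set_integrable_def)
qed

lemma test_functions_dense_Cc:
  assumes g: "Cc g" and e: "0 < e" shows "\<exists>\<phi>. test_function UNIV \<phi> \<and> nrm (\<lambda>z. \<phi> z - g z) < e"
proof -
  obtain r where r: "0 < r" "\<And>z. r < norm z \<Longrightarrow> g z = 0" using Cc_support[OF g] by metis
  define J where "J = (LINT z|lborel. indicator (cball (0::'d phase) (r + 1)) z * (1 / w z))"
  have J: "0 \<le> J" unfolding J_def using w_pos by (intro Bochner_Integration.integral_nonneg) (auto simp: less_imp_le)
  \<comment> \<open>The mollification error is at most \<open>a\<close> and lives in the ball of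
    radius r + 1, over which 1 / w has integral \<open>J\<close>. This bounds the norm by a sqrt J,
    hence by e / 2; the summand 1 covers J = 0.\<close>
  define a where "a = e / (2 * (sqrt J + 1))"
  have a: "0 < a" using e J by (simp add: a_def add_nonneg_pos)
  obtain N where N: "\<And>n z. N \<le> n \<Longrightarrow> \<bar>mollify g n z - g z\<bar> \<le> a" using mollify_uniform[OF g a] by metis
  have mg: "test_function UNIV (mollify g N)" by (rule mollify_test_function[OF g])
  have mH: "(\<lambda>z. mollify g N z - g z) \<in> H" by (intro H_diff Cc_H g test_function_Cc[OF mg])
  have pt: "(mollify g N z - g z)\<^sup>2 / w z \<le> a\<^sup>2 * (indicator (cball 0 (r + 1)) z * (1 / w z))" for z
  proof (cases "norm z \<le> r + 1")
    case True
    have "(mollify g N z - g z)\<^sup>2 \<le> a\<^sup>2" using N[of N z] a abs_le_square_iff[of "mollify g N z - g z" a] by simp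
    then show ?thesis using True w_pos[of z] by (simp add: divide_right_mono less_imp_le)
  next
    case False
    have "1 / real (Suc N) \<le> 1" by simp
    then have "r + 1 / real (Suc N) < norm z" using False by linarith
    then have "mollify g N z = 0" using mollify_support[of r g] r(2) by blast
    moreover have "g z = 0" using r False by simp
    ultimately show ?thesis using False by simp
  qed
  have "(nrm (\<lambda>z. mollify g N z - g z))\<^sup>2 \<le> (LINT z|lborel. a\<^sup>2 * (indicator (cball 0 (r + 1)) z * (1 / w z)))"
    unfolding nrm_square ip_inf_def power2_eq_square[symmetric]
    using pt H_square[OF mH] by (intro integral_mono integrable_mult_right integrable_inverse_cball) auto
  also have "\<dots> = a\<^sup>2 * J" unfolding J_def by (rule integral_mult_right_zero)
  also have "\<dots> = (a * sqrt J)\<^sup>2" using J by (simp add: power_mult_distrib)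
  finally have "nrm (\<lambda>z. mollify g N z - g z) \<le> a * sqrt J"
    by (rule power2_le_imp_le) (use a J in simp)
  also have "\<dots> < e"
  proof -
    have "a * sqrt J \<le> a * (sqrt J + 1)" using a by simp
    also have "\<dots> = e / 2"
    proof -
      have "sqrt J + 1 \<noteq> 0" using real_sqrt_ge_zero[OF J] by linarith
      moreover have "e / (2 * c) * c = e / 2" if "c \<noteq> 0" for c :: real using that by simp
      ultimately show ?thesis unfolding a_def by blast
    qed
    finally show ?thesis using e by simp
  qed
  finally show ?thesis using mg by blast
qed

text \<open>Three approximations of error e / 3 each: truncation to a bounded function of bounded
  support, continuous functions converging off a negligible set, and mollification.\<close>

lemma test_functions_dense:
  assumes f: "f \<in> H" and e: "0 < e" shows "\<exists>\<phi>. test_function UNIV \<phi> \<and> nrm (\<lambda>z. \<phi> z - f z) < e"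
proof -
  note H_measurable[OF f, measurable]
  define fk where "fk k z = (if norm z \<le> real k \<and> \<bar>f z\<bar> \<le> real k then f z else 0)" for k z
  have [measurable]: "fk k \<in> borel_measurable borel" for k unfolding fk_def by measurable
  have "(\<lambda>k. nrm (\<lambda>z. fk k z - f z)) \<longlonglongrightarrow> 0"
  proof (rule nrm_tendsto_0[OF _ H_square[OF f]])
    show "(fk k z - f z)\<^sup>2 / w z \<le> (f z)\<^sup>2 / w z" for k z
      using w_pos[of z] by (auto simp: fk_def intro!: divide_right_mono)
    have "(\<lambda>k. fk k z - f z) \<longlonglongrightarrow> 0" for z
    proof (rule tendsto_eventually)
      obtain K where K: "max (norm z) \<bar>f z\<bar> \<le> real K" using real_arch_simple by blast
      have "fk k z - f z = 0" if "K \<le> k" for k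
        using K that by (auto simp: fk_def)
      then show "\<forall>\<^sub>F k in sequentially. fk k z - f z = 0" by (auto simp: eventually_sequentially)
    qed
    then show "AE z in lborel. (\<lambda>k. fk k z - f z) \<longlonglongrightarrow> 0" by simp
  qed measurable
  then have "\<forall>\<^sub>F k in sequentially. nrm (\<lambda>z. fk k z - f z) < e / 3"
    using e by (intro order_tendstoD) auto
  then obtain k where k: "nrm (\<lambda>z. fk k z - f z) < e / 3" by (auto simp: eventually_sequentially)
  have fkH: "fk k \<in> H"
    by (rule H_bound[OF _ H_square[OF f]]) (use w_pos in \<open>auto simp: fk_def less_imp_le\<close>)
  have "fk k \<in> borel_measurable lebesgue" by (simp add: measurable_completion)
  then have "fk k measurable_on UNIV"
    by (simp add: lebesgue_measurable_imp_measurable_on)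
  then obtain N g where Ng: "negligible N" "\<And>n. continuous_on UNIV (g n)"
    "\<And>z. z \<notin> N \<Longrightarrow> (\<lambda>n. g n z) \<longlonglongrightarrow> fk k z"
    unfolding measurable_on_def by auto
  \<comment> \<open>The continuous functions \<open>g n\<close> converge almost everywhere, but
    without a common bound. Clamping their values and cutting them off in z provides the dominating
    function.\<close>
  define h where "h n z = max 0 (min 1 (real k + 1 - norm z)) * max (- real k) (min (real k) (g n z))" for n and z :: "'d phase"
  have hc: "Cc (h n)" for n
    by (rule CcI[of _ "real k + 1"]) (auto simp: h_def intro!: continuous_intros Ng)
  have hb: "\<bar>h n z\<bar> \<le> real k" for n z
  proof -
    have "\<bar>h n z\<bar> \<le> 1 * real k" unfolding h_def abs_mult by (intro mult_mono) auto
    then show ?thesis by simp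
  qed
  have hm [measurable]: "h n \<in> borel_measurable borel" for n using hc by (rule Cc_measurable)
  have "(\<lambda>n. nrm (\<lambda>z. h n z - fk k z)) \<longlonglongrightarrow> 0"
  proof (rule nrm_tendsto_0[OF _ integrable_inverse_cball[of "real k + 1" "(2 * real k)\<^sup>2"]])
    fix n z
    show "(h n z - fk k z)\<^sup>2 / w z \<le> indicator (cball 0 (real k + 1)) z * ((2 * real k)\<^sup>2 / w z)"
    proof (cases "norm z \<le> real k + 1")
      case True
      have "\<bar>h n z - fk k z\<bar> \<le> \<bar>2 * real k\<bar>" using hb[of n z] by (auto simp: fk_def)
      then have "(h n z - fk k z)\<^sup>2 \<le> (2 * real k)\<^sup>2" using abs_le_square_iff by blast
      then show ?thesis using True w_pos[of z] by (simp add: divide_right_mono less_imp_le)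
    next
      case False
      then show ?thesis by (simp add: h_def fk_def)
    qed
  next
    have "N \<in> null_sets lebesgue" using Ng(1) negligible_iff_null_sets by blast
    then have "AE z in lebesgue. z \<notin> N" by (rule AE_not_in)
    then have "AE z in lborel. z \<notin> N" by (simp add: AE_completion_iff)
    then show "AE z in lborel. (\<lambda>n. h n z - fk k z) \<longlonglongrightarrow> 0"
    proof eventually_elim
      case (elim z)
      have "(\<lambda>n. h n z) \<longlonglongrightarrow> max 0 (min 1 (real k + 1 - norm z)) * max (- real k) (min (real k) (fk k z))"
        unfolding h_def using Ng(3)[OF elim] by (intro tendsto_intros)
      moreover have "max 0 (min 1 (real k + 1 - norm z)) * max (- real k) (min (real k) (fk k z)) = fk k z"
        by (auto simp: fk_def)
      ultimately show ?case by (simp add: LIM_zero)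
    qed
  qed measurable
  then have "\<forall>\<^sub>F n in sequentially. nrm (\<lambda>z. h n z - fk k z) < e / 3"
    using e by (intro order_tendstoD) auto
  then obtain n where n: "nrm (\<lambda>z. h n z - fk k z) < e / 3" by (auto simp: eventually_sequentially)
  obtain \<phi> where \<phi>: "test_function UNIV \<phi>" "nrm (\<lambda>z. \<phi> z - h n z) < e / 3"
    using test_functions_dense_Cc[OF hc, of "e / 3" n] e by auto
  have \<phi>H: "\<phi> \<in> H" using \<phi>(1) by (rule test_function_H)
  have "nrm (\<lambda>z. \<phi> z - f z) \<le> nrm (\<lambda>z. \<phi> z - h n z) + (nrm (\<lambda>z. h n z - fk k z) + nrm (\<lambda>z. fk k z - f z))"
    using nrm_diff_triangle[OF \<phi>H Cc_H[OF hc[of n]] f] nrm_diff_triangle[OF Cc_H[OF hc[of n]] fkH f] by linarith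
  then show ?thesis using \<phi> n k by (intro exI[of _ \<phi>]) auto
qed

end

section \<open>Local boundedness of the semigroup\<close>

locale weighted_semigroup = weighted w for w :: "'d::finite phase \<Rightarrow> real" +
  fixes S :: "real \<Rightarrow> ('d phase \<Rightarrow> real) \<Rightarrow> ('d phase \<Rightarrow> real)"
  assumes semigroup: "C0_semigroup w S"
begin

lemma S_H: "0 \<le> t \<Longrightarrow> f \<in> H \<Longrightarrow> S t f \<in> H"
  using semigroup by (simp add: C0_semigroup_def)

lemma S_lin_AE:
  "0 \<le> t \<Longrightarrow> f \<in> H \<Longrightarrow> g \<in> H \<Longrightarrow> AE z in lborel. S t (\<lambda>y. a * f y + b * g y) z = a * S t f z + b * S t g z"
  using semigroup unfolding C0_semigroup_def by blast

lemma S_bounded: "0 \<le> t \<Longrightarrow> \<exists>B. \<forall>f\<in>H. nrm (S t f) \<le> B * nrm f"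
  using semigroup unfolding C0_semigroup_def by blast

lemma S_0_AE: "f \<in> H \<Longrightarrow> AE z in lborel. S 0 f z = f z"
  using semigroup unfolding C0_semigroup_def by blast

lemma S_add_AE: "0 \<le> s \<Longrightarrow> 0 \<le> t \<Longrightarrow> f \<in> H \<Longrightarrow> AE z in lborel. S (s + t) f z = S s (S t f) z"
  using semigroup unfolding C0_semigroup_def by blast

lemma S_cont: "f \<in> H \<Longrightarrow> ((\<lambda>t. nrm (\<lambda>z. S t f z - f z)) \<longlongrightarrow> 0) (at_right 0)"
  using semigroup unfolding C0_semigroup_def by blast

lemma nrm_cong_H: "f \<in> H \<Longrightarrow> g \<in> H \<Longrightarrow> AE z in lborel. f z = g z \<Longrightarrow> nrm f = nrm g"
  by (intro nrm_cong_AE H_measurable)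

lemma nrm_S_lin:
  assumes "0 \<le> t" "f \<in> H" "g \<in> H"
  shows "nrm (S t (\<lambda>y. a * f y + b * g y)) = nrm (\<lambda>z. a * S t f z + b * S t g z)"
  using assms by (intro nrm_cong_H S_lin_AE S_H H_lin)

lemma nrm_S_diff:
  assumes "0 \<le> t" "f \<in> H" "g \<in> H"
  shows "nrm (S t (\<lambda>y. f y - g y)) = nrm (\<lambda>z. S t f z - S t g z)"
  using nrm_S_lin[OF assms, of 1 "-1"] by simp

lemma nrm_S_cmult:
  assumes "0 \<le> t" "f \<in> H"
  shows "nrm (S t (\<lambda>y. a * f y)) = \<bar>a\<bar> * nrm (S t f)"
  using nrm_S_lin[OF assms assms(2), of a 0] nrm_cmult by simp

section \<open>The operator norm of the semigroup\<close>

definition opn :: "real \<Rightarrow> real" where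
  "opn t = (SUP f\<in>{f \<in> H. nrm f \<le> 1}. nrm (S t f))"

lemma opn_bdd: assumes "0 \<le> t" shows "bdd_above ((\<lambda>f. nrm (S t f)) ` {f \<in> H. nrm f \<le> 1})"
proof -
  obtain B where B: "\<And>f. f \<in> H \<Longrightarrow> nrm (S t f) \<le> B * nrm f" using S_bounded[OF assms] by auto
  have "nrm (S t f) \<le> \<bar>B\<bar>" if "f \<in> H" "nrm f \<le> 1" for f
  proof -
    have "nrm (S t f) \<le> B * nrm f" using B that by simp
    also have "\<dots> \<le> \<bar>B\<bar> * nrm f" using nrm_nonneg by (intro mult_right_mono) auto
    also have "\<dots> \<le> \<bar>B\<bar> * 1" using that by (intro mult_left_mono) auto
    finally show ?thesis by simp
  qed
  then show ?thesis by (intro bdd_aboveI[of _ "\<bar>B\<bar>"]) auto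
qed

lemma nrm_S_le_opn: assumes t: "0 \<le> t" and f: "f \<in> H" shows "nrm (S t f) \<le> opn t * nrm f"
proof (cases "nrm f = 0")
  case True
  then show ?thesis using S_bounded[OF t] f nrm_nonneg[of "S t f"] by force
next
  case False
  then have p: "0 < nrm f" using nrm_nonneg[of f] by simp
  let ?g = "\<lambda>z. (1 / nrm f) * f z"
  have "nrm ?g = 1" "?g \<in> H" using p nrm_cmult[of "1 / nrm f" f] H_cmult[OF f, of "1 / nrm f"] by auto
  then have "nrm (S t ?g) \<le> opn t"
    unfolding opn_def using opn_bdd[OF t] by (intro cSUP_upper) auto
  then show ?thesis unfolding nrm_S_cmult[OF t f] using p by (simp add: divide_le_eq)
qed

lemma opn_nonneg: assumes "0 \<le> t" shows "0 \<le> opn t"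
proof -
  have "nrm (S t (\<lambda>_. 0)) \<le> opn t"
    unfolding opn_def using opn_bdd[OF assms] H_zero by (intro cSUP_upper) (auto simp: nrm_zero)
  then show ?thesis using nrm_nonneg order_trans by blast
qed

lemma opn_add: assumes "0 \<le> s" "0 \<le> t" shows "opn (s + t) \<le> opn s * opn t"
  unfolding opn_def[of "s + t"]
proof (rule cSUP_least)
  show "{f \<in> H. nrm f \<le> 1} \<noteq> {}" using H_zero nrm_zero by auto
  fix f assume f: "f \<in> {f \<in> H. nrm f \<le> 1}"
  have "nrm (S (s + t) f) = nrm (S s (S t f))"
    using f assms by (intro nrm_cong_H S_add_AE S_H) auto
  also have "\<dots> \<le> opn s * nrm (S t f)" using f assms by (intro nrm_S_le_opn S_H) auto
  also have "\<dots> \<le> opn s * (opn t * nrm f)"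
    using f assms by (intro mult_left_mono nrm_S_le_opn opn_nonneg) auto
  also have "\<dots> \<le> opn s * (opn t * 1)"
    using f assms by (intro mult_left_mono opn_nonneg) auto
  finally show "nrm (S (s + t) f) \<le> opn s * opn t" by simp
qed

lemma opn_near:
  assumes t: "0 \<le> t" and c: "c < opn t" obtains g where "g \<in> H" "nrm g \<le> 1" "c < nrm (S t g)"
proof -
  have "{f \<in> H. nrm f \<le> 1} \<noteq> {}" using H_zero nrm_zero by auto
  then show ?thesis using c that unfolding opn_def by (subst (asm) less_cSUP_iff[OF _ opn_bdd[OF t]]) auto
qed

text \<open>Sokal's elementary proof of the uniform boundedness principle: of the two points
  \<open>x \<plusminus> y\<close> one has an image of norm at least that of the image of \<open>y\<close>.\<close>

lemma opn_bounded_near_0: "\<exists>\<delta>>0. \<exists>B. \<forall>t\<in>{0..\<delta>}. opn t \<le> B"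
proof (rule ccontr)
  assume "\<not> (\<exists>\<delta>>0. \<exists>B. \<forall>t\<in>{0..\<delta>}. opn t \<le> B)"
  \<comment> \<open>The threshold is what the argument loses: the image of \<open>x (Suc n)\<close>
    has norm at least 3^(-n) (2 / 3) \<open>opn (\<tau> n)\<close>, the rest of the series
    contributes at most 3^(-n) (1 / 2) \<open>opn (\<tau> n)\<close>, and the factors differ by
    3^(-n) / 6.\<close>
  then have "\<exists>t\<in>{0..1 / real (Suc n)}. 6 * 3 ^ n * real (Suc n) < opn t" for n
    by (metis not_le of_nat_0_less_iff zero_less_Suc zero_less_divide_1_iff)
  then obtain \<tau> where \<tau>: "\<And>n. 0 \<le> \<tau> n" "\<And>n. \<tau> n \<le> 1 / real (Suc n)"
    "\<And>n. 6 * 3 ^ n * real (Suc n) < opn (\<tau> n)"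
    by (metis atLeastAtMost_iff)
  have pos: "0 < opn (\<tau> n)" for n
    using \<tau>(3)[of n] by (rule order.strict_trans1[rotated]) simp
  have "\<exists>g. g \<in> H \<and> nrm g \<le> 1 \<and> 2 / 3 * opn (\<tau> n) < nrm (S (\<tau> n) g)" for n
    using opn_near[OF \<tau>(1)[of n], of "2 / 3 * opn (\<tau> n)"] pos[of n] by auto
  then obtain g where g: "\<And>n. g n \<in> H" "\<And>n. nrm (g n) \<le> 1"
    "\<And>n. 2 / 3 * opn (\<tau> n) < nrm (S (\<tau> n) (g n))" by metis
  define y where "y n z = (1 / 3) ^ n * g n z" for n z
  have yH: "y n \<in> H" for n unfolding y_def by (intro H_cmult g)
  have Sy: "nrm (S (\<tau> n) (y n)) = (1 / 3) ^ n * nrm (S (\<tau> n) (g n))" for n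
    unfolding y_def using nrm_S_cmult[OF \<tau>(1) g(1), of n "(1 / 3) ^ n" n] by simp
  define x where "x = rec_nat (\<lambda>_. 0) (\<lambda>n xn. if nrm (S (\<tau> n) (y n)) \<le> nrm (S (\<tau> n) (\<lambda>z. xn z + y n z))
      then (\<lambda>z. xn z + y n z) else (\<lambda>z. xn z - y n z))"
  have x0: "x 0 = (\<lambda>_. 0)" by (simp add: x_def)
  have xS: "x (Suc n) = (if nrm (S (\<tau> n) (y n)) \<le> nrm (S (\<tau> n) (\<lambda>z. x n z + y n z))
      then (\<lambda>z. x n z + y n z) else (\<lambda>z. x n z - y n z))" for n
    by (simp add: x_def)
  have xH: "x n \<in> H" for n by (induction n) (auto simp: x0 xS H_zero intro!: H_add H_diff yH)
  have key: "nrm (S (\<tau> n) (y n)) \<le> nrm (S (\<tau> n) (x (Suc n)))" for n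
  proof (cases "nrm (S (\<tau> n) (y n)) \<le> nrm (S (\<tau> n) (\<lambda>z. x n z + y n z))")
    case False
    have pH: "(\<lambda>z. x n z + y n z) \<in> H" "(\<lambda>z. x n z - y n z) \<in> H" by (intro H_add H_diff xH yH)+
    have "2 * nrm (S (\<tau> n) (y n)) = nrm (S (\<tau> n) (\<lambda>z. 2 * y n z))"
      using nrm_S_cmult[OF \<tau>(1) yH, of n 2 n] by simp
    also have "(\<lambda>z. 2 * y n z) = (\<lambda>z. (x n z + y n z) - (x n z - y n z))" by auto
    also have "nrm (S (\<tau> n) \<dots>) \<le> nrm (S (\<tau> n) (\<lambda>z. x n z + y n z)) + nrm (S (\<tau> n) (\<lambda>z. x n z - y n z))"
      unfolding nrm_S_diff[OF \<tau>(1) pH] by (intro nrm_triangle_diff S_H \<tau> pH)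
    finally show ?thesis using False by (simp add: xS)
  qed (simp add: xS)
  define d where "d n z = x (Suc n) z - x n z" for n z
  have dH: "d n \<in> H" for n unfolding d_def by (intro H_diff xH)
  have "d n = y n \<or> d n = (\<lambda>z. - 1 * y n z)" for n by (auto simp: d_def[abs_def] xS)
  then have "nrm (d n) = nrm (y n)" for n using nrm_cmult[of "-1" "y n"] by (metis abs_minus_cancel abs_one mult_1)
  moreover have "nrm (y n) \<le> (1 / 3) ^ n" for n
    unfolding y_def nrm_cmult using g(2)[of n] by (simp add: mult_left_le)
  ultimately have dn: "nrm (d n) \<le> (1 / 3) ^ n" for n by metis
  obtain X where X: "X \<in> H" "\<And>N. nrm (\<lambda>z. X z - (\<Sum>n<N. d n z)) \<le> (\<Sum>n. (1 / 3) ^ (n + N))"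
  proof -
    have "summable (\<lambda>n. (1 / 3 :: real) ^ n)" by (simp add: summable_geometric)
    from H_complete[of d "\<lambda>n. (1 / 3) ^ n", OF dH dn this] that show thesis by blast
  qed
  have sumd: "(\<Sum>k<n. d k z) = x n z" for n z by (induction n) (auto simp: x0 d_def)
  have Xx: "nrm (\<lambda>z. X z - x (Suc n) z) \<le> (1 / 3) ^ n / 2" for n
  proof -
    have "(\<Sum>k. (1 / 3 :: real) ^ (k + Suc n)) = (1 / 3) ^ Suc n * (\<Sum>k. (1 / 3) ^ k)"
      unfolding power_add by (subst suminf_mult[symmetric]) (auto simp: mult.commute)
    also have "(\<Sum>k. (1 / 3 :: real) ^ k) = 3 / 2" by (subst suminf_geometric) auto
    finally show ?thesis using X(2)[of "Suc n"] unfolding sumd by simp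
  qed
  have big: "real (Suc n) \<le> nrm (S (\<tau> n) X)" for n
  proof -
    have "nrm (S (\<tau> n) (x (Suc n))) \<le> nrm (S (\<tau> n) X) + nrm (\<lambda>z. S (\<tau> n) (x (Suc n)) z - S (\<tau> n) X z)"
      by (intro nrm_le_diff S_H \<tau> xH X)
    moreover have "nrm (\<lambda>z. S (\<tau> n) (x (Suc n)) z - S (\<tau> n) X z) \<le> opn (\<tau> n) * ((1 / 3) ^ n / 2)"
    proof -
      have "nrm (\<lambda>z. S (\<tau> n) (x (Suc n)) z - S (\<tau> n) X z) = nrm (S (\<tau> n) (\<lambda>z. x (Suc n) z - X z))"
        by (simp add: nrm_S_diff \<tau> xH X)
      also have "\<dots> \<le> opn (\<tau> n) * nrm (\<lambda>z. x (Suc n) z - X z)"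
        by (intro nrm_S_le_opn \<tau> H_diff xH X)
      also have "\<dots> \<le> opn (\<tau> n) * ((1 / 3) ^ n / 2)"
        using Xx[of n] nrm_minus_commute[of X "x (Suc n)"] by (intro mult_left_mono opn_nonneg \<tau>) simp
      finally show ?thesis .
    qed
    moreover have "(1 / 3) ^ n * (2 / 3 * opn (\<tau> n)) \<le> nrm (S (\<tau> n) (x (Suc n)))"
      using key[of n] g(3)[of n] unfolding Sy
      by (intro order_trans[OF mult_left_mono key[of n, unfolded Sy]]) auto
    ultimately have "(1 / 3) ^ n * (opn (\<tau> n) / 6) \<le> nrm (S (\<tau> n) X)" by (simp add: algebra_simps)
    moreover have "real (Suc n) \<le> (1 / 3) ^ n * (opn (\<tau> n) / 6)"
      using \<tau>(3)[of n] by (simp add: power_one_over field_simps)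
    ultimately show ?thesis by simp
  qed
  \<comment> \<open>Strong continuity at 0 bounds the orbit of \<open>X\<close> for small times,
    whereas \<open>big\<close> makes it unbounded along \<tau>, which tends to 0.\<close>
  have "\<forall>\<^sub>F t in at_right 0. nrm (\<lambda>z. S t X z - X z) < 1"
    using S_cont[OF X(1)] by (rule order_tendstoD) simp
  then obtain b where b: "0 < b" "\<And>t. 0 < t \<Longrightarrow> t < b \<Longrightarrow> nrm (\<lambda>z. S t X z - X z) < 1"
    by (auto simp: eventually_at_right_field)
  obtain m where m: "1 / b + nrm X + 1 < real m" using reals_Archimedean2 by blast
  have "1 / real (Suc m) < b"
  proof -
    have "1 / b < real (Suc m)" using m nrm_nonneg[of X] by simp
    then show ?thesis using b(1) by (simp add: field_simps)
  qed
  then have tb: "\<tau> m < b" using \<tau>(2)[of m] by linarith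
  have "nrm (\<lambda>z. S (\<tau> m) X z - X z) \<le> 1"
  \<comment> \<open>Strong continuity is a limit from the right and says nothing at t = 0, where
    \<open>S 0\<close> is the identity up to a null set.\<close>
  proof (cases "\<tau> m = 0")
    case True
    have "nrm (\<lambda>z. S 0 X z - X z) = nrm (\<lambda>_. 0)"
      using S_0_AE[OF X(1)] X(1) by (intro nrm_cong_H H_diff S_H H_zero) auto
    then show ?thesis using True nrm_zero by simp
  next
    case False
    then show ?thesis using b(2)[of "\<tau> m"] tb \<tau>(1)[of m] by simp
  qed
  moreover have "nrm (S (\<tau> m) X) \<le> nrm X + nrm (\<lambda>z. S (\<tau> m) X z - X z)"
    by (intro nrm_le_diff S_H \<tau> X)
  ultimately have "real (Suc m) \<le> nrm X + 1" using big[of m] by linarith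
  moreover have "0 < 1 / b" using b(1) by simp
  ultimately show False using m by simp
qed

text \<open>An interval of length T is covered by finitely many steps of length at most \<delta>,
  and \<open>opn\<close> is submultiplicative.\<close>

lemma opn_locally_bounded: "\<exists>B\<ge>1. \<forall>t\<in>{0..T}. \<forall>f\<in>H. nrm (S t f) \<le> B * nrm f"
proof -
  obtain \<delta> B0 where "0 < \<delta>" "\<forall>t\<in>{0..\<delta>}. opn t \<le> B0" using opn_bounded_near_0 by blast
  then have B0: "0 < \<delta>" "\<And>t. 0 \<le> t \<Longrightarrow> t \<le> \<delta> \<Longrightarrow> opn t \<le> B0" by auto
  define B where "B = max 1 B0"
  obtain m where m: "T / \<delta> \<le> real m" using real_arch_simple by blast
  \<comment> \<open>There is one power more than the number of steps, because the induction starts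
    from the bound \<open>B\<close> for \<open>opn 0\<close>.\<close>
  have pw: "opn (real k * s) \<le> B ^ Suc k" if "0 \<le> s" "s \<le> \<delta>" for k s
  proof (induction k)
    case 0
    show ?case using B0(2)[of 0] B0(1) by (simp add: B_def)
  next
    case (Suc k)
    have "opn (real (Suc k) * s) = opn (s + real k * s)" by (simp add: algebra_simps)
    also have "\<dots> \<le> opn s * opn (real k * s)" using that by (intro opn_add) auto
    also have "\<dots> \<le> B * B ^ Suc k"
      using that B0(2)[of s] Suc by (intro mult_mono opn_nonneg) (auto simp: B_def)
    finally show ?case by simp
  qed
  have "nrm (S t f) \<le> B ^ Suc (Suc m) * nrm f" if t: "t \<in> {0..T}" and f: "f \<in> H" for t f
  proof -
    have "t / real (Suc m) \<le> \<delta>"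
    proof -
      have "t \<le> real m * \<delta>" using t m B0(1) by (simp add: divide_le_eq)
      also have "\<dots> \<le> real (Suc m) * \<delta>" using B0(1) by simp
      finally show ?thesis by (simp add: divide_le_eq mult.commute)
    qed
    then have "opn (real (Suc m) * (t / real (Suc m))) \<le> B ^ Suc (Suc m)"
      using t by (intro pw) auto
    then have "opn t \<le> B ^ Suc (Suc m)" by simp
    then show ?thesis using nrm_S_le_opn[of t f] t f nrm_nonneg[of f]
      by (meson atLeastAtMost_iff mult_right_mono order_trans)
  qed
  moreover have "1 \<le> B ^ Suc (Suc m)" by (rule one_le_power) (simp add: B_def)
  ultimately show ?thesis by blast
qed

end

section \<open>Approximation of orbits by splines of test functions\<close>

text \<open>The primitive of the hat function on \<open>[-1, 1]\<close>, a quadratic spline.\<close>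

definition ramp :: "real \<Rightarrow> real" where
  "ramp s = ((max 0 (s + 1))\<^sup>2 - 2 * (max 0 s)\<^sup>2 + (max 0 (s - 1))\<^sup>2) / 2"

definition hat :: "real \<Rightarrow> real" where
  "hat s = max 0 (s + 1) - 2 * max 0 s + max 0 (s - 1)"

section \<open>The quadratic spline\<close>

lemma pos_square_DERIV: "((\<lambda>s. (max 0 s)\<^sup>2) has_real_derivative 2 * max 0 t) (at (t::real))"
proof -
  consider "t < 0" | "t = 0" | "0 < t" by linarith
  then show ?thesis
  proof cases
    case 1
    have "\<forall>\<^sub>F s in nhds t. (max 0 s)\<^sup>2 = (0::real)"
      using eventually_nhds_in_open[of "{..<0}" t] 1 by (auto elim!: eventually_mono)
    then show ?thesis using 1 DERIV_cong_ev[OF refl _ refl, of "\<lambda>s. (max 0 s)\<^sup>2" "\<lambda>_. 0" t 0] by simp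
  next
    case 2
    have "((\<lambda>h::real. (max 0 h)\<^sup>2 / h) \<longlongrightarrow> 0) (at 0)"
    proof (rule Lim_null_comparison)
      show "\<forall>\<^sub>F h::real in at 0. norm ((max 0 h)\<^sup>2 / h) \<le> \<bar>h\<bar>"
        by (auto simp: max_def power2_eq_square intro!: always_eventually)
      show "((\<lambda>h::real. \<bar>h\<bar>) \<longlongrightarrow> 0) (at 0)" by (intro tendsto_rabs_zero tendsto_ident_at)
    qed
    then show ?thesis using 2 by (simp add: DERIV_def)
  next
    case 3
    have "\<forall>\<^sub>F s in nhds t. (max 0 s)\<^sup>2 = s\<^sup>2"
      using eventually_nhds_in_open[of "{0<..}" t] 3 by (auto elim!: eventually_mono)
    moreover have "((\<lambda>s. s\<^sup>2) has_real_derivative 2 * t) (at t)" by (auto intro!: derivative_eq_intros)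
    ultimately show ?thesis using 3 DERIV_cong_ev[OF refl _ refl, of "\<lambda>s. (max 0 s)\<^sup>2" "\<lambda>s. s\<^sup>2" t "2 * t"] by simp
  qed
qed

lemma ramp_DERIV: "(ramp has_real_derivative hat t) (at t)"
proof -
  have sh: "((\<lambda>s. (max 0 (s + c))\<^sup>2) has_real_derivative 2 * max 0 (t + c)) (at t)" for c
    using DERIV_shift[of "\<lambda>s. (max 0 s)\<^sup>2" "2 * max 0 (t + c)" t c] pos_square_DERIV[of "t + c"] by simp
  have "((\<lambda>s. ((max 0 (s + 1))\<^sup>2 - 2 * (max 0 (s + 0))\<^sup>2 + (max 0 (s + -1))\<^sup>2) / 2) has_real_derivative
      (2 * max 0 (t + 1) - 2 * (2 * max 0 (t + 0)) + 2 * max 0 (t + -1)) / 2) (at t)"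
    by (intro DERIV_cdivide DERIV_add DERIV_diff DERIV_cmult sh)
  moreover have "(2 * max 0 (t + 1) - 2 * (2 * max 0 (t + 0)) + 2 * max 0 (t + -1)) / 2 = hat t"
    by (simp add: hat_def)
  ultimately show ?thesis unfolding ramp_def[abs_def] by simp
qed

lemma ramp_values:
  "1 \<le> s \<Longrightarrow> ramp s = 1" "s \<le> -1 \<Longrightarrow> ramp s = 0"
  "0 \<le> s \<Longrightarrow> s \<le> 1 \<Longrightarrow> ramp s = 1 - (1 - s)\<^sup>2 / 2" "0 \<le> s \<Longrightarrow> s \<le> 1 \<Longrightarrow> ramp (s - 1) = s\<^sup>2 / 2"
  by (auto simp: ramp_def max_def power2_eq_square field_simps)

lemma hat_values:
  "1 \<le> s \<Longrightarrow> hat s = 0" "s \<le> -1 \<Longrightarrow> hat s = 0"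
  "0 \<le> s \<Longrightarrow> s \<le> 1 \<Longrightarrow> hat s = 1 - s" "0 \<le> s \<Longrightarrow> s \<le> 1 \<Longrightarrow> hat (s - 1) = s"
  by (auto simp: hat_def max_def)

text \<open>At time j + s with s in [0, 1], the ramps with index below j are saturated at 1 and
  telescope, and those with index above j + 1 are still 0. What is left is a combination of three
  neighbouring nodes, convex in the application, and its derivative interpolates two neighbouring
  increments.\<close>

lemma spline_local:
  fixes Y :: "nat \<Rightarrow> real"
  assumes s: "0 \<le> s" "s \<le> 1" and j: "j < N"
  shows "Y 0 + (\<Sum>k<Suc N. ramp (real j + s - real k) * (Y (Suc k) - Y k)) =
      (1 - ramp s) * Y j + (ramp s - ramp (s - 1)) * Y (Suc j) + ramp (s - 1) * Y (Suc (Suc j))"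
    and "(\<Sum>k<Suc N. hat (real j + s - real k) * (Y (Suc k) - Y k)) =
      (1 - s) * (Y (Suc j) - Y j) + s * (Y (Suc (Suc j)) - Y (Suc j))"
proof -
  have split: "(\<Sum>k<Suc N. u k) = (\<Sum>k<j. u k) + u j + u (Suc j) + (\<Sum>k\<in>{Suc (Suc j)..<Suc N}. u k)" for u :: "nat \<Rightarrow> real"
  proof -
    have "{..<Suc N} = {..<j} \<union> {j..<Suc N}" using j by auto
    then have "(\<Sum>k<Suc N. u k) = (\<Sum>k<j. u k) + (\<Sum>k\<in>{j..<Suc N}. u k)"
      by (simp add: sum.union_disjoint ivl_disj_int)
    also have "(\<Sum>k\<in>{j..<Suc N}. u k) = u j + (u (Suc j) + (\<Sum>k\<in>{Suc (Suc j)..<Suc N}. u k))"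
    proof -
      have "j < Suc N" "Suc j < Suc N" using j by auto
      then show ?thesis by (simp only: sum.atLeast_Suc_lessThan)
    qed
    finally show ?thesis by simp
  qed
  have hi: "real j + s - real k \<le> -1" if "k \<in> {Suc (Suc j)..<Suc N}" for k
  proof -
    have "real (Suc (Suc j)) \<le> real k" using that by (intro of_nat_mono) auto
    then show ?thesis using s by simp
  qed
  have lo: "1 \<le> real j + s - real k" if "k < j" for k
  proof -
    have "real (Suc k) \<le> real j" using that by (intro of_nat_mono) auto
    then show ?thesis using s by simp
  qed
  have a1: "real j + s - real (Suc j) = s - 1" "real j + s - real j = s" by auto
  have "(\<Sum>k<j. ramp (real j + s - real k) * (Y (Suc k) - Y k)) = Y j - Y 0"
    using lo by (simp add: ramp_values(1) sum_lessThan_telescope)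
  moreover have "(\<Sum>k\<in>{Suc (Suc j)..<Suc N}. ramp (real j + s - real k) * (Y (Suc k) - Y k)) = 0"
    using hi by (intro sum.neutral) (auto simp: ramp_values(2))
  ultimately show "Y 0 + (\<Sum>k<Suc N. ramp (real j + s - real k) * (Y (Suc k) - Y k)) =
      (1 - ramp s) * Y j + (ramp s - ramp (s - 1)) * Y (Suc j) + ramp (s - 1) * Y (Suc (Suc j))"
    unfolding split a1 by (simp add: algebra_simps)
  have "(\<Sum>k<j. hat (real j + s - real k) * (Y (Suc k) - Y k)) = 0"
    using lo by (intro sum.neutral) (auto simp: hat_values(1))
  moreover have "(\<Sum>k\<in>{Suc (Suc j)..<Suc N}. hat (real j + s - real k) * (Y (Suc k) - Y k)) = 0"
    using hi by (intro sum.neutral) (auto simp: hat_values(2))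
  ultimately show "(\<Sum>k<Suc N. hat (real j + s - real k) * (Y (Suc k) - Y k)) =
      (1 - s) * (Y (Suc j) - Y j) + s * (Y (Suc (Suc j)) - Y (Suc j))"
    unfolding split a1 using s by (simp add: hat_values)
qed

section \<open>Orbits of test functions and their time derivatives\<close>

locale generated_semigroup = weighted_semigroup w S
  for w :: "'d::finite phase \<Rightarrow> real" and S +
  fixes A :: "('d phase \<Rightarrow> real) \<Rightarrow> 'd phase \<Rightarrow> real"
  assumes generator: "test_function UNIV \<phi> \<Longrightarrow> in_generator w S \<phi> (A \<phi>)"
    and core: "in_generator w S f h \<Longrightarrow> 0 < \<epsilon> \<Longrightarrow>
      \<exists>\<phi>. test_function UNIV \<phi> \<and> nrm (\<lambda>z. \<phi> z - f z) < \<epsilon> \<and> nrm (\<lambda>z. A \<phi> z - h z) < \<epsilon>"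
    and A_diff: "test_function UNIV \<phi> \<Longrightarrow> test_function UNIV \<psi> \<Longrightarrow>
      A (\<lambda>z. \<phi> z - \<psi> z) z = A \<phi> z - A \<psi> z"
begin

lemma A_H: "test_function UNIV \<phi> \<Longrightarrow> A \<phi> \<in> H"
  using generator by (simp add: in_generator_def)

text \<open>\<open>S t\<close> is bounded and maps the difference quotient of \<open>f\<close> at
  time 0 to that of the orbit at time t, up to a null set.\<close>

lemma orbit_in_generator:
  assumes t: "0 \<le> t" and g: "in_generator w S f h" shows "in_generator w S (S t f) (S t h)"
proof -
  have fH: "f \<in> H" "h \<in> H" and lim: "((\<lambda>s. nrm (\<lambda>z. (S s f z - f z) / s - h z)) \<longlongrightarrow> 0) (at_right 0)"
    using g by (auto simp: in_generator_def)
  have le: "nrm (\<lambda>z. (S s (S t f) z - S t f z) / s - S t h z) \<le> opn t * nrm (\<lambda>z. (S s f z - f z) / s - h z)"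
    if s: "0 < s" for s
  proof -
    have H1: "S s f \<in> H" using fH s by (intro S_H) auto
    have H2: "(\<lambda>y. S s f y - f y) \<in> H" using H1 fH by (intro H_diff)
    have H3: "(\<lambda>y. (1 / s) * (S s f y - f y) + (-1) * h y) \<in> H" using H2 fH by (intro H_lin)
    have "AE z in lborel. (S s (S t f) z - S t f z) / s - S t h z =
        S t (\<lambda>y. (1 / s) * (S s f y - f y) + (-1) * h y) z"
    proof -
      have "AE z in lborel. S (s + t) f z = S s (S t f) z" "AE z in lborel. S (t + s) f z = S t (S s f) z"
        using s t fH by (auto intro!: S_add_AE)
      moreover have "AE z in lborel. S t (\<lambda>y. 1 * S s f y + (-1) * f y) z = 1 * S t (S s f) z + (-1) * S t f z"
        by (intro S_lin_AE t fH H1)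
      moreover have "AE z in lborel. S t (\<lambda>y. (1 / s) * (S s f y - f y) + (-1) * h y) z =
          (1 / s) * S t (\<lambda>y. S s f y - f y) z + (-1) * S t h z"
        by (intro S_lin_AE t fH H2)
      ultimately show ?thesis by eventually_elim (auto simp: add.commute[of s t])
    qed
    then have "nrm (\<lambda>z. (S s (S t f) z - S t f z) / s - S t h z) =
        nrm (S t (\<lambda>y. (1 / s) * (S s f y - f y) + (-1) * h y))"
      by (intro nrm_cong_H)
        (use H_lin[OF H_diff[OF S_H[of s "S t f"] S_H[OF t fH(1)]] S_H[OF t fH(2)], of "1 / s" "-1"]
          S_H[OF t H3] S_H[OF t fH(1)] s in auto)
    also have "\<dots> \<le> opn t * nrm (\<lambda>y. (1 / s) * (S s f y - f y) + (-1) * h y)"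
      by (intro nrm_S_le_opn t H3)
    finally show ?thesis by simp
  qed
  have "((\<lambda>s. nrm (\<lambda>z. (S s (S t f) z - S t f z) / s - S t h z)) \<longlongrightarrow> 0) (at_right 0)"
  proof (rule tendsto_sandwich)
    show "\<forall>\<^sub>F s in at_right 0. 0 \<le> nrm (\<lambda>z. (S s (S t f) z - S t f z) / s - S t h z)"
      using nrm_nonneg by simp
    show "\<forall>\<^sub>F s in at_right 0. nrm (\<lambda>z. (S s (S t f) z - S t f z) / s - S t h z) \<le>
        opn t * nrm (\<lambda>z. (S s f z - f z) / s - h z)"
      using le by (auto simp: eventually_at_right_field intro!: exI[of _ 1])
    show "((\<lambda>s. opn t * nrm (\<lambda>z. (S s f z - f z) / s - h z)) \<longlongrightarrow> 0) (at_right 0)"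
      using tendsto_mult_left[OF lim, of "opn t"] by simp
  qed simp
  then show ?thesis using fH t by (simp add: in_generator_def S_H)
qed

lemma nrm_S_step:
  assumes t: "0 \<le> t" and s: "0 \<le> s" and f: "f \<in> H"
  shows "nrm (\<lambda>z. S (t + s) f z - S t f z) = nrm (S t (\<lambda>y. S s f y - f y))"
proof -
  have "AE z in lborel. S (t + s) f z - S t f z = 1 * S t (S s f) z + (-1) * S t f z"
    using S_add_AE[OF t s f] by eventually_elim simp
  then have "nrm (\<lambda>z. S (t + s) f z - S t f z) = nrm (\<lambda>z. 1 * S t (S s f) z + (-1) * S t f z)"
    by (intro nrm_cong_H H_diff H_lin S_H) (use t s f in auto)
  also have "\<dots> = nrm (S t (\<lambda>y. 1 * S s f y + (-1) * f y))"
    by (intro nrm_S_lin[symmetric] S_H t s f)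
  finally show ?thesis by simp
qed

lemma nrm_convex3:
  assumes X: "X \<in> H" "Y \<in> H" "Z \<in> H" "v \<in> H"
    and r: "nrm (\<lambda>z. X z - v z) \<le> r" "nrm (\<lambda>z. Y z - v z) \<le> r" "nrm (\<lambda>z. Z z - v z) \<le> r"
    and c: "0 \<le> a" "0 \<le> b" "0 \<le> c" "a + b + c = 1"
  shows "nrm (\<lambda>z. a * X z + b * Y z + c * Z z - v z) \<le> r"
proof -
  have eq: "(\<lambda>z. a * X z + b * Y z + c * Z z - v z) =
      (\<lambda>z. (a * (X z - v z) + b * (Y z - v z)) + c * (Z z - v z))"
  proof
    fix z
    have "v z = (a + b + c) * v z" using c by simp
    then show "a * X z + b * Y z + c * Z z - v z = (a * (X z - v z) + b * (Y z - v z)) + c * (Z z - v z)"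
      by (simp add: algebra_simps)
  qed
  have "nrm (\<lambda>z. a * X z + b * Y z + c * Z z - v z) \<le>
      nrm (\<lambda>z. a * (X z - v z) + b * (Y z - v z)) + nrm (\<lambda>z. c * (Z z - v z))"
    unfolding eq using X by (intro nrm_triangle H_lin H_cmult H_diff)
  also have "nrm (\<lambda>z. a * (X z - v z) + b * (Y z - v z)) \<le> nrm (\<lambda>z. a * (X z - v z)) + nrm (\<lambda>z. b * (Y z - v z))"
    using X by (intro nrm_triangle H_cmult H_diff)
  finally have "nrm (\<lambda>z. a * X z + b * Y z + c * Z z - v z) \<le>
      a * nrm (\<lambda>z. X z - v z) + b * nrm (\<lambda>z. Y z - v z) + c * nrm (\<lambda>z. Z z - v z)"
    unfolding nrm_cmult using c by simp
  also have "\<dots> \<le> a * r + b * r + c * r" using r c by (intro add_mono mult_left_mono)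
  also have "\<dots> = r" using c by (simp flip: distrib_right)
  finally show ?thesis .
qed

text \<open>All functions are finite sums of scalar functions of t times test functions, so that
  every derivative is classical. The bound \<open>C\<close> is separate from \<epsilon>: in the
  energy balance it multiplies \<epsilon> and has to stay fixed as \<epsilon> tends to 0.\<close>

definition approximates ::
  "('d phase \<Rightarrow> real) \<Rightarrow> real \<Rightarrow> real \<Rightarrow> real \<Rightarrow> nat \<Rightarrow> (nat \<Rightarrow> real \<Rightarrow> real) \<Rightarrow> (nat \<Rightarrow> real \<Rightarrow> real) \<Rightarrow>
    (nat \<Rightarrow> 'd phase \<Rightarrow> real) \<Rightarrow> bool" where
  "approximates \<phi> T \<epsilon> C n p p' \<psi> \<longleftrightarrow>
    (\<forall>k. test_function UNIV (\<psi> k)) \<and> (\<forall>k t. (p k has_real_derivative p' k t) (at t)) \<and>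
    (\<forall>k. continuous_on UNIV (p' k)) \<and>
    (\<forall>t\<in>{0..T}. nrm (\<lambda>z. (\<Sum>k<n. p' k t * \<psi> k z) - (\<Sum>k<n. p k t * A (\<psi> k) z)) \<le> \<epsilon>) \<and>
    (\<forall>t\<in>{0..T}. nrm (\<lambda>z. \<Sum>k<n. p k t * \<psi> k z) \<le> C) \<and>
    nrm (\<lambda>z. (\<Sum>k<n. p k 0 * \<psi> k z) - \<phi> z) \<le> \<epsilon> \<and>
    nrm (\<lambda>z. (\<Sum>k<n. p k T * \<psi> k z) - S T \<phi> z) \<le> \<epsilon>"

lemma test_function_diff:
  assumes "test_function UNIV \<phi>" "test_function UNIV \<psi>"
  shows "test_function UNIV (\<lambda>z. \<phi> z - \<psi> z :: real)"
proof -
  have "Cc (\<lambda>z. \<phi> z - \<psi> z)" using assms by (intro Cc_diff test_function_Cc)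
  then obtain r where r: "\<And>z. r < norm z \<Longrightarrow> \<phi> z - \<psi> z = 0" using Cc_support by metis
  have "C_k k (\<lambda>z. \<phi> z + (-1) * \<psi> z)" for k
    using assms by (intro C_k_add C_k_mult C_k_const test_function_C_k)
  then show ?thesis using r by (intro test_functionI[of _ r]) auto
qed

text \<open>The orbit of a test function stays in the domain of the generator, which maps S(t)
  \<phi> to S(t) A \<phi>, and this is continuous in t. On a fine time grid each sample is replaced
  by a test function close to it in the graph norm, and the nodes are joined by a quadratic spline,
  whose time derivative is continuous.\<close>

lemma orbit_approximation:
  assumes \<phi>: "test_function UNIV \<phi>" and T: "0 < T"
  shows "\<exists>C\<ge>0. \<forall>\<epsilon>>0. \<exists>n p p' \<psi>. approximates \<phi> T \<epsilon> C n p p' \<psi>"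
proof -
  \<comment> \<open>The bound is taken up to T + 1 because the spline on the last interval involves
    a node beyond T.\<close>
  obtain B where B: "1 \<le> B" "\<And>t f. 0 \<le> t \<Longrightarrow> t \<le> T + 1 \<Longrightarrow> f \<in> H \<Longrightarrow> nrm (S t f) \<le> B * nrm f"
    using opn_locally_bounded[of "T + 1"] by auto
  define g where "g = A \<phi>"
  have H: "\<phi> \<in> H" "g \<in> H" using \<phi> by (auto simp: g_def A_H test_function_H)
  have gen: "in_generator w S \<phi> g" unfolding g_def by (rule generator[OF \<phi>])
  show ?thesis
  proof (intro exI[of _ "B * nrm \<phi> + 1"] conjI allI impI)
    show "0 \<le> B * nrm \<phi> + 1" using B nrm_nonneg[of \<phi>] by simp
    fix \<epsilon> :: real assume \<epsilon>: "0 < \<epsilon>"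
    \<comment> \<open>The residual will be at most 3 B \<eta> from the values of \<open>A\<close>
      plus 4 B \<eta> from the slopes; the minimum with 1 keeps the uniform bound at B |\<phi>| +
      1.\<close>
    define \<eta> where "\<eta> = min \<epsilon> 1 / (7 * B)"
    have \<eta>: "0 < \<eta>" "7 * B * \<eta> \<le> \<epsilon>" "7 * B * \<eta> \<le> 1" using \<epsilon> B by (auto simp: \<eta>_def)
    have "\<forall>\<^sub>F s in at_right 0. nrm (\<lambda>z. (S s \<phi> z - \<phi> z) / s - g z) < \<eta>"
      using gen \<eta>(1) unfolding in_generator_def by (auto intro: order_tendstoD)
    moreover have "\<forall>\<^sub>F s in at_right 0. nrm (\<lambda>z. S s \<phi> z - \<phi> z) < \<eta>" "\<forall>\<^sub>F s in at_right 0. nrm (\<lambda>z. S s g z - g z) < \<eta>"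
      by (rule order_tendstoD(2)[OF S_cont[OF H(1)] \<eta>(1)], rule order_tendstoD(2)[OF S_cont[OF H(2)] \<eta>(1)])
    ultimately have "\<forall>\<^sub>F s in at_right 0. nrm (\<lambda>z. (S s \<phi> z - \<phi> z) / s - g z) < \<eta> \<and>
        nrm (\<lambda>z. S s \<phi> z - \<phi> z) < \<eta> \<and> nrm (\<lambda>z. S s g z - g z) < \<eta>"
      by eventually_elim auto
    then obtain b where b: "0 < b" "\<And>s. 0 < s \<Longrightarrow> s < b \<Longrightarrow> nrm (\<lambda>z. (S s \<phi> z - \<phi> z) / s - g z) < \<eta> \<and>
        nrm (\<lambda>z. S s \<phi> z - \<phi> z) < \<eta> \<and> nrm (\<lambda>z. S s g z - g z) < \<eta>"
      by (auto simp: eventually_at_right_field)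
    obtain N where N: "T / min b 1 < real N" using reals_Archimedean2 by blast
    have N0: "0 < N" using N T b by (cases N) (auto simp: divide_less_0_iff)
    define \<tau> where "\<tau> = T / real N"
    have \<tau>: "0 < \<tau>" "\<tau> < b" "\<tau> \<le> 1" "real N * \<tau> = T"
    proof -
      have m: "0 < min b 1" using b(1) by simp
      have "\<tau> < min b 1" using N N0 m by (simp only: \<tau>_def divide_less_eq of_nat_0_less_iff if_True mult.commute)
      then show "\<tau> < b" "\<tau> \<le> 1" by auto
    qed (use N0 T in \<open>auto simp: \<tau>_def\<close>)
    note small = b(2)[OF \<tau>(1,2)]
    define y where "y k = S (real k * \<tau>) \<phi>" for k
    define h where "h k = S (real k * \<tau>) g" for k
    have tk: "0 \<le> real k * \<tau>" for k using \<tau> by simp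
    have tk1: "real k * \<tau> \<le> T + 1" if "k \<le> Suc N" for k
    proof -
      have "real k * \<tau> \<le> real (Suc N) * \<tau>" using that \<tau> by (intro mult_right_mono) auto
      then show ?thesis using \<tau> by (simp add: algebra_simps)
    qed
    have yH: "y k \<in> H" "h k \<in> H" for k unfolding y_def h_def by (intro S_H tk H)+
    have step: "nrm (\<lambda>z. S (real (Suc k) * \<tau>) f z - S (real k * \<tau>) f z) \<le> B * \<eta>"
      if "k \<le> Suc N" "f \<in> H" "nrm (\<lambda>z. S \<tau> f z - f z) < \<eta>" for k f
    proof -
      have "real (Suc k) * \<tau> = real k * \<tau> + \<tau>" by (simp add: algebra_simps)
      then have "nrm (\<lambda>z. S (real (Suc k) * \<tau>) f z - S (real k * \<tau>) f z) =
          nrm (S (real k * \<tau>) (\<lambda>z. S \<tau> f z - f z))"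
        using nrm_S_step[OF tk[of k], of \<tau> f] \<tau>(1) that(2) by simp
      also have "\<dots> \<le> B * nrm (\<lambda>z. S \<tau> f z - f z)"
        using that \<tau> by (intro B tk tk1 H_diff S_H) auto
      also have "\<dots> \<le> B * \<eta>" using that(3) B(1) by (intro mult_left_mono) auto
      finally show ?thesis .
    qed
    have ystep: "nrm (\<lambda>z. y (Suc k) z - y k z) \<le> B * \<eta>" "nrm (\<lambda>z. h (Suc k) z - h k z) \<le> B * \<eta>"
      if "k \<le> Suc N" for k
      unfolding y_def h_def using step[OF that H(1)] step[OF that H(2)] small by blast+
    \<comment> \<open>The slope of the orbit between two nodes is \<open>S (real k * \<tau>)\<close>
      applied to the first difference quotient, which is \<eta>-close to \<open>g\<close>.\<close>
    have slope: "nrm (\<lambda>z. (1 / \<tau>) * (y (Suc k) z - y k z) - h k z) \<le> B * \<eta>" if k: "k \<le> Suc N" for k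
    proof -
      have "AE z in lborel. S (real k * \<tau> + \<tau>) \<phi> z = S (real k * \<tau>) (S \<tau> \<phi>) z"
        using S_add_AE[OF tk _ H(1), of \<tau> k] \<tau>(1) by simp
      moreover have "AE z in lborel. S (real k * \<tau>) (\<lambda>u. 1 * S \<tau> \<phi> u + (-1) * \<phi> u) z =
          1 * S (real k * \<tau>) (S \<tau> \<phi>) z + (-1) * S (real k * \<tau>) \<phi> z"
        using \<tau>(1) by (intro S_lin_AE tk H S_H) auto
      moreover have "AE z in lborel. S (real k * \<tau>) (\<lambda>u. (1 / \<tau>) * (S \<tau> \<phi> u - \<phi> u) + (-1) * g u) z =
          (1 / \<tau>) * S (real k * \<tau>) (\<lambda>u. S \<tau> \<phi> u - \<phi> u) z + (-1) * S (real k * \<tau>) g z"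
        using \<tau>(1) by (intro S_lin_AE tk H S_H H_diff) auto
      ultimately have ae: "AE z in lborel. (1 / \<tau>) * (y (Suc k) z - y k z) - h k z =
          S (real k * \<tau>) (\<lambda>u. (1 / \<tau>) * (S \<tau> \<phi> u - \<phi> u) + (-1) * g u) z"
      proof eventually_elim
        case (elim z)
        have "real (Suc k) * \<tau> = real k * \<tau> + \<tau>" by (simp add: algebra_simps)
        then have "y (Suc k) z = S (real k * \<tau>) (S \<tau> \<phi>) z" using elim(1) by (simp add: y_def)
        then show ?case using elim(2,3) by (simp add: y_def h_def)
      qed
      have hH: "(\<lambda>u. (1 / \<tau>) * (S \<tau> \<phi> u - \<phi> u) + (-1) * g u) \<in> H"
        using \<tau>(1) by (intro H_lin H_diff S_H H) auto
      have lH: "(\<lambda>z. (1 / \<tau>) * (y (Suc k) z - y k z) - h k z) \<in> H"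
        by (intro H_diff H_cmult yH)
      have "nrm (\<lambda>z. (1 / \<tau>) * (y (Suc k) z - y k z) - h k z) =
          nrm (S (real k * \<tau>) (\<lambda>u. (1 / \<tau>) * (S \<tau> \<phi> u - \<phi> u) + (-1) * g u))"
        using nrm_cong_H[OF lH S_H[OF tk hH] ae] .
      also have "\<dots> \<le> B * nrm (\<lambda>u. (1 / \<tau>) * (S \<tau> \<phi> u - \<phi> u) + (-1) * g u)"
        using k by (intro B tk tk1 hH)
      also have "\<dots> \<le> B * \<eta>" using small B(1) by (intro mult_left_mono) auto
      finally show ?thesis .
    qed
    \<comment> \<open>The tolerance carries a factor \<tau> because the slopes of the spline divide
      differences of nodes by \<tau>.\<close>
    have "\<exists>\<xi>. test_function UNIV \<xi> \<and> nrm (\<lambda>z. \<xi> z - y k z) < \<eta> * \<tau> \<and> nrm (\<lambda>z. A \<xi> z - h k z) < \<eta> * \<tau>" for k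
      unfolding y_def h_def using \<eta> \<tau> by (intro core orbit_in_generator gen tk) auto
    then obtain \<xi> where \<xi>: "\<And>k. test_function UNIV (\<xi> k)" "\<And>k. nrm (\<lambda>z. \<xi> k z - y k z) < \<eta> * \<tau>"
      "\<And>k. nrm (\<lambda>z. A (\<xi> k) z - h k z) < \<eta> * \<tau>" by metis
    have \<xi>H: "\<xi> k \<in> H" "A (\<xi> k) \<in> H" for k using \<xi>(1) by (auto intro: test_function_H A_H)
    have \<eta>\<tau>: "\<eta> * \<tau> \<le> B * \<eta>"
    proof -
      have "\<eta> * \<tau> \<le> \<eta> * B" using \<eta> \<tau> B by (intro mult_left_mono) auto
      then show ?thesis by (simp add: mult.commute)
    qed
    \<comment> \<open>One B \<eta> is spent on replacing a node, and at most two on moving it by up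
      to two steps of the grid.\<close>
    have near2: "nrm (\<lambda>z. X i z - Y j z) \<le> 3 * (B * \<eta>)"
      if XY: "\<And>k. X k \<in> H" "\<And>k. Y k \<in> H" "\<And>k. nrm (\<lambda>z. X k z - Y k z) \<le> B * \<eta>"
        "\<And>k. k \<le> Suc N \<Longrightarrow> nrm (\<lambda>z. Y (Suc k) z - Y k z) \<le> B * \<eta>" and j: "j < N"
        and i: "i = j \<or> i = Suc j \<or> i = Suc (Suc j)" for X Y i j
    proof -
      have s0: "nrm (\<lambda>z. Y j z - Y j z) = 0" using nrm_zero by simp
      have s1: "nrm (\<lambda>z. Y (Suc j) z - Y j z) \<le> B * \<eta>" using XY(4) j by simp
      have s2: "nrm (\<lambda>z. Y (Suc (Suc j)) z - Y j z) \<le> B * \<eta> + B * \<eta>"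
        using nrm_diff_triangle[OF XY(2,2,2), of "Suc (Suc j)" j "Suc j"] XY(4)[of "Suc j"] s1 j by simp
      have Bn: "0 \<le> B * \<eta>" using B \<eta> by simp
      then have "nrm (\<lambda>z. Y i z - Y j z) \<le> B * \<eta> + B * \<eta>" using i s0 s1 s2 by auto
      then show ?thesis using nrm_diff_triangle[OF XY(1,2,2), of i j i] XY(3)[of i] by linarith
    qed
    have nearA: "nrm (\<lambda>z. A (\<xi> i) z - h j z) \<le> 3 * (B * \<eta>)"
      and near: "nrm (\<lambda>z. \<xi> i z - y j z) \<le> 3 * (B * \<eta>)"
      if "j < N" "i = j \<or> i = Suc j \<or> i = Suc (Suc j)" for i j
    proof -
      have l: "nrm (\<lambda>z. A (\<xi> k) z - h k z) \<le> B * \<eta>" "nrm (\<lambda>z. \<xi> k z - y k z) \<le> B * \<eta>" for k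
        using \<xi>(2,3)[of k] \<eta>\<tau> by linarith+
      show "nrm (\<lambda>z. A (\<xi> i) z - h j z) \<le> 3 * (B * \<eta>)"
        by (rule near2[of "\<lambda>k. A (\<xi> k)" h, OF \<xi>H(2) yH(2) l(1) ystep(2) that])
      show "nrm (\<lambda>z. \<xi> i z - y j z) \<le> 3 * (B * \<eta>)"
        by (rule near2[of \<xi> y, OF \<xi>H(1) yH(1) l(2) ystep(1) that])
    qed
    have slope\<xi>: "nrm (\<lambda>z. (1 / \<tau>) * (\<xi> (Suc i) z - \<xi> i z) - h j z) \<le> 4 * (B * \<eta>)"
      if j: "j < N" and i: "i = j \<or> i = Suc j" for i j
    proof -
      have iN: "i \<le> Suc N" using i j by auto
      have e: "nrm (\<lambda>z. (1 / \<tau>) * (\<xi> k z - y k z)) \<le> \<eta>" for k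
        unfolding nrm_cmult using \<xi>(2)[of k] \<tau>(1) by (simp add: divide_le_eq less_imp_le)
      have kH: "(\<lambda>z. (1 / \<tau>) * (\<xi> k z - y k z)) \<in> H" for k by (intro H_cmult H_diff \<xi>H yH)
      have sH: "(\<lambda>z. (1 / \<tau>) * (y (Suc i) z - y i z) - h i z) \<in> H" by (intro H_diff H_cmult yH)
      have eq: "(\<lambda>z. (1 / \<tau>) * (\<xi> (Suc i) z - \<xi> i z) - h j z) = (\<lambda>z.
          (((1 / \<tau>) * (\<xi> (Suc i) z - y (Suc i) z) - (1 / \<tau>) * (\<xi> i z - y i z)) +
          ((1 / \<tau>) * (y (Suc i) z - y i z) - h i z)) + (h i z - h j z))"
        by (auto simp: algebra_simps)
      have "nrm (\<lambda>z. (1 / \<tau>) * (\<xi> (Suc i) z - \<xi> i z) - h j z) \<le> ((nrm (\<lambda>z. (1 / \<tau>) * (\<xi> (Suc i) z - y (Suc i) z)) + nrm (\<lambda>z. (1 / \<tau>) * (\<xi> i z - y i z))) +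
          nrm (\<lambda>z. (1 / \<tau>) * (y (Suc i) z - y i z) - h i z)) + nrm (\<lambda>z. h i z - h j z)"
        unfolding eq
        by (intro nrm_triangle[THEN order_trans] add_mono nrm_triangle_diff order_refl H_add H_diff kH sH yH)
      \<comment> \<open>Two errors \<eta> come from the replaced nodes, B \<eta> from the slope of
        the orbit and B \<eta> from moving \<open>h\<close> by at most one step; B \<ge> 1 merges
        them into 4 B \<eta>.\<close>
      also have "\<dots> \<le> ((\<eta> + \<eta>) + B * \<eta>) + B * \<eta>"
      proof (intro add_mono e slope iN)
        show "nrm (\<lambda>z. h i z - h j z) \<le> B * \<eta>"
          using i ystep(2)[of j] j nrm_zero B \<eta> by auto
      qed
      also have "\<dots> \<le> 4 * (B * \<eta>)" using B \<eta> mult_right_mono[of 1 B \<eta>] by simp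
      finally show ?thesis .
    qed
    define \<psi> where "\<psi> k = (case k of 0 \<Rightarrow> \<xi> 0 | Suc i \<Rightarrow> (\<lambda>z. \<xi> (Suc i) z - \<xi> i z))" for k
    define p where "p k t = (case k of 0 \<Rightarrow> 1 | Suc i \<Rightarrow> ramp (t / \<tau> - real i))" for k t
    define p' where "p' k t = (case k of 0 \<Rightarrow> 0 | Suc i \<Rightarrow> hat (t / \<tau> - real i) * (1 / \<tau>))" for k t
    have D: "(p k has_real_derivative p' k t) (at t)" for k t
    proof (cases k)
      case (Suc i)
      have "((\<lambda>t. ramp (t / \<tau> - real i)) has_real_derivative hat (t / \<tau> - real i) * (1 / \<tau>)) (at t)"
        by (rule DERIV_chain2[OF ramp_DERIV]) (use \<tau>(1) in \<open>auto intro!: derivative_eq_intros\<close>)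
      then show ?thesis using Suc by (simp add: p_def[abs_def] p'_def)
    qed (simp add: p_def[abs_def] p'_def)
    have sums: "(\<Sum>k<Suc (Suc N). p k t * \<psi> k z) = \<xi> 0 z + (\<Sum>k<Suc N. ramp (t / \<tau> - real k) * (\<xi> (Suc k) z - \<xi> k z))"
      "(\<Sum>k<Suc (Suc N). p k t * A (\<psi> k) z) = A (\<xi> 0) z + (\<Sum>k<Suc N. ramp (t / \<tau> - real k) * (A (\<xi> (Suc k)) z - A (\<xi> k) z))"
      "(\<Sum>k<Suc (Suc N). p' k t * \<psi> k z) = (1 / \<tau>) * (\<Sum>k<Suc N. hat (t / \<tau> - real k) * (\<xi> (Suc k) z - \<xi> k z))" for t z
      unfolding sum.lessThan_Suc_shift[of _ "Suc N"] sum_distrib_left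
      by (simp_all add: p_def p'_def \<psi>_def A_diff \<xi> mult_ac del: sum.lessThan_Suc)
    have loc: "nrm (\<lambda>z. (\<Sum>k<Suc (Suc N). p k t * \<psi> k z) - y j z) \<le> 3 * (B * \<eta>)"
      "nrm (\<lambda>z. (\<Sum>k<Suc (Suc N). p' k t * \<psi> k z) - (\<Sum>k<Suc (Suc N). p k t * A (\<psi> k) z)) \<le> 7 * (B * \<eta>)"
      if j: "j < N" and t: "real j * \<tau> \<le> t" "t \<le> real (Suc j) * \<tau>" for j t
    proof -
      define s where "s = t / \<tau> - real j"
      have s: "0 \<le> s" "s \<le> 1" using t \<tau>(1) by (auto simp: s_def field_simps)
      have ts: "t / \<tau> = real j + s" by (simp add: s_def)
      have cv: "0 \<le> 1 - ramp s" "0 \<le> ramp s - ramp (s - 1)" "0 \<le> ramp (s - 1)"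
        "(1 - ramp s) + (ramp s - ramp (s - 1)) + ramp (s - 1) = 1"
      proof -
        show "0 \<le> ramp s - ramp (s - 1)"
        proof -
          have "s\<^sup>2 \<le> s" "(1 - s)\<^sup>2 \<le> 1 - s" using s by (simp_all add: power2_eq_square mult_left_le mult_left_le_one_le)
          then show ?thesis using s by (simp add: ramp_values)
        qed
      qed (use s in \<open>auto simp: ramp_values\<close>)
      show "nrm (\<lambda>z. (\<Sum>k<Suc (Suc N). p k t * \<psi> k z) - y j z) \<le> 3 * (B * \<eta>)"
        unfolding sums ts spline_local(1)[OF s j, of "\<lambda>k. \<xi> k z" for z]
        by (intro nrm_convex3 cv \<xi>H yH near j) auto
      have a: "nrm (\<lambda>z. (\<Sum>k<Suc (Suc N). p k t * A (\<psi> k) z) - h j z) \<le> 3 * (B * \<eta>)"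
        unfolding sums ts spline_local(1)[OF s j, of "\<lambda>k. A (\<xi> k) z" for z]
        by (intro nrm_convex3 cv \<xi>H yH nearA j) auto
      \<comment> \<open>The two slopes are treated as three points of a convex combination, the
        third with coefficient 0.\<close>
      have "nrm (\<lambda>z. (1 - s) * ((1 / \<tau>) * (\<xi> (Suc j) z - \<xi> j z)) + s * ((1 / \<tau>) * (\<xi> (Suc (Suc j)) z - \<xi> (Suc j) z))
          + 0 * h j z - h j z) \<le> 4 * (B * \<eta>)"
        using s B \<eta> by (intro nrm_convex3 slope\<xi> j \<xi>H yH H_cmult H_diff) (auto simp: nrm_zero)
      note b0 = this
      have e: "(1 / \<tau>) * ((1 - s) * (\<xi> (Suc j) z - \<xi> j z) + s * (\<xi> (Suc (Suc j)) z - \<xi> (Suc j) z)) =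
          (1 - s) * ((1 / \<tau>) * (\<xi> (Suc j) z - \<xi> j z)) + s * ((1 / \<tau>) * (\<xi> (Suc (Suc j)) z - \<xi> (Suc j) z))
          + 0 * h j z" for z
        by (simp only: distrib_left mult.left_commute mult_zero_left add_0_right)
      have b: "nrm (\<lambda>z. (\<Sum>k<Suc (Suc N). p' k t * \<psi> k z) - h j z) \<le> 4 * (B * \<eta>)"
        unfolding sums ts spline_local(2)[OF s j, of "\<lambda>k. \<xi> k z" for z] e by (rule b0)
      have pH: "(\<lambda>z. \<Sum>k<Suc (Suc N). p' k t * \<psi> k z) \<in> H" "(\<lambda>z. \<Sum>k<Suc (Suc N). p k t * A (\<psi> k) z) \<in> H"
        unfolding sums by (intro H_cmult H_add H_sum H_diff \<xi>H)+
      show "nrm (\<lambda>z. (\<Sum>k<Suc (Suc N). p' k t * \<psi> k z) - (\<Sum>k<Suc (Suc N). p k t * A (\<psi> k) z)) \<le> 7 * (B * \<eta>)"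
        using nrm_diff_triangle[OF pH(1) yH(2) pH(2), of j] a b
          nrm_minus_commute[of "h j" "\<lambda>z. \<Sum>k<Suc (Suc N). p k t * A (\<psi> k) z"] by linarith
    qed
    have find: "\<exists>j<N. real j * \<tau> \<le> t \<and> t \<le> real (Suc j) * \<tau>" if t: "0 \<le> t" "t \<le> T" for t
    \<comment> \<open>At t = T the floor function would select the interval after the last
      one.\<close>
    proof (cases "t = T")
      case True
      then show ?thesis using \<tau> N0 by (intro exI[of _ "N - 1"]) auto
    next
      case False
      define j where "j = nat \<lfloor>t / \<tau>\<rfloor>"
      have q: "0 \<le> t / \<tau>" using t \<tau> by simp
      have j: "real j \<le> t / \<tau>" "t / \<tau> < real j + 1"
        using q unfolding j_def by (simp_all add: of_nat_nat)
      have "t / \<tau> < real N" using False t \<tau> by (simp add: divide_less_eq)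
      then have "j < N" using j by linarith
      moreover have "real j * \<tau> \<le> t" "t \<le> real (Suc j) * \<tau>"
        using j \<tau>(1) by (auto simp: field_simps)
      ultimately show ?thesis by blast
    qed
    have \<psi>T: "test_function UNIV (\<psi> k)" for k
      by (cases k) (auto simp: \<psi>_def intro: test_function_diff \<xi>)
    have fH: "(\<lambda>z. \<Sum>k<Suc (Suc N). p k t * \<psi> k z) \<in> H" for t
      by (intro H_sum H_cmult test_function_H \<psi>T)
    have yb: "nrm (y j) \<le> B * nrm \<phi>" if "j < N" for j
      unfolding y_def using that by (intro B tk tk1 H) auto
    show "\<exists>n p p' \<psi>. approximates \<phi> T \<epsilon> (B * nrm \<phi> + 1) n p p' \<psi>"
      unfolding approximates_def
    proof (rule exI[of _ "Suc (Suc N)"], rule exI[of _ p], rule exI[of _ p'], rule exI[of _ \<psi>],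
        intro conjI allI ballI)
      show "test_function UNIV (\<psi> k)" for k by (rule \<psi>T)
      show "(p k has_real_derivative p' k t) (at t)" for k t by (rule D)
      show "continuous_on UNIV (p' k)" for k
        using \<tau>(1) by (cases k) (auto simp: p'_def[abs_def] hat_def intro!: continuous_intros)
      fix t assume "t \<in> {0..T}"
      then obtain j where j: "j < N" "real j * \<tau> \<le> t" "t \<le> real (Suc j) * \<tau>" using find by auto
      show "nrm (\<lambda>z. (\<Sum>k<Suc (Suc N). p' k t * \<psi> k z) - (\<Sum>k<Suc (Suc N). p k t * A (\<psi> k) z)) \<le> \<epsilon>"
        using loc(2)[OF j] \<eta>(2) by linarith
      show "nrm (\<lambda>z. \<Sum>k<Suc (Suc N). p k t * \<psi> k z) \<le> B * nrm \<phi> + 1"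
        using nrm_le_diff[OF fH yH(1), of t j] loc(1)[OF j] yb[OF j(1)] \<eta>(3) B(1) \<eta>(1)
          mult_nonneg_nonneg[of B \<eta>] by linarith
    next
      have "nrm (\<lambda>z. y 0 z - \<phi> z) = nrm (\<lambda>_. 0)"
        unfolding y_def using S_0_AE[OF H(1)] by (intro nrm_cong_H H_diff S_H H H_zero) auto
      then have "nrm (\<lambda>z. y 0 z - \<phi> z) = 0" using nrm_zero by simp
      moreover have "nrm (\<lambda>z. (\<Sum>k<Suc (Suc N). p k 0 * \<psi> k z) - y 0 z) \<le> 3 * (B * \<eta>)"
        using N0 \<tau> by (intro loc(1)) auto
      ultimately show "nrm (\<lambda>z. (\<Sum>k<Suc (Suc N). p k 0 * \<psi> k z) - \<phi> z) \<le> \<epsilon>"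
        using nrm_diff_triangle[OF fH yH(1) H(1), of 0 0] \<eta>(1,2) B(1) mult_nonneg_nonneg[of B \<eta>] by linarith
    next
      have N1: "Suc (N - 1) = N" using N0 by simp
      have yN: "y N = S T \<phi>" by (simp add: y_def \<tau>)
      have "nrm (\<lambda>z. (\<Sum>k<Suc (Suc N). p k T * \<psi> k z) - y (N - 1) z) \<le> 3 * (B * \<eta>)"
        using N0 \<tau> by (intro loc(1)) (auto simp: N1 simp flip: \<tau>(4))
      moreover have "nrm (\<lambda>z. y (N - 1) z - y N z) \<le> B * \<eta>"
        using ystep(1)[of "N - 1"] unfolding N1 by (simp add: nrm_minus_commute)
      ultimately show "nrm (\<lambda>z. (\<Sum>k<Suc (Suc N). p k T * \<psi> k z) - S T \<phi> z) \<le> \<epsilon>"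
        using nrm_diff_triangle[OF fH yH(1,1), of T N "N - 1"] \<eta>(1,2) B(1) mult_nonneg_nonneg[of B \<eta>]
        unfolding yN by linarith
    qed
  qed
qed

end

section \<open>The kinetic operator in terms of directional derivatives\<close>

definition dd :: "('a::euclidean_space \<Rightarrow> real) \<Rightarrow> 'a \<Rightarrow> 'a \<Rightarrow> real" where
  "dd f b z = deriv (\<lambda>s. f (z + s *\<^sub>R b)) 0"

text \<open>\<open>dd\<close> is a total function; it is \<open>C1 f b\<close> that makes
  \<open>dd f b\<close> a continuous derivative.\<close>

definition C1 :: "('a::euclidean_space \<Rightarrow> real) \<Rightarrow> 'a \<Rightarrow> bool" where
  "C1 f b \<longleftrightarrow> dder f b (dd f b) \<and> continuous_on UNIV (dd f b)"

lemma dd_eq: "dder f b f' \<Longrightarrow> dd f b = f'"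
  by (rule ext) (auto simp: dder_def dd_def intro!: DERIV_imp_deriv)

lemma C1I: "dder f b f' \<Longrightarrow> continuous_on UNIV f' \<Longrightarrow> C1 f b"
  using dd_eq by (fastforce simp: C1_def)

lemma C1_dder: "C1 f b \<Longrightarrow> dder f b (dd f b)" by (simp add: C1_def)

lemma C1_cont: "C1 f b \<Longrightarrow> continuous_on UNIV (dd f b)" by (simp add: C1_def)

lemma C_1_C1: assumes "C_k 1 f" shows "C1 f b" "dd f b = (\<lambda>z. frechet_derivative f (at z) b)"
proof -
  have "C_k (Suc 0) f" using assms by simp
  from C_1_dder[OF this] show "C1 f b" "dd f b = (\<lambda>z. frechet_derivative f (at z) b)"
    using C1I dd_eq by blast+
qed

lemma C_1_deriv: "C_k 1 f \<Longrightarrow> (f has_derivative frechet_derivative f (at z)) (at z)"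
  using C_1_differentiable(1)[of 0 f] by simp

lemma C_1_cont: "C_k 1 f \<Longrightarrow> continuous_on UNIV f" by (rule C_k_continuous)

lemma dd_mult: "C1 f b \<Longrightarrow> C1 g b \<Longrightarrow> dd (\<lambda>z. f z * g z) b = (\<lambda>z. dd f b z * g z + f z * dd g b z)"
  by (intro dd_eq dder_mult C1_dder)

lemma C1_mult:
  "C1 f b \<Longrightarrow> C1 g b \<Longrightarrow> continuous_on UNIV f \<Longrightarrow> continuous_on UNIV g \<Longrightarrow> C1 (\<lambda>z. f z * g z) b"
  by (rule C1I[OF dder_mult[OF C1_dder C1_dder]]) (auto intro!: continuous_intros C1_cont)

lemma C1_divide:
  assumes "C1 f b" "C1 g b" "continuous_on UNIV f" "continuous_on UNIV g" "\<And>z. g z \<noteq> 0"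
  shows "C1 (\<lambda>z. f z / g z) b" "dd (\<lambda>z. f z / g z) b = (\<lambda>z. (dd f b z * g z - f z * dd g b z) / (g z)\<^sup>2)"
proof -
  have d: "dder (\<lambda>z. f z / g z) b (\<lambda>z. (dd f b z * g z - f z * dd g b z) / (g z)\<^sup>2)"
    using assms by (intro dder_divide C1_dder)
  then show "dd (\<lambda>z. f z / g z) b = (\<lambda>z. (dd f b z * g z - f z * dd g b z) / (g z)\<^sup>2)" by (rule dd_eq)
  show "C1 (\<lambda>z. f z / g z) b"
    using assms by (intro C1I[OF d]) (auto intro!: continuous_intros C1_cont)
qed

lemma dd_slice: "dder f (0, b) f' \<Longrightarrow> dder (\<lambda>v. f (x, v)) b (\<lambda>v. f' (x, v))"
  by (auto simp: dder_def)

lemma dd_slice_fst: "dder f (b, 0) f' \<Longrightarrow> dder (\<lambda>x. f (x, v)) b (\<lambda>x. f' (x, v))"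
  by (auto simp: dder_def)

text \<open>\<open>grad_v\<close> and \<open>div_v\<close> are built from Frechet derivatives in v.
  Total differentiability of the slices is what identifies these with directional derivatives, whose
  mere existence would not suffice.\<close>

definition slice_diff :: "('d::finite phase \<Rightarrow> real) \<Rightarrow> bool" where
  "slice_diff f \<longleftrightarrow> (\<forall>x v. (\<lambda>u. f (x, u)) differentiable (at v))"

lemma slice_diffD: "slice_diff f \<Longrightarrow> (\<lambda>u. f (x, u)) differentiable (at v)"
  by (simp add: slice_diff_def)

lemma frechet_slice:
  fixes f :: "'d::finite phase \<Rightarrow> real"
  assumes "slice_diff f" "dder f (0, b) f'"
  shows "frechet_derivative (\<lambda>u. f (x, u)) (at v) b = f' (x, v)"
proof -
  have "((\<lambda>u. f (x, u)) has_derivative frechet_derivative (\<lambda>u. f (x, u)) (at w)) (at w)" for w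
    using slice_diffD[OF assms(1)] frechet_derivative_works by blast
  then have "dder (\<lambda>u. f (x, u)) b (\<lambda>w. frechet_derivative (\<lambda>u. f (x, u)) (at w) b)"
    by (rule has_derivative_dder)
  then show ?thesis using dder_unique[OF _ dd_slice[OF assms(2)]] by metis
qed

lemma grad_v_inner:
  assumes "slice_diff f" "dder f (0, b) f'" "b \<in> Basis"
  shows "grad_v f z \<bullet> b = f' z"
  using assms frechet_slice[OF assms(1,2)]
  by (cases z) (simp add: grad_v_def grad_def inner_sum_left inner_Basis if_distrib cong: if_cong)

lemma C_1_slice_diff:
  fixes f :: "'d::finite phase \<Rightarrow> real"
  assumes "C_k 1 f" shows "slice_diff f"
  unfolding slice_diff_def
proof (intro allI)
  fix x v :: "real ^ 'd"
  have "((\<lambda>u. (x, u)) has_derivative (\<lambda>h. (0, h))) (at v)" by (auto intro!: derivative_eq_intros)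
  from has_derivative_compose[OF this C_1_deriv[OF assms]]
  show "(\<lambda>u. f (x, u)) differentiable (at v)" by (auto simp: differentiable_def)
qed

lemma grad_x_inner:
  fixes f :: "'d::finite phase \<Rightarrow> real"
  assumes "C_k 1 f" "b \<in> Basis" shows "grad_x f z \<bullet> b = dd f (b, 0) z"
proof -
  obtain x v where z: "z = (x, v)" by (cases z)
  have "((\<lambda>y. (y, v)) has_derivative (\<lambda>h. (h, 0))) (at x)" by (auto intro!: derivative_eq_intros)
  from has_derivative_compose[OF this C_1_deriv[OF assms(1)]]
  have "frechet_derivative (\<lambda>y. f (y, v)) (at x) = (\<lambda>h. frechet_derivative f (at (x, v)) (h, 0))"
    using frechet_derivative_at by metis
  then show ?thesis using assms(2) C_1_C1(2)[OF assms(1), of "(b, 0)"]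
    by (simp add: z grad_x_def grad_def inner_sum_left inner_Basis if_distrib cong: if_cong)
qed

lemma div_v_eq:
  fixes F :: "'d::finite phase \<Rightarrow> real ^ 'd"
  assumes "\<And>b. b \<in> Basis \<Longrightarrow> slice_diff (\<lambda>z. F z \<bullet> b)"
    and "\<And>b. b \<in> Basis \<Longrightarrow> dder (\<lambda>z. F z \<bullet> b) (0, b) (D b)"
  shows "div_v F z = (\<Sum>b\<in>Basis. D b z)"
proof -
  obtain x v where z: "z = (x, v)" by (cases z)
  have "(\<lambda>u. F (x, u)) differentiable (at v)"
    using assms(1) by (subst differentiable_componentwise_within) (auto dest: slice_diffD)
  then have d: "((\<lambda>u. F (x, u)) has_derivative frechet_derivative (\<lambda>u. F (x, u)) (at v)) (at v)"
    using frechet_derivative_works by blast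
  have "frechet_derivative (\<lambda>u. F (x, u)) (at v) b \<bullet> b = D b (x, v)" if b: "b \<in> Basis" for b
  proof -
    have "((\<lambda>u. F (x, u) \<bullet> b) has_derivative (\<lambda>h. frechet_derivative (\<lambda>u. F (x, u)) (at v) h \<bullet> b)) (at v)"
      using d by (rule has_derivative_inner_left)
    then have "frechet_derivative (\<lambda>u. F (x, u) \<bullet> b) (at v) b = frechet_derivative (\<lambda>u. F (x, u)) (at v) b \<bullet> b"
      using frechet_derivative_at by metis
    then show ?thesis using frechet_slice[OF assms(1)[OF b] assms(2)[OF b]] by simp
  qed
  then show ?thesis by (simp add: z div_v_def divergence_def)
qed

lemma C2_in_v_props:
  assumes "C2_in_v f"
  shows "continuous_on UNIV f" "slice_diff f" "C1 f (0, b)" "slice_diff (dd f (0, b))" "C1 (dd f (0, b)) (0, c)"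
proof -
  obtain f' f'' where f: "\<And>x v. ((\<lambda>u. f (x, u)) has_derivative f' (x, v)) (at v)"
    "\<And>x v h. ((\<lambda>u. f' (x, u) h) has_derivative f'' (x, v) h) (at v)"
    "\<And>h. continuous_on UNIV (\<lambda>z. f' z h)" "\<And>h k. continuous_on UNIV (\<lambda>z. f'' z h k)"
    using assms by (auto simp: C2_in_v_def)
  show "continuous_on UNIV f" using assms by (simp add: C2_in_v_def)
  show "slice_diff f" using f(1) by (auto simp: slice_diff_def differentiable_def)
  have lift: "dder g (0, h) (\<lambda>z. g' z h)" if "\<And>x v. ((\<lambda>u. g (x, u)) has_derivative g' (x, v)) (at v)"
    for g :: "'a phase \<Rightarrow> real" and g' h
  proof -
    have "dder (\<lambda>u. g (x, u)) h (\<lambda>v. g' (x, v) h)" for x using that by (rule has_derivative_dder)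
    then show ?thesis by (auto simp: dder_def)
  qed
  have d1: "dder f (0, h) (\<lambda>z. f' z h)" for h by (rule lift[OF f(1)])
  then show "C1 f (0, b)" using f(3) by (rule C1I)
  have eq: "dd f (0, b) = (\<lambda>z. f' z b)" by (rule dd_eq[OF d1])
  show "slice_diff (dd f (0, b))" unfolding eq using f(2) by (auto simp: slice_diff_def differentiable_def)
  have "dder (\<lambda>z. f' z b) (0, c) (\<lambda>z. f'' z b c)" using lift[of "\<lambda>z. f' z b" "\<lambda>z. f'' z b"] f(2) by blast
  then show "C1 (dd f (0, b)) (0, c)" unfolding eq using f(4) by (rule C1I)
qed

lemma slice_diff_intros:
  assumes "slice_diff f" "slice_diff g"
  shows "slice_diff (\<lambda>z. f z * g z)" "slice_diff (\<lambda>z. f z - g z)" "(\<And>z. g z \<noteq> 0) \<Longrightarrow> slice_diff (\<lambda>z. f z / g z)"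
  using assms by (auto simp: slice_diff_def intro!: derivative_intros)

lemma C2_in_v_test: assumes "test_function UNIV f" shows "C2_in_v f"
proof -
  have C2: "C_k (Suc (Suc 0)) f" using assms by (rule test_function_C_k)
  define f' where "f' z h = frechet_derivative f (at z) (0, h)" for z h
  have C1': "C_k (Suc 0) (\<lambda>z. f' z h)" for h unfolding f'_def by (rule C_1_differentiable(2)[OF C2])
  define f'' where "f'' z h k = frechet_derivative (\<lambda>z. f' z h) (at z) (0, k)" for z h k
  have emb: "((\<lambda>u. (x, u)) has_derivative (\<lambda>h. (0, h))) (at v)" for x v :: "real ^ 'a"
    by (auto intro!: derivative_eq_intros)
  show ?thesis unfolding C2_in_v_def
  proof (intro conjI exI[of _ f'] exI[of _ f''] allI)
    show "continuous_on UNIV f" by (rule C_k_continuous[OF C2])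
    show "((\<lambda>u. f (x, u)) has_derivative f' (x, v)) (at v)" for x v
      using has_derivative_compose[OF emb C_1_differentiable(1)[OF C2]] by (simp add: f'_def[abs_def])
    show "((\<lambda>u. f' (x, u) h) has_derivative f'' (x, v) h) (at v)" for x v h
      using has_derivative_compose[OF emb C_1_differentiable(1)[OF C1']] by (simp add: f''_def[abs_def])
    show "continuous_on UNIV (\<lambda>z. f' z h)" for h by (rule C_k_continuous[OF C1'])
    show "continuous_on UNIV (\<lambda>z. f'' z h k)" for h k
      unfolding f''_def by (rule C_k_continuous[OF C_1_differentiable(2)[OF C1']])
  qed
qed

section \<open>Velocity moments and adjoint operators\<close>

definition v_mom :: "(real ^ 'd::finite \<Rightarrow> real) \<Rightarrow> ('d phase \<Rightarrow> real) \<Rightarrow> real ^ 'd \<Rightarrow> real" where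
  "v_mom k f x = (LINT v|lborel. k v * f (x, v))"

lemma Cc_lift_support:
  assumes "Cc (k :: real ^ 'd::finite \<Rightarrow> real)"
  obtains r where "\<And>v. r < norm v \<Longrightarrow> k v = 0" using Cc_support[OF assms] by metis

lemma continuous_lift:
  assumes "continuous_on UNIV (k :: 'b::euclidean_space \<Rightarrow> real)"
  shows "continuous_on UNIV (\<lambda>z::'a::euclidean_space \<times> 'b. k (snd z))"
  by (rule continuous_on_compose2[OF assms]) (auto intro!: continuous_intros)

lemma v_mom_continuous:
  assumes k: "Cc k" and f: "continuous_on UNIV f" shows "continuous_on UNIV (v_mom k f)"
proof -
  obtain r where r: "\<And>v. r < norm v \<Longrightarrow> k v = 0" using Cc_lift_support[OF k] by metis
  have "continuous_on UNIV (\<lambda>x. LINT v|lborel. (\<lambda>z. k (snd z) * f z) (x, v))"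
    by (rule continuous_param_integral[of _ r])
      (use r f k in \<open>auto intro!: continuous_intros continuous_lift simp: Cc_def\<close>)
  then show ?thesis by (simp add: v_mom_def[abs_def])
qed

lemma v_mom_dder:
  assumes k: "Cc k" and f: "continuous_on UNIV f" "C1 f (b, 0)"
  shows "dder (v_mom k f) b (v_mom k (dd f (b, 0)))"
proof -
  obtain r where r: "\<And>v. r < norm v \<Longrightarrow> k v = 0" using Cc_lift_support[OF k] by metis
  have "dder (\<lambda>x. LINT v|lborel. (\<lambda>z. k (snd z) * f z) (x, v)) b
      (\<lambda>x. LINT v|lborel. (\<lambda>z. k (snd z) * dd f (b, 0) z) (x, v))"
  proof (rule dder_param_integral[of _ r])
    show "dder (\<lambda>z. k (snd z) * f z) (b, 0) (\<lambda>z. k (snd z) * dd f (b, 0) z)"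
      using C1_dder[OF f(2)] by (auto simp: dder_def intro!: DERIV_cmult)
  qed (use r f k C1_cont[OF f(2)] in \<open>auto intro!: continuous_intros continuous_lift simp: Cc_def\<close>)
  then show ?thesis by (simp add: v_mom_def[abs_def])
qed

lemma v_mom_integrable:
  assumes "Cc k" "continuous_on UNIV f" shows "integrable lborel (\<lambda>v. k v * f (x, v))"
  by (intro Cc_integrable Cc_supported_mult assms continuous_slice)

text \<open>The derivative of log M in the velocity direction b, which is what the bound on |grad_v
  M| / M controls.\<close>

definition mlog :: "('d::finite phase \<Rightarrow> real) \<Rightarrow> real ^ 'd \<Rightarrow> 'd phase \<Rightarrow> real" where
  "mlog M b z = dd M (0, b) z / M z"

text \<open>The component along b of M grad_v (f / M), written so that \<open>M\<close> enters
  through its logarithmic derivative only.\<close>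

definition flux :: "('d::finite phase \<Rightarrow> real) \<Rightarrow> ('d phase \<Rightarrow> real) \<Rightarrow> real ^ 'd \<Rightarrow> 'd phase \<Rightarrow> real" where
  "flux M f b z = dd f (0, b) z - f z * mlog M b z"

lemma mlog_props:
  assumes "C2_in_v M" "\<And>z. 0 < M z"
  shows "C1 (mlog M b) (0, c)" "continuous_on UNIV (mlog M b)" "slice_diff (mlog M b)"
proof -
  have nz: "M z \<noteq> 0" for z using assms(2)[of z] by simp
  note M = C2_in_v_props[OF assms(1)]
  show "C1 (mlog M b) (0, c)" unfolding mlog_def[abs_def]
    by (rule C1_divide(1)[OF M(5) M(3) C1_cont[OF M(3)] M(1) nz])
  show "continuous_on UNIV (mlog M b)" unfolding mlog_def[abs_def]
    using nz by (intro continuous_intros C1_cont M) auto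
  show "slice_diff (mlog M b)" unfolding mlog_def[abs_def]
    by (rule slice_diff_intros(3)[OF M(4) M(2) nz])
qed

lemma flux_props:
  assumes "C2_in_v M" "\<And>z. 0 < M z" "C2_in_v f"
  shows "C1 (flux M f b) (0, b)" "continuous_on UNIV (flux M f b)" "slice_diff (flux M f b)"
    "dd (flux M f b) (0, b) z =
      dd (dd f (0, b)) (0, b) z - (dd f (0, b) z * mlog M b z + f z * dd (mlog M b) (0, b) z)"
proof -
  note m = mlog_props[OF assms(1,2)] and f = C2_in_v_props[OF assms(3)]
  have d: "dder (flux M f b) (0, b) (\<lambda>z. dd (dd f (0, b)) (0, b) z -
      (dd f (0, b) z * mlog M b z + f z * dd (mlog M b) (0, b) z))"
    unfolding flux_def[abs_def] by (intro dder_diff dder_mult C1_dder f m)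
  then show "dd (flux M f b) (0, b) z =
      dd (dd f (0, b)) (0, b) z - (dd f (0, b) z * mlog M b z + f z * dd (mlog M b) (0, b) z)"
    by (simp add: dd_eq)
  show "C1 (flux M f b) (0, b)"
    by (rule C1I[OF d]) (intro continuous_intros C1_cont f m)
  show "continuous_on UNIV (flux M f b)" unfolding flux_def[abs_def]
    by (intro continuous_intros C1_cont f m)
  show "slice_diff (flux M f b)" unfolding flux_def[abs_def]
    by (intro slice_diff_intros f m)
qed

lemma Fokker_Planck_eq:
  fixes M f :: "'d::finite phase \<Rightarrow> real"
  assumes "C2_in_v M" "\<And>z. 0 < M z" "C2_in_v f"
  shows "collision_op Fokker_Planck M f z = (\<Sum>b\<in>Basis. dd (flux M f b) (0, b) z)"
proof -
  have nz: "M z \<noteq> 0" for z using assms(2)[of z] by simp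
  note M = C2_in_v_props[OF assms(1)] and f = C2_in_v_props[OF assms(3)]
  have eq: "(\<lambda>z. (M z *\<^sub>R grad_v (\<lambda>y. f y / M y) z) \<bullet> b) = flux M f b" if b: "b \<in> Basis" for b
  proof
    fix z
    have "grad_v (\<lambda>y. f y / M y) z \<bullet> b = (dd f (0, b) z * M z - f z * dd M (0, b) z) / (M z)\<^sup>2"
      using grad_v_inner[OF slice_diff_intros(3)[OF f(2) M(2) nz]
          C1_dder[OF C1_divide(1)[OF f(3) M(3) f(1) M(1) nz]] b]
      unfolding C1_divide(2)[OF f(3) M(3) f(1) M(1) nz] .
    then show "(M z *\<^sub>R grad_v (\<lambda>y. f y / M y) z) \<bullet> b = flux M f b z"
      using nz[of z] by (simp add: flux_def mlog_def field_simps power2_eq_square)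
  qed
  show ?thesis unfolding collision_op.simps
  proof (rule div_v_eq)
    fix b :: "real ^ 'd" assume b: "b \<in> Basis"
    show "slice_diff (\<lambda>z. (M z *\<^sub>R grad_v (\<lambda>y. f y / M y) z) \<bullet> b)"
      unfolding eq[OF b] by (rule flux_props(3)[OF assms])
    show "dder (\<lambda>z. (M z *\<^sub>R grad_v (\<lambda>y. f y / M y) z) \<bullet> b) (0, b) (dd (flux M f b) (0, b))"
      unfolding eq[OF b] by (rule C1_dder[OF flux_props(1)[OF assms]])
  qed
qed

text \<open>One summand of the v-divergence of \<open>G\<close>: the derivative of the component
  along b in the direction b.\<close>

definition div_G :: "('d::finite phase \<Rightarrow> real ^ 'd) \<Rightarrow> real ^ 'd \<Rightarrow> 'd phase \<Rightarrow> real" where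
  "div_G G b = dd (\<lambda>z. G z \<bullet> b) (0, b)"

lemma smooth_inner:
  assumes "smooth G" shows "C_k 1 (\<lambda>z. G z \<bullet> b)" "C1 (\<lambda>z. G z \<bullet> b) c" "continuous_on UNIV (\<lambda>z. G z \<bullet> b)"
    "continuous_on UNIV G"
proof -
  have "C_k (Suc 0) G" using assms by (auto simp: smooth_def simp del: C_k.simps)
  then obtain G' where G': "\<And>z. (G has_derivative G' z) (at z)" "\<And>h. continuous_on UNIV (\<lambda>z. G' z h)"
    by auto
  have "C_k (Suc 0) (\<lambda>z. G z \<bullet> b)" unfolding C_k.simps
    by (rule exI[of _ "\<lambda>z h. G' z h \<bullet> b"]) (auto intro!: has_derivative_inner_left G' continuous_intros)
  then show c: "C_k 1 (\<lambda>z. G z \<bullet> b)" by simp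
  show "C1 (\<lambda>z. G z \<bullet> b) c" by (rule C_1_C1(1)[OF c])
  show "continuous_on UNIV (\<lambda>z. G z \<bullet> b)" by (rule C_1_cont[OF c])
  show "continuous_on UNIV G" using assms C_k_continuous unfolding smooth_def by blast
qed

lemma div_G_cont: "smooth G \<Longrightarrow> continuous_on UNIV (div_G G b)"
  unfolding div_G_def by (rule C1_cont[OF smooth_inner(2)])

lemma transport_eq:
  fixes G :: "'d::finite phase \<Rightarrow> real ^ 'd"
  assumes G: "smooth G" and f: "C_k 1 f"
  shows "transport_op G f z = (\<Sum>b\<in>Basis. (snd z \<bullet> b) * dd f (b, 0) z +
    (dd f (0, b) z * (G z \<bullet> b) + f z * div_G G b z))"
proof -
  have "snd z \<bullet> grad_x f z = (\<Sum>b\<in>Basis. (snd z \<bullet> b) * dd f (b, 0) z)"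
    by (subst euclidean_inner) (simp add: grad_x_inner[OF f])
  moreover have "div_v (\<lambda>y. f y *\<^sub>R G y) z = (\<Sum>b\<in>Basis. dd f (0, b) z * (G z \<bullet> b) + f z * div_G G b z)"
  proof (rule div_v_eq)
    fix b :: "real ^ 'd"
    show "slice_diff (\<lambda>z. (f z *\<^sub>R G z) \<bullet> b)"
      using slice_diff_intros(1)[OF C_1_slice_diff[OF f] C_1_slice_diff[OF smooth_inner(1)[OF G]]] by simp
    show "dder (\<lambda>z. (f z *\<^sub>R G z) \<bullet> b) (0, b) (\<lambda>z. dd f (0, b) z * (G z \<bullet> b) + f z * div_G G b z)"
      using dder_mult[OF C1_dder[OF C_1_C1(1)[OF f]] C1_dder[OF smooth_inner(2)[OF G]]]
      by (simp add: div_G_def)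
  qed
  ultimately show ?thesis by (simp add: transport_op_def sum.distrib)
qed

text \<open>The adjoint of the collision operator with respect to dv, on functions of v alone: the
  Laplacian of k plus grad log M . grad k for Fokker-Planck, and <k M> - k for BGK.\<close>

fun coll_adj :: "collision \<Rightarrow> ('d::finite phase \<Rightarrow> real) \<Rightarrow> (real ^ 'd \<Rightarrow> real) \<Rightarrow> 'd phase \<Rightarrow> real" where
  "coll_adj Fokker_Planck M k z = (\<Sum>b\<in>Basis. dd (dd k b) b (snd z) + dd k b (snd z) * mlog M b z)"
| "coll_adj BGK M k z = v_mom k M (fst z) - k (snd z)"

text \<open>The v-part of the adjoint of the generator, on functions of v alone. The transport term
  in x is left over in the moment identities as an x-divergence.\<close>

definition kin_adj ::
  "collision \<Rightarrow> ('d::finite phase \<Rightarrow> real ^ 'd) \<Rightarrow> ('d phase \<Rightarrow> real) \<Rightarrow> (real ^ 'd \<Rightarrow> real) \<Rightarrow> 'd phase \<Rightarrow> real" where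
  "kin_adj L G M k z = (\<Sum>b\<in>Basis. dd k b (snd z) * (G z \<bullet> b)) + coll_adj L M k z"

section \<open>Moment identities for the kinetic equation\<close>

locale kinetic_data =
  fixes L :: collision and G :: "'d::finite phase \<Rightarrow> real ^ 'd" and M f_inf :: "'d phase \<Rightarrow> real"
  assumes G: "smooth G" and M_dens: "velocity_densities M" and reg: "regular_data L M f_inf"
    and stationary: "\<And>z. transport_op G f_inf z = collision_op L M f_inf z"
    and f_inf_integrable: "integrable lborel f_inf" and f_inf_1: "(LINT z|lborel. f_inf z) = 1"
begin

text \<open>A class that contains both the test functions and \<open>f_inf\<close>, so that the same
  moment identities serve the approximate solutions and the stationary state.\<close>

definition admissible :: "('d phase \<Rightarrow> real) \<Rightarrow> bool" where
  "admissible f \<longleftrightarrow> C_k 1 f \<and> (L = Fokker_Planck \<longrightarrow> C2_in_v f) \<and> (\<forall>x. integrable lborel (\<lambda>v. f (x, v)))"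

lemma f_inf_pos: "0 < f_inf z" using reg unfolding regular_data_def by blast

lemma f_inf_C: "C_k 1 f_inf" using reg unfolding regular_data_def by blast

lemma f_inf_cont: "continuous_on UNIV f_inf" by (rule C_1_cont[OF f_inf_C])

lemma f_inf_admissible: "admissible f_inf"
  using reg unfolding admissible_def regular_data_def by blast

lemma rho_pos: "0 < vavg f_inf x" using reg unfolding regular_data_def by blast

lemma rho_C: "C_k 1 (vavg f_inf)" using reg unfolding regular_data_def by blast

lemma rho_cont: "continuous_on UNIV (vavg f_inf)" by (rule C_1_cont[OF rho_C])

lemma M_FP: "L = Fokker_Planck \<Longrightarrow> C2_in_v M" "L = Fokker_Planck \<Longrightarrow> 0 < M z"
  using reg unfolding regular_data_def by blast+

lemma M_slice: "integrable lborel (\<lambda>v. M (x, v))" "(LINT v|lborel. M (x, v)) = 1" "0 \<le> M z"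
  "M \<in> borel_measurable borel"
  using M_dens unfolding velocity_densities_def vavg_def by blast+

lemma test_admissible: assumes "test_function UNIV f" shows "admissible f"
proof -
  obtain r where r: "\<And>z. r < norm z \<Longrightarrow> f z = 0" using Cc_support[OF test_function_Cc[OF assms]] by metis
  have c: "continuous_on UNIV f" by (rule Cc_continuous[OF test_function_Cc[OF assms]])
  have "Cc (\<lambda>v. f (x, v))" for x
  proof (rule Cc_slice[OF c])
    fix x v :: "real ^ 'd" assume "r < norm v"
    then have "r < norm (x, v)" using norm_snd_le[of v x] by linarith
    then show "f (x, v) = 0" by (rule r)
  qed
  then show ?thesis using assms test_function_C_k[OF assms, of 1]
    by (simp add: admissible_def Cc_integrable C2_in_v_test)
qed

lemma admissible_C: "admissible f \<Longrightarrow> C_k 1 f" unfolding admissible_def by blast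
lemma admissible_C1: "admissible f \<Longrightarrow> C1 f b" using admissible_C C_1_C1(1) by blast
lemma admissible_cont: "admissible f \<Longrightarrow> continuous_on UNIV f" using admissible_C C_1_cont by blast
lemma admissible_int: "admissible f \<Longrightarrow> integrable lborel (\<lambda>v. f (x, v))" by (simp add: admissible_def)
lemma admissible_C2: "admissible f \<Longrightarrow> L = Fokker_Planck \<Longrightarrow> C2_in_v f" unfolding admissible_def by blast

lemma transport_cont: assumes "admissible f" shows "continuous_on UNIV (transport_op G f)"
  unfolding transport_eq[OF G admissible_C[OF assms], abs_def]
  using assms by (intro continuous_intros C1_cont admissible_C1 admissible_cont smooth_inner[OF G] div_G_cont[OF G])

text \<open>Continuity of \<open>M\<close> is not among the assumptions for BGK; it is read off the
  stationary equation, solved for \<open>M\<close>.\<close>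

lemma M_BGK_cont: assumes "L = BGK" shows "continuous_on UNIV M"
proof -
  have "M z = (transport_op G f_inf z + f_inf z) / vavg f_inf (fst z)" for z
    using stationary[of z] assms rho_pos[of "fst z"] by (simp add: field_simps)
  then have "M = (\<lambda>z. (transport_op G f_inf z + f_inf z) / vavg f_inf (fst z))" by blast
  moreover have "continuous_on UNIV (\<lambda>z. (transport_op G f_inf z + f_inf z) / vavg f_inf (fst z))"
    using rho_pos by (intro continuous_intros transport_cont f_inf_admissible f_inf_cont
      continuous_on_compose2[OF rho_cont]) (auto simp: less_imp_neq[symmetric] intro: less_imp_neq[symmetric])
  ultimately show ?thesis by simp
qed

lemma M_cont: "continuous_on UNIV M"
  using M_BGK_cont C2_in_v_props(1)[OF M_FP(1)] by (cases L) auto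

text \<open>Only the v-derivatives are integrated by parts. The x-derivatives pass in front of the
  integral, which is why the velocity factor joins \<open>k\<close> in the first sum.\<close>

lemma moment_transport:
  assumes f: "admissible f" and k: "test_function UNIV k"
  shows "(LINT v|lborel. k v * transport_op G f (x, v)) =
    (\<Sum>b\<in>Basis. dd (v_mom (\<lambda>v. k v * (v \<bullet> b)) f) b x)
    - (LINT v|lborel. (\<Sum>b\<in>Basis. dd k b v * (G (x, v) \<bullet> b)) * f (x, v))"
proof -
  have Ck: "Cc k" by (rule test_function_Cc[OF k])
  have k1: "C1 k b" for b by (rule C_1_C1(1)[OF test_function_C_k[OF k]])
  have Cdk: "Cc (dd k b)" for b by (rule dder_Cc[OF Ck C1_dder[OF k1] C1_cont[OF k1]])
  have fc: "continuous_on UNIV f" by (rule admissible_cont[OF f])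
  have f1: "C1 f b" for b by (rule admissible_C1[OF f])
  note g1 = smooth_inner[OF G]
  have Ckb: "Cc (\<lambda>v. k v * (v \<bullet> b))" for b
    by (rule Cc_supported_mult(1)[OF Ck]) (intro continuous_intros)
  define D where "D b z = dd f (0, b) z * (G z \<bullet> b) + f z * div_G G b z" for b z
  have Dd: "dder (\<lambda>z. f z * (G z \<bullet> b)) (0, b) (D b)" for b
    using dder_mult[OF C1_dder[OF f1] C1_dder[OF g1(2)]] by (simp add: D_def[abs_def] div_G_def)
  have Dc: "continuous_on UNIV (D b)" for b
    unfolding D_def[abs_def] div_G_def by (intro continuous_intros C1_cont f1 fc g1)
  have i1: "integrable lborel (\<lambda>v. (k v * (v \<bullet> b)) * dd f (b, 0) (x, v))" for b
    by (rule v_mom_integrable[OF Ckb C1_cont[OF f1]])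
  have i2: "integrable lborel (\<lambda>v. k v * D b (x, v))" for b
    by (rule v_mom_integrable[OF Ck Dc])
  have i3: "integrable lborel (\<lambda>v. (dd k b v * (G (x, v) \<bullet> b)) * f (x, v))" for b
    using v_mom_integrable[OF Cdk, of "\<lambda>z. (G z \<bullet> b) * f z" b x] fc g1(3)
    by (simp add: continuous_on_mult mult.assoc)
  have ibp: "(LINT v|lborel. k v * D b (x, v)) = - (LINT v|lborel. (dd k b v * (G (x, v) \<bullet> b)) * f (x, v))" for b
  proof -
    have "(LINT v|lborel. dd k b v * (f (x, v) * (G (x, v) \<bullet> b))) = - (LINT v|lborel. k v * D b (x, v))"
      by (rule integral_by_parts[OF Ck _ C1_dder[OF k1] dd_slice[OF Dd] C1_cont[OF k1]])
        (auto intro!: continuous_intros continuous_slice[OF fc] continuous_slice[OF g1(3)] continuous_slice[OF Dc])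
    moreover have "(\<lambda>v. dd k b v * (f (x, v) * (G (x, v) \<bullet> b))) = (\<lambda>v. (dd k b v * (G (x, v) \<bullet> b)) * f (x, v))"
      by (simp add: mult_ac)
    ultimately show ?thesis by simp
  qed
  have "(LINT v|lborel. k v * transport_op G f (x, v)) =
      (LINT v|lborel. (\<Sum>b\<in>Basis. (k v * (v \<bullet> b)) * dd f (b, 0) (x, v) + k v * D b (x, v)))"
    unfolding transport_eq[OF G admissible_C[OF f]] D_def
    by (simp add: sum_distrib_left distrib_left mult.assoc)
  also have "\<dots> = (\<Sum>b\<in>Basis. (LINT v|lborel. (k v * (v \<bullet> b)) * dd f (b, 0) (x, v)) + (LINT v|lborel. k v * D b (x, v)))"
    by (subst Bochner_Integration.integral_sum) (auto intro!: Bochner_Integration.integrable_add i1 i2 sum.cong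
      Bochner_Integration.integral_add)
  also have "\<dots> = (\<Sum>b\<in>Basis. dd (v_mom (\<lambda>v. k v * (v \<bullet> b)) f) b x) +
      (\<Sum>b\<in>Basis. - (LINT v|lborel. (dd k b v * (G (x, v) \<bullet> b)) * f (x, v)))"
    unfolding sum.distrib ibp dd_eq[OF v_mom_dder[OF Ckb fc f1]] by (simp add: v_mom_def)
  also have "(\<Sum>b\<in>Basis. - (LINT v|lborel. (dd k b v * (G (x, v) \<bullet> b)) * f (x, v))) =
      - (LINT v|lborel. (\<Sum>b\<in>Basis. dd k b v * (G (x, v) \<bullet> b)) * f (x, v))"
    using i3 by (simp add: sum_distrib_right sum_negf Bochner_Integration.integral_sum)
  finally show ?thesis by simp
qed

text \<open>For Fokker-Planck the two v-derivatives move to \<open>k\<close> one after the other.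
  For BGK the gain term is the product of the scalars <f> and <k M>, which may be read as an
  integral against f.\<close>

lemma moment_collision:
  assumes f: "admissible f" and k: "test_function UNIV k"
  shows "(LINT v|lborel. k v * collision_op L M f (x, v)) = (LINT v|lborel. coll_adj L M k (x, v) * f (x, v))"
proof -
  have Ck: "Cc k" by (rule test_function_Cc[OF k])
  have k1: "C1 k b" for b by (rule C_1_C1(1)[OF test_function_C_k[OF k]])
  have k2: "C1 (dd k b) c" for b c
  proof -
    have "C_k (Suc 0) (dd k b)"
      using C_1_differentiable(2)[OF test_function_C_k[OF k, of "Suc (Suc 0)"]]
        C_1_C1(2)[OF test_function_C_k[OF k]] by simp
    then have "C_k 1 (dd k b)" by simp
    then show ?thesis by (rule C_1_C1(1))
  qed
  have Cdk: "Cc (dd k b)" for b by (rule dder_Cc[OF Ck C1_dder[OF k1] C1_cont[OF k1]])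
  have Cddk: "Cc (dd (dd k b) b)" for b by (rule dder_Cc[OF Cdk C1_dder[OF k2] C1_cont[OF k2]])
  have fc: "continuous_on UNIV f" by (rule admissible_cont[OF f])
  show ?thesis
  proof (cases L)
    case Fokker_Planck
    note f2 = admissible_C2[OF f Fokker_Planck] and M = M_FP[OF Fokker_Planck]
    note Y = flux_props[OF M f2] and m = mlog_props[OF M] and f' = C2_in_v_props[OF f2]
    have i: "integrable lborel (\<lambda>v. k v * dd (flux M f b) (0, b) (x, v))" for b
      by (rule v_mom_integrable[OF Ck C1_cont[OF Y(1)]])
    have j1: "integrable lborel (\<lambda>v. dd (dd k b) b v * f (x, v))" for b
      by (rule v_mom_integrable[OF Cddk fc])
    have j2: "integrable lborel (\<lambda>v. dd k b v * (f (x, v) * mlog M b (x, v)))" for b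
      by (rule v_mom_integrable[OF Cdk, of "\<lambda>z. f z * mlog M b z"]) (intro continuous_intros fc m)
    have j3: "integrable lborel (\<lambda>v. dd k b v * dd f (0, b) (x, v))" for b
      by (rule v_mom_integrable[OF Cdk C1_cont[OF f'(3)]])
    have ibp: "(LINT v|lborel. k v * dd (flux M f b) (0, b) (x, v)) =
        (LINT v|lborel. dd (dd k b) b v * f (x, v)) + (LINT v|lborel. dd k b v * (f (x, v) * mlog M b (x, v)))" for b
    proof -
      have "(LINT v|lborel. dd k b v * flux M f b (x, v)) = - (LINT v|lborel. k v * dd (flux M f b) (0, b) (x, v))"
        by (rule integral_by_parts[OF Ck _ C1_dder[OF k1] dd_slice[OF C1_dder[OF Y(1)]] C1_cont[OF k1]])
          (auto intro!: continuous_slice[OF Y(2)] continuous_slice[OF C1_cont[OF Y(1)]])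
      moreover have "(LINT v|lborel. dd k b v * flux M f b (x, v)) =
          (LINT v|lborel. dd k b v * dd f (0, b) (x, v)) - (LINT v|lborel. dd k b v * (f (x, v) * mlog M b (x, v)))"
        using j2 j3 by (simp add: flux_def right_diff_distrib)
      moreover have "(LINT v|lborel. dd (dd k b) b v * f (x, v)) = - (LINT v|lborel. dd k b v * dd f (0, b) (x, v))"
        by (rule integral_by_parts[OF Cdk _ C1_dder[OF k2] dd_slice[OF C1_dder[OF f'(3)]] C1_cont[OF k2]])
          (auto intro!: continuous_slice[OF fc] continuous_slice[OF C1_cont[OF f'(3)]])
      ultimately show ?thesis by simp
    qed
    have "(LINT v|lborel. k v * collision_op L M f (x, v)) = (\<Sum>b\<in>Basis. LINT v|lborel. k v * dd (flux M f b) (0, b) (x, v))"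
      unfolding Fokker_Planck Fokker_Planck_eq[OF M f2] sum_distrib_left using i
      by (intro Bochner_Integration.integral_sum)
    also have "\<dots> = (\<Sum>b\<in>Basis. LINT v|lborel. dd (dd k b) b v * f (x, v) + dd k b v * (f (x, v) * mlog M b (x, v)))"
      unfolding ibp using j1 j2 by simp
    also have "\<dots> = (LINT v|lborel. (\<Sum>b\<in>Basis. dd (dd k b) b v * f (x, v) + dd k b v * (f (x, v) * mlog M b (x, v))))"
      using j1 j2 by (intro Bochner_Integration.integral_sum[symmetric]) auto
    also have "\<dots> = (LINT v|lborel. coll_adj L M k (x, v) * f (x, v))"
      unfolding Fokker_Planck
      by (simp add: sum_distrib_right sum_distrib_left distrib_right distrib_left mult_ac)
    finally show ?thesis .
  next
    case BGK
    have iM: "integrable lborel (\<lambda>v. k v * M (x, v))" by (rule v_mom_integrable[OF Ck M_cont])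
    have ik: "integrable lborel (\<lambda>v. k v * f (x, v))" by (rule v_mom_integrable[OF Ck fc])
    have "(LINT v|lborel. k v * collision_op L M f (x, v)) =
        (LINT v|lborel. vavg f x * (k v * M (x, v)) - k v * f (x, v))"
      unfolding BGK by (simp add: right_diff_distrib mult_ac)
    also have "\<dots> = vavg f x * v_mom k M x - v_mom k f x"
      using iM ik by (simp add: v_mom_def)
    also have "\<dots> = (LINT v|lborel. v_mom k M x * f (x, v) - k v * f (x, v))"
      using admissible_int[OF f, of x] ik by (simp add: v_mom_def vavg_def)
    also have "\<dots> = (LINT v|lborel. coll_adj L M k (x, v) * f (x, v))"
      unfolding BGK by (simp add: left_diff_distrib)
    finally show ?thesis .
  qed
qed

end

section \<open>Mass, dissipation and local coercivity\<close>

lemma nn_integral_phase: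
  fixes f :: "'d::finite phase \<Rightarrow> ennreal"
  assumes "f \<in> borel_measurable borel"
  shows "(\<integral>\<^sup>+x. (\<integral>\<^sup>+v. f (x, v) \<partial>lborel) \<partial>lborel) = (\<integral>\<^sup>+z. f z \<partial>lborel)"
  using lborel.nn_integral_fst[of f lborel] assms by (simp add: lborel_prod)

lemma integral_phase:
  fixes f :: "'d::finite phase \<Rightarrow> real"
  assumes "integrable lborel f"
  shows "(LINT x|lborel. (LINT v|lborel. f (x, v))) = (LINT z|lborel. f z)"
    "integrable lborel (\<lambda>x. LINT v|lborel. f (x, v))"
proof -
  have i: "integrable (lborel \<Otimes>\<^sub>M lborel) f" using assms by (simp only: lborel_prod)
  show "(LINT x|lborel. (LINT v|lborel. f (x, v))) = (LINT z|lborel. f z)"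
    using lborel_pair.integral_fst'[OF i] by (simp only: lborel_prod)
  show "integrable lborel (\<lambda>x. LINT v|lborel. f (x, v))"
    using lborel_pair.integrable_fst'[OF i] .
qed

lemma dd_lin:
  assumes "C1 f c" "C1 g c"
  shows "dd (\<lambda>z. a * f z + b * g z) c = (\<lambda>z. a * dd f c z + b * dd g c z)"
  by (rule dd_eq[OF dder_add[OF dder_cmult[OF C1_dder[OF assms(1)]] dder_cmult[OF C1_dder[OF assms(2)]]]])

lemma test_function_lin:
  assumes "test_function UNIV f" "test_function UNIV g"
  shows "test_function UNIV (\<lambda>z. a * f z + b * g z :: real)"
proof -
  have "Cc (\<lambda>z. a * f z + b * g z)" using assms by (intro Cc_add Cc_const_mult test_function_Cc)
  then obtain r where r: "\<And>z. r < norm z \<Longrightarrow> a * f z + b * g z = 0" using Cc_support[of "\<lambda>z. a * f z + b * g z"] by blast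
  have "C_k k (\<lambda>z. a * f z + b * g z)" for k
    using assms by (intro C_k_add C_k_mult C_k_const test_function_C_k)
  then show ?thesis using r by (rule test_functionI)
qed

lemma test_function_zero: "test_function UNIV (\<lambda>_::'a::euclidean_space. 0 :: real)"
  by (rule test_functionI[of _ 0]) (auto intro: C_k_const)

lemma test_function_sum:
  "(\<And>i. i \<in> I \<Longrightarrow> test_function UNIV (f i)) \<Longrightarrow> test_function UNIV (\<lambda>z. \<Sum>i\<in>I. c i * f i z :: real)"
proof (induction I rule: infinite_finite_induct)
  case (insert i I)
  then show ?case using test_function_lin[of "f i" "\<lambda>z. \<Sum>i\<in>I. c i * f i z" "c i" 1] by simp
qed (auto intro: test_function_zero)

lemma Cc_slice_phase: assumes "Cc (f :: 'd::finite phase \<Rightarrow> real)" shows "Cc (\<lambda>v. f (x, v))"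
proof -
  obtain r where r: "\<And>z. r < norm z \<Longrightarrow> f z = 0" using Cc_support[OF assms] by metis
  show ?thesis
  proof (rule Cc_slice[OF Cc_continuous[OF assms]])
    fix x v :: "real ^ 'd" assume "r < norm v"
    then have "r < norm (x, v)" using norm_snd_le[of v x] by linarith
    then show "f (x, v) = 0" by (rule r)
  qed
qed

lemma Cc_vavg: assumes f: "Cc (f :: 'd::finite phase \<Rightarrow> real)" shows "Cc (vavg f)"
proof -
  obtain r where r: "\<And>z. r < norm z \<Longrightarrow> f z = 0" using Cc_support[OF assms] by metis
  have "f (x, v) = 0" if "r < norm v" for x v using r[of "(x, v)"] norm_snd_le[of v x] that by simp
  then have "continuous_on UNIV (\<lambda>x. LINT v|lborel. f (x, v))"
    by (rule continuous_param_integral[OF Cc_continuous[OF f]])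
  moreover have "(LINT v|lborel. f (x, v)) = 0" if "r < norm x" for x
  proof -
    have "f (x, v) = 0" for v using r[of "(x, v)"] norm_fst_le[of x v] that by simp
    then show ?thesis by simp
  qed
  ultimately show ?thesis unfolding vavg_def[abs_def] by (rule CcI)
qed

section \<open>Linearity, continuity and conservation of mass of the generator\<close>

context kinetic_data
begin

abbreviation A where "A \<equiv> kinetic_op L G M"

lemma transport_lin:
  assumes f: "test_function UNIV f" and g: "test_function UNIV g"
  shows "transport_op G (\<lambda>z. a * f z + b * g z) z = a * transport_op G f z + b * transport_op G g z"
proof -
  note fa = test_admissible[OF f] and ga = test_admissible[OF g] and la = test_admissible[OF test_function_lin[OF f g]]
  show ?thesis
    unfolding transport_eq[OF G admissible_C[OF la]] transport_eq[OF G admissible_C[OF fa]]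
      transport_eq[OF G admissible_C[OF ga]] dd_lin[OF admissible_C1[OF fa] admissible_C1[OF ga]]
    by (simp add: sum_distrib_left algebra_simps flip: sum.distrib)
qed

lemma collision_lin:
  assumes f: "test_function UNIV f" and g: "test_function UNIV g"
  shows "collision_op L M (\<lambda>z. a * f z + b * g z) z = a * collision_op L M f z + b * collision_op L M g z"
proof (cases L)
  case Fokker_Planck
  note M = M_FP[OF Fokker_Planck]
  note f2 = C2_in_v_test[OF f] and g2 = C2_in_v_test[OF g] and l2 = C2_in_v_test[OF test_function_lin[OF f g]]
  have "flux M (\<lambda>z. a * f z + b * g z) e = (\<lambda>z. a * flux M f e z + b * flux M g e z)" for e
    unfolding flux_def[abs_def] dd_lin[OF C2_in_v_props(3)[OF f2] C2_in_v_props(3)[OF g2]]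
    by (simp add: algebra_simps)
  then show ?thesis
    unfolding Fokker_Planck Fokker_Planck_eq[OF M f2] Fokker_Planck_eq[OF M g2] Fokker_Planck_eq[OF M l2]
    by (simp add: dd_lin[OF flux_props(1)[OF M f2] flux_props(1)[OF M g2]] sum_distrib_left sum.distrib)
next
  case BGK
  have "vavg (\<lambda>z. a * f z + b * g z) x = a * vavg f x + b * vavg g x" for x
    unfolding vavg_def using admissible_int[OF test_admissible[OF f]] admissible_int[OF test_admissible[OF g]] by simp
  then show ?thesis by (simp add: BGK algebra_simps)
qed

lemma A_lin:
  assumes "test_function UNIV f" "test_function UNIV g"
  shows "A (\<lambda>z. a * f z + b * g z) z = a * A f z + b * A g z"
  by (simp add: kinetic_op_def transport_lin[OF assms] collision_lin[OF assms] algebra_simps)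

lemma A_sum:
  "(\<And>i. i \<in> I \<Longrightarrow> test_function UNIV (f i)) \<Longrightarrow> A (\<lambda>z. \<Sum>i\<in>I. c i * f i z) z = (\<Sum>i\<in>I. c i * A (f i) z)"
proof (induction I rule: infinite_finite_induct)
  case (insert i I)
  then show ?case using A_lin[of "f i" "\<lambda>z. \<Sum>i\<in>I. c i * f i z" "c i" 1] test_function_sum[of I f c] by simp
qed (use A_lin[OF test_function_zero test_function_zero, of 0 0] in simp_all)

lemma collision_cont: assumes "test_function UNIV f" shows "continuous_on UNIV (collision_op L M f)"
proof (cases L)
  case Fokker_Planck
  have "collision_op L M f = (\<lambda>z. \<Sum>b\<in>Basis. dd (flux M f b) (0, b) z)"
    unfolding Fokker_Planck using Fokker_Planck_eq[OF M_FP[OF Fokker_Planck] C2_in_v_test[OF assms]] by blast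
  then show ?thesis
    using flux_props(1)[OF M_FP[OF Fokker_Planck] C2_in_v_test[OF assms]]
    by (auto intro!: continuous_intros C1_cont)
next
  case BGK
  have "continuous_on UNIV (vavg f)" by (rule Cc_continuous[OF Cc_vavg[OF test_function_Cc[OF assms]]])
  then have cv: "continuous_on UNIV (\<lambda>z::'d phase. vavg f (fst z))"
    by (rule continuous_on_compose2) (auto intro!: continuous_intros)
  show ?thesis unfolding BGK collision_op.simps
    by (intro continuous_on_diff continuous_on_mult cv M_cont Cc_continuous[OF test_function_Cc[OF assms]])
qed

lemma A_cont: "test_function UNIV f \<Longrightarrow> continuous_on UNIV (A f)"
  unfolding kinetic_op_def
  by (intro continuous_intros transport_cont collision_cont test_admissible)

lemma velocity_coord: "C1 (\<lambda>z::'d phase. snd z \<bullet> b) c" "dd (\<lambda>z::'d phase. snd z \<bullet> b) (e, 0) = (\<lambda>_. 0)"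
  "continuous_on UNIV (\<lambda>z::'d phase. snd z \<bullet> b)"
proof -
  have d: "dder (\<lambda>z::'d phase. snd z \<bullet> b) c (\<lambda>_. snd c \<bullet> b)" for c
    using dder_inner[of "(0, b)" c] by (simp add: inner_prod_def)
  show "C1 (\<lambda>z::'d phase. snd z \<bullet> b) c" by (rule C1I[OF d]) auto
  show "dd (\<lambda>z::'d phase. snd z \<bullet> b) (e, 0) = (\<lambda>_. 0)" using dd_eq[OF d[of "(e, 0)"]] by simp
  show "continuous_on UNIV (\<lambda>z::'d phase. snd z \<bullet> b)" by (intro continuous_intros)
qed

lemma integral_dd_eq_0: "Cc f \<Longrightarrow> C1 f b \<Longrightarrow> integrable lborel (dd f b) \<and> (LINT z|lborel. dd f b z) = 0"
  using integral_dder_eq_0[OF _ C1_dder C1_cont] Cc_integrable[OF dder_Cc[OF _ C1_dder C1_cont]] by blast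

text \<open>The operator is the divergence of a compactly supported flux, since v does not depend on
  x.\<close>

lemma transport_mass:
  assumes f: "test_function UNIV f"
  shows "integrable lborel (transport_op G f)" "(LINT z|lborel. transport_op G f z) = 0"
proof -
  note fa = test_admissible[OF f] and Cf = test_function_Cc[OF f]
  have X: "C1 (\<lambda>z. (snd z \<bullet> b) * f z) (b, 0)" "C1 (\<lambda>z. f z * (G z \<bullet> b)) (0, b)" for b
    by (intro C1_mult admissible_C1[OF fa] admissible_cont[OF fa] velocity_coord smooth_inner[OF G])+
  have C: "Cc (\<lambda>z. (snd z \<bullet> b) * f z)" "Cc (\<lambda>z. f z * (G z \<bullet> b))" for b
    by (rule Cc_supported_mult[OF Cf velocity_coord(3)], rule Cc_supported_mult[OF Cf smooth_inner(3)[OF G]])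
  have eq: "transport_op G f z = (\<Sum>b\<in>Basis. dd (\<lambda>z. (snd z \<bullet> b) * f z) (b, 0) z + dd (\<lambda>z. f z * (G z \<bullet> b)) (0, b) z)" for z
    unfolding transport_eq[OF G admissible_C[OF fa]] dd_mult[OF velocity_coord(1) admissible_C1[OF fa]]
      dd_mult[OF admissible_C1[OF fa] smooth_inner(2)[OF G]] velocity_coord(2)
    by (simp add: div_G_def)
  note I = integral_dd_eq_0[OF C(1) X(1)] integral_dd_eq_0[OF C(2) X(2)]
  show "integrable lborel (transport_op G f)" unfolding eq[abs_def]
    using I by (intro Bochner_Integration.integrable_sum Bochner_Integration.integrable_add) auto
  show "(LINT z|lborel. transport_op G f z) = 0" unfolding eq
    using I by (subst Bochner_Integration.integral_sum) auto
qed

lemma collision_mass: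
  assumes f: "test_function UNIV f"
  shows "integrable lborel (collision_op L M f)" "(LINT z|lborel. collision_op L M f z) = 0"
proof -
  note Cf = test_function_Cc[OF f]
  have "integrable lborel (collision_op L M f) \<and> (LINT z|lborel. collision_op L M f z) = 0"
  proof (cases L)
    case Fokker_Planck
    note M = M_FP[OF Fokker_Planck] and f2 = C2_in_v_test[OF f]
    have "Cc (flux M f b)" for b unfolding flux_def[abs_def]
      by (intro Cc_diff dder_Cc[OF Cf C1_dder C1_cont] Cc_supported_mult(1)[OF Cf] C2_in_v_props(3)[OF f2] mlog_props(2)[OF M])
    note I = integral_dd_eq_0[OF this flux_props(1)[OF M f2]]
    have eq: "collision_op L M f = (\<lambda>z. \<Sum>b\<in>Basis. dd (flux M f b) (0, b) z)"
      unfolding Fokker_Planck using Fokker_Planck_eq[OF M f2] by blast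
    show ?thesis unfolding eq using I by (auto simp: Bochner_Integration.integral_sum)
  next
    case BGK
    note Cv = Cc_vavg[OF Cf]
    define K where "K z = vavg f (fst z) * M z" for z
    have "K \<in> borel_measurable borel"
      unfolding K_def[abs_def]
      by (intro borel_measurable_continuous_onI continuous_on_mult M_cont
          continuous_on_compose2[OF Cc_continuous[OF Cv]]) (auto intro!: continuous_intros)
    then have Kc: "K \<in> borel_measurable (lborel \<Otimes>\<^sub>M lborel)" by (simp add: lborel_prod)
    have s: "integrable lborel (\<lambda>v. K (x, v))" "(LINT v|lborel. K (x, v)) = vavg f x"
      "(LINT v|lborel. norm (K (x, v))) = \<bar>vavg f x\<bar>" for x
      using M_slice(1,2)[of x] M_slice(3) by (simp_all add: K_def abs_mult)
    \<comment> \<open>The fibre integrals of |K| are |<f>|, because \<open>M\<close> integrates to 1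
      in v; so integrability on phase space follows from that of <f>.\<close>
    have "integrable (lborel \<Otimes>\<^sub>M lborel) K"
      by (rule lborel_pair.Fubini_integrable[OF Kc]) (use s Cc_integrable[OF Cv] in auto)
    then have Ki: "integrable lborel K" by (simp add: lborel_prod)
    have fi: "integrable lborel f" by (rule Cc_integrable[OF Cf])
    have "(LINT z|lborel. K z) = (LINT z|lborel. f z)"
      using integral_phase(1)[OF Ki] integral_phase(1)[OF fi] s by (simp add: vavg_def)
    moreover have "collision_op L M f = (\<lambda>z. K z - f z)" by (auto simp: BGK K_def)
    ultimately show ?thesis using Ki fi by simp
  qed
  then show "integrable lborel (collision_op L M f)" "(LINT z|lborel. collision_op L M f z) = 0" by auto
qed

lemma A_mass: "test_function UNIV f \<Longrightarrow> (LINT z|lborel. A f z) = 0"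
  unfolding kinetic_op_def by (simp add: transport_mass collision_mass)

lemma A_integrable: "test_function UNIV f \<Longrightarrow> integrable lborel (A f)"
  unfolding kinetic_op_def by (simp add: transport_mass collision_mass)

section \<open>Dissipation of a single test function, written as \<open>h * f_inf\<close>\<close>

context
  fixes f h assumes f: "test_function UNIV f"
  defines "h \<equiv> \<lambda>z. f z / f_inf z"
begin

lemma h_props: "Cc h" "C1 h b" "continuous_on UNIV h" "f = (\<lambda>z. h z * f_inf z)"
  "dd f b z = dd h b z * f_inf z + h z * dd f_inf b z"
proof -
  have nz: "f_inf z \<noteq> 0" for z using f_inf_pos[of z] by simp
  note fa = test_admissible[OF f]
  show c: "Cc h" unfolding h_def by (rule Cc_divide[OF test_function_Cc[OF f] f_inf_cont nz])
  show C: "C1 h b" for b unfolding h_def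
    by (rule C1_divide(1)[OF admissible_C1[OF fa] admissible_C1[OF f_inf_admissible] admissible_cont[OF fa] f_inf_cont nz])
  show "continuous_on UNIV h" by (rule Cc_continuous[OF c])
  show e: "f = (\<lambda>z. h z * f_inf z)" using nz by (simp add: h_def)
  show "dd f b z = dd h b z * f_inf z + h z * dd f_inf b z"
    by (subst e) (simp add: dd_mult[OF C admissible_C1[OF f_inf_admissible]])
qed

text \<open>The integrand is the phase-space divergence of (h^2 / 2) f_inf (v, G). The stationary
  equation later replaces the transport of \<open>f_inf\<close> by the collision operator of
  \<open>f_inf\<close>, and this is what makes the dissipation relative to
  \<open>f_inf\<close>.\<close>

lemma transport_energy:
  "integrable lborel (\<lambda>z. transport_op G f z * h z - (h z)\<^sup>2 / 2 * transport_op G f_inf z)"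
  "(LINT z|lborel. transport_op G f z * h z - (h z)\<^sup>2 / 2 * transport_op G f_inf z) = 0"
proof -
  note fa = test_admissible[OF f] and i1 = admissible_C1[OF f_inf_admissible]
  define X where "X b z = (h z * h z) * f_inf z * ((1 / 2) * (snd z \<bullet> b))" for b z
  define Y where "Y b z = (h z * h z) * f_inf z * ((1 / 2) * (G z \<bullet> b))" for b z
  have c2: "C1 (\<lambda>z. (1 / 2) * k z) c" "dd (\<lambda>z. (1 / 2) * k z) c = (\<lambda>z. (1 / 2) * dd k c z)" if "C1 k c" for k :: "'d phase \<Rightarrow> real" and c
    by (rule C1I[OF dder_cmult[OF C1_dder[OF that]]], intro continuous_intros C1_cont that)
      (rule dd_eq[OF dder_cmult[OF C1_dder[OF that]]])
  have hh: "C1 (\<lambda>z. h z * h z) c" "C1 (\<lambda>z. h z * h z * f_inf z) c" for c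
    by (intro C1_mult h_props i1 f_inf_cont continuous_intros)+
  have X1: "C1 (X b) (b, 0)" "C1 (Y b) (0, b)" for b
    unfolding X_def[abs_def] Y_def[abs_def]
    by (intro C1_mult hh c2 velocity_coord smooth_inner[OF G] continuous_intros h_props f_inf_cont)+
  have XC: "Cc (X b)" "Cc (Y b)" for b
    unfolding X_def[abs_def] Y_def[abs_def]
    by (intro Cc_supported_mult(1) h_props f_inf_cont continuous_intros smooth_inner[OF G])+
  have Xd: "dd (X b) (b, 0) z = (h z * dd h (b, 0) z * f_inf z + h z * h z / 2 * dd f_inf (b, 0) z) * (snd z \<bullet> b)" for b z
    unfolding X_def[abs_def] dd_mult[OF hh(2) c2(1)[OF velocity_coord(1)]] dd_mult[OF hh(1) i1]
      dd_mult[OF h_props(2) h_props(2)] c2(2)[OF velocity_coord(1)] velocity_coord(2)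
    by (simp add: algebra_simps)
  have Yd: "dd (Y b) (0, b) z = (h z * dd h (0, b) z * f_inf z + h z * h z / 2 * dd f_inf (0, b) z) * (G z \<bullet> b)
      + h z * h z / 2 * f_inf z * div_G G b z" for b z
    unfolding Y_def[abs_def] dd_mult[OF hh(2) c2(1)[OF smooth_inner(2)[OF G]]] dd_mult[OF hh(1) i1]
      dd_mult[OF h_props(2) h_props(2)] c2(2)[OF smooth_inner(2)[OF G]] div_G_def
    by (simp add: algebra_simps)
  have eq: "transport_op G f z * h z - (h z)\<^sup>2 / 2 * transport_op G f_inf z = (\<Sum>b\<in>Basis. dd (X b) (b, 0) z + dd (Y b) (0, b) z)" for z
  proof -
    have fz: "f z = h z * f_inf z" by (subst h_props(4)) (rule refl)
    show ?thesis
      unfolding transport_eq[OF G admissible_C[OF fa]] transport_eq[OF G f_inf_C] h_props(5) Xd Yd fz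
        sum_distrib_left sum_distrib_right sum_subtractf[symmetric]
      by (rule sum.cong[OF refl]) (simp add: field_simps power2_eq_square)
  qed
  note I = integral_dd_eq_0[OF XC(1) X1(1)] integral_dd_eq_0[OF XC(2) X1(2)]
  show "integrable lborel (\<lambda>z. transport_op G f z * h z - (h z)\<^sup>2 / 2 * transport_op G f_inf z)"
    unfolding eq using I by (intro Bochner_Integration.integrable_sum Bochner_Integration.integrable_add) auto
  show "(LINT z|lborel. transport_op G f z * h z - (h z)\<^sup>2 / 2 * transport_op G f_inf z) = 0"
    unfolding eq using I by (subst Bochner_Integration.integral_sum) auto
qed

text \<open>The collision operator L need not annihilate \<open>f_inf\<close>, but the combination h
  L f - (h^2 / 2) L f_inf is a v-divergence minus |grad_v h|^2 f_inf.\<close>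

lemma Fokker_Planck_energy:
  assumes FP: "L = Fokker_Planck"
  defines "Q \<equiv> \<lambda>z. \<Sum>b\<in>Basis. (dd h (0, b) z)\<^sup>2 * f_inf z"
  shows "Cc Q" "ip_inf f_inf (A f) f = - (LINT z|lborel. Q z)"
proof -
  note M = M_FP[OF FP] and f2 = C2_in_v_test[OF f] and i2 = admissible_C2[OF f_inf_admissible FP]
  note F = flux_props[OF M f2] and I = flux_props[OF M i2]
  have dh: "Cc (dd h b)" for b by (rule dder_Cc[OF h_props(1) C1_dder[OF h_props(2)] C1_cont[OF h_props(2)]])
  show CQ: "Cc Q" unfolding Q_def power2_eq_square
    by (intro Cc_sum Cc_supported_mult(1) dh f_inf_cont C1_cont h_props)
  \<comment> \<open>Subtracting h times the flux of \<open>f_inf\<close> cancels the drift due to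
    \<open>M\<close> and leaves \<open>f_inf\<close> times the derivative of h.\<close>
  define W where "W b z = flux M f b z - h z * flux M f_inf b z" for b z
  have W: "W b z = dd h (0, b) z * f_inf z" for b z
  proof -
    have fz: "f z = h z * f_inf z" by (subst h_props(4)) (rule refl)
    show ?thesis unfolding W_def flux_def h_props(5) fz by (simp add: algebra_simps)
  qed
  have Wd: "dder (W b) (0, b) (\<lambda>z. dd (flux M f b) (0, b) z -
      (dd h (0, b) z * flux M f_inf b z + h z * dd (flux M f_inf b) (0, b) z))" for b
    unfolding W_def[abs_def] by (intro dder_diff dder_mult C1_dder F I h_props)
  have Wc: "continuous_on UNIV (W b)" for b
    unfolding W_def[abs_def] by (intro continuous_intros F I h_props)
  define X where "X b z = (1 / 2) * ((h z * h z) * flux M f_inf b z) + h z * W b z" for b z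
  have Xd: "dder (X b) (0, b) (\<lambda>z. (1 / 2) * ((dd h (0, b) z * h z + h z * dd h (0, b) z) * flux M f_inf b z +
      (h z * h z) * dd (flux M f_inf b) (0, b) z) + (dd h (0, b) z * W b z + h z * (dd (flux M f b) (0, b) z -
      (dd h (0, b) z * flux M f_inf b z + h z * dd (flux M f_inf b) (0, b) z))))" for b
    unfolding X_def[abs_def]
    by (intro dder_add dder_cmult[where c = "1 / 2"] dder_mult C1_dder h_props I Wd)
  have XC: "Cc (X b)" for b
    unfolding X_def[abs_def] by (intro Cc_add Cc_const_mult Cc_supported_mult(1) h_props I Wc)
  have X1: "C1 (X b) (0, b)" for b
    by (rule C1I[OF Xd]) (intro continuous_intros C1_cont F I h_props Wc)
  have eq: "A f z * f z / f_inf z = (\<Sum>b\<in>Basis. dd (X b) (0, b) z) - Q z -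
      (transport_op G f z * h z - (h z)\<^sup>2 / 2 * transport_op G f_inf z)" for z
  proof -
    have "collision_op L M f z * h z - (h z)\<^sup>2 / 2 * collision_op L M f_inf z =
        (\<Sum>b\<in>Basis. dd (X b) (0, b) z) - Q z"
      unfolding FP Fokker_Planck_eq[OF M f2] Fokker_Planck_eq[OF M i2] Q_def dd_eq[OF Xd] W
        sum_distrib_left sum_distrib_right sum_subtractf[symmetric]
      by (rule sum.cong[OF refl]) (simp add: field_simps power2_eq_square)
    moreover have "A f z * f z / f_inf z = A f z * h z" by (simp add: h_def)
    ultimately show ?thesis using stationary[of z] by (simp add: kinetic_op_def algebra_simps)
  qed
  have Q_int: "integrable lborel Q" by (rule Cc_integrable[OF CQ])
  note J = integral_dd_eq_0[OF XC X1]
  show "ip_inf f_inf (A f) f = - (LINT z|lborel. Q z)"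
    unfolding ip_inf_def eq using J Q_int transport_energy
    by (simp add: Bochner_Integration.integral_sum)
qed

lemma BGK_energy:
  assumes BGK: "L = BGK"
  defines "Q \<equiv> \<lambda>z. (h z)\<^sup>2 / 2 * (vavg f_inf (fst z) * M z) + (h z)\<^sup>2 / 2 * f_inf z - vavg f (fst z) * M z * h z"
  shows "Cc Q" "ip_inf f_inf (A f) f = - (LINT z|lborel. Q z)"
proof -
  have cv: "continuous_on UNIV (\<lambda>z::'d phase. vavg f (fst z))" "continuous_on UNIV (\<lambda>z::'d phase. vavg f_inf (fst z))"
    by (rule continuous_on_compose2[OF Cc_continuous[OF Cc_vavg[OF test_function_Cc[OF f]]]]
        continuous_on_compose2[OF rho_cont]; auto intro!: continuous_intros)+
  have "Q = (\<lambda>z. h z * (h z / 2 * (vavg f_inf (fst z) * M z) + h z / 2 * f_inf z - vavg f (fst z) * M z))"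
    by (auto simp: Q_def power2_eq_square algebra_simps)
  moreover have "Cc (\<lambda>z. h z * (h z / 2 * (vavg f_inf (fst z) * M z) + h z / 2 * f_inf z - vavg f (fst z) * M z))"
    by (intro Cc_supported_mult(1) h_props continuous_intros cv M_cont f_inf_cont) auto
  ultimately show CQ: "Cc Q" by simp
  have eq: "A f z * f z / f_inf z = - Q z - (transport_op G f z * h z - (h z)\<^sup>2 / 2 * transport_op G f_inf z)" for z
  proof -
    have fz: "f z = h z * f_inf z" by (subst h_props(4)) (rule refl)
    have "A f z * f z / f_inf z = A f z * h z" by (simp add: h_def)
    also have "\<dots> = - (transport_op G f z * h z) + (vavg f (fst z) * M z - h z * f_inf z) * h z"
      unfolding kinetic_op_def BGK collision_op.simps fz by (simp add: algebra_simps)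
    finally have e: "A f z * f z / f_inf z = - (transport_op G f z * h z) + (vavg f (fst z) * M z - h z * f_inf z) * h z" .
    have st: "transport_op G f_inf z = vavg f_inf (fst z) * M z - f_inf z"
      using stationary[of z] unfolding BGK by simp
    show ?thesis unfolding e st Q_def by (simp add: field_simps power2_eq_square)
  qed
  show "ip_inf f_inf (A f) f = - (LINT z|lborel. Q z)"
    unfolding ip_inf_def eq using Cc_integrable[OF CQ] transport_energy by simp
qed

text \<open>Expanding the square and using <M> = 1 and h f_inf = f turns the double integral of
  local coercivity into twice the density \<open>q\<close> of the dissipation, which accounts for
  the factor 1 / 2 in that hypothesis.\<close>

lemma BGK_double_integral:
  fixes x
  assumes BGK: "L = BGK"
  defines "q \<equiv> LINT v|lborel. (h (x, v))\<^sup>2 / 2 * (vavg f_inf x * M (x, v)) + (h (x, v))\<^sup>2 / 2 * f_inf (x, v) - vavg f x * M (x, v) * h (x, v)"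
  shows "(\<integral>\<^sup>+(v, u). ennreal ((h (x, v) - h (x, u))\<^sup>2 * f_inf (x, v) * M (x, u)) \<partial>lborel) = ennreal (2 * q)" "0 \<le> q"
proof -
  have hC: "Cc (\<lambda>v. h (x, v))" by (rule Cc_slice_phase[OF h_props(1)])
  have hc: "continuous_on UNIV (\<lambda>v. h (x, v))" by (rule Cc_continuous[OF hC])
  note Mc = continuous_slice[OF M_cont, of x] and fc = continuous_slice[OF f_inf_cont, of x]
  define m1 where "m1 = (LINT u|lborel. h (x, u) * M (x, u))"
  define m2 where "m2 = (LINT u|lborel. (h (x, u) * h (x, u)) * M (x, u))"
  define a where "a = (LINT v|lborel. (h (x, v) * h (x, v)) * f_inf (x, v))"
  have i1: "integrable lborel (\<lambda>u. h (x, u) * M (x, u))" "integrable lborel (\<lambda>u. (h (x, u) * h (x, u)) * M (x, u))"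
    "integrable lborel (\<lambda>v. (h (x, v) * h (x, v)) * f_inf (x, v))"
    by (intro Cc_integrable Cc_supported_mult(1) hC hc Mc fc)+
  have fi: "integrable lborel (\<lambda>v. f_inf (x, v))" "integrable lborel (\<lambda>v. f (x, v))"
    by (intro admissible_int f_inf_admissible test_admissible f)+
  have fz: "f z = h z * f_inf z" for z by (subst h_props(4)) (rule refl)
  have inner: "(\<integral>\<^sup>+u. ennreal ((h (x, v) - h (x, u))\<^sup>2 * f_inf (x, v) * M (x, u)) \<partial>lborel) =
      ennreal (f_inf (x, v) * ((h (x, v))\<^sup>2 - 2 * h (x, v) * m1 + m2))"
    and inner0: "0 \<le> f_inf (x, v) * ((h (x, v))\<^sup>2 - 2 * h (x, v) * m1 + m2)" for v
  proof -
    have e: "(h (x, v) - h (x, u))\<^sup>2 * f_inf (x, v) * M (x, u) = f_inf (x, v) * ((h (x, v))\<^sup>2 * M (x, u)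
        - 2 * h (x, v) * (h (x, u) * M (x, u)) + (h (x, u) * h (x, u)) * M (x, u))" for u
      by (simp add: power2_eq_square algebra_simps)
    have int: "integrable lborel (\<lambda>u. (h (x, v) - h (x, u))\<^sup>2 * f_inf (x, v) * M (x, u))"
      unfolding e using i1 M_slice(1)[of x] by simp
    have nn: "0 \<le> (h (x, v) - h (x, u))\<^sup>2 * f_inf (x, v) * M (x, u)" for u
      using f_inf_pos[of "(x, v)"] M_slice(3)[of "(x, u)"] by simp
    have val: "(LINT u|lborel. (h (x, v) - h (x, u))\<^sup>2 * f_inf (x, v) * M (x, u)) =
        f_inf (x, v) * ((h (x, v))\<^sup>2 - 2 * h (x, v) * m1 + m2)"
      unfolding e using i1 M_slice(1,2)[of x] by (simp add: m1_def m2_def)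
    show "(\<integral>\<^sup>+u. ennreal ((h (x, v) - h (x, u))\<^sup>2 * f_inf (x, v) * M (x, u)) \<partial>lborel) =
        ennreal (f_inf (x, v) * ((h (x, v))\<^sup>2 - 2 * h (x, v) * m1 + m2))"
      using nn by (subst nn_integral_eq_integral[OF int]) (auto simp: val)
    show "0 \<le> f_inf (x, v) * ((h (x, v))\<^sup>2 - 2 * h (x, v) * m1 + m2)"
      unfolding val[symmetric] using nn by (intro Bochner_Integration.integral_nonneg)
  qed
  have e2: "f_inf (x, v) * ((h (x, v))\<^sup>2 - 2 * h (x, v) * m1 + m2) =
      (h (x, v) * h (x, v)) * f_inf (x, v) - (2 * m1) * f (x, v) + m2 * f_inf (x, v)" for v
    by (simp add: fz power2_eq_square algebra_simps)
  have int2: "integrable lborel (\<lambda>v. f_inf (x, v) * ((h (x, v))\<^sup>2 - 2 * h (x, v) * m1 + m2))"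
    unfolding e2 using i1 fi by simp
  have val2: "(LINT v|lborel. f_inf (x, v) * ((h (x, v))\<^sup>2 - 2 * h (x, v) * m1 + m2)) = a - 2 * m1 * vavg f x + m2 * vavg f_inf x"
    unfolding e2 using i1 fi by (simp add: a_def vavg_def)
  have q: "2 * q = (a - 2 * m1 * vavg f x + m2 * vavg f_inf x)"
  proof -
    have "q = (LINT v|lborel. (vavg f_inf x / 2) * ((h (x, v) * h (x, v)) * M (x, v)) + (1 / 2) * ((h (x, v) * h (x, v)) * f_inf (x, v))
        - vavg f x * (h (x, v) * M (x, v)))"
      unfolding q_def by (simp add: power2_eq_square mult_ac)
    also have "\<dots> = (vavg f_inf x / 2) * m2 + (1 / 2) * a - vavg f x * m1"
      using i1 by (simp add: m1_def m2_def a_def)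
    finally show ?thesis by (simp add: field_simps)
  qed
  have meas: "(\<lambda>p. ennreal ((h (x, fst p) - h (x, snd p))\<^sup>2 * f_inf (x, fst p) * M (x, snd p))) \<in> borel_measurable (borel :: 'd phase measure)"
    by (intro measurable_compose[OF _ measurable_ennreal] borel_measurable_continuous_onI continuous_intros
        continuous_on_compose2[OF hc] continuous_on_compose2[OF fc] continuous_on_compose2[OF Mc]) auto
  have "(\<integral>\<^sup>+(v, u). ennreal ((h (x, v) - h (x, u))\<^sup>2 * f_inf (x, v) * M (x, u)) \<partial>lborel) =
      (\<integral>\<^sup>+v. (\<integral>\<^sup>+u. ennreal ((h (x, v) - h (x, u))\<^sup>2 * f_inf (x, v) * M (x, u)) \<partial>lborel) \<partial>lborel)"
    using nn_integral_phase[OF meas] by (simp add: case_prod_beta')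
  also have "\<dots> = ennreal (a - 2 * m1 * vavg f x + m2 * vavg f_inf x)"
    unfolding inner using inner0 by (subst nn_integral_eq_integral[OF int2]) (auto simp: val2)
  finally show "(\<integral>\<^sup>+(v, u). ennreal ((h (x, v) - h (x, u))\<^sup>2 * f_inf (x, v) * M (x, u)) \<partial>lborel) = ennreal (2 * q)"
    using q by simp
  have "0 \<le> (LINT v|lborel. f_inf (x, v) * ((h (x, v))\<^sup>2 - 2 * h (x, v) * m1 + m2))"
    using inner0 by (intro Bochner_Integration.integral_nonneg)
  then show "0 \<le> q" using q by (simp add: val2)
qed

text \<open>Local coercivity is applied on the fibre over each x and integrated in x; the fibre
  integrals on its right-hand side add up to the dissipation by the two energy identities.\<close>

lemma dissipation_controls_defect:
  assumes lc: "local_coercivity L M f_inf lambda1"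
  shows "0 \<le> - ip_inf f_inf (A f) f"
    "(\<integral>\<^sup>+x. velocity_defect f_inf x (\<lambda>v. f (x, v)) \<partial>lborel) \<le> ennreal (lambda1 * (- ip_inf f_inf (A f) f))"
proof -
  have fi: "integrable lborel (\<lambda>v. f (x, v))" for x by (intro admissible_int test_admissible f)
  have "0 \<le> - ip_inf f_inf (A f) f \<and> (\<integral>\<^sup>+x. velocity_defect f_inf x (\<lambda>v. f (x, v)) \<partial>lborel) \<le> ennreal (lambda1 * (- ip_inf f_inf (A f) f))"
  proof (cases L)
    case Fokker_Planck
    define Q where "Q = (\<lambda>z. \<Sum>b\<in>Basis. (dd h (0, b) z)\<^sup>2 * f_inf z)"
    note E = Fokker_Planck_energy[OF Fokker_Planck, folded Q_def]
    have l1: "0 < lambda1" using lc Fokker_Planck by simp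
    have Q0: "0 \<le> Q z" for z unfolding Q_def using f_inf_pos[of z] by (intro sum_nonneg) auto
    have gr: "(norm (grad (\<lambda>u. f (x, u) / f_inf (x, u)) v))\<^sup>2 * f_inf (x, v) = Q (x, v)" for x v
    proof -
      have sd: "slice_diff h" unfolding h_def
        using f_inf_pos by (intro slice_diff_intros(3) C_1_slice_diff f_inf_C admissible_C test_admissible f) (auto simp: less_imp_neq[symmetric] intro: less_imp_neq[symmetric])
      have "(norm (grad_v h (x, v)))\<^sup>2 = (\<Sum>b\<in>Basis. (grad_v h (x, v) \<bullet> b)\<^sup>2)"
        unfolding power2_norm_eq_inner by (subst euclidean_inner) (simp add: power2_eq_square)
      also have "\<dots> = (\<Sum>b\<in>Basis. (dd h (0, b) (x, v))\<^sup>2)"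
        using grad_v_inner[OF sd C1_dder[OF h_props(2)]] by simp
      finally show ?thesis by (simp add: Q_def grad_v_def h_def sum_distrib_right)
    qed
    have sl: "C_k 1 (\<lambda>v. f (x, v))" for x
    proof -
      have "bounded_linear (\<lambda>v::real^'d. (0::real^'d, v))" by (intro bounded_linear_Pair bounded_linear_zero bounded_linear_ident)
      from C_k_affine[OF this test_function_C_k[OF f], of 1 "(x, 0)"] show ?thesis by simp
    qed
    have "velocity_defect f_inf x (\<lambda>v. f (x, v)) \<le> ennreal lambda1 * (\<integral>\<^sup>+v. ennreal (Q (x, v)) \<partial>lborel)" for x
      using lc sl[of x] fi[of x] unfolding Fokker_Planck local_coercivity.simps gr[symmetric] by blast
    then have "(\<integral>\<^sup>+x. velocity_defect f_inf x (\<lambda>v. f (x, v)) \<partial>lborel) \<le>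
        (\<integral>\<^sup>+x. ennreal lambda1 * (\<integral>\<^sup>+v. ennreal (Q (x, v)) \<partial>lborel) \<partial>lborel)"
      by (intro nn_integral_mono)
    also have "\<dots> = ennreal lambda1 * (\<integral>\<^sup>+x. (\<integral>\<^sup>+v. ennreal (Q (x, v)) \<partial>lborel) \<partial>lborel)"
    proof (rule nn_integral_cmult)
      have "(\<lambda>z. ennreal (Q z)) \<in> borel_measurable (lborel \<Otimes>\<^sub>M lborel)"
        unfolding lborel_prod using Cc_measurable[OF E(1)] by simp
      then show "(\<lambda>x. \<integral>\<^sup>+v. ennreal (Q (x, v)) \<partial>lborel) \<in> borel_measurable lborel"
        by (rule lborel.borel_measurable_nn_integral_fst)
    qed
    also have "(\<integral>\<^sup>+x. (\<integral>\<^sup>+v. ennreal (Q (x, v)) \<partial>lborel) \<partial>lborel) = (\<integral>\<^sup>+z. ennreal (Q z) \<partial>lborel)"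
      using Cc_measurable[OF E(1)] by (intro nn_integral_phase) simp
    also have "\<dots> = ennreal (LINT z|lborel. Q z)"
      using Q0 by (intro nn_integral_eq_integral Cc_integrable E) auto
    finally have "(\<integral>\<^sup>+x. velocity_defect f_inf x (\<lambda>v. f (x, v)) \<partial>lborel) \<le> ennreal (lambda1 * (LINT z|lborel. Q z))"
      using l1 by (simp only: ennreal_mult' less_imp_le)
    moreover have "0 \<le> (LINT z|lborel. Q z)"
      using Q0 by (intro Bochner_Integration.integral_nonneg)
    ultimately show ?thesis unfolding E(2) minus_minus by (intro conjI)
  next
    case BGK
    define Q where "Q = (\<lambda>z. (h z)\<^sup>2 / 2 * (vavg f_inf (fst z) * M z) + (h z)\<^sup>2 / 2 * f_inf z - vavg f (fst z) * M z * h z)"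
    note E = BGK_energy[OF BGK, folded Q_def]
    have l1: "0 < lambda1" using lc BGK by simp
    define q where "q x = (LINT v|lborel. Q (x, v))" for x
    have q: "(\<integral>\<^sup>+(v, u). ennreal ((h (x, v) - h (x, u))\<^sup>2 * f_inf (x, v) * M (x, u)) \<partial>lborel) = ennreal (2 * q x)" "0 \<le> q x" for x
      using BGK_double_integral[OF BGK, of x] by (simp_all add: q_def Q_def)
    note Qi = Cc_integrable[OF E(1)]
    have qi: "integrable lborel q" "(LINT x|lborel. q x) = (LINT z|lborel. Q z)"
      using integral_phase[OF Qi] by (simp_all add: q_def[abs_def])
    have "velocity_defect f_inf x (\<lambda>v. f (x, v)) \<le> ennreal (lambda1 * q x)" for x
    proof -
      have "(\<lambda>v. f (x, v)) \<in> borel_measurable borel"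
        by (rule borel_measurable_continuous_onI[OF continuous_slice[OF Cc_continuous[OF test_function_Cc[OF f]]]])
      then have "velocity_defect f_inf x (\<lambda>v. f (x, v)) \<le> ennreal (lambda1 / 2) *
          (\<integral>\<^sup>+(v, u). ennreal ((f (x, v) / f_inf (x, v) - f (x, u) / f_inf (x, u))\<^sup>2 * f_inf (x, v) * M (x, u)) \<partial>lborel)"
        using lc fi[of x] unfolding BGK local_coercivity.simps by blast
      also have "\<dots> = ennreal (lambda1 / 2) * ennreal (2 * q x)" using q(1)[of x] by (simp add: h_def)
      also have "\<dots> = ennreal (lambda1 * q x)" using l1 q(2)[of x] by (simp flip: ennreal_mult')
      finally show ?thesis .
    qed
    then have "(\<integral>\<^sup>+x. velocity_defect f_inf x (\<lambda>v. f (x, v)) \<partial>lborel) \<le> (\<integral>\<^sup>+x. ennreal (lambda1 * q x) \<partial>lborel)"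
      by (intro nn_integral_mono)
    also have "\<dots> = ennreal (lambda1 * (LINT z|lborel. Q z))"
      using qi q(2) l1 by (subst nn_integral_eq_integral) auto
    finally have "(\<integral>\<^sup>+x. velocity_defect f_inf x (\<lambda>v. f (x, v)) \<partial>lborel) \<le> ennreal (lambda1 * (LINT z|lborel. Q z))" .
    moreover have "0 \<le> (LINT z|lborel. Q z)"
      unfolding qi(2)[symmetric] using q(2) by (intro Bochner_Integration.integral_nonneg)
    ultimately show ?thesis unfolding E(2) minus_minus by (intro conjI)
  qed
  then show "0 \<le> - ip_inf f_inf (A f) f"
    "(\<integral>\<^sup>+x. velocity_defect f_inf x (\<lambda>v. f (x, v)) \<partial>lborel) \<le> ennreal (lambda1 * (- ip_inf f_inf (A f) f))" by auto
qed

end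

end

section \<open>Inversion of the moment matrix\<close>

text \<open>P s (q s - q0) = y s - P s q0 tends to 0, and coercivity bounds q s - q0 by it.
  Solutions of linear equations thus converge without any formula for the inverse, and this yields
  both continuity and differentiability of the inverse matrix.\<close>

lemma coercive_tendsto:
  fixes P :: "'i \<Rightarrow> 'e::euclidean_space \<Rightarrow> 'e"
  assumes m: "0 < m" and co: "\<forall>\<^sub>F s in Fl. \<forall>y. m * norm y \<le> norm (P s y)" and lin: "\<And>s. linear (P s)"
    and P: "\<And>y. ((\<lambda>s. P s y) \<longlongrightarrow> P0 y) Fl" and y: "(y \<longlongrightarrow> y0) Fl"
    and q: "\<forall>\<^sub>F s in Fl. P s (q s) = y s" "P0 q0 = y0"
  shows "(q \<longlongrightarrow> q0) Fl"
proof -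
  have "((\<lambda>s. y s - P s q0) \<longlongrightarrow> y0 - P0 q0) Fl" by (intro tendsto_intros P y)
  then have "((\<lambda>s. y s - P s q0) \<longlongrightarrow> 0) Fl" using q(2) by simp
  then have lim: "((\<lambda>s. norm (y s - P s q0) / m) \<longlongrightarrow> 0) Fl"
    by (intro tendsto_divide_zero tendsto_norm_zero)
  have "\<forall>\<^sub>F s in Fl. norm (q s - q0) \<le> norm (y s - P s q0) / m"
    using co q(1)
  proof eventually_elim
    case (elim s)
    have "m * norm (q s - q0) \<le> norm (P s (q s - q0))" using elim by blast
    also have "P s (q s - q0) = y s - P s q0" using elim linear_diff[OF lin[of s]] by simp
    finally show ?case using m by (simp add: le_divide_eq mult.commute)
  qed
  then have "((\<lambda>s. q s - q0) \<longlongrightarrow> 0) Fl" using lim by (rule Lim_null_comparison)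
  then show ?thesis by (simp add: LIM_zero_iff)
qed

lemma has_vector_derivative_at_0_iff:
  "(f has_vector_derivative D) (at (0::real)) \<longleftrightarrow> ((\<lambda>s. (1 / s) *\<^sub>R (f s - f 0)) \<longlongrightarrow> D) (at 0)"
proof -
  have "norm (f h - f 0 - h *\<^sub>R D) / \<bar>h\<bar> = norm ((1 / h) *\<^sub>R (f h - f 0) - D)" if "h \<noteq> 0" for h
  proof -
    have "(1 / h) *\<^sub>R (f h - f 0 - h *\<^sub>R D) = (1 / h) *\<^sub>R (f h - f 0) - D"
      using that by (simp add: scaleR_diff_right)
    then have "norm ((1 / h) *\<^sub>R (f h - f 0) - D) = norm ((1 / h) *\<^sub>R (f h - f 0 - h *\<^sub>R D))" by simp
    then show ?thesis by (simp only: norm_scaleR) simp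
  qed
  then have "((\<lambda>h. norm (f h - f 0 - h *\<^sub>R D) / \<bar>h\<bar>) \<longlongrightarrow> 0) (at 0) \<longleftrightarrow>
      ((\<lambda>h. norm ((1 / h) *\<^sub>R (f h - f 0) - D)) \<longlongrightarrow> 0) (at 0)"
    by (intro filterlim_cong) (auto simp: eventually_at_filter)
  then show ?thesis
    by (simp add: has_vector_derivative_def has_derivative_at tendsto_norm_zero_iff LIM_zero_iff bounded_linear_scaleR_left)
qed

locale coercive_family =
  fixes P :: "'x::euclidean_space \<Rightarrow> 'e::euclidean_space \<Rightarrow> 'e" and mu :: "'x \<Rightarrow> real"
  assumes lin: "linear (P x)" and mu_pos: "0 < mu x" and mu_cont: "continuous_on UNIV mu"
    and coercive: "mu x * (norm y)\<^sup>2 \<le> y \<bullet> P x y" and P_cont: "continuous_on UNIV (\<lambda>x. P x y)"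
begin

lemma lower: "mu x * norm y \<le> norm (P x y)"
proof (cases "y = 0")
  case False
  have "mu x * (norm y)\<^sup>2 \<le> norm y * norm (P x y)"
    using coercive[of x y] norm_cauchy_schwarz[of y "P x y"] by linarith
  then show ?thesis using False by (simp add: power2_eq_square)
qed simp

definition inve :: "'x \<Rightarrow> 'e \<Rightarrow> 'e" where "inve x y = (SOME q. P x q = y)"

lemma P_inve: "P x (inve x y) = y"
proof -
  have "inj (P x)"
  proof (rule linear_injective_0[OF lin, THEN iffD2], intro allI impI)
    fix y assume "P x y = 0"
    then have "mu x * norm y \<le> 0" using lower[of x y] by simp
    then show "y = 0" using mu_pos[of x] by (simp add: mult_le_0_iff)
  qed
  then have "surj (P x)" using linear_injective_imp_surjective[OF lin] by blast
  then obtain q where "P x q = y" by (metis surjD)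
  then show ?thesis unfolding inve_def by (rule someI)
qed

lemma norm_inve: "norm (inve x y) \<le> norm y / mu x"
  using lower[of x "inve x y"] mu_pos[of x] by (simp add: P_inve field_simps)

lemma lower_near: "\<forall>\<^sub>F s in at x. \<forall>y. mu x / 2 * norm y \<le> norm (P s y)"
proof -
  have "(mu \<longlongrightarrow> mu x) (at x)" using mu_cont by (simp add: continuous_on_def)
  then have "\<forall>\<^sub>F s in at x. mu x / 2 < mu s" using mu_pos[of x] by (intro order_tendstoD) auto
  then show ?thesis
  proof eventually_elim
    case (elim s)
    have "mu x / 2 * norm y \<le> mu s * norm y" for y using elim by (intro mult_right_mono) auto
    then show ?case using lower[of s] order_trans by blast
  qed
qed

lemma inve_continuous:
  assumes "continuous_on UNIV y" shows "continuous_on UNIV (\<lambda>x. inve x (y x))"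
  unfolding continuous_on_def
proof
  fix x :: 'x
  have "(y \<longlongrightarrow> y x) (at x)" using assms by (simp add: continuous_on_def)
  note y = this
  have P: "((\<lambda>s. P s e) \<longlongrightarrow> P x e) (at x)" for e using P_cont by (simp add: continuous_on_def)
  have "0 < mu x / 2" using mu_pos[of x] by simp
  from coercive_tendsto[OF this lower_near lin P y, of "\<lambda>x. inve x (y x)" "inve x (y x)"]
  show "((\<lambda>x. inve x (y x)) \<longlongrightarrow> inve x (y x)) (at x within UNIV)" by (simp add: P_inve)
qed

text \<open>The rule that P^(-1) has derivative - P^(-1) P' P^(-1): the difference quotient of q =
  P^(-1) y solves an equation whose right-hand side is minus the difference quotient of P at the
  fixed vector q 0, so it converges by coercivity.\<close>

lemma inve_vector_derivative:
  assumes P': "\<And>y. ((\<lambda>s. P (x + s *\<^sub>R b) y) has_vector_derivative P' y) (at 0)"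
  shows "((\<lambda>s. inve (x + s *\<^sub>R b) y) has_vector_derivative - inve x (P' (inve x y))) (at 0)"
proof -
  define q where "q s = inve (x + s *\<^sub>R b) y" for s
  let ?P = "\<lambda>s. P (x + s *\<^sub>R b)"
  have line: "((\<lambda>s::real. x + s *\<^sub>R b) \<longlongrightarrow> x) (at 0)" by (auto intro!: tendsto_eq_intros)
  have Pt: "((\<lambda>s. ?P s e) \<longlongrightarrow> P x e) (at 0)" for e
    using continuous_on_tendsto_compose[OF P_cont line, of e] by simp
  \<comment> \<open>\<open>lower_near\<close> concerns a punctured neighbourhood of x. The point x
    is added so that the bound can be composed with the line x + s b, which is constant if b =
    0.\<close>
  have co: "\<forall>\<^sub>F s in at 0. \<forall>y. mu x / 2 * norm y \<le> norm (?P s y)"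
  proof -
    have "\<forall>\<^sub>F s in nhds x. \<forall>y. mu x / 2 * norm y \<le> norm (P s y)"
    proof -
      have "mu x / 2 * norm y \<le> norm (P x y)" for y
      proof -
        have "mu x / 2 * norm y \<le> mu x * norm y" using mu_pos[of x] by (intro mult_right_mono) auto
        then show ?thesis using lower[of x y] by linarith
      qed
      then show ?thesis using lower_near[of x] unfolding eventually_at_filter
        by (auto elim!: eventually_mono)
    qed
    then show ?thesis using line by (rule eventually_compose_filterlim)
  qed
  have Pq: "?P s (q s) = y" for s by (simp add: q_def P_inve)
  have "((\<lambda>s. (1 / s) *\<^sub>R (q s - q 0)) \<longlongrightarrow> - inve x (P' (inve x y))) (at 0)"
  proof (rule coercive_tendsto[OF _ co lin])
    show "((\<lambda>s. ?P s e) \<longlongrightarrow> P x e) (at 0)" for e by (rule Pt)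
    show "((\<lambda>s. - ((1 / s) *\<^sub>R (?P s (q 0) - P x (q 0)))) \<longlongrightarrow> - P' (q 0)) (at 0)"
      using P'[of "q 0"] by (intro tendsto_minus) (simp add: has_vector_derivative_at_0_iff)
    show "\<forall>\<^sub>F s in at 0. ?P s ((1 / s) *\<^sub>R (q s - q 0)) = - ((1 / s) *\<^sub>R (?P s (q 0) - P x (q 0)))"
    proof (intro always_eventually allI)
      fix s
      have "P x (q 0) = y" using Pq[of 0] by simp
      then show "?P s ((1 / s) *\<^sub>R (q s - q 0)) = - ((1 / s) *\<^sub>R (?P s (q 0) - P x (q 0)))"
        unfolding linear_scale[OF lin] linear_diff[OF lin] Pq by (simp add: scaleR_diff_right)
    qed
    show "P x (- inve x (P' (inve x y))) = - P' (q 0)"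
      using linear_neg[OF lin] by (simp add: P_inve q_def)
  qed (use mu_pos[of x] in simp)
  then show ?thesis
    unfolding q_def[symmetric] has_vector_derivative_at_0_iff by simp
qed

end

section \<open>Velocity moments\<close>

lemma C_k_ident: "C_k k (\<lambda>x::real. x)"
proof (cases k)
  case (Suc n)
  show ?thesis unfolding Suc C_k.simps
    by (rule exI[of _ "\<lambda>_ h. h"]) (auto intro: C_k_const)
qed auto

text \<open>The products of the bump \<open>eta\<close> with the components of \<open>(1, v)\<close> are the test functions in \<open>v\<close>
  whose moments determine the space-time gradient of the density.\<close>

definition eta :: "real ^ 'd::finite \<Rightarrow> real" where
  "eta = (SOME j. test_function UNIV j \<and> (\<forall>z. 0 \<le> j z) \<and> 0 < j 0 \<and> (\<forall>z. 1 < norm z \<longrightarrow> j z = 0))"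

lemma eta: "test_function UNIV (eta :: real ^ 'd::finite \<Rightarrow> real)" "0 \<le> eta (v :: real ^ 'd)" "0 < eta (0 :: real ^ 'd)"
  "1 < norm v \<Longrightarrow> eta v = 0"
proof -
  have "\<exists>j :: real ^ 'd \<Rightarrow> real. test_function UNIV j \<and> (\<forall>z. 0 \<le> j z) \<and> 0 < j 0 \<and> (\<forall>z. 1 < norm z \<longrightarrow> j z = 0)"
    using bump_ex[of 1] by (metis zero_less_one)
  from someI_ex[OF this, folded eta_def]
  show "test_function UNIV (eta :: real ^ 'd \<Rightarrow> real)" "0 \<le> eta v" "0 < eta (0 :: real ^ 'd)" "1 < norm v \<Longrightarrow> eta v = 0"
    by blast+
qed

type_synonym 'd spacetime = "real \<times> (real ^ 'd)"

definition vmon :: "'d::finite spacetime \<Rightarrow> real ^ 'd \<Rightarrow> real" where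
  "vmon l v = (1, v) \<bullet> l"

definition vtest :: "'d::finite spacetime \<Rightarrow> real ^ 'd \<Rightarrow> real" where
  "vtest l v = eta v * vmon l v"

lemma vmon_C_k: "C_k k (vmon l)"
proof -
  have "C_k k (\<lambda>v. (\<lambda>x::real. x) (v \<bullet> snd l + fst l))"
    by (rule C_k_affine[OF bounded_linear_inner_left C_k_ident])
  then show ?thesis by (simp add: vmon_def[abs_def] inner_prod_def add.commute)
qed

lemma vmon_cont: "continuous_on UNIV (vmon l)" by (rule C_k_continuous[OF vmon_C_k])

lemma vtest_test: "test_function UNIV (vtest l)"
  unfolding vtest_def[abs_def]
  by (rule test_functionI[of _ 1]) (use eta in \<open>auto intro: C_k_mult test_function_C_k vmon_C_k\<close>)

lemma vtest_out: "1 < norm v \<Longrightarrow> vtest l v = 0" by (simp add: vtest_def eta)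

text \<open>The entry with indices l and j of the matrix eta (1, v) (1, v)^T.\<close>

definition vmm :: "'d::finite spacetime \<Rightarrow> 'd spacetime \<Rightarrow> real ^ 'd \<Rightarrow> real" where
  "vmm l j v = vtest l v * vmon j v"

lemma vmm_Cc: "Cc (vmm l j)"
  unfolding vmm_def[abs_def] by (rule Cc_supported_mult(1)[OF test_function_Cc[OF vtest_test] vmon_cont])

lemma vmm_commute: "vmm l j = vmm j l" by (auto simp: vmm_def vtest_def)

lemma vtest_C1: "C1 (vtest l) b" "C1 (dd (vtest l) b) c" "Cc (dd (vtest l) b)" "Cc (dd (dd (vtest l) b) c)" "Cc (vtest l)"
proof -
  show 1: "C1 (vtest l) b" for b by (rule C_1_C1(1)[OF test_function_C_k[OF vtest_test]])
  show c: "Cc (vtest l)" by (rule test_function_Cc[OF vtest_test])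
  have "C_k (Suc 0) (dd (vtest l) b)"
    unfolding C_1_C1(2)[OF test_function_C_k[OF vtest_test]]
    by (rule C_1_differentiable(2)[OF test_function_C_k[OF vtest_test]])
  then have "C_k 1 (dd (vtest l) b)" by simp
  then show 2: "C1 (dd (vtest l) b) c" by (rule C_1_C1(1))
  show 3: "Cc (dd (vtest l) b)" by (rule dder_Cc[OF c C1_dder[OF 1] C1_cont[OF 1]])
  show "Cc (dd (dd (vtest l) b) c)" by (rule dder_Cc[OF 3 C1_dder[OF 2] C1_cont[OF 2]])
qed

lemma dd_vtest_out: "1 < norm v \<Longrightarrow> dd (vtest l) b v = 0" "1 < norm v \<Longrightarrow> dd (dd (vtest l) b) c v = 0"
proof -
  show d: "dd (vtest l) b v = 0" if "1 < norm v" for v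
    by (rule dder_support[OF C1_dder[OF vtest_C1(1)] vtest_out that])
  show "1 < norm v \<Longrightarrow> dd (dd (vtest l) b) c v = 0"
    by (rule dder_support[OF C1_dder[OF vtest_C1(2)] d])
qed

lemma Cc_bounded_ex: "Cc f \<Longrightarrow> \<exists>B. \<forall>z. \<bar>f z\<bar> \<le> B"
  by (erule Cc_bounded) blast

lemma Cc_family_bound:
  fixes f :: "'i \<Rightarrow> 'a::euclidean_space \<Rightarrow> real"
  assumes "finite I" "\<And>i. i \<in> I \<Longrightarrow> Cc (f i)"
  shows "\<exists>B. \<forall>i\<in>I. \<forall>z. \<bar>f i z\<bar> \<le> B"
  using assms
proof (induction I)
  case (insert i I)
  obtain B where B: "\<forall>i\<in>I. \<forall>z. \<bar>f i z\<bar> \<le> B" using insert by auto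
  have "Cc (f i)" by (simp add: insert.prems)
  then obtain B' where "\<forall>z. \<bar>f i z\<bar> \<le> B'" using Cc_bounded_ex by blast
  then have "\<forall>j\<in>insert i I. \<forall>z. \<bar>f j z\<bar> \<le> max B B'" using B by (simp add: le_max_iff_disj)
  then show ?case by blast
qed simp

text \<open>Finitely many compactly supported functions fixed by the dimension are involved, so
  \<open>N\<close> is a number that depends on the dimension alone.\<close>

lemma vtest_bounds:
  "\<exists>N>0. \<forall>l\<in>Basis. \<forall>j\<in>Basis. \<forall>b\<in>Basis. \<forall>v :: real ^ 'd::finite.
    \<bar>vtest l v\<bar> \<le> N \<and> \<bar>vmm l j v\<bar> \<le> N \<and> \<bar>dd (vtest l) b v\<bar> \<le> N \<and> \<bar>dd (dd (vtest l) b) b v\<bar> \<le> N"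
proof -
  let ?I = "(Basis :: 'd spacetime set) \<times> (Basis :: 'd spacetime set) \<times> (Basis :: (real ^ 'd) set)"
  have f: "finite ?I" by (intro finite_cartesian_product) auto
  obtain B1 where B1: "\<forall>i\<in>?I. \<forall>v. \<bar>vtest (fst i) v\<bar> \<le> B1"
    using Cc_family_bound[OF f, of "\<lambda>i. vtest (fst i)"] vtest_C1(5) by blast
  obtain B2 where B2: "\<forall>i\<in>?I. \<forall>v. \<bar>vmm (fst i) (fst (snd i)) v\<bar> \<le> B2"
    using Cc_family_bound[OF f, of "\<lambda>i. vmm (fst i) (fst (snd i))"] vmm_Cc by blast
  obtain B3 where B3: "\<forall>i\<in>?I. \<forall>v. \<bar>dd (vtest (fst i)) (snd (snd i)) v\<bar> \<le> B3"
    using Cc_family_bound[OF f, of "\<lambda>i. dd (vtest (fst i)) (snd (snd i))"] vtest_C1(3) by blast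
  obtain B4 where B4: "\<forall>i\<in>?I. \<forall>v. \<bar>dd (dd (vtest (fst i)) (snd (snd i))) (snd (snd i)) v\<bar> \<le> B4"
    using Cc_family_bound[OF f, of "\<lambda>i. dd (dd (vtest (fst i)) (snd (snd i))) (snd (snd i))"] vtest_C1(4) by blast
  define N where "N = Max {1, B1, B2, B3, B4}"
  have N: "1 \<le> N" "B1 \<le> N" "B2 \<le> N" "B3 \<le> N" "B4 \<le> N" unfolding N_def by auto
  show ?thesis
  proof (rule exI[of _ N], intro conjI ballI allI)
    fix l j :: "'d spacetime" and b v :: "real ^ 'd"
    assume "l \<in> Basis" "j \<in> Basis" "b \<in> Basis"
    then have i: "(l, j, b) \<in> ?I" by simp
    show "\<bar>vtest l v\<bar> \<le> N" using bspec[OF B1 i, THEN spec, of v] N by simp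
    show "\<bar>vmm l j v\<bar> \<le> N" using bspec[OF B2 i, THEN spec, of v] N by simp
    show "\<bar>dd (vtest l) b v\<bar> \<le> N" using bspec[OF B3 i, THEN spec, of v] N by simp
    show "\<bar>dd (dd (vtest l) b) b v\<bar> \<le> N" using bspec[OF B4 i, THEN spec, of v] N by simp
  qed (use N in simp)
qed

text \<open>A nonzero affine function cannot vanish on a whole neighbourhood of 0, where
  \<open>eta\<close> is positive, so the quadratic form is positive on the unit sphere. Compactness
  of the sphere gives a positive minimum, again depending on the dimension alone.\<close>

lemma vtest_coercive:
  "\<exists>k>0. \<forall>y :: 'd::finite spacetime. k * (norm y)\<^sup>2 \<le> (LINT v|lborel. eta v * (vmon y v)\<^sup>2)"
proof -
  let ?q = "\<lambda>y :: 'd spacetime. LINT v|lborel. eta v * (vmon y v)\<^sup>2"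
  have Ce: "Cc (eta :: real ^ 'd \<Rightarrow> real)" by (rule test_function_Cc[OF eta(1)])
  have Cq: "Cc (\<lambda>v. eta v * (vmon y v)\<^sup>2)" for y :: "'d spacetime"
    by (rule Cc_supported_mult(1)[OF Ce]) (intro continuous_intros vmon_cont)
  have cont: "continuous_on UNIV ?q"
  proof -
    have "continuous_on UNIV (\<lambda>y :: 'd spacetime. LINT v|lborel. (\<lambda>z. eta (snd z) * (vmon (fst z) (snd z))\<^sup>2) (y, v))"
      by (rule continuous_param_integral[of _ 1])
        (auto simp: vmon_def eta(4) intro!: continuous_intros continuous_lift Cc_continuous[OF Ce])
    then show ?thesis by simp
  qed
  have pos: "0 < ?q y" if "norm y = 1" for y :: "'d spacetime"
  proof -
    obtain r where r: "0 < r" "\<And>v :: real ^ 'd. norm v < r \<Longrightarrow> 0 < eta v"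
    proof -
      have "open {v :: real ^ 'd. 0 < eta v}"
        using open_Collect_less[OF continuous_on_const Cc_continuous[OF Ce]] by simp
      then obtain r where "0 < r" "ball 0 r \<subseteq> {v :: real ^ 'd. 0 < eta v}"
        using eta(3) open_contains_ball by (metis mem_Collect_eq)
      then show thesis by (intro that[of r]) auto
    qed
    have "\<exists>a. norm a < r \<and> vmon y a \<noteq> 0"
    proof (cases "fst y = 0")
      case False
      then show ?thesis using r(1) by (intro exI[of _ 0]) (simp add: vmon_def inner_prod_def)
    next
      case True
      then have s: "snd y \<noteq> 0" using that by (auto simp: norm_prod_def)
      \<comment> \<open>This point lies in the direction of the linear part, at distance r / 2 from
        the origin.\<close>
      define a where "a = (r / (2 * norm (snd y))) *\<^sub>R snd y"
      have "norm a < r" using r(1) s by (simp add: a_def)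
      moreover have "vmon y a \<noteq> 0" using True s r(1) by (simp add: vmon_def a_def inner_prod_def)
      ultimately show ?thesis by blast
    qed
    then obtain a where "norm a < r" "vmon y a \<noteq> 0" by blast
    then show ?thesis using eta(2) r(2) by (intro Cc_integral_pos[OF Cq, of _ a]) (auto simp: zero_le_mult_iff)
  qed
  have "\<exists>y0\<in>sphere (0 :: 'd spacetime) 1. \<forall>y\<in>sphere 0 1. ?q y0 \<le> ?q y"
    by (rule continuous_attains_inf) (auto intro: continuous_on_subset[OF cont])
  then obtain y0 :: "'d spacetime" where y0: "norm y0 = 1" "\<And>y. norm y = 1 \<Longrightarrow> ?q y0 \<le> ?q y" by auto
  have "?q y0 * (norm y)\<^sup>2 \<le> ?q y" for y :: "'d spacetime"
  proof (cases "y = 0")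
    case False
    have "vmon ((1 / norm y) *\<^sub>R y) v = (1 / norm y) * vmon y v" for v by (simp add: vmon_def)
    then have pt: "eta v * (vmon ((1 / norm y) *\<^sub>R y) v)\<^sup>2 = (1 / (norm y)\<^sup>2) * (eta v * (vmon y v)\<^sup>2)" for v
      by (simp add: power_divide)
    have "?q ((1 / norm y) *\<^sub>R y) = (1 / (norm y)\<^sup>2) * ?q y"
      unfolding pt by (rule integral_mult_right_zero)
    then have "?q y0 \<le> (1 / (norm y)\<^sup>2) * ?q y"
      using y0(2)[of "(1 / norm y) *\<^sub>R y"] False by simp
    then show ?thesis using False by (simp add: le_divide_eq)
  qed (simp add: vmon_def)
  then show ?thesis using pos[OF y0(1)] by (intro exI[of _ "?q y0"]) auto
qed

section \<open>The velocity averaging kernel\<close>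

lemma vmon_expand: "vmon y v = (\<Sum>j\<in>Basis. (y \<bullet> j) * vmon j v)"
  unfolding vmon_def by (subst euclidean_inner) (simp add: mult.commute)

lemma grad_inner:
  assumes "C_k 1 f" "b \<in> Basis" shows "grad f x \<bullet> b = dd f b x"
  using assms(2) C_1_C1(2)[OF assms(1), of b]
  by (simp add: grad_def inner_sum_left inner_Basis if_distrib cong: if_cong)

text \<open>\<open>N\<close> and \<open>kap\<close> are the numbers of \<open>vtest_bounds\<close>
  and \<open>vtest_coercive\<close>. Having them as parameters keeps the dependence on the dimension
  apart from that on the constants of the hypotheses.\<close>

locale moment_data = kinetic_data L G M f_inf
  for L and G :: "'d::finite phase \<Rightarrow> real ^ 'd" and M f_inf +
  fixes c_inf c_coll N kap :: real
  assumes c_inf_pos: "0 < c_inf" and c_inf: "norm v \<le> 1 \<Longrightarrow> c_inf * vavg f_inf x \<le> f_inf (x, v)"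
    and c_coll_nonneg: "0 \<le> c_coll"
    and c_coll: "L = Fokker_Planck \<Longrightarrow> norm v \<le> 1 \<Longrightarrow> b \<in> Basis \<Longrightarrow> \<bar>mlog M b (x, v)\<bar> \<le> c_coll"
    and N_pos: "0 < N" and N: "l \<in> Basis \<Longrightarrow> j \<in> Basis \<Longrightarrow> b \<in> Basis \<Longrightarrow>
      \<bar>vtest l (v :: real ^ 'd)\<bar> \<le> N \<and> \<bar>vmm l j v\<bar> \<le> N \<and> \<bar>dd (vtest l) b v\<bar> \<le> N \<and> \<bar>dd (dd (vtest l) b) b v\<bar> \<le> N"
    and kap_pos: "0 < kap"
    and kap: "kap * (norm (y :: 'd spacetime))\<^sup>2 \<le> (LINT v|lborel. eta v * (vmon y v)\<^sup>2)"
begin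

section \<open>The moment matrix and its inverse\<close>

abbreviation rho :: "real ^ 'd \<Rightarrow> real" where "rho \<equiv> vavg f_inf"

definition mom :: "'d spacetime \<Rightarrow> 'd spacetime \<Rightarrow> real ^ 'd \<Rightarrow> real" where
  "mom l j = v_mom (vmm l j) f_inf"

lemma mom_cont: "continuous_on UNIV (mom l j)"
  unfolding mom_def by (rule v_mom_continuous[OF vmm_Cc f_inf_cont])

lemma mom_C1: "C1 (mom l j) b" "dd (mom l j) b = v_mom (vmm l j) (dd f_inf (b, 0))"
proof -
  have d: "dder (mom l j) b (v_mom (vmm l j) (dd f_inf (b, 0)))"
    unfolding mom_def by (rule v_mom_dder[OF vmm_Cc f_inf_cont admissible_C1[OF f_inf_admissible]])
  then show "dd (mom l j) b = v_mom (vmm l j) (dd f_inf (b, 0))" by (rule dd_eq)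
  show "C1 (mom l j) b"
    by (rule C1I[OF d]) (rule v_mom_continuous[OF vmm_Cc C1_cont[OF admissible_C1[OF f_inf_admissible]]])
qed

lemma mom_commute: "mom l j = mom j l" by (simp add: mom_def vmm_commute)

text \<open>The symmetric matrix of the second moments: the integral of eta (1, v) (1, v)^T against
  f_inf(x, v) dv.\<close>

definition Pm :: "real ^ 'd \<Rightarrow> 'd spacetime \<Rightarrow> 'd spacetime" where
  "Pm x y = (\<Sum>l\<in>Basis. (\<Sum>j\<in>Basis. mom l j x * (y \<bullet> j)) *\<^sub>R l)"

definition dPm :: "real ^ 'd \<Rightarrow> real ^ 'd \<Rightarrow> 'd spacetime \<Rightarrow> 'd spacetime" where
  "dPm b x y = (\<Sum>l\<in>Basis. (\<Sum>j\<in>Basis. dd (mom l j) b x * (y \<bullet> j)) *\<^sub>R l)"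

definition mu :: "real ^ 'd \<Rightarrow> real" where "mu x = c_inf * kap * rho x"

lemma mu_gt_0: "0 < mu x" using c_inf_pos kap_pos rho_pos by (simp add: mu_def)

lemma Pm_inner: "l \<in> Basis \<Longrightarrow> Pm x y \<bullet> l = (\<Sum>j\<in>Basis. mom l j x * (y \<bullet> j))"
  by (simp add: Pm_def inner_sum_left inner_Basis if_distrib cong: if_cong)

sublocale coercive_family Pm mu
proof (rule coercive_family.intro)
  fix x :: "real ^ 'd" and y :: "'d spacetime"
  show "linear (Pm x)"
    by (rule linearI) (simp_all add: Pm_def inner_add_left distrib_left sum.distrib scaleR_add_left
        scaleR_sum_right sum_distrib_left mult.left_commute)
  show "0 < mu x" by (rule mu_gt_0)
  show "continuous_on UNIV mu" unfolding mu_def[abs_def] by (intro continuous_intros rho_cont)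
  show "continuous_on UNIV (\<lambda>x. Pm x y)" unfolding Pm_def by (intro continuous_intros mom_cont)
  have Ce: "Cc (eta :: real ^ 'd \<Rightarrow> real)" by (rule test_function_Cc[OF eta(1)])
  have i: "integrable lborel (\<lambda>v. vmm l j v * f_inf (x, v))" for l j
    by (rule v_mom_integrable[OF vmm_Cc f_inf_cont])
  have "y \<bullet> Pm x y = (\<Sum>l\<in>Basis. (y \<bullet> l) * (\<Sum>j\<in>Basis. mom l j x * (y \<bullet> j)))"
    by (subst euclidean_inner) (simp add: Pm_inner)
  also have "\<dots> = (\<Sum>l\<in>Basis. \<Sum>j\<in>Basis. LINT v|lborel. (y \<bullet> l) * (y \<bullet> j) * (vmm l j v * f_inf (x, v)))"
    by (simp add: mom_def v_mom_def sum_distrib_left mult_ac)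
  also have "\<dots> = (LINT v|lborel. (\<Sum>l\<in>Basis. \<Sum>j\<in>Basis. (y \<bullet> l) * (y \<bullet> j) * (vmm l j v * f_inf (x, v))))"
    using i by (simp add: Bochner_Integration.integral_sum)
  also have "(\<lambda>v. \<Sum>l\<in>Basis. \<Sum>j\<in>Basis. (y \<bullet> l) * (y \<bullet> j) * (vmm l j v * f_inf (x, v))) =
      (\<lambda>v. eta v * (vmon y v)\<^sup>2 * f_inf (x, v))"
    unfolding power2_eq_square vmon_expand[of y]
    by (simp add: vmm_def vtest_def sum_distrib_left sum_distrib_right mult_ac)
  finally have e: "y \<bullet> Pm x y = (LINT v|lborel. eta v * (vmon y v)\<^sup>2 * f_inf (x, v))" .
  have "mu x * (norm y)\<^sup>2 \<le> c_inf * rho x * (LINT v|lborel. eta v * (vmon y v)\<^sup>2)"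
    using mult_left_mono[OF kap[of y], of "c_inf * rho x"] c_inf_pos rho_pos[of x]
    by (simp add: mu_def mult_ac)
  also have "\<dots> = (LINT v|lborel. c_inf * rho x * (eta v * (vmon y v)\<^sup>2))" by (rule integral_mult_right_zero[symmetric])
  also have "\<dots> \<le> (LINT v|lborel. eta v * (vmon y v)\<^sup>2 * f_inf (x, v))"
  proof (rule integral_mono)
    have C: "Cc (\<lambda>v. eta v * (vmon y v)\<^sup>2)"
      by (rule Cc_supported_mult(1)[OF Ce]) (intro continuous_intros vmon_cont)
    show "integrable lborel (\<lambda>v. c_inf * rho x * (eta v * (vmon y v)\<^sup>2))"
      by (intro Cc_integrable Cc_const_mult C)
    show "integrable lborel (\<lambda>v. eta v * (vmon y v)\<^sup>2 * f_inf (x, v))"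
      by (intro Cc_integrable Cc_supported_mult(1)[OF C] continuous_slice f_inf_cont)
    fix v :: "real ^ 'd"
    show "c_inf * rho x * (eta v * (vmon y v)\<^sup>2) \<le> eta v * (vmon y v)\<^sup>2 * f_inf (x, v)"
    proof (cases "norm v \<le> 1")
      case True
      have "0 \<le> eta v * (vmon y v)\<^sup>2" using eta(2)[of v] by simp
      from mult_right_mono[OF c_inf[OF True, of x] this] show ?thesis by (simp add: mult_ac)
    qed (simp add: eta(4))
  qed
  finally show "mu x * (norm y)\<^sup>2 \<le> y \<bullet> Pm x y" unfolding e .
qed

text \<open>The entries of the inverse of the moment matrix.\<close>

definition B :: "'d spacetime \<Rightarrow> 'd spacetime \<Rightarrow> real ^ 'd \<Rightarrow> real" where
  "B e l x = inve x e \<bullet> l"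

lemma B_cont: "continuous_on UNIV (B e l)"
  unfolding B_def[abs_def] by (intro continuous_intros inve_continuous)

lemma dPm_cont: assumes "continuous_on UNIV y" shows "continuous_on UNIV (\<lambda>x. dPm b x (y x))"
  unfolding dPm_def by (intro continuous_intros C1_cont mom_C1 assms)

lemma B_C1: "C1 (B e l) b" "dd (B e l) b x = - (inve x (dPm b x (inve x e)) \<bullet> l)"
proof -
  have P': "((\<lambda>s. Pm (x + s *\<^sub>R b) y) has_vector_derivative dPm b x y) (at 0)" for x y
    unfolding Pm_def dPm_def
  proof (rule has_vector_derivative_sum)
    fix l :: "'d spacetime"
    have "((\<lambda>s. \<Sum>j\<in>Basis. mom l j (x + s *\<^sub>R b) * (y \<bullet> j)) has_real_derivative
        (\<Sum>j\<in>Basis. dd (mom l j) b x * (y \<bullet> j))) (at 0)"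
      by (intro DERIV_sum DERIV_cmult_right dderD C1_dder mom_C1)
    then show "((\<lambda>s. (\<Sum>j\<in>Basis. mom l j (x + s *\<^sub>R b) * (y \<bullet> j)) *\<^sub>R l) has_vector_derivative
        (\<Sum>j\<in>Basis. dd (mom l j) b x * (y \<bullet> j)) *\<^sub>R l) (at 0)"
      unfolding has_real_derivative_iff_has_vector_derivative
      by (rule bounded_linear.has_vector_derivative[OF bounded_linear_scaleR_left])
  qed
  have d: "dder (B e l) b (\<lambda>x. - (inve x (dPm b x (inve x e)) \<bullet> l))"
    unfolding dder_def
  proof
    fix x
    have "((\<lambda>s. inve (x + s *\<^sub>R b) e) has_vector_derivative - inve x (dPm b x (inve x e))) (at 0)"
      by (rule inve_vector_derivative[OF P'])
    from bounded_linear.has_vector_derivative[OF bounded_linear_inner_left this, of l]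
    show "((\<lambda>s. B e l (x + s *\<^sub>R b)) has_real_derivative - (inve x (dPm b x (inve x e)) \<bullet> l)) (at 0)"
      by (simp add: B_def has_real_derivative_iff_has_vector_derivative)
  qed
  then show "dd (B e l) b x = - (inve x (dPm b x (inve x e)) \<bullet> l)" by (simp add: dd_eq)
  show "C1 (B e l) b"
    by (rule C1I[OF d]) (intro continuous_intros inve_continuous dPm_cont)
qed

lemma B_mom: "j \<in> Basis \<Longrightarrow> (\<Sum>l\<in>Basis. B e l x * mom l j x) = e \<bullet> j"
  using Pm_inner[of j x "inve x e"] by (simp add: P_inve B_def mom_commute[of j] mult.commute)

text \<open>The derivative of the identity that says P^(-1) P = 1. It is the cancellation that
  removes the terms with \<open>F\<close> when the kernel is paired with
  \<open>f_inf\<close>.\<close>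

lemma B_mom_dd:
  assumes "j \<in> Basis"
  shows "(\<Sum>l\<in>Basis. dd (B e l) b x * mom l j x + B e l x * dd (mom l j) b x) = 0"
proof -
  have "dder (\<lambda>x. \<Sum>l\<in>Basis. B e l x * mom l j x) b
      (\<lambda>x. \<Sum>l\<in>Basis. dd (B e l) b x * mom l j x + B e l x * dd (mom l j) b x)"
    by (intro dder_sum dder_mult C1_dder B_C1 mom_C1)
  then show ?thesis unfolding B_mom[OF assms] by (rule dder_const_imp_zero)
qed

section \<open>Bounds in terms of the spatial weight\<close>

definition W1 :: "real ^ 'd \<Rightarrow> real" where
  "W1 x = (LINT v:cball 0 1|lborel. norm (grad_x (\<lambda>z. f_inf z / rho (fst z)) (x, v)))"

definition W2 :: "real ^ 'd \<Rightarrow> real" where "W2 x = norm (grad rho x /\<^sub>R rho x)"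

definition WG :: "real ^ 'd \<Rightarrow> real" where
  "WG x = (LINT v:cball 0 1|lborel. f_inf (x, v) * (norm (G (x, v)))\<^sup>2)"

lemma weight_eq: "spatial_weight G f_inf x = 1 + WG x / rho x + (W1 x)\<^sup>2 + (W2 x)\<^sup>2"
  by (simp add: spatial_weight_def WG_def W1_def W2_def)

lemma ball_integrable:
  assumes "continuous_on UNIV (k :: real ^ 'd \<Rightarrow> real)"
  shows "integrable lborel (\<lambda>v. indicator (cball 0 1) v * k v)"
proof -
  have "set_integrable lborel (cball 0 1) k"
    unfolding set_integrable_def
    by (rule borel_integrable_compact) (auto intro: continuous_on_subset[OF assms])
  then show ?thesis by (simp add: set_integrable_def)
qed

text \<open>Writing f_inf = rho g separates the two ways in which \<open>f_inf\<close> varies with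
  x: the gradient of rho is measured by \<open>W2\<close> and that of the profile g by
  \<open>W1\<close>.\<close>

lemma profile:
  defines "g \<equiv> \<lambda>z. f_inf z / rho (fst z)"
  shows "C1 g (b, 0)" "dd f_inf (b, 0) (x, v) = dd rho b x * g (x, v) + rho x * dd g (b, 0) (x, v)"
    "b \<in> Basis \<Longrightarrow> \<bar>dd g (b, 0) z\<bar> \<le> norm (grad_x g z)" "continuous_on UNIV (\<lambda>z. norm (grad_x g z))"
proof -
  have nz: "rho x \<noteq> 0" for x using rho_pos[of x] by simp
  have rc: "continuous_on UNIV (\<lambda>z::'d phase. rho (fst z))"
    by (rule continuous_on_compose2[OF rho_cont]) (auto intro!: continuous_intros)
  have r1d: "dder (\<lambda>z::'d phase. rho (fst z)) (b, 0) (\<lambda>z. dd rho b (fst z))" for b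
    using C1_dder[OF C_1_C1(1)[OF rho_C]] by (auto simp: dder_def)
  have r1: "C1 (\<lambda>z::'d phase. rho (fst z)) (b, 0)" for b
    by (rule C1I[OF r1d])
      (rule continuous_on_compose2[OF C1_cont[OF C_1_C1(1)[OF rho_C]]], auto intro!: continuous_intros)
  show g1: "C1 g (b, 0)" for b unfolding g_def
    by (rule C1_divide(1)[OF admissible_C1[OF f_inf_admissible] r1 f_inf_cont rc nz])
  have "f_inf = (\<lambda>z. rho (fst z) * g z)" using nz by (auto simp: g_def)
  then have "dd f_inf (b, 0) = dd (\<lambda>z. rho (fst z) * g z) (b, 0)" by simp
  also have "\<dots> = (\<lambda>z. dd rho b (fst z) * g z + rho (fst z) * dd g (b, 0) z)"
    by (rule dd_eq[OF dder_mult[OF r1d C1_dder[OF g1]]])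
  finally show "dd f_inf (b, 0) (x, v) = dd rho b x * g (x, v) + rho x * dd g (b, 0) (x, v)" by simp
  have gx: "grad_x g z \<bullet> b = dd g (b, 0) z" if b: "b \<in> Basis" for b z
  proof -
    obtain x v where z: "z = (x, v)" by (cases z)
    have f: "((\<lambda>y. f_inf (y, v)) has_derivative (\<lambda>h. frechet_derivative f_inf (at (y, v)) (h, 0))) (at y)" for y
      by (rule has_derivative_compose[of "\<lambda>y. (y, v)", OF _ C_1_deriv[OF f_inf_C]]) (auto intro!: derivative_eq_intros)
    have "(\<lambda>y. g (y, v)) differentiable (at y)" for y
    proof -
      have "(\<lambda>y. f_inf (y, v)) differentiable (at y)" "rho differentiable (at y)"
        using f[of y] C_1_deriv[OF rho_C, of y] unfolding differentiable_def by blast+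
      then show ?thesis unfolding g_def fst_conv using nz by (rule differentiable_divide)
    qed
    then have "((\<lambda>y. g (y, v)) has_derivative frechet_derivative (\<lambda>y. g (y, v)) (at y)) (at y)" for y
      using frechet_derivative_works by blast
    then have "dder (\<lambda>y. g (y, v)) b (\<lambda>y. frechet_derivative (\<lambda>y. g (y, v)) (at y) b)"
      by (rule has_derivative_dder)
    then have "frechet_derivative (\<lambda>y. g (y, v)) (at x) b = dd g (b, 0) (x, v)"
      using dder_unique[OF _ dd_slice_fst[OF C1_dder[OF g1]]] by metis
    then show ?thesis using b
      by (simp add: z grad_x_def grad_def inner_sum_left inner_Basis if_distrib cong: if_cong)
  qed
  show "b \<in> Basis \<Longrightarrow> \<bar>dd g (b, 0) z\<bar> \<le> norm (grad_x g z)"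
    using Basis_le_norm[of b "grad_x g z"] by (simp add: gx)
  have "grad_x g z = (\<Sum>b\<in>Basis. dd g (b, 0) z *\<^sub>R b)" for z
    by (subst euclidean_representation[symmetric]) (simp add: gx)
  then show "continuous_on UNIV (\<lambda>z. norm (grad_x g z))"
    by (simp only:) (intro continuous_intros C1_cont g1)
qed

lemma W_nonneg: "0 \<le> W1 x" "0 \<le> W2 x" "0 \<le> WG x"
  using f_inf_pos by (auto simp: W1_def W2_def WG_def set_lebesgue_integral_def less_imp_le
      intro!: Bochner_Integration.integral_nonneg)

lemma dd_mom_bound:
  assumes "l \<in> Basis" "j \<in> Basis" "b \<in> Basis"
  shows "\<bar>dd (mom l j) b x\<bar> \<le> N * (rho x * (W1 x + W2 x))"
proof -
  let ?g = "\<lambda>z. f_inf z / rho (fst z)"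
  let ?I = "\<lambda>v :: real ^ 'd. indicator (cball 0 1) v :: real"
  have r: "0 < rho x" by (rule rho_pos)
  have fi: "integrable lborel (\<lambda>v. f_inf (x, v))" by (rule admissible_int[OF f_inf_admissible])
  have gi: "integrable lborel (\<lambda>v. ?I v * norm (grad_x ?g (x, v)))"
    by (rule ball_integrable[OF continuous_slice[OF profile(4)]])
  have W1: "W1 x = (LINT v|lborel. ?I v * norm (grad_x ?g (x, v)))"
    by (simp add: W1_def set_lebesgue_integral_def)
  have dr: "\<bar>dd rho b x\<bar> \<le> rho x * W2 x"
  proof -
    have "\<bar>dd rho b x\<bar> \<le> norm (grad rho x)"
      using Basis_le_norm[OF assms(3), of "grad rho x"] grad_inner[OF rho_C assms(3), of x] by simp
    also have "\<dots> = rho x * W2 x" using r by (simp add: W2_def)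
    finally show ?thesis .
  qed
  have i: "integrable lborel (\<lambda>v. vmm l j v * dd f_inf (b, 0) (x, v))"
    by (rule v_mom_integrable[OF vmm_Cc C1_cont[OF admissible_C1[OF f_inf_admissible]]])
  have pt: "\<bar>vmm l j v * dd f_inf (b, 0) (x, v)\<bar> \<le>
      N * W2 x * f_inf (x, v) + N * rho x * (?I v * norm (grad_x ?g (x, v)))" for v
  proof (cases "norm v \<le> 1")
    case True
    have v: "\<bar>vmm l j v\<bar> \<le> N" using N[OF assms] by blast
    have "\<bar>dd f_inf (b, 0) (x, v)\<bar> \<le> \<bar>dd rho b x\<bar> * ?g (x, v) + rho x * \<bar>dd ?g (b, 0) (x, v)\<bar>"
      unfolding profile(2) using r f_inf_pos[of "(x, v)"]
      by (intro order_trans[OF abs_triangle_ineq]) (simp add: abs_mult less_imp_le)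
    also have "\<dots> \<le> (rho x * W2 x) * ?g (x, v) + rho x * norm (grad_x ?g (x, v))"
      using dr r f_inf_pos[of "(x, v)"] profile(3)[OF assms(3), of "(x, v)"]
      by (intro add_mono mult_right_mono mult_left_mono) (auto simp: less_imp_le)
    also have "\<dots> = W2 x * f_inf (x, v) + rho x * norm (grad_x ?g (x, v))" using r by simp
    finally have "\<bar>vmm l j v\<bar> * \<bar>dd f_inf (b, 0) (x, v)\<bar> \<le> N * (W2 x * f_inf (x, v) + rho x * norm (grad_x ?g (x, v)))"
      using v N_pos by (intro mult_mono) auto
    then show ?thesis using True by (simp add: abs_mult algebra_simps)
  next
    case False
    then show ?thesis using N_pos W_nonneg[of x] f_inf_pos[of "(x, v)"] by (simp add: vmm_def vtest_out)
  qed
  have "\<bar>dd (mom l j) b x\<bar> = \<bar>LINT v|lborel. vmm l j v * dd f_inf (b, 0) (x, v)\<bar>"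
    by (simp add: mom_C1 v_mom_def)
  also have "\<dots> \<le> (LINT v|lborel. N * W2 x * f_inf (x, v) + N * rho x * (?I v * norm (grad_x ?g (x, v))))"
    using i fi gi pt by (intro integral_abs_bound[THEN order_trans] integral_mono) auto
  also have "\<dots> = N * W2 x * rho x + N * rho x * W1 x"
    using fi gi by (simp add: W1 vavg_def)
  finally show ?thesis by (simp add: algebra_simps)
qed

definition nE :: real where "nE = real DIM('d spacetime)"

lemma nE: "1 \<le> nE" "real DIM(real ^ 'd) \<le> nE" by (auto simp: nE_def)

lemma B_bound: "l \<in> Basis \<Longrightarrow> e \<in> Basis \<Longrightarrow> \<bar>B e l x\<bar> \<le> 1 / mu x"
  using Basis_le_norm[of l "inve x e"] norm_inve[of x e] by (simp add: B_def)

lemma dPm_bound: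
  assumes b: "b \<in> Basis" shows "norm (dPm b x y) \<le> nE\<^sup>2 * (N * (rho x * (W1 x + W2 x))) * norm y"
proof -
  let ?m = "N * (rho x * (W1 x + W2 x))"
  have "norm (dPm b x y) \<le> (\<Sum>l\<in>Basis. norm ((\<Sum>j\<in>Basis. dd (mom l j) b x * (y \<bullet> j)) *\<^sub>R (l :: 'd spacetime)))"
    unfolding dPm_def by (rule norm_sum)
  also have "\<dots> \<le> (\<Sum>l\<in>(Basis :: 'd spacetime set). nE * (?m * norm y))"
  proof (rule sum_mono)
    fix l :: "'d spacetime" assume l: "l \<in> Basis"
    have "\<bar>\<Sum>j\<in>Basis. dd (mom l j) b x * (y \<bullet> j)\<bar> \<le> (\<Sum>j\<in>(Basis :: 'd spacetime set). \<bar>dd (mom l j) b x * (y \<bullet> j)\<bar>)"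
      by (rule sum_abs)
    also have "\<dots> \<le> (\<Sum>j\<in>(Basis :: 'd spacetime set). ?m * norm y)"
      unfolding abs_mult by (intro sum_mono mult_mono dd_mom_bound l b Basis_le_norm) (use N_pos rho_pos[of x] W_nonneg[of x] in \<open>auto simp: less_imp_le\<close>)
    finally show "norm ((\<Sum>j\<in>Basis. dd (mom l j) b x * (y \<bullet> j)) *\<^sub>R l) \<le> nE * (?m * norm y)"
      using l by (simp add: nE_def)
  qed
  also have "\<dots> = nE\<^sup>2 * ?m * norm y" by (simp add: nE_def power2_eq_square)
  finally show ?thesis .
qed

text \<open>The derivative of the inverse contains the inverse twice, hence the square of
  \<open>mu\<close>. As \<open>mu\<close> is proportional to rho, the bound is of order 1 / rho
  times \<open>W1 x + W2 x\<close>.\<close>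

lemma dB_bound:
  assumes l: "l \<in> Basis" and e: "e \<in> Basis" and b: "b \<in> Basis"
  shows "\<bar>dd (B e l) b x\<bar> \<le> nE\<^sup>2 * (N * (rho x * (W1 x + W2 x))) / (mu x)\<^sup>2"
proof -
  let ?m = "nE\<^sup>2 * (N * (rho x * (W1 x + W2 x)))"
  have m0: "0 \<le> ?m" using N_pos rho_pos[of x] W_nonneg[of x] by (auto simp: less_imp_le)
  have "\<bar>dd (B e l) b x\<bar> \<le> norm (inve x (dPm b x (inve x e)))"
    using Basis_le_norm[OF l, of "inve x (dPm b x (inve x e))"] by (simp add: B_C1(2))
  also have "\<dots> \<le> norm (dPm b x (inve x e)) / mu x" by (rule norm_inve)
  also have "\<dots> \<le> (?m * norm (inve x e)) / mu x"
    using mu_gt_0[of x] by (intro divide_right_mono dPm_bound b) auto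
  also have "\<dots> \<le> (?m * (1 / mu x)) / mu x"
    using mu_gt_0[of x] norm_inve[of x e] e m0 by (intro divide_right_mono mult_left_mono) auto
  finally show ?thesis by (simp add: power2_eq_square)
qed

text \<open>The second term carries no indicator of the unit ball because for BGK the adjoint
  contains <k M>, which is constant in v.\<close>

lemma kin_adj_bound:
  assumes l: "l \<in> Basis"
  shows "\<bar>kin_adj L G M (vtest l) (x, v)\<bar> \<le>
    nE * N * (indicator (cball 0 1) v * norm (G (x, v))) + 2 * nE * N * (1 + c_coll)"
proof -
  obtain j :: "'d spacetime" where j: "j \<in> Basis" using nonempty_Basis by blast
  obtain b0 :: "real ^ 'd" where b0: "b0 \<in> Basis" using nonempty_Basis by blast
  have dc: "real DIM(real ^ 'd) * y \<le> nE * y" if "0 \<le> y" for y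
    using nE(2) that by (rule mult_right_mono)
  have "\<bar>\<Sum>b\<in>Basis. dd (vtest l) b v * (G (x, v) \<bullet> b)\<bar> \<le> nE * (N * (indicator (cball 0 1) v * norm (G (x, v))))"
  proof -
    have "\<bar>\<Sum>b\<in>Basis. dd (vtest l) b v * (G (x, v) \<bullet> b)\<bar> \<le> (\<Sum>b\<in>Basis. \<bar>dd (vtest l) b v * (G (x, v) \<bullet> b)\<bar>)"
      by (rule sum_abs)
    also have "\<dots> \<le> (\<Sum>b\<in>(Basis :: (real ^ 'd) set). N * (indicator (cball 0 1) v * norm (G (x, v))))"
    proof (rule sum_mono)
      fix b :: "real ^ 'd" assume b: "b \<in> Basis"
      show "\<bar>dd (vtest l) b v * (G (x, v) \<bullet> b)\<bar> \<le> N * (indicator (cball 0 1) v * norm (G (x, v)))"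
      proof (cases "norm v \<le> 1")
        case True
        then show ?thesis using N[OF l j b, of v] Basis_le_norm[OF b, of "G (x, v)"] N_pos
          by (auto simp: abs_mult intro!: mult_mono)
      next
        case False
        then show ?thesis by (simp add: dd_vtest_out)
      qed
    qed
    also have "\<dots> \<le> nE * (N * (indicator (cball 0 1) v * norm (G (x, v))))"
      using dc[of "N * (indicator (cball 0 1) v * norm (G (x, v)))"] N_pos by simp
    finally show ?thesis .
  qed
  moreover have "\<bar>coll_adj L M (vtest l) (x, v)\<bar> \<le> 2 * nE * N * (1 + c_coll)"
  proof (cases L)
    case Fokker_Planck
    have "\<bar>coll_adj L M (vtest l) (x, v)\<bar> \<le>
        (\<Sum>b\<in>Basis. \<bar>dd (dd (vtest l) b) b v + dd (vtest l) b v * mlog M b (x, v)\<bar>)"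
      by (simp add: Fokker_Planck sum_abs)
    also have "\<dots> \<le> (\<Sum>b\<in>(Basis :: (real ^ 'd) set). N * (1 + c_coll))"
    proof (rule sum_mono)
      fix b :: "real ^ 'd" assume b: "b \<in> Basis"
      show "\<bar>dd (dd (vtest l) b) b v + dd (vtest l) b v * mlog M b (x, v)\<bar> \<le> N * (1 + c_coll)"
      proof (cases "norm v \<le> 1")
        case True
        have "\<bar>dd (vtest l) b v * mlog M b (x, v)\<bar> \<le> N * c_coll"
          unfolding abs_mult using N[OF l j b, of v] c_coll[OF Fokker_Planck True b] N_pos by (intro mult_mono) auto
        then show ?thesis using N[OF l j b, of v]
            abs_triangle_ineq[of "dd (dd (vtest l) b) b v" "dd (vtest l) b v * mlog M b (x, v)"] by (simp add: algebra_simps)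
      next
        case False
        then show ?thesis using N_pos c_coll_nonneg by (simp add: dd_vtest_out)
      qed
    qed
    also have "\<dots> \<le> nE * (N * (1 + c_coll))" using dc[of "N * (1 + c_coll)"] N_pos c_coll_nonneg by simp
    also have "\<dots> \<le> 2 * nE * N * (1 + c_coll)"
    proof -
      have "0 \<le> nE * (N * (1 + c_coll))" using nE N_pos c_coll_nonneg by simp
      moreover have "2 * nE * N * (1 + c_coll) = 2 * (nE * (N * (1 + c_coll)))" by (simp only: mult.assoc)
      ultimately show ?thesis by linarith
    qed
    finally show ?thesis .
  next
    case BGK
    have vb: "\<bar>vtest l u\<bar> \<le> N" for u using N[OF l j b0] by blast
    have i: "integrable lborel (\<lambda>u. vtest l u * M (x, u))" by (rule v_mom_integrable[OF vtest_C1(5) M_cont])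
    have "\<bar>v_mom (vtest l) M x\<bar> \<le> (LINT u|lborel. \<bar>vtest l u * M (x, u)\<bar>)"
      unfolding v_mom_def by (rule integral_abs_bound)
    also have "\<dots> \<le> (LINT u|lborel. N * M (x, u))"
    proof (rule integral_mono)
      show "\<bar>vtest l u * M (x, u)\<bar> \<le> N * M (x, u)" for u
        unfolding abs_mult using vb[of u] M_slice(3)[of "(x, u)"] by (simp add: mult_right_mono)
    qed (use i M_slice(1)[of x] in simp_all)
    finally have "\<bar>v_mom (vtest l) M x\<bar> \<le> (LINT u|lborel. N * M (x, u))" .
    then have "\<bar>v_mom (vtest l) M x\<bar> \<le> N" using M_slice(2)[of x] by simp
    then have "\<bar>coll_adj L M (vtest l) (x, v)\<bar> \<le> 2 * N" using vb[of v] by (simp add: BGK)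
    also have "\<dots> \<le> 2 * nE * N * (1 + c_coll)"
    proof -
      have "1 * 1 \<le> nE * (1 + c_coll)" using nE(1) c_coll_nonneg by (intro mult_mono) auto
      from mult_left_mono[OF this, of "2 * N"] show ?thesis using N_pos by (simp add: mult_ac)
    qed
    finally show ?thesis .
  qed
  ultimately show ?thesis unfolding kin_adj_def by (simp add: algebra_simps)
qed

text \<open>The kernel of the functional that the space-time field \<open>F\<close> with gradient \<open>D\<close> induces on
  distributions in \<open>v\<close>, and the one acting on the residual of the equation.\<close>

definition Kf :: "'d spacetime \<Rightarrow> ('d spacetime \<Rightarrow> 'd spacetime) \<Rightarrow> real ^ 'd \<Rightarrow> real ^ 'd \<Rightarrow> real" where
  "Kf F D x v = (\<Sum>e\<in>Basis. \<Sum>l\<in>Basis.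
    (F \<bullet> e) * ((\<Sum>b\<in>Basis. dd (B e l) b x * vmm l (0, b) v) + B e l x * kin_adj L G M (vtest l) (x, v))
    + (\<Sum>j\<in>Basis. (D j \<bullet> e) * (B e l x * vmm l j v)))"

definition Kr :: "'d spacetime \<Rightarrow> real ^ 'd \<Rightarrow> real ^ 'd \<Rightarrow> real" where
  "Kr F x v = (\<Sum>e\<in>Basis. \<Sum>l\<in>Basis. (F \<bullet> e) * (B e l x * vtest l v))"

text \<open>The fifth power of the dimension counts sums over basis vectors: two for the indices e
  and l, two in \<open>dPm\<close> and one in the divergence of \<open>B\<close>. The last factor
  holds the constants of the hypotheses; all the others depend on the dimension only.\<close>

definition qK :: real where
  "qK = 2 * nE ^ 5 * (1 + N)\<^sup>2 * (1 + 1 / kap)\<^sup>2 * ((1 + 1 / c_inf)\<^sup>2 * (1 + c_coll))"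

lemma mu_inv: "1 / mu x \<le> (1 + 1 / c_inf) * (1 + 1 / kap) / rho x" "0 \<le> 1 / mu x"
proof -
  have "1 / mu x = (1 / c_inf) * (1 / kap) / rho x" by (simp add: mu_def)
  also have "\<dots> \<le> (1 + 1 / c_inf) * (1 + 1 / kap) / rho x"
    using c_inf_pos kap_pos rho_pos[of x] by (intro divide_right_mono mult_mono) auto
  finally show "1 / mu x \<le> (1 + 1 / c_inf) * (1 + 1 / kap) / rho x" .
  show "0 \<le> 1 / mu x" using mu_gt_0[of x] by simp
qed

text \<open>Every factor of \<open>qK\<close> is at least 1, so the coefficients that occur in the
  bounds of the kernels can all be enlarged to the same product.\<close>

lemma qK_coeffs:
  shows "nE ^ 5 * N\<^sup>2 * rho x / (mu x)\<^sup>2 \<le> qK / rho x"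
    and "2 * nE ^ 3 * N * (1 + c_coll) / mu x \<le> qK / rho x"
    and "nE ^ 3 * N / mu x \<le> qK / rho x" and "nE\<^sup>2 * N / mu x \<le> qK / rho x" and "0 < qK"
proof -
  define ci where "ci = 1 + 1 / c_inf"
  define ki where "ki = 1 + 1 / kap"
  define cc where "cc = 1 + c_coll"
  define n1 where "n1 = 1 + N"
  have ge: "1 \<le> ci" "1 \<le> ki" "1 \<le> cc" "1 \<le> n1" "N \<le> n1" "0 < N" "1 \<le> nE"
    using c_inf_pos kap_pos c_coll_nonneg N_pos nE by (auto simp: ci_def ki_def cc_def n1_def)
  have q: "qK = 2 * nE ^ 5 * n1\<^sup>2 * ki\<^sup>2 * (ci\<^sup>2 * cc)" by (simp add: qK_def ci_def ki_def cc_def n1_def)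
  show q0: "0 < qK" unfolding q using ge by (intro mult_pos_pos zero_less_power) auto
  have r: "0 < rho x" by (rule rho_pos)
  have m: "1 / mu x \<le> ci * ki / rho x" "0 \<le> 1 / mu x" using mu_inv[of x] by (simp_all add: ci_def ki_def)
  have pw: "1 \<le> a ^ k" if "1 \<le> a" for a :: real and k using that by (rule one_le_power)
  have sq: "a \<le> a\<^sup>2" if "1 \<le> a" for a :: real using that by (simp add: power2_eq_square)
  have np: "nE ^ i \<le> nE ^ 5" if "i \<le> 5" for i using that ge by (intro power_increasing) auto
  have main: "2 * nE ^ i * N * cc / mu x \<le> qK / rho x" if i: "i \<le> 5" for i
  proof -
    have "2 * nE ^ i * N * cc / mu x = (2 * nE ^ i * N * cc) * (1 / mu x)" by simp
    also have "\<dots> \<le> (2 * nE ^ 5 * n1\<^sup>2 * cc) * (ci\<^sup>2 * ki\<^sup>2 / rho x)"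
    proof (intro mult_mono order_trans[OF m(1)] divide_right_mono np i)
      show "N \<le> n1\<^sup>2" using sq[of n1] ge by linarith
      show "ci \<le> ci\<^sup>2" "ki \<le> ki\<^sup>2" using sq ge by auto
    qed (use ge m r in auto)
    finally show ?thesis by (simp add: q mult_ac)
  qed
  have cc0: "a / mu x \<le> a * cc / mu x" if "0 \<le> a" for a
  proof -
    have "a * 1 \<le> a * cc" using that ge by (intro mult_left_mono) auto
    from mult_right_mono[OF this m(2)] show ?thesis by simp
  qed
  show "2 * nE ^ 3 * N * (1 + c_coll) / mu x \<le> qK / rho x" using main[of 3] by (simp add: cc_def)
  have half: "nE ^ i * N / mu x \<le> qK / rho x" if i: "i \<le> 5" for i
  proof -
    have n0: "0 \<le> nE ^ i * N" using ge by simp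
    have "nE ^ i * N / mu x \<le> 2 * (nE ^ i * N / mu x)"
    proof -
      have "0 \<le> nE ^ i * N / mu x" using n0 mu_gt_0[of x] by simp
      moreover have "a \<le> 2 * a" if "0 \<le> a" for a :: real using that by simp
      ultimately show ?thesis by blast
    qed
    also have "\<dots> \<le> 2 * (nE ^ i * N * cc / mu x)" using cc0[OF n0] by simp
    also have "\<dots> \<le> qK / rho x" using main[OF i] by (simp add: mult_ac)
    finally show ?thesis .
  qed
  show "nE ^ 3 * N / mu x \<le> qK / rho x" using half[of 3] by simp
  show "nE\<^sup>2 * N / mu x \<le> qK / rho x" using half[of 2] by simp
  have "nE ^ 5 * N\<^sup>2 * rho x / (mu x)\<^sup>2 = nE ^ 5 * N\<^sup>2 * rho x * (1 / mu x)\<^sup>2" by (simp add: power_one_over)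
  also have "\<dots> \<le> nE ^ 5 * n1\<^sup>2 * rho x * (ci * ki / rho x)\<^sup>2"
    using ge m r by (intro mult_mono power_mono) auto
  also have "\<dots> = (nE ^ 5 * n1\<^sup>2 * ki\<^sup>2 * ci\<^sup>2) * 1 * 1 / rho x" using r by (simp add: power2_eq_square field_simps)
  also have "\<dots> \<le> (nE ^ 5 * n1\<^sup>2 * ki\<^sup>2 * ci\<^sup>2) * 2 * cc / rho x"
    using ge r by (intro divide_right_mono mult_mono) auto
  also have "\<dots> = qK / rho x" by (simp add: q mult_ac)
  finally show "nE ^ 5 * N\<^sup>2 * rho x / (mu x)\<^sup>2 \<le> qK / rho x" .
qed

section \<open>Pointwise bounds of the kernels\<close>

lemma Kf_bound:
  "\<bar>Kf F D x v\<bar> \<le> qK / rho x * (norm F * (1 + W1 x + W2 x + indicator (cball 0 1) v * norm (G (x, v)))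
    + (\<Sum>j\<in>Basis. norm (D j)))"
proof -
  let ?g = "indicator (cball 0 1) v * norm (G (x, v))" and ?W = "W1 x + W2 x" and ?nD = "\<Sum>j\<in>(Basis :: 'd spacetime set). norm (D j)"
  let ?dB = "nE\<^sup>2 * (N * (rho x * ?W)) / (mu x)\<^sup>2"
  let ?ka = "nE * N * ?g + 2 * nE * N * (1 + c_coll)"
  obtain b0 :: "real ^ 'd" where b0: "b0 \<in> Basis" using nonempty_Basis by blast
  have m: "0 \<le> 1 / mu x" "0 < mu x" using mu_gt_0[of x] by simp_all
  have r: "0 < rho x" by (rule rho_pos)
  have g0: "0 \<le> ?g" "0 \<le> ?W" "0 \<le> ?nD" using W_nonneg[of x] by (auto intro: sum_nonneg)
  have dB0: "0 \<le> ?dB" using N_pos r g0(2) by (auto simp: less_imp_le)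
  have ka0: "0 \<le> ?ka" using N_pos g0(1) nE(1) c_coll_nonneg by (intro add_nonneg_nonneg mult_nonneg_nonneg) auto
  have tm: "\<bar>(F \<bullet> e) * ((\<Sum>b\<in>Basis. dd (B e l) b x * vmm l (0, b) v) + B e l x * kin_adj L G M (vtest l) (x, v))
      + (\<Sum>j\<in>Basis. (D j \<bullet> e) * (B e l x * vmm l j v))\<bar> \<le> norm F * (nE * (?dB * N) + 1 / mu x * ?ka) + ?nD * (1 / mu x * N)"
    if e: "e \<in> Basis" and l: "l \<in> Basis" for e l
  proof -
    have "\<bar>\<Sum>b\<in>Basis. dd (B e l) b x * vmm l (0, b) v\<bar> \<le> (\<Sum>b\<in>(Basis :: (real ^ 'd) set). ?dB * N)"
    proof (rule order_trans[OF sum_abs sum_mono])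
      fix b :: "real ^ 'd" assume b: "b \<in> Basis"
      then have jb: "(0, b) \<in> (Basis :: 'd spacetime set)" by (simp add: Basis_prod_def)
      show "\<bar>dd (B e l) b x * vmm l (0, b) v\<bar> \<le> ?dB * N"
        unfolding abs_mult using dB_bound[OF l e b, of x] N[OF l jb b, of v] dB0 by (intro mult_mono) auto
    qed
    also have "\<dots> = real DIM(real ^ 'd) * (?dB * N)" by (rule sum_constant)
    also have "\<dots> \<le> nE * (?dB * N)"
      by (rule mult_right_mono[OF nE(2)]) (rule mult_nonneg_nonneg[OF dB0 less_imp_le[OF N_pos]])
    finally have s1: "\<bar>\<Sum>b\<in>Basis. dd (B e l) b x * vmm l (0, b) v\<bar> \<le> nE * (?dB * N)" .
    have s2: "\<bar>B e l x * kin_adj L G M (vtest l) (x, v)\<bar> \<le> 1 / mu x * ?ka"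
      unfolding abs_mult using B_bound[OF l e, of x] kin_adj_bound[OF l, of x v] m by (intro mult_mono) auto
    have s3: "\<bar>(F \<bullet> e) * ((\<Sum>b\<in>Basis. dd (B e l) b x * vmm l (0, b) v) + B e l x * kin_adj L G M (vtest l) (x, v))\<bar>
        \<le> norm F * (nE * (?dB * N) + 1 / mu x * ?ka)"
      unfolding abs_mult[of "F \<bullet> e"]
      by (intro mult_mono Basis_le_norm e order_trans[OF abs_triangle_ineq] add_mono s1 s2) auto
    have "\<bar>\<Sum>j\<in>Basis. (D j \<bullet> e) * (B e l x * vmm l j v)\<bar> \<le> (\<Sum>j\<in>(Basis :: 'd spacetime set). norm (D j) * (1 / mu x * N))"
    proof (rule order_trans[OF sum_abs sum_mono])
      fix j :: "'d spacetime" assume j: "j \<in> Basis"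
      show "\<bar>(D j \<bullet> e) * (B e l x * vmm l j v)\<bar> \<le> norm (D j) * (1 / mu x * N)"
        unfolding abs_mult using B_bound[OF l e, of x] N[OF l j b0, of v] m
        by (intro mult_mono Basis_le_norm e) auto
    qed
    also have "\<dots> = ?nD * (1 / mu x * N)" by (rule sum_distrib_right[symmetric])
    finally have s4: "\<bar>\<Sum>j\<in>Basis. (D j \<bullet> e) * (B e l x * vmm l j v)\<bar> \<le> ?nD * (1 / mu x * N)" .
    show ?thesis by (rule order_trans[OF abs_triangle_ineq add_mono[OF s3 s4]])
  qed
  have "\<bar>Kf F D x v\<bar> \<le> (\<Sum>e\<in>(Basis :: 'd spacetime set). \<Sum>l\<in>(Basis :: 'd spacetime set).
      norm F * (nE * (?dB * N) + 1 / mu x * ?ka) + ?nD * (1 / mu x * N))"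
    unfolding Kf_def by (intro order_trans[OF sum_abs] sum_mono tm)
  also have "\<dots> = nE * (nE * (norm F * (nE * (?dB * N) + 1 / mu x * ?ka) + ?nD * (1 / mu x * N)))"
    by (simp add: nE_def)
  also have "\<dots> = norm F * (?W * (nE ^ 5 * N\<^sup>2 * rho x / (mu x)\<^sup>2) + ?g * (nE ^ 3 * N / mu x)
      + 2 * nE ^ 3 * N * (1 + c_coll) / mu x) + ?nD * (nE\<^sup>2 * N / mu x)"
    using m(2) by (simp add: field_simps power2_eq_square power3_eq_cube eval_nat_numeral)
  also have "\<dots> \<le> norm F * (?W * (qK / rho x) + ?g * (qK / rho x) + qK / rho x) + ?nD * (qK / rho x)"
    by (intro add_mono mult_left_mono qK_coeffs g0 norm_ge_zero)
  also have "\<dots> = qK / rho x * (norm F * (1 + W1 x + W2 x + ?g) + ?nD)"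
  proof -
    have "a * (b * c + g * c + c) + d * c = c * (a * (1 + b + g) + d)" for a b c d g :: real
      by (simp add: algebra_simps)
    from this[of "norm F" ?W "qK / rho x" ?g ?nD] show ?thesis by (simp only: add.assoc[symmetric])
  qed
  finally show ?thesis .
qed

lemma Kr_bound: "\<bar>Kr F x v\<bar> \<le> qK / rho x * norm F"
proof -
  obtain b0 :: "real ^ 'd" where b0: "b0 \<in> Basis" using nonempty_Basis by blast
  have "\<bar>Kr F x v\<bar> \<le> (\<Sum>e\<in>(Basis :: 'd spacetime set). \<Sum>l\<in>(Basis :: 'd spacetime set). norm F * (1 / mu x * N))"
    unfolding Kr_def
  proof (intro order_trans[OF sum_abs] sum_mono)
    fix e l :: "'d spacetime" assume e: "e \<in> Basis" and l: "l \<in> Basis"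
    show "\<bar>(F \<bullet> e) * (B e l x * vtest l v)\<bar> \<le> norm F * (1 / mu x * N)"
      unfolding abs_mult using B_bound[OF l e, of x] N[OF l l b0, of v] mu_gt_0[of x]
      by (intro mult_mono Basis_le_norm e) auto
  qed
  also have "\<dots> = nE\<^sup>2 * N / mu x * norm F" by (simp add: nE_def power2_eq_square)
  also have "\<dots> \<le> qK / rho x * norm F" by (intro mult_right_mono qK_coeffs) auto
  finally show ?thesis .
qed

end

text \<open>Young's inequality with the factors k sqrt f and g / sqrt f. The right-hand side is an
  extended real, since the weighted square integral of \<open>g\<close> may be infinite.\<close>

lemma Young_integral:
  fixes k g f :: "'a::euclidean_space \<Rightarrow> real"
  assumes [measurable]: "k \<in> borel_measurable borel" "g \<in> borel_measurable borel" "f \<in> borel_measurable borel"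
    and f: "\<And>v. 0 < f v" and i: "integrable lborel (\<lambda>v. (k v)\<^sup>2 * f v)" and th: "0 < th"
  shows "ennreal \<bar>LINT v|lborel. k v * g v\<bar> \<le>
    ennreal (th * (LINT v|lborel. (k v)\<^sup>2 * f v)) + ennreal (1 / (4 * th)) * (\<integral>\<^sup>+v. ennreal ((g v)\<^sup>2 / f v) \<partial>lborel)"
\<comment> \<open>If the product is not integrable, its integral is 0 by convention.\<close>
proof (cases "integrable lborel (\<lambda>v. k v * g v)")
  case True
  have pt: "\<bar>k v * g v\<bar> \<le> th * ((k v)\<^sup>2 * f v) + 1 / (4 * th) * ((g v)\<^sup>2 / f v)" for v
  proof -
    define a where "a = sqrt (th * f v) * \<bar>k v\<bar>"
    define b where "b = \<bar>g v\<bar> / (2 * sqrt (th * f v))"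
    have p: "0 < th * f v" using th f[of v] by simp
    have "th \<noteq> 0" "f v \<noteq> 0" using th f[of v] by auto
    then have "\<bar>k v * g v\<bar> = 2 * a * b" using p by (simp add: a_def b_def abs_mult)
    also have "\<dots> \<le> a\<^sup>2 + b\<^sup>2" by (rule sum_squares_bound)
    also have "a\<^sup>2 = th * ((k v)\<^sup>2 * f v)" using p by (simp add: a_def power_mult_distrib)
    also have "b\<^sup>2 = 1 / (4 * th) * ((g v)\<^sup>2 / f v)" using p by (simp add: b_def power_mult_distrib power_divide)
    finally show ?thesis .
  qed
  have "ennreal \<bar>LINT v|lborel. k v * g v\<bar> \<le> (\<integral>\<^sup>+v. ennreal \<bar>k v * g v\<bar> \<partial>lborel)"
    using integral_norm_bound_ennreal[OF True] by simp
  also have "\<dots> \<le> (\<integral>\<^sup>+v. ennreal (th * ((k v)\<^sup>2 * f v)) + ennreal (1 / (4 * th)) * ennreal ((g v)\<^sup>2 / f v) \<partial>lborel)"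
  proof (rule nn_integral_mono)
    fix v
    have "ennreal \<bar>k v * g v\<bar> \<le> ennreal (th * ((k v)\<^sup>2 * f v) + 1 / (4 * th) * ((g v)\<^sup>2 / f v))"
      by (rule ennreal_leI[OF pt])
    also have "\<dots> = ennreal (th * ((k v)\<^sup>2 * f v)) + ennreal (1 / (4 * th) * ((g v)\<^sup>2 / f v))"
      using th f[of v] by (intro ennreal_plus) auto
    also have "ennreal (1 / (4 * th) * ((g v)\<^sup>2 / f v)) = ennreal (1 / (4 * th)) * ennreal ((g v)\<^sup>2 / f v)"
      using th f[of v] by (intro ennreal_mult) auto
    finally show "ennreal \<bar>k v * g v\<bar> \<le> ennreal (th * ((k v)\<^sup>2 * f v)) + ennreal (1 / (4 * th)) * ennreal ((g v)\<^sup>2 / f v)" .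
  qed
  also have "\<dots> = (\<integral>\<^sup>+v. ennreal (th * ((k v)\<^sup>2 * f v)) \<partial>lborel) + ennreal (1 / (4 * th)) * (\<integral>\<^sup>+v. ennreal ((g v)\<^sup>2 / f v) \<partial>lborel)"
    by (subst nn_integral_add) (auto simp: nn_integral_cmult)
  also have "(\<integral>\<^sup>+v. ennreal (th * ((k v)\<^sup>2 * f v)) \<partial>lborel) = ennreal (th * (LINT v|lborel. (k v)\<^sup>2 * f v))"
    using i th f by (subst nn_integral_eq_integral) (auto simp: less_imp_le)
  finally show ?thesis .
qed (simp add: not_integrable_integral_eq)

lemma sum_regroup:
  fixes c :: real
  shows "(\<Sum>l\<in>A. c * a l + (\<Sum>j\<in>B. d j * m l j)) = c * (\<Sum>l\<in>A. a l) + (\<Sum>j\<in>B. d j * (\<Sum>l\<in>A. m l j))"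
proof -
  have "(\<Sum>l\<in>A. \<Sum>j\<in>B. d j * m l j) = (\<Sum>j\<in>B. \<Sum>l\<in>A. d j * m l j)" by (rule sum.swap)
  then show ?thesis by (simp add: sum.distrib sum_distrib_left)
qed

context moment_data
begin

section \<open>Pairing of the kernels with functions of v\<close>

lemma kin_adj_integrable:
  assumes f: "admissible f" shows "integrable lborel (\<lambda>v. kin_adj L G M (vtest l) (x, v) * f (x, v))"
    and "continuous_on UNIV (\<lambda>v. kin_adj L G M (vtest l) (x, v))"
    and "(LINT v|lborel. kin_adj L G M (vtest l) (x, v) * f (x, v)) =
      (\<Sum>b\<in>Basis. dd (v_mom (vmm l (0, b)) f) b x) + (LINT v|lborel. vtest l v * (collision_op L M f (x, v) - transport_op G f (x, v)))"
proof -
  note fc = admissible_cont[OF f] and vt = vtest_C1[of l]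
  have Gc: "continuous_on UNIV (\<lambda>v. G (x, v) \<bullet> b)" for b by (rule continuous_slice[OF smooth_inner(3)[OF G]])
  have C1: "Cc (\<lambda>v. \<Sum>b\<in>Basis. dd (vtest l) b v * (G (x, v) \<bullet> b))"
    by (intro Cc_sum Cc_supported_mult(1) vt Gc)
  have i1: "integrable lborel (\<lambda>v. (\<Sum>b\<in>Basis. dd (vtest l) b v * (G (x, v) \<bullet> b)) * f (x, v))"
    by (intro Cc_integrable Cc_supported_mult(1)[OF C1] continuous_slice[OF fc])
  have i2c: "integrable lborel (\<lambda>v. coll_adj L M (vtest l) (x, v) * f (x, v)) \<and> continuous_on UNIV (\<lambda>v. coll_adj L M (vtest l) (x, v))"
  proof (cases L)
    case Fokker_Planck
    have "Cc (\<lambda>v. coll_adj L M (vtest l) (x, v))"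
      unfolding Fokker_Planck coll_adj.simps snd_conv
      by (intro Cc_sum Cc_add Cc_supported_mult(1) vt continuous_slice mlog_props(2)[OF M_FP[OF Fokker_Planck]])
    then show ?thesis using Cc_integrable[OF Cc_supported_mult(1)[OF _ continuous_slice[OF fc]]] Cc_continuous by blast
  next
    case BGK
    have "integrable lborel (\<lambda>v. v_mom (vtest l) M x * f (x, v) - vtest l v * f (x, v))"
      using admissible_int[OF f, of x] v_mom_integrable[OF vt(5) fc] by simp
    moreover have "continuous_on UNIV (\<lambda>v. v_mom (vtest l) M x - vtest l v)"
      by (intro continuous_intros Cc_continuous vt)
    ultimately show ?thesis by (simp add: BGK left_diff_distrib)
  qed
  then have i2: "integrable lborel (\<lambda>v. coll_adj L M (vtest l) (x, v) * f (x, v))" by blast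
  show "integrable lborel (\<lambda>v. kin_adj L G M (vtest l) (x, v) * f (x, v))"
    unfolding kin_adj_def using i1 i2 by (simp add: distrib_right)
  show "continuous_on UNIV (\<lambda>v. kin_adj L G M (vtest l) (x, v))"
    unfolding kin_adj_def snd_conv by (intro continuous_on_add Cc_continuous[OF C1] i2c[THEN conjunct2])
  have s: "(LINT v|lborel. kin_adj L G M (vtest l) (x, v) * f (x, v)) =
      (LINT v|lborel. (\<Sum>b\<in>Basis. dd (vtest l) b v * (G (x, v) \<bullet> b)) * f (x, v)) +
      (LINT v|lborel. coll_adj L M (vtest l) (x, v) * f (x, v))"
    unfolding kin_adj_def using i1 i2 by (simp add: distrib_right)
  have vk: "(\<lambda>v. vtest l v * (v \<bullet> b)) = vmm l (0, b)" for b by (auto simp: vmm_def vmon_def)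
  have iT: "integrable lborel (\<lambda>v. vtest l v * transport_op G f (x, v))"
    by (rule v_mom_integrable[OF vt(5) transport_cont[OF f]])
  have iC: "integrable lborel (\<lambda>v. vtest l v * collision_op L M f (x, v))"
  proof (cases L)
    case Fokker_Planck
    have "(\<lambda>v. vtest l v * collision_op L M f (x, v)) = (\<lambda>v. \<Sum>b\<in>Basis. vtest l v * dd (flux M f b) (0, b) (x, v))"
      unfolding Fokker_Planck Fokker_Planck_eq[OF M_FP[OF Fokker_Planck] admissible_C2[OF f Fokker_Planck]] by (simp add: sum_distrib_left)
    then show ?thesis
      using v_mom_integrable[OF vt(5) C1_cont[OF flux_props(1)[OF M_FP[OF Fokker_Planck] admissible_C2[OF f Fokker_Planck]]]] by simp
  next
    case BGK
    have "(\<lambda>v. vtest l v * collision_op L M f (x, v)) = (\<lambda>v. vavg f x * (vtest l v * M (x, v)) - vtest l v * f (x, v))"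
      unfolding BGK by (simp add: right_diff_distrib mult_ac)
    then show ?thesis using v_mom_integrable[OF vt(5) M_cont] v_mom_integrable[OF vt(5) fc] by simp
  qed
  have "(LINT v|lborel. vtest l v * (collision_op L M f (x, v) - transport_op G f (x, v))) =
      (LINT v|lborel. vtest l v * collision_op L M f (x, v)) - (LINT v|lborel. vtest l v * transport_op G f (x, v))"
    using iT iC by (simp add: right_diff_distrib)
  then show "(LINT v|lborel. kin_adj L G M (vtest l) (x, v) * f (x, v)) =
      (\<Sum>b\<in>Basis. dd (v_mom (vmm l (0, b)) f) b x) + (LINT v|lborel. vtest l v * (collision_op L M f (x, v) - transport_op G f (x, v)))"
    unfolding s moment_transport[OF f vtest_test] moment_collision[OF f vtest_test] vk by simp
qed

lemma Kf_cont: "continuous_on UNIV (Kf F D x)"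
  unfolding Kf_def[abs_def]
  by (intro continuous_intros kin_adj_integrable(2)[OF f_inf_admissible] Cc_continuous[OF vmm_Cc])

lemma Kr_cont: "continuous_on UNIV (Kr F x)"
  unfolding Kr_def[abs_def] by (intro continuous_intros Cc_continuous[OF vtest_C1(5)])

lemma Kf_pair:
  assumes f: "admissible f"
  shows "integrable lborel (\<lambda>v. Kf F D x v * f (x, v))"
    and "(LINT v|lborel. Kf F D x v * f (x, v)) = (\<Sum>e\<in>Basis. \<Sum>l\<in>Basis.
      (F \<bullet> e) * ((\<Sum>b\<in>Basis. dd (B e l) b x * v_mom (vmm l (0, b)) f x) + B e l x * (LINT v|lborel. kin_adj L G M (vtest l) (x, v) * f (x, v)))
      + (\<Sum>j\<in>Basis. (D j \<bullet> e) * (B e l x * v_mom (vmm l j) f x)))"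
proof -
  note i1 = v_mom_integrable[OF vmm_Cc admissible_cont[OF f]] and i2 = kin_adj_integrable(1)[OF f]
  have eq: "Kf F D x v * f (x, v) = (\<Sum>e\<in>Basis. \<Sum>l\<in>Basis.
      (F \<bullet> e) * ((\<Sum>b\<in>Basis. dd (B e l) b x * (vmm l (0, b) v * f (x, v))) + B e l x * (kin_adj L G M (vtest l) (x, v) * f (x, v)))
      + (\<Sum>j\<in>Basis. (D j \<bullet> e) * (B e l x * (vmm l j v * f (x, v)))))" for v
    unfolding Kf_def sum_distrib_right
    by (intro sum.cong refl) (simp add: sum_distrib_right sum_distrib_left distrib_left distrib_right mult.assoc)
  show "integrable lborel (\<lambda>v. Kf F D x v * f (x, v))"
    unfolding eq by (intro Bochner_Integration.integrable_sum Bochner_Integration.integrable_add integrable_mult_right i1 i2)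
  show "(LINT v|lborel. Kf F D x v * f (x, v)) = (\<Sum>e\<in>Basis. \<Sum>l\<in>Basis.
      (F \<bullet> e) * ((\<Sum>b\<in>Basis. dd (B e l) b x * v_mom (vmm l (0, b)) f x) + B e l x * (LINT v|lborel. kin_adj L G M (vtest l) (x, v) * f (x, v)))
      + (\<Sum>j\<in>Basis. (D j \<bullet> e) * (B e l x * v_mom (vmm l j) f x)))"
    unfolding eq v_mom_def using i1 i2
    by (simp add: Bochner_Integration.integral_sum Bochner_Integration.integral_add)
qed

text \<open>This is what the kernel is made for. Stationarity turns the moments of
  \<open>kin_adj\<close> into x-derivatives of the moments of \<open>f_inf\<close>, so the
  coefficient of \<open>F\<close> is the derivative of P^(-1) P = 1 and vanishes; the terms with
  \<open>D\<close> reduce to the trace, again by P^(-1) P = 1. Pairing with u(x) f_inf therefore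
  gives u div F.\<close>

lemma Kf_f_inf: "(LINT v|lborel. Kf F D x v * f_inf (x, v)) = (\<Sum>j\<in>Basis. D j \<bullet> j)"
proof -
  have ka: "(LINT v|lborel. kin_adj L G M (vtest l) (x, v) * f_inf (x, v)) = (\<Sum>b\<in>Basis. dd (mom l (0, b)) b x)" for l
    unfolding kin_adj_integrable(3)[OF f_inf_admissible] stationary by (simp add: mom_def)
  have z: "(\<Sum>l\<in>Basis. (\<Sum>b\<in>Basis. dd (B e l) b x * mom l (0, b) x) + B e l x * (\<Sum>b\<in>Basis. dd (mom l (0, b)) b x)) = 0" for e
  proof -
    have "(\<Sum>l\<in>Basis. (\<Sum>b\<in>Basis. dd (B e l) b x * mom l (0, b) x) + B e l x * (\<Sum>b\<in>Basis. dd (mom l (0, b)) b x)) =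
        (\<Sum>b\<in>Basis. \<Sum>l\<in>Basis. dd (B e l) b x * mom l (0, b) x + B e l x * dd (mom l (0, b)) b x)"
      by (subst sum.swap) (simp add: sum_distrib_left sum.distrib)
    also have "\<dots> = 0" by (intro sum.neutral ballI B_mom_dd) (simp add: Basis_prod_def)
    finally show ?thesis .
  qed
  have "(LINT v|lborel. Kf F D x v * f_inf (x, v)) = (\<Sum>e\<in>Basis. (F \<bullet> e) *
      (\<Sum>l\<in>Basis. (\<Sum>b\<in>Basis. dd (B e l) b x * mom l (0, b) x) + B e l x * (\<Sum>b\<in>Basis. dd (mom l (0, b)) b x))
      + (\<Sum>j\<in>Basis. (D j \<bullet> e) * (\<Sum>l\<in>Basis. B e l x * mom l j x)))"
    unfolding Kf_pair(2)[OF f_inf_admissible] ka mom_def[symmetric] sum_regroup ..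
  also have "\<dots> = (\<Sum>e\<in>Basis. \<Sum>j\<in>Basis. (D j \<bullet> e) * (e \<bullet> j))"
    unfolding z by (simp add: B_mom)
  also have "\<dots> = (\<Sum>j\<in>Basis. \<Sum>e\<in>Basis. (D j \<bullet> e) * (j \<bullet> e))"
    by (subst sum.swap) (simp add: inner_commute)
  also have "\<dots> = (\<Sum>j\<in>Basis. D j \<bullet> j)" by (simp flip: euclidean_inner)
  finally show ?thesis .
qed

text \<open>The matrix of localised moments of \<open>f\<close>, multiplied by the inverse of that
  of \<open>f_inf\<close>. For f = u(x) f_inf it is u times the identity matrix.\<close>

definition mfun :: "('d phase \<Rightarrow> real) \<Rightarrow> 'd spacetime \<Rightarrow> 'd spacetime \<Rightarrow> real ^ 'd \<Rightarrow> real" where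
  "mfun f e j x = (\<Sum>l\<in>Basis. B e l x * v_mom (vmm l j) f x)"

lemma mfun_props:
  assumes f: "test_function UNIV f"
  shows "Cc (mfun f e j)" "C1 (mfun f e j) b"
    "dd (mfun f e j) b x = (\<Sum>l\<in>Basis. dd (B e l) b x * v_mom (vmm l j) f x + B e l x * dd (v_mom (vmm l j) f) b x)"
proof -
  note fa = test_admissible[OF f]
  have v: "dder (v_mom (vmm l j) f) b (v_mom (vmm l j) (dd f (b, 0)))" for l b
    by (rule v_mom_dder[OF vmm_Cc admissible_cont[OF fa] admissible_C1[OF fa]])
  have v1: "C1 (v_mom (vmm l j) f) b" for l b
    by (rule C1I[OF v v_mom_continuous[OF vmm_Cc C1_cont[OF admissible_C1[OF fa]]]])
  have vc: "continuous_on UNIV (v_mom (vmm l j) f)" for l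
    by (rule v_mom_continuous[OF vmm_Cc admissible_cont[OF fa]])
  have d: "dder (mfun f e j) b (\<lambda>x. \<Sum>l\<in>Basis. dd (B e l) b x * v_mom (vmm l j) f x + B e l x * dd (v_mom (vmm l j) f) b x)" for b
    unfolding mfun_def[abs_def] by (intro dder_sum dder_mult C1_dder B_C1 v1)
  then show "dd (mfun f e j) b x = (\<Sum>l\<in>Basis. dd (B e l) b x * v_mom (vmm l j) f x + B e l x * dd (v_mom (vmm l j) f) b x)"
    by (rule fun_cong[OF dd_eq])
  show "C1 (mfun f e j) b"
    by (rule C1I[OF d]) (intro continuous_intros C1_cont B_C1 v1 vc B_cont)
  obtain r where r: "\<And>z. r < norm z \<Longrightarrow> f z = 0" using Cc_support[OF test_function_Cc[OF f]] by blast
  show "Cc (mfun f e j)"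
  proof (rule CcI)
    show "continuous_on UNIV (mfun f e j)"
      unfolding mfun_def[abs_def] by (intro continuous_intros B_cont vc)
    fix x :: "real ^ 'd" assume "r < norm x"
    then have "f (x, v) = 0" for v using r[of "(x, v)"] norm_fst_le[of x v] by simp
    then show "mfun f e j x = 0" by (simp add: mfun_def v_mom_def)
  qed
qed

lemma Kr_pair:
  assumes "\<And>l. integrable lborel (\<lambda>v. vtest l v * g v)"
  shows "integrable lborel (\<lambda>v. Kr F x v * g v)"
    "(LINT v|lborel. Kr F x v * g v) = (\<Sum>e\<in>Basis. (F \<bullet> e) * (\<Sum>l\<in>Basis. B e l x * (LINT v|lborel. vtest l v * g v)))"
proof -
  have eq: "Kr F x v * g v = (\<Sum>e\<in>Basis. (F \<bullet> e) * (\<Sum>l\<in>Basis. B e l x * (vtest l v * g v)))" for v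
    unfolding Kr_def by (simp add: sum_distrib_right sum_distrib_left mult.assoc)
  show "integrable lborel (\<lambda>v. Kr F x v * g v)"
    unfolding eq by (intro Bochner_Integration.integrable_sum integrable_mult_right assms)
  show "(LINT v|lborel. Kr F x v * g v) = (\<Sum>e\<in>Basis. (F \<bullet> e) * (\<Sum>l\<in>Basis. B e l x * (LINT v|lborel. vtest l v * g v)))"
    unfolding eq using assms by (simp add: Bochner_Integration.integral_sum)
qed

text \<open>Every term on the right is of the form \<open>F \<partial>\<zeta> + (\<partial>F) \<zeta>\<close>, so the integral over the slab vanishes.\<close>

lemma static_balance:
  assumes f: "test_function UNIV f"
  shows "p * (LINT v|lborel. Kf F D x v * f (x, v)) + (LINT v|lborel. Kr F x v * (p' * f (x, v) - p * A f (x, v))) =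
    (\<Sum>e\<in>Basis. (F \<bullet> e) * (p' * mfun f e (1, 0) x) + (D (1, 0) \<bullet> e) * (p * mfun f e (1, 0) x)) +
    (\<Sum>e\<in>Basis. \<Sum>b\<in>Basis. (F \<bullet> e) * (p * dd (mfun f e (0, b)) b x) + (D (0, b) \<bullet> e) * (p * mfun f e (0, b) x))"
proof -
  note fa = test_admissible[OF f]
  have iA: "integrable lborel (\<lambda>v. vtest l v * A f (x, v))" for l
    by (rule v_mom_integrable[OF vtest_C1(5) A_cont[OF f]])
  have iF: "integrable lborel (\<lambda>v. vtest l v * f (x, v))" for l
    by (rule v_mom_integrable[OF vtest_C1(5) admissible_cont[OF fa]])
  have iR: "integrable lborel (\<lambda>v. vtest l v * (p' * f (x, v) - p * A f (x, v)))"
    and eR: "(LINT v|lborel. vtest l v * (p' * f (x, v) - p * A f (x, v))) =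
      p' * v_mom (vmm l (1, 0)) f x - p * (LINT v|lborel. vtest l v * A f (x, v))" for l
  proof -
    have e: "vtest l v * (p' * f (x, v) - p * A f (x, v)) = p' * (vtest l v * f (x, v)) - p * (vtest l v * A f (x, v))" for v
      by (simp add: algebra_simps)
    show "integrable lborel (\<lambda>v. vtest l v * (p' * f (x, v) - p * A f (x, v)))"
      unfolding e using iA iF by simp
    show "(LINT v|lborel. vtest l v * (p' * f (x, v) - p * A f (x, v))) =
      p' * v_mom (vmm l (1, 0)) f x - p * (LINT v|lborel. vtest l v * A f (x, v))"
      unfolding e using iA iF by (simp add: v_mom_def vmm_def vmon_def)
  qed
  have ka: "(LINT v|lborel. kin_adj L G M (vtest l) (x, v) * f (x, v)) =
      (\<Sum>b\<in>Basis. dd (v_mom (vmm l (0, b)) f) b x) + (LINT v|lborel. vtest l v * A f (x, v))" for l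
    unfolding kin_adj_integrable(3)[OF fa] by (simp add: kinetic_op_def)
  let ?J = "\<lambda>l. LINT v|lborel. vtest l v * A f (x, v)"
  have sB: "(\<Sum>j\<in>(Basis :: 'd spacetime set). h j) = h (1, 0) + (\<Sum>b\<in>Basis. h (0, b))" for h :: "'d spacetime \<Rightarrow> real"
  proof -
    have b: "(Basis :: 'd spacetime set) = insert (1, 0) ((\<lambda>b. (0, b)) ` Basis)"
      by (auto simp: Basis_prod_def)
    have "(1, 0) \<notin> (\<lambda>b. (0 :: real, b :: real ^ 'd)) ` Basis" by auto
    then show ?thesis by (subst b) (simp add: sum.reindex inj_on_def)
  qed
  have inner: "(\<Sum>l\<in>Basis. (\<Sum>b\<in>Basis. dd (B e l) b x * v_mom (vmm l (0, b)) f x) +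
      B e l x * ((\<Sum>b\<in>Basis. dd (v_mom (vmm l (0, b)) f) b x) + ?J l)) =
      (\<Sum>b\<in>Basis. dd (mfun f e (0, b)) b x) + (\<Sum>l\<in>Basis. B e l x * ?J l)" for e
  proof -
    have "(\<Sum>b\<in>Basis. dd (mfun f e (0, b)) b x) = (\<Sum>l\<in>Basis. \<Sum>b\<in>Basis.
        dd (B e l) b x * v_mom (vmm l (0, b)) f x + B e l x * dd (v_mom (vmm l (0, b)) f) b x)"
      unfolding mfun_props(3)[OF f] by (rule sum.swap)
    then show ?thesis by (simp add: sum.distrib sum_distrib_left distrib_left)
  qed
  have "(LINT v|lborel. Kf F D x v * f (x, v)) =
      (\<Sum>e\<in>Basis. (F \<bullet> e) * ((\<Sum>b\<in>Basis. dd (mfun f e (0, b)) b x) + (\<Sum>l\<in>Basis. B e l x * ?J l))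
      + (\<Sum>j\<in>Basis. (D j \<bullet> e) * mfun f e j x))"
    unfolding Kf_pair(2)[OF fa] ka sum_regroup inner mfun_def[symmetric] ..
  then have 1: "p * (LINT v|lborel. Kf F D x v * f (x, v)) =
      (\<Sum>e\<in>Basis. (F \<bullet> e) * (p * ((\<Sum>b\<in>Basis. dd (mfun f e (0, b)) b x) + (\<Sum>l\<in>Basis. B e l x * ?J l)))
      + (\<Sum>j\<in>Basis. (D j \<bullet> e) * (p * mfun f e j x)))"
    by (simp add: sum_distrib_left distrib_left mult.left_commute)
  have 2: "(LINT v|lborel. Kr F x v * (p' * f (x, v) - p * A f (x, v))) =
      (\<Sum>e\<in>Basis. (F \<bullet> e) * (p' * mfun f e (1, 0) x - p * (\<Sum>l\<in>Basis. B e l x * ?J l)))"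
    unfolding Kr_pair(2)[of "\<lambda>v. p' * f (x, v) - p * A f (x, v)", OF iR] eR mfun_def
    by (simp add: right_diff_distrib sum_subtractf sum_distrib_left mult_ac)
  \<comment> \<open>The terms with the moments of \<open>A f\<close> cancel between the two
    pairings.\<close>
  show ?thesis unfolding 1 2 sB[of "\<lambda>j. (D j \<bullet> e) * (p * mfun f e j x)" for e] sum.distrib[symmetric]
    by (rule sum.cong[OF refl]) (simp add: sum.distrib sum_distrib_left algebra_simps)
qed

text \<open>The factor 5 is the number of summands whose sum is squared in \<open>Kf_square\<close>,
  and \<open>nE\<close> comes from the Cauchy-Schwarz inequality for the sum of the norms of the
  partial derivatives.\<close>

definition cK :: real where "cK = 5 * nE * qK\<^sup>2"

lemma cK_pos: "0 < cK" using nE(1) qK_coeffs(5) by (auto simp: cK_def)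

lemma sum5_square:
  fixes a b c d e :: real shows "(a + b + c + d + e)\<^sup>2 \<le> 5 * (a\<^sup>2 + b\<^sup>2 + c\<^sup>2 + d\<^sup>2 + e\<^sup>2)"
proof -
  have "5 * (a\<^sup>2 + b\<^sup>2 + c\<^sup>2 + d\<^sup>2 + e\<^sup>2) - (a + b + c + d + e)\<^sup>2 =
      (a - b)\<^sup>2 + (a - c)\<^sup>2 + (a - d)\<^sup>2 + (a - e)\<^sup>2 + (b - c)\<^sup>2 + (b - d)\<^sup>2 + (b - e)\<^sup>2
      + (c - d)\<^sup>2 + (c - e)\<^sup>2 + (d - e)\<^sup>2"
    by (simp add: power2_eq_square algebra_simps)
  also have "\<dots> \<ge> 0" by (intro add_nonneg_nonneg) auto
  finally show ?thesis by simp
qed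

text \<open>Squaring \<open>Kf_bound\<close> and integrating against f_inf dv reproduces the weight:
  the constant, \<open>W1\<close> and \<open>W2\<close> are multiplied by the mass rho, while the
  force is integrated against \<open>f_inf\<close> over the unit ball.\<close>

lemma Kf_square:
  shows "integrable lborel (\<lambda>v. (Kf F D x v)\<^sup>2 * f_inf (x, v))"
    and "(LINT v|lborel. (Kf F D x v)\<^sup>2 * f_inf (x, v)) \<le>
      cK * (((norm F)\<^sup>2 * spatial_weight G f_inf x + (\<Sum>j\<in>Basis. (norm (D j))\<^sup>2)) / rho x)"
proof -
  let ?nD = "\<Sum>j\<in>(Basis :: 'd spacetime set). norm (D j)" and ?sD = "\<Sum>j\<in>(Basis :: 'd spacetime set). (norm (D j))\<^sup>2"
  let ?I = "\<lambda>v :: real ^ 'd. indicator (cball 0 1) v :: real"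
  have r: "0 < rho x" by (rule rho_pos)
  have fi: "integrable lborel (\<lambda>v. f_inf (x, v))" by (rule admissible_int[OF f_inf_admissible])
  have Gi: "integrable lborel (\<lambda>v. ?I v * (f_inf (x, v) * (norm (G (x, v)))\<^sup>2))"
    by (intro ball_integrable continuous_intros continuous_slice[OF f_inf_cont] continuous_slice[OF smooth_inner(4)[OF G]])
  have WG: "WG x = (LINT v|lborel. ?I v * (f_inf (x, v) * (norm (G (x, v)))\<^sup>2))"
    by (simp add: WG_def set_lebesgue_integral_def)
  define c where "c = 5 * (qK / rho x)\<^sup>2"
  define U where "U v = c * (((norm F)\<^sup>2 * (1 + (W1 x)\<^sup>2 + (W2 x)\<^sup>2) + ?nD\<^sup>2) * f_inf (x, v)
      + (norm F)\<^sup>2 * (?I v * (f_inf (x, v) * (norm (G (x, v)))\<^sup>2)))" for v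
  have Ui: "integrable lborel U" unfolding U_def[abs_def] using fi Gi by simp
  have pt: "(Kf F D x v)\<^sup>2 * f_inf (x, v) \<le> U v" for v
  proof -
    let ?g = "?I v * norm (G (x, v))"
    have b0: "0 \<le> qK / rho x * (norm F * (1 + W1 x + W2 x + ?g) + ?nD)"
      using qK_coeffs(5) r W_nonneg[of x] by (intro mult_nonneg_nonneg add_nonneg_nonneg sum_nonneg) auto
    have "(Kf F D x v)\<^sup>2 \<le> (qK / rho x * (norm F * (1 + W1 x + W2 x + ?g) + ?nD))\<^sup>2"
      using Kf_bound[of F D x v] b0 by (metis abs_ge_zero power2_abs power_mono)
    also have "\<dots> = (qK / rho x)\<^sup>2 * (norm F + norm F * W1 x + norm F * W2 x + norm F * ?g + ?nD)\<^sup>2"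
      by (simp add: power_mult_distrib[symmetric] algebra_simps)
    also have "\<dots> \<le> (qK / rho x)\<^sup>2 * (5 * ((norm F)\<^sup>2 + (norm F * W1 x)\<^sup>2 + (norm F * W2 x)\<^sup>2 + (norm F * ?g)\<^sup>2 + ?nD\<^sup>2))"
      by (intro mult_left_mono sum5_square) simp
    also have "\<dots> = c * ((norm F)\<^sup>2 * (1 + (W1 x)\<^sup>2 + (W2 x)\<^sup>2) + ?nD\<^sup>2 + (norm F)\<^sup>2 * (?I v * (norm (G (x, v)))\<^sup>2))"
      by (simp add: c_def power_mult_distrib indicator_def algebra_simps)
    finally have "(Kf F D x v)\<^sup>2 * f_inf (x, v) \<le> c * ((norm F)\<^sup>2 * (1 + (W1 x)\<^sup>2 + (W2 x)\<^sup>2) + ?nD\<^sup>2 + (norm F)\<^sup>2 * (?I v * (norm (G (x, v)))\<^sup>2)) * f_inf (x, v)"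
      using f_inf_pos[of "(x, v)"] by (intro mult_right_mono) auto
    then show ?thesis by (simp add: U_def algebra_simps)
  qed
  have Km: "(\<lambda>v. (Kf F D x v)\<^sup>2 * f_inf (x, v)) \<in> borel_measurable lborel"
    using borel_measurable_continuous_onI[of "\<lambda>v. (Kf F D x v)\<^sup>2 * f_inf (x, v)"]
    by (simp add: continuous_on_mult continuous_on_power Kf_cont continuous_slice[OF f_inf_cont])
  show i: "integrable lborel (\<lambda>v. (Kf F D x v)\<^sup>2 * f_inf (x, v))"
  proof (rule Bochner_Integration.integrable_bound[OF Ui Km], intro AE_I2)
    fix v
    have "0 \<le> (Kf F D x v)\<^sup>2 * f_inf (x, v)" using f_inf_pos[of "(x, v)"] by simp
    then show "norm ((Kf F D x v)\<^sup>2 * f_inf (x, v)) \<le> norm (U v)" using pt[of v] by simp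
  qed
  have "(LINT v|lborel. (Kf F D x v)\<^sup>2 * f_inf (x, v)) \<le> (LINT v|lborel. U v)"
    using i Ui pt by (intro integral_mono)
  also have "\<dots> = c * (((norm F)\<^sup>2 * (1 + (W1 x)\<^sup>2 + (W2 x)\<^sup>2) + ?nD\<^sup>2) * rho x + (norm F)\<^sup>2 * WG x)"
    unfolding U_def[abs_def] WG using fi Gi by (simp add: vavg_def)
  also have "\<dots> = 5 * qK\<^sup>2 * (((norm F)\<^sup>2 * spatial_weight G f_inf x + ?nD\<^sup>2) / rho x)"
    using r by (simp add: c_def weight_eq power_divide field_simps power2_eq_square)
  also have "\<dots> \<le> 5 * qK\<^sup>2 * ((nE * ((norm F)\<^sup>2 * spatial_weight G f_inf x) + nE * ?sD) / rho x)"
  proof (intro mult_left_mono divide_right_mono add_mono)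
    have w0: "0 \<le> (norm F)\<^sup>2 * spatial_weight G f_inf x"
      using W_nonneg[of x] r by (simp add: weight_eq)
    show "(norm F)\<^sup>2 * spatial_weight G f_inf x \<le> nE * ((norm F)\<^sup>2 * spatial_weight G f_inf x)"
      using mult_right_mono[OF nE(1) w0] by simp
    have "?nD\<^sup>2 \<le> (\<Sum>j\<in>(Basis :: 'd spacetime set). 1\<^sup>2) * ?sD"
      using Cauchy_Schwarz_ineq_sum[of "\<lambda>_. 1" "\<lambda>j. norm (D j)" "Basis :: 'd spacetime set"] by simp
    then show "?nD\<^sup>2 \<le> nE * ?sD" by (simp add: nE_def)
  qed (use r in auto)
  also have "\<dots> = cK * (((norm F)\<^sup>2 * spatial_weight G f_inf x + ?sD) / rho x)"
    by (simp add: cK_def algebra_simps add_divide_distrib)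
  finally show "(LINT v|lborel. (Kf F D x v)\<^sup>2 * f_inf (x, v)) \<le>
      cK * (((norm F)\<^sup>2 * spatial_weight G f_inf x + ?sD) / rho x)" .
qed

lemma Kr_square:
  shows "integrable lborel (\<lambda>v. (Kr F x v)\<^sup>2 * f_inf (x, v))"
    and "(LINT v|lborel. (Kr F x v)\<^sup>2 * f_inf (x, v)) \<le> cK * ((norm F)\<^sup>2 * spatial_weight G f_inf x / rho x)"
proof -
  have r: "0 < rho x" by (rule rho_pos)
  have fi: "integrable lborel (\<lambda>v. f_inf (x, v))" by (rule admissible_int[OF f_inf_admissible])
  define U where "U v = (qK / rho x * norm F)\<^sup>2 * f_inf (x, v)" for v
  have Ui: "integrable lborel U" unfolding U_def[abs_def] using fi by simp
  have pt: "(Kr F x v)\<^sup>2 * f_inf (x, v) \<le> U v" for v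
  proof -
    have "(Kr F x v)\<^sup>2 \<le> (qK / rho x * norm F)\<^sup>2"
      using Kr_bound[of F x v] by (metis abs_ge_zero power2_abs power_mono)
    then show ?thesis unfolding U_def using f_inf_pos[of "(x, v)"] by (intro mult_right_mono) auto
  qed
  have Km: "(\<lambda>v. (Kr F x v)\<^sup>2 * f_inf (x, v)) \<in> borel_measurable lborel"
    using borel_measurable_continuous_onI[of "\<lambda>v. (Kr F x v)\<^sup>2 * f_inf (x, v)"]
    by (simp add: continuous_on_mult continuous_on_power Kr_cont continuous_slice[OF f_inf_cont])
  show i: "integrable lborel (\<lambda>v. (Kr F x v)\<^sup>2 * f_inf (x, v))"
  proof (rule Bochner_Integration.integrable_bound[OF Ui Km], intro AE_I2)
    fix v
    have "0 \<le> (Kr F x v)\<^sup>2 * f_inf (x, v)" using f_inf_pos[of "(x, v)"] by simp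
    then show "norm ((Kr F x v)\<^sup>2 * f_inf (x, v)) \<le> norm (U v)" using pt[of v] by simp
  qed
  have "(LINT v|lborel. (Kr F x v)\<^sup>2 * f_inf (x, v)) \<le> (LINT v|lborel. U v)"
    using i Ui pt by (intro integral_mono)
  also have "\<dots> = (qK / rho x * norm F)\<^sup>2 * rho x" unfolding U_def[abs_def] using fi by (simp add: vavg_def)
  also have "\<dots> = qK\<^sup>2 * ((norm F)\<^sup>2 * 1 / rho x)" using r by (simp add: power2_eq_square field_simps)
  also have "\<dots> \<le> cK * ((norm F)\<^sup>2 * spatial_weight G f_inf x / rho x)"
  proof (intro mult_mono divide_right_mono)
    have "qK\<^sup>2 * 1 \<le> qK\<^sup>2 * (5 * nE)" using nE(1) by (intro mult_left_mono) auto
    then show "qK\<^sup>2 \<le> cK" by (simp add: cK_def mult_ac)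
    show "1 \<le> spatial_weight G f_inf x" using W_nonneg[of x] r by (simp add: weight_eq)
  qed (use r cK_pos in auto)
  finally show "(LINT v|lborel. (Kr F x v)\<^sup>2 * f_inf (x, v)) \<le> cK * ((norm F)\<^sup>2 * spatial_weight G f_inf x / rho x)" .
qed

end

section \<open>The space-time estimate\<close>

lemma product_integrable:
  fixes a :: "'a::euclidean_space \<Rightarrow> real" and b :: "'b::euclidean_space \<Rightarrow> real"
  assumes a: "integrable lborel a" and b: "integrable lborel b"
  shows "integrable lborel (\<lambda>z. a (fst z) * b (snd z))"
    "(LINT z|lborel. a (fst z) * b (snd z)) = (LINT x|lborel. a x) * (LINT y|lborel. b y)"
proof -
  note [measurable] = borel_measurable_integrable[OF a] borel_measurable_integrable[OF b]
  let ?k = "\<lambda>z. a (fst z) * b (snd z)"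
  have m: "?k \<in> borel_measurable (lborel \<Otimes>\<^sub>M lborel)" by measurable
  have i: "integrable (lborel \<Otimes>\<^sub>M lborel) ?k"
    by (rule lborel_pair.Fubini_integrable[OF m]) (use a b in \<open>auto simp: abs_mult\<close>)
  then show "integrable lborel ?k" by (simp add: lborel_prod)
  show "(LINT z|lborel. ?k z) = (LINT x|lborel. a x) * (LINT y|lborel. b y)"
    using lborel_pair.integral_fst'[OF i] by (simp add: lborel_prod)
qed

lemma borel_measurable_pair_lborel:
  fixes k :: "('a::euclidean_space \<times> 'b::euclidean_space) \<Rightarrow> 'c::topological_space"
  assumes "k \<in> borel_measurable borel"
  shows "k \<in> borel_measurable (borel \<Otimes>\<^sub>M lborel)"
proof -
  have "sets (borel \<Otimes>\<^sub>M lborel :: ('a \<times> 'b) measure) = sets (borel \<Otimes>\<^sub>M borel)"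
    by (rule sets_pair_measure_cong) simp_all
  then show ?thesis using assms unfolding borel_prod by (simp cong: measurable_cong_sets)
qed

lemma slab_sets [measurable]: "slab T \<in> sets borel"
  by (simp add: slab_def borel_closed closed_Times)

lemma indicator_slab: "indicator (slab T) z = (indicator {0..T} (fst z) :: 'c::zero_neq_one)"
  by (cases z) (auto simp: slab_def indicator_def)

text \<open>A compactly supported factor in t that equals 1 on a neighbourhood of [0, T]. It turns
  functions given on the slab into compactly supported ones and leaves them and their derivatives
  unchanged on the slab.\<close>

definition tcut :: "real \<Rightarrow> real \<Rightarrow> real" where
  "tcut T t = ramp (t + 2) * ramp (T + 2 - t)"

definition tcut' :: "real \<Rightarrow> real \<Rightarrow> real" where
  "tcut' T t = hat (t + 2) * ramp (T + 2 - t) + ramp (t + 2) * (hat (T + 2 - t) * (- 1))"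

lemma ramp_cont: "continuous_on UNIV ramp"
  using DERIV_isCont[OF ramp_DERIV] by (auto intro: continuous_at_imp_continuous_on)

lemma hat_cont: "continuous_on UNIV hat"
  unfolding hat_def[abs_def] by (intro continuous_intros)

lemma tcut_props:
  "0 \<le> t \<Longrightarrow> t \<le> T \<Longrightarrow> tcut T t = 1" "0 \<le> t \<Longrightarrow> t \<le> T \<Longrightarrow> tcut' T t = 0"
  "\<bar>T\<bar> + 3 < \<bar>t\<bar> \<Longrightarrow> tcut T t = 0"
  "(tcut T has_real_derivative tcut' T t) (at t)" "continuous_on UNIV (tcut T)" "continuous_on UNIV (tcut' T)"
proof -
  show "0 \<le> t \<Longrightarrow> t \<le> T \<Longrightarrow> tcut T t = 1" by (simp add: tcut_def ramp_values)
  show "0 \<le> t \<Longrightarrow> t \<le> T \<Longrightarrow> tcut' T t = 0" by (simp add: tcut'_def ramp_values hat_values)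
  show "tcut T t = 0" if "\<bar>T\<bar> + 3 < \<bar>t\<bar>"
  proof -
    have "t + 2 \<le> -1 \<or> T + 2 - t \<le> -1" using that by linarith
    then show ?thesis by (auto simp: tcut_def ramp_values)
  qed
  have "((\<lambda>t. ramp (t + 2)) has_real_derivative hat (t + 2)) (at t)"
    using DERIV_shift[of ramp "hat (t + 2)" t 2] ramp_DERIV by simp
  moreover have "((\<lambda>t. ramp (T + 2 - t)) has_real_derivative hat (T + 2 - t) * (- 1)) (at t)"
    by (rule DERIV_chain2[OF ramp_DERIV]) (auto intro!: derivative_eq_intros)
  ultimately show "(tcut T has_real_derivative tcut' T t) (at t)"
    unfolding tcut_def[abs_def] tcut'_def by (auto intro: DERIV_cong[OF DERIV_mult])
  show "continuous_on UNIV (tcut T)" unfolding tcut_def[abs_def]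
    by (intro continuous_intros continuous_on_compose2[OF ramp_cont]) auto
  show "continuous_on UNIV (tcut' T)" unfolding tcut'_def[abs_def]
    by (intro continuous_intros continuous_on_compose2[OF ramp_cont] continuous_on_compose2[OF hat_cont]) auto
qed

lemma spacetime_Cc:
  fixes m :: "real ^ 'd::finite \<Rightarrow> real"
  assumes q: "continuous_on UNIV q" and m: "Cc m"
  shows "Cc (\<lambda>z. (tcut T (fst z) * q (fst z)) * m (snd z))"
proof -
  obtain r where r: "0 < r" "\<And>x. r < norm x \<Longrightarrow> m x = 0" using Cc_support[OF m] by blast
  show ?thesis
  proof (rule CcI)
    show "continuous_on UNIV (\<lambda>z. (tcut T (fst z) * q (fst z)) * m (snd z))"
      by (intro continuous_intros continuous_on_compose2[OF tcut_props(5)] continuous_on_compose2[OF q]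
          continuous_on_compose2[OF Cc_continuous[OF m]]) auto
    fix z :: "real \<times> (real ^ 'd)" assume "(\<bar>T\<bar> + 3) + r < norm z"
    then have "\<bar>T\<bar> + 3 < \<bar>fst z\<bar> \<or> r < norm (snd z)"
      using norm_Pair_le[of "fst z" "snd z"] by (auto simp: not_less[symmetric])
    then show "(tcut T (fst z) * q (fst z)) * m (snd z) = 0" using r tcut_props(3)[of T "fst z"] by auto
  qed
qed

context moment_data
begin

text \<open>The function \<open>zeta\<close> only has to agree with \<open>a\<close> on the slab,
  which leaves room for a cutoff in time outside it.\<close>

lemma weak_scalar:
  fixes F :: "'d spacetime \<Rightarrow> 'd spacetime"
  assumes W: "has_weak_gradient_on F D ({0<..<T} \<times> UNIV)"
    and tr: "has_time_traces T F D (\<lambda>_. 0) (\<lambda>_. 0)" and T: "0 < T" and j: "j \<in> Basis"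
    and F: "set_integrable lborel (slab T) F" and D: "set_integrable lborel (slab T) (\<lambda>z. D z j)"
    and z: "Cc zeta" "dder zeta j zeta'" "continuous_on UNIV zeta'"
    and eq: "\<And>z. z \<in> slab T \<Longrightarrow> zeta z = a z" "\<And>z. z \<in> slab T \<Longrightarrow> zeta' z = a' z"
  shows "set_integrable lborel (slab T) (\<lambda>z. (F z \<bullet> e) * a' z + (D z j \<bullet> e) * a z)"
    "(LINT z:slab T|lborel. (F z \<bullet> e) * a' z + (D z j \<bullet> e) * a z) = 0"
proof -
  have i1: "set_integrable lborel (slab T) (\<lambda>z. zeta' z *\<^sub>R F z)"
    by (rule set_integrable_Cc_scaleR[OF F dder_Cc[OF z]])
  have i2: "set_integrable lborel (slab T) (\<lambda>z. zeta z *\<^sub>R D z j)"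
    by (rule set_integrable_Cc_scaleR[OF D z(1)])
  have i: "set_integrable lborel (slab T) (\<lambda>z. zeta' z *\<^sub>R F z + zeta z *\<^sub>R D z j)"
    by (rule set_integral_add(1)[OF i1 i2])
  have v: "(LINT z:slab T|lborel. zeta' z *\<^sub>R F z + zeta z *\<^sub>R D z j) = 0"
    using set_integral_add(2)[OF i1 i2] weak_gradient_slab[OF W tr j T F D z] by simp
  have e: "(\<lambda>z. indicator (slab T) z *\<^sub>R ((F z \<bullet> e) * a' z + (D z j \<bullet> e) * a z)) =
      (\<lambda>z. (indicator (slab T) z *\<^sub>R (zeta' z *\<^sub>R F z + zeta z *\<^sub>R D z j)) \<bullet> e)"
    using eq by (auto simp: indicator_def inner_add_left)
  show "set_integrable lborel (slab T) (\<lambda>z. (F z \<bullet> e) * a' z + (D z j \<bullet> e) * a z)"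
    using i unfolding set_integrable_def e by (rule integrable_inner_left)
  show "(LINT z:slab T|lborel. (F z \<bullet> e) * a' z + (D z j \<bullet> e) * a z) = 0"
    unfolding set_lebesgue_integral_def e
    using i[unfolded set_integrable_def] v[unfolded set_lebesgue_integral_def] by (subst integral_inner_left) auto
qed

text \<open>Through \<open>tcut\<close>, the functions that \<open>static_balance\<close> pairs with
  \<open>F\<close> and its gradient become compactly supported, and the vanishing traces remove the
  boundary terms in t.\<close>

lemma weak_balance:
  fixes F :: "'d spacetime \<Rightarrow> 'd spacetime"
  assumes W: "has_weak_gradient_on F D ({0<..<T} \<times> UNIV)"
    and tr: "has_time_traces T F D (\<lambda>_. 0) (\<lambda>_. 0)" and T: "0 < T"
    and F: "set_integrable lborel (slab T) F" and D: "\<And>j. j \<in> Basis \<Longrightarrow> set_integrable lborel (slab T) (\<lambda>z. D z j)"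
    and f: "test_function UNIV f" and p: "\<And>t. (p has_real_derivative p' t) (at t)" "continuous_on UNIV p'"
  defines "h \<equiv> \<lambda>z. p (fst z) * (LINT v|lborel. Kf (F z) (D z) (snd z) v * f (snd z, v)) +
      (LINT v|lborel. Kr (F z) (snd z) v * (p' (fst z) * f (snd z, v) - p (fst z) * A f (snd z, v)))"
  shows "set_integrable lborel (slab T) h" "(LINT z:slab T|lborel. h z) = 0"
proof -
  have pc: "continuous_on UNIV p" using DERIV_isCont[OF p(1)] by (auto intro: continuous_at_imp_continuous_on)
  note m = mfun_props[OF f]
  define h1 where "h1 e z = (F z \<bullet> e) * (p' (fst z) * mfun f e (1, 0) (snd z)) + (D z (1, 0) \<bullet> e) * (p (fst z) * mfun f e (1, 0) (snd z))" for e z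
  define h2 where "h2 e b z = (F z \<bullet> e) * (p (fst z) * dd (mfun f e (0, b)) b (snd z)) + (D z (0, b) \<bullet> e) * (p (fst z) * mfun f e (0, b) (snd z))" for e b z
  have h: "h z = (\<Sum>e\<in>Basis. h1 e z) + (\<Sum>e\<in>Basis. \<Sum>b\<in>Basis. h2 e b z)" for z
    unfolding h_def h1_def h2_def by (rule static_balance[OF f])
  have slabD: "0 \<le> fst z \<and> fst z \<le> T" if "z \<in> slab T" for z :: "'d spacetime"
    using that by (cases z) (auto simp: slab_def)
  have 1: "set_integrable lborel (slab T) (h1 e) \<and> (LINT z:slab T|lborel. h1 e z) = 0" for e
  proof -
    let ?zeta = "\<lambda>z :: 'd spacetime. (tcut T (fst z) * p (fst z)) * mfun f e (1, 0) (snd z)"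
    let ?zeta' = "\<lambda>z :: 'd spacetime. (tcut' T (fst z) * p (fst z) + tcut T (fst z) * p' (fst z)) * mfun f e (1, 0) (snd z)"
    have d: "dder ?zeta (1, 0) ?zeta'"
      unfolding dder_def
    proof
      fix z :: "'d spacetime"
      have "((\<lambda>s. tcut T (fst z + s) * p (fst z + s)) has_real_derivative
          (tcut' T (fst z) * p (fst z) + tcut T (fst z) * p' (fst z))) (at 0)"
      proof -
        have "((\<lambda>t. tcut T t * p t) has_real_derivative
            (tcut' T (fst z) * p (fst z) + tcut T (fst z) * p' (fst z))) (at (fst z))"
          by (rule DERIV_cong[OF DERIV_mult[OF tcut_props(4) p(1)]]) simp
        then show ?thesis using DERIV_shift[of "\<lambda>t. tcut T t * p t" _ 0 "fst z"] by (simp add: add.commute)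
      qed
      from DERIV_cmult_right[OF this, of "mfun f e (1, 0) (snd z)"]
      show "((\<lambda>s. ?zeta (z + s *\<^sub>R (1, 0))) has_real_derivative ?zeta' z) (at 0)" by simp
    qed
    have c: "continuous_on UNIV ?zeta'"
      by (intro continuous_intros continuous_on_compose2[OF tcut_props(5)] continuous_on_compose2[OF tcut_props(6)]
          continuous_on_compose2[OF pc] continuous_on_compose2[OF p(2)] continuous_on_compose2[OF Cc_continuous[OF m(1)]]) auto
    have b1: "(1, 0) \<in> (Basis :: 'd spacetime set)" by (simp add: Basis_prod_def)
    note ws = weak_scalar[OF W tr T b1 F D[OF b1] spacetime_Cc[OF pc m(1)] d c,
        of "\<lambda>z. p (fst z) * mfun f e (1, 0) (snd z)" "\<lambda>z. p' (fst z) * mfun f e (1, 0) (snd z)" e]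
    show ?thesis unfolding h1_def[abs_def] using ws slabD by (auto simp: tcut_props)
  qed
  have 2: "set_integrable lborel (slab T) (h2 e b) \<and> (LINT z:slab T|lborel. h2 e b z) = 0" if b: "b \<in> Basis" for e b
  proof -
    let ?zeta = "\<lambda>z :: 'd spacetime. (tcut T (fst z) * p (fst z)) * mfun f e (0, b) (snd z)"
    let ?zeta' = "\<lambda>z :: 'd spacetime. (tcut T (fst z) * p (fst z)) * dd (mfun f e (0, b)) b (snd z)"
    have d: "dder ?zeta (0, b) ?zeta'"
      unfolding dder_def
    proof
      fix z :: "'d spacetime"
      show "((\<lambda>s. ?zeta (z + s *\<^sub>R (0, b))) has_real_derivative ?zeta' z) (at 0)"
        using DERIV_cmult[OF dderD[OF C1_dder[OF m(2)[of e "(0, b)" b]], of "snd z"], of "tcut T (fst z) * p (fst z)"] by simp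
    qed
    have c: "continuous_on UNIV ?zeta'"
      by (intro continuous_intros continuous_on_compose2[OF tcut_props(5)]
          continuous_on_compose2[OF pc] continuous_on_compose2[OF C1_cont[OF m(2)]]) auto
    have b1: "(0, b) \<in> (Basis :: 'd spacetime set)" using b by (simp add: Basis_prod_def)
    note ws = weak_scalar[OF W tr T b1 F D[OF b1] spacetime_Cc[OF pc m(1)] d c,
        of "\<lambda>z. p (fst z) * mfun f e (0, b) (snd z)" "\<lambda>z. p (fst z) * dd (mfun f e (0, b)) b (snd z)" e]
    show ?thesis unfolding h2_def[abs_def] using ws slabD by (auto simp: tcut_props)
  qed
  have i1: "integrable lborel (\<lambda>z. indicator (slab T) z *\<^sub>R h1 e z)" "(LINT z|lborel. indicator (slab T) z *\<^sub>R h1 e z) = 0" for e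
    using 1[of e] by (auto simp: set_integrable_def set_lebesgue_integral_def)
  have i2: "integrable lborel (\<lambda>z. indicator (slab T) z *\<^sub>R h2 e b z)" "(LINT z|lborel. indicator (slab T) z *\<^sub>R h2 e b z) = 0"
    if "b \<in> Basis" for e b
    using 2[OF that, of e] by (auto simp: set_integrable_def set_lebesgue_integral_def)
  have eq: "indicator (slab T) z *\<^sub>R h z = (\<Sum>e\<in>Basis. indicator (slab T) z *\<^sub>R h1 e z) + (\<Sum>e\<in>Basis. \<Sum>b\<in>Basis. indicator (slab T) z *\<^sub>R h2 e b z)" for z
    unfolding h by (simp add: distrib_left sum_distrib_left)
  show "set_integrable lborel (slab T) h"
    unfolding set_integrable_def eq
    by (intro Bochner_Integration.integrable_add Bochner_Integration.integrable_sum i1 i2)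
  show "(LINT z:slab T|lborel. h z) = 0"
    unfolding set_lebesgue_integral_def eq
  proof (subst Bochner_Integration.integral_add)
    show "integrable lborel (\<lambda>z. \<Sum>e\<in>Basis. indicator (slab T) z *\<^sub>R h1 e z)"
      by (intro Bochner_Integration.integrable_sum i1)
    show "integrable lborel (\<lambda>z. \<Sum>e\<in>Basis. \<Sum>b\<in>Basis. indicator (slab T) z *\<^sub>R h2 e b z)"
      by (intro Bochner_Integration.integrable_sum i2)
    have "(LINT z|lborel. (\<Sum>e\<in>Basis. indicator (slab T) z *\<^sub>R h1 e z)) = 0"
      by (subst Bochner_Integration.integral_sum) (rule i1(1), simp only: i1(2) sum.neutral_const)
    moreover have "(LINT z|lborel. (\<Sum>b\<in>Basis. indicator (slab T) z *\<^sub>R h2 e b z)) = 0" for e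
      by (subst Bochner_Integration.integral_sum) (erule i2(1), rule sum.neutral, blast intro: i2(2))
    then have "(LINT z|lborel. (\<Sum>e\<in>Basis. \<Sum>b\<in>Basis. indicator (slab T) z *\<^sub>R h2 e b z)) = 0"
      by (subst Bochner_Integration.integral_sum) (intro Bochner_Integration.integrable_sum i2, simp_all only: sum.neutral_const)
    ultimately show "(LINT z|lborel. (\<Sum>e\<in>Basis. indicator (slab T) z *\<^sub>R h1 e z)) +
        (LINT z|lborel. (\<Sum>e\<in>Basis. \<Sum>b\<in>Basis. indicator (slab T) z *\<^sub>R h2 e b z)) = 0"
      by (simp only: add_0)
  qed
qed

section \<open>Measurability and integrability on the slab\<close>

lemma spatial_weight_measurable: "spatial_weight G f_inf \<in> borel_measurable borel"
proof -
  have par: "(\<lambda>x. LINT v|lborel. indicator (cball 0 1) v * k (x, v)) \<in> borel_measurable borel"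
    if k: "continuous_on UNIV k" for k :: "'d phase \<Rightarrow> real"
  proof -
    have [measurable]: "k \<in> borel_measurable borel" by (rule borel_measurable_continuous_onI[OF k])
    have "indicator (cball 0 1) (snd z) = (indicator (UNIV \<times> cball 0 1) z :: real)" for z :: "'d phase"
      by (cases z) (simp add: indicator_def)
    moreover have "(UNIV \<times> cball 0 1 :: 'd phase set) \<in> sets borel"
      by (intro borel_closed closed_Times) auto
    ultimately have "(\<lambda>z :: 'd phase. indicator (cball 0 1) (snd z) * k z) \<in> borel_measurable borel"
      by simp
    from borel_measurable_pair_lborel[OF this]
    have "(\<lambda>(x, v). indicator (cball 0 1) v * k (x, v)) \<in> borel_measurable (borel \<Otimes>\<^sub>M (lborel :: (real ^ 'd) measure))"
      by (simp add: split_beta')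
    then show ?thesis by (rule lborel.borel_measurable_lebesgue_integral)
  qed
  have [measurable]: "rho \<in> borel_measurable borel" by (rule borel_measurable_continuous_onI[OF rho_cont])
  have [measurable]: "WG \<in> borel_measurable borel"
    using par[of "\<lambda>z. f_inf z * (norm (G z))\<^sup>2"] f_inf_cont smooth_inner(4)[OF G]
    by (simp add: WG_def[abs_def] set_lebesgue_integral_def continuous_intros)
  have [measurable]: "W1 \<in> borel_measurable borel"
    using par[OF profile(4)] by (simp add: W1_def[abs_def] set_lebesgue_integral_def)
  have g: "grad rho = (\<lambda>x. \<Sum>b\<in>Basis. dd rho b x *\<^sub>R b)"
  proof
    fix x show "grad rho x = (\<Sum>b\<in>Basis. dd rho b x *\<^sub>R b)"
      by (subst euclidean_representation[symmetric]) (simp add: grad_inner[OF rho_C])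
  qed
  then have "continuous_on UNIV (grad rho)"
    unfolding g by (intro continuous_intros C1_cont C_1_C1(1)[OF rho_C])
  then have [measurable]: "grad rho \<in> borel_measurable borel" by (rule borel_measurable_continuous_onI)
  have [measurable]: "W2 \<in> borel_measurable borel" unfolding W2_def[abs_def] by measurable
  show ?thesis unfolding weight_eq[abs_def] by measurable
qed

lemma rho_integral: "integrable lborel rho" "(LINT x|lborel. rho x) = 1"
  using integral_phase[OF f_inf_integrable] f_inf_1 by (simp_all add: vavg_def[abs_def])

lemma slab_rho:
  assumes T: "0 < T"
  shows "set_integrable lborel (slab T) (\<lambda>z. rho (snd z))" "(LINT z:slab T|lborel. rho (snd z)) = T"
proof -
  have i: "integrable lborel (indicator {0..T} :: real \<Rightarrow> real)"
    by (rule integrable_real_indicator) (simp_all add: emeasure_lborel_Icc_eq)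
  have v: "(LINT t|lborel. (indicator {0..T} t :: real)) = T"
    unfolding Bochner_Integration.integral_indicator using less_imp_le[OF T] by simp
  show "set_integrable lborel (slab T) (\<lambda>z. rho (snd z))"
    unfolding set_integrable_def indicator_slab real_scaleR_def by (rule product_integrable(1)[OF i rho_integral(1)])
  show "(LINT z:slab T|lborel. rho (snd z)) = T"
    unfolding set_lebesgue_integral_def indicator_slab real_scaleR_def
    by (subst product_integrable(2)[OF i rho_integral(1)]) (simp only: v rho_integral mult_1_right)
qed

lemma slab_Cc:
  assumes "Cc zeta" "\<And>z. z \<in> slab T \<Longrightarrow> zeta z = h z"
  shows "set_integrable lborel (slab T) h"
proof -
  have "integrable lborel (\<lambda>z. indicator (slab T) z *\<^sub>R zeta z)"
    using integrable_mult_indicator[OF _ Cc_integrable[OF assms(1)], of "slab T"] by simp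
  moreover have "(\<lambda>z. indicator (slab T) z *\<^sub>R zeta z) = (\<lambda>z. indicator (slab T) z *\<^sub>R h z)"
    using assms(2) by (auto simp: indicator_def)
  ultimately show ?thesis by (simp add: set_integrable_def)
qed

end

context moment_data
begin

section \<open>The bound on the density\<close>

lemma vavg_sum:
  fixes psi :: "nat \<Rightarrow> 'd phase \<Rightarrow> real"
  assumes "\<And>k. test_function UNIV (psi k)"
  shows "vavg (\<lambda>z. \<Sum>k<n. c k * psi k z) x = (\<Sum>k<n. c k * vavg (psi k) x)"
  unfolding vavg_def using admissible_int[OF test_admissible[OF assms]]
  by (simp add: Bochner_Integration.integral_sum)

lemma defect_measurable:
  fixes h :: "'d spacetime \<times> (real ^ 'd) \<Rightarrow> real"
  assumes "continuous_on UNIV h"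
  shows "(\<lambda>z. \<integral>\<^sup>+v. ennreal ((h (z, v))\<^sup>2 / f_inf (snd z, v)) \<partial>lborel) \<in> borel_measurable borel"
proof -
  have nz: "f_inf z \<noteq> 0" for z using f_inf_pos[of z] by simp
  have "continuous_on UNIV (\<lambda>y :: 'd spacetime \<times> (real ^ 'd). (h y)\<^sup>2 / f_inf (snd (fst y), snd y))"
    using nz by (intro continuous_intros assms continuous_on_compose2[OF f_inf_cont]) auto
  from borel_measurable_continuous_onI[OF this]
  have "(\<lambda>y. ennreal ((h y)\<^sup>2 / f_inf (snd (fst y), snd y))) \<in> borel_measurable (borel :: ('d spacetime \<times> (real ^ 'd)) measure)"
    by simp
  from borel_measurable_pair_lborel[OF this]
  have "(\<lambda>(z, v). ennreal ((h (z, v))\<^sup>2 / f_inf (snd z, v))) \<in> borel_measurable (borel \<Otimes>\<^sub>M (lborel :: (real ^ 'd) measure))"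
    by (simp add: split_beta')
  then show ?thesis by (rule lborel.borel_measurable_nn_integral)
qed

text \<open>With g = r - m rho, div F = g and u = r / rho, the quantity X, the integral of g^2 /
  rho, equals that of u div F, since g has mean zero. By \<open>Kf_f_inf\<close> this is the pairing
  of the kernel with u f_inf, and by \<open>weak_balance\<close> it is minus the pairings with f - u
  f_inf and with the residual. Young's inequality bounds those by the energy of \<open>F\<close>,
  which spatial coercivity bounds by X, plus the defect and the residual.\<close>

lemma spacetime_estimate:
  fixes psi :: "nat \<Rightarrow> 'd phase \<Rightarrow> real" and p p' :: "nat \<Rightarrow> real \<Rightarrow> real" and n :: nat
  assumes sc: "spatial_coercivity G f_inf T lambda2"
    and psi: "\<And>k. test_function UNIV (psi k)"
    and p: "\<And>k t. (p k has_real_derivative p' k t) (at t)" "\<And>k. continuous_on UNIV (p' k)"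
  defines "f \<equiv> \<lambda>t z. \<Sum>k<n. p k t * psi k z"
    and "R \<equiv> \<lambda>t z. (\<Sum>k<n. p' k t * psi k z) - (\<Sum>k<n. p k t * A (psi k) z)"
  defines "m \<equiv> (LINT z:slab T|lborel. vavg (f (fst z)) (snd z)) / T"
  assumes Q: "(\<integral>\<^sup>+z\<in>slab T. (velocity_defect f_inf (snd z) (\<lambda>v. f (fst z) (snd z, v)) +
      (\<integral>\<^sup>+v. ennreal ((R (fst z) (snd z, v))\<^sup>2 / f_inf (snd z, v)) \<partial>lborel)) \<partial>lborel) \<le> ennreal Qr" "0 \<le> Qr"
  shows "set_integrable lborel (slab T) (\<lambda>z. (vavg (f (fst z)) (snd z))\<^sup>2 / rho (snd z))"
    and "(LINT z:slab T|lborel. (vavg (f (fst z)) (snd z))\<^sup>2 / rho (snd z)) - T * m\<^sup>2 \<le> 2 * cK * max lambda2 1 * Qr"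
proof -
  have T: "0 < T" using sc by (simp add: spatial_coercivity_def)
  have pc: "continuous_on UNIV (p k)" for k
    using DERIV_isCont[OF p(1)] by (auto intro: continuous_at_imp_continuous_on)
  have slabD: "tcut T (fst z) = 1" if "z \<in> slab T" for z :: "'d spacetime"
    using that by (cases z) (auto simp: slab_def tcut_props)
  have rnz: "rho x \<noteq> 0" and rp: "0 < rho x" for x using rho_pos[of x] by auto
  have fnz: "f_inf z \<noteq> 0" for z using f_inf_pos[of z] by simp
  have rc: "continuous_on UNIV (\<lambda>z :: 'd spacetime. rho (snd z))"
    by (rule continuous_on_compose2[OF rho_cont]) (auto intro!: continuous_intros)
  have Cv: "Cc (vavg (psi k))" for k by (rule Cc_vavg[OF test_function_Cc[OF psi]])
  define r where "r z = vavg (f (fst z)) (snd z)" for z :: "'d spacetime"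
  have r: "r z = (\<Sum>k<n. p k (fst z) * vavg (psi k) (snd z))" for z
    unfolding r_def f_def by (rule vavg_sum[OF psi])
  have rcont: "continuous_on UNIV r" unfolding r[abs_def]
    by (intro continuous_intros continuous_on_compose2[OF pc] continuous_on_compose2[OF Cc_continuous[OF Cv]]) auto
  define rt where "rt z = (\<Sum>k<n. (tcut T (fst z) * p k (fst z)) * vavg (psi k) (snd z))" for z :: "'d spacetime"
  have rtC: "Cc rt" unfolding rt_def[abs_def] by (intro Cc_sum spacetime_Cc pc Cv)
  have rt: "rt z = r z" if "z \<in> slab T" for z using slabD[OF that] by (simp add: rt_def r)
  have ri: "set_integrable lborel (slab T) r" by (rule slab_Cc[OF rtC rt])
  have r2i: "set_integrable lborel (slab T) (\<lambda>z. (r z)\<^sup>2 / rho (snd z))"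
  proof (rule slab_Cc)
    show "Cc (\<lambda>z. rt z * rt z / rho (snd z))"
      by (rule Cc_divide[OF Cc_supported_mult(1)[OF rtC Cc_continuous[OF rtC]] rc rnz])
  qed (simp add: rt power2_eq_square)
  then show "set_integrable lborel (slab T) (\<lambda>z. (vavg (f (fst z)) (snd z))\<^sup>2 / rho (snd z))"
    by (simp add: r_def)
  note sr = slab_rho[OF T]
  have m: "(LINT z:slab T|lborel. r z) = m * T" using T by (simp add: m_def r_def)
  \<comment> \<open>As rho has mass 1, its integral over the slab is T, so subtracting m rho makes
    the mean zero, as spatial coercivity demands.\<close>
  define g where "g z = r z - m * rho (snd z)" for z
  have gcont: "continuous_on UNIV g" unfolding g_def[abs_def] by (intro continuous_intros rcont rc)
  have mri: "set_integrable lborel (slab T) (\<lambda>z. m * rho (snd z))" using sr(1) by (rule set_integrable_mult_right)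
  have gi: "set_integrable lborel (slab T) g" unfolding g_def by (rule set_integral_diff(1)[OF ri mri])
  have g0: "(LINT z:slab T|lborel. g z) = 0"
    unfolding g_def using set_integral_diff(2)[OF ri mri] m sr(2) by simp
  have g2: "(g z)\<^sup>2 / rho (snd z) = (r z)\<^sup>2 / rho (snd z) - (2 * m) * r z + m * (m * rho (snd z))" for z
    using rnz[of "snd z"] by (simp add: g_def power2_eq_square field_simps)
  have i2: "set_integrable lborel (slab T) (\<lambda>z. (2 * m) * r z)" "set_integrable lborel (slab T) (\<lambda>z. m * (m * rho (snd z)))"
    using ri mri by (auto intro: set_integrable_mult_right)
  have g2i: "set_integrable lborel (slab T) (\<lambda>z. (g z)\<^sup>2 / rho (snd z))"
    unfolding g2 by (intro set_integral_add(1) set_integral_diff(1) r2i i2)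
  define X where "X = (LINT z:slab T|lborel. (g z)\<^sup>2 / rho (snd z))"
  have X: "X = (LINT z:slab T|lborel. (r z)\<^sup>2 / rho (snd z)) - T * m\<^sup>2"
  proof -
    have "X = (LINT z:slab T|lborel. (r z)\<^sup>2 / rho (snd z)) - (2 * m) * (LINT z:slab T|lborel. r z) + m * (m * (LINT z:slab T|lborel. rho (snd z)))"
      unfolding X_def g2 using set_integral_add(2)[OF set_integral_diff(1)[OF r2i i2(1)] i2(2)] set_integral_diff(2)[OF r2i i2(1)]
      by simp
    then show ?thesis using m sr(2) by (simp add: power2_eq_square algebra_simps)
  qed
  have X0: "0 \<le> X" unfolding X_def set_lebesgue_integral_def
    using rp by (intro Bochner_Integration.integral_nonneg) (auto simp: less_imp_le)
  have Xnn: "(\<integral>\<^sup>+z\<in>slab T. ennreal ((g z)\<^sup>2 / rho (snd z)) \<partial>lborel) = ennreal X"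
  proof -
    have "(\<integral>\<^sup>+z\<in>slab T. ennreal ((g z)\<^sup>2 / rho (snd z)) \<partial>lborel) = (\<integral>\<^sup>+z. ennreal (indicator (slab T) z *\<^sub>R ((g z)\<^sup>2 / rho (snd z))) \<partial>lborel)"
      by (intro nn_integral_cong) (simp add: indicator_def)
    also have "\<dots> = ennreal X" unfolding X_def set_lebesgue_integral_def
      using g2i rp by (intro nn_integral_eq_integral) (auto simp: set_integrable_def less_imp_le)
    finally show ?thesis .
  qed
  have gm: "g \<in> borel_measurable borel" by (rule borel_measurable_continuous_onI[OF gcont])
  have fin: "(\<integral>\<^sup>+z\<in>slab T. ennreal ((g z)\<^sup>2 / rho (snd z)) \<partial>lborel) < \<infinity>" unfolding Xnn by simp
  have "\<exists>(F :: 'd spacetime \<Rightarrow> 'd spacetime) D. has_weak_gradient_on F D ({0<..<T} \<times> UNIV) \<and>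
      (AE z in lborel. z \<in> slab T \<longrightarrow> (\<Sum>b\<in>Basis. D z b \<bullet> b) = g z) \<and> has_time_traces T F D (\<lambda>_. 0) (\<lambda>_. 0) \<and>
      (\<integral>\<^sup>+z\<in>slab T. ennreal (((norm (F z))\<^sup>2 * spatial_weight G f_inf (snd z) + (\<Sum>b\<in>Basis. (norm (D z b))\<^sup>2))
          / rho (snd z)) \<partial>lborel) \<le> ennreal lambda2 * (\<integral>\<^sup>+z\<in>slab T. ennreal ((g z)\<^sup>2 / rho (snd z)) \<partial>lborel)"
    by (rule sc[unfolded spatial_coercivity_def, THEN conjunct2, rule_format]) (intro conjI gm fin g0)
  then obtain F :: "'d spacetime \<Rightarrow> 'd spacetime" and D where
    W: "has_weak_gradient_on F D ({0<..<T} \<times> UNIV)" and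
    dv: "AE z in lborel. z \<in> slab T \<longrightarrow> (\<Sum>b\<in>Basis. D z b \<bullet> b) = g z" and
    tr: "has_time_traces T F D (\<lambda>_. 0) (\<lambda>_. 0)" and
    E: "(\<integral>\<^sup>+z\<in>slab T. ennreal (((norm (F z))\<^sup>2 * spatial_weight G f_inf (snd z) + (\<Sum>b\<in>Basis. (norm (D z b))\<^sup>2))
          / rho (snd z)) \<partial>lborel) \<le> ennreal lambda2 * ennreal X"
    unfolding Xnn by blast
  have Fm [measurable]: "F \<in> borel_measurable borel" using W by (simp add: has_weak_gradient_on_def)
  have Dm [measurable]: "b \<in> Basis \<Longrightarrow> (\<lambda>z. D z b) \<in> borel_measurable borel" for b
    using W by (simp add: has_weak_gradient_on_def)
  have [measurable]: "(\<lambda>z :: 'd spacetime. rho (snd z)) \<in> borel_measurable borel" by (rule borel_measurable_continuous_onI[OF rc])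
  have [measurable]: "(\<lambda>z :: 'd spacetime. spatial_weight G f_inf (snd z)) \<in> borel_measurable borel"
    by (rule measurable_compose[OF borel_measurable_continuous_onI[OF continuous_on_snd[OF continuous_on_id]] spatial_weight_measurable])
  define en where "en z = ((norm (F z))\<^sup>2 * spatial_weight G f_inf (snd z) + (\<Sum>b\<in>Basis. (norm (D z b))\<^sup>2)) / rho (snd z)" for z
  have [measurable]: "en \<in> borel_measurable borel" unfolding en_def[abs_def] by measurable
  have w1: "1 \<le> spatial_weight G f_inf x" for x using W_nonneg[of x] rp[of x] by (simp add: weight_eq)
  have en0: "0 \<le> en z" for z unfolding en_def using w1[of "snd z"] rp[of "snd z"]
    by (intro divide_nonneg_pos add_nonneg_nonneg mult_nonneg_nonneg sum_nonneg) auto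
  \<comment> \<open>No sign of \<open>lambda2\<close> is assumed; the maximum with 1 gives a
    positive constant, by which th can be defined.\<close>
  have E': "(\<integral>\<^sup>+z\<in>slab T. ennreal (en z) \<partial>lborel) \<le> ennreal (max lambda2 1) * ennreal X"
    using order_trans[OF E mult_right_mono[of "ennreal lambda2" "ennreal (max lambda2 1)" "ennreal X"]]
    unfolding en_def by (simp add: ennreal_leI)
  have eni: "integrable lborel (\<lambda>z. indicator (slab T) z * en z)"
  proof (rule integrableI_nonneg)
    have "(\<integral>\<^sup>+z. ennreal (indicator (slab T) z * en z) \<partial>lborel) = (\<integral>\<^sup>+z\<in>slab T. ennreal (en z) \<partial>lborel)"
      by (intro nn_integral_cong) (simp add: indicator_def)
    also have "\<dots> \<le> ennreal (max lambda2 1) * ennreal X" by (rule E')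
    also have "\<dots> < \<infinity>" by (simp add: ennreal_mult_less_top)
    finally show "(\<integral>\<^sup>+z. ennreal (indicator (slab T) z * en z) \<partial>lborel) < \<infinity>" .
  qed (use en0 in auto)
  \<comment> \<open>Used with s = rho: square integrability against 1 / rho implies integrability
    over the slab, because rho itself is integrable there.\<close>
  have small: "a \<le> a\<^sup>2 / s + s" if "0 < s" for a s :: real
  proof -
    have "0 \<le> (a - s)\<^sup>2 + a\<^sup>2 + s\<^sup>2" by simp
    then have "a * s \<le> a\<^sup>2 + s * s" by (simp add: power2_eq_square algebra_simps)
    then show ?thesis using that by (simp add: field_simps power2_eq_square)
  qed
  have dom: "set_integrable lborel (slab T) H" if Hm: "H \<in> borel_measurable borel"
    and le: "\<And>z. (norm (H z))\<^sup>2 / rho (snd z) \<le> en z" for H :: "'d spacetime \<Rightarrow> 'd spacetime"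
    unfolding set_integrable_def
  proof (rule Bochner_Integration.integrable_bound)
    show "integrable lborel (\<lambda>z. indicator (slab T) z * en z + indicator (slab T) z *\<^sub>R rho (snd z))"
      using eni sr(1) unfolding set_integrable_def by (rule Bochner_Integration.integrable_add)
    show "(\<lambda>z. indicator (slab T) z *\<^sub>R H z) \<in> borel_measurable lborel" using Hm by simp
    have "norm (H z) \<le> en z + rho (snd z)" for z
      using small[OF rp, of "norm (H z)" "snd z"] le[of z] by linarith
    then show "AE z in lborel. norm (indicator (slab T) z *\<^sub>R H z) \<le> norm (indicator (slab T) z * en z + indicator (slab T) z *\<^sub>R rho (snd z))"
      by (intro AE_I2) (auto simp: indicator_def intro: order_trans[OF _ abs_ge_self])
  qed
  have Fi: "set_integrable lborel (slab T) F"
  proof (rule dom[OF Fm])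
    fix z
    have "(norm (F z))\<^sup>2 * 1 \<le> (norm (F z))\<^sup>2 * spatial_weight G f_inf (snd z)" using w1 by (intro mult_left_mono) auto
    moreover have "0 \<le> (\<Sum>b\<in>(Basis :: 'd spacetime set). (norm (D z b))\<^sup>2)" by (intro sum_nonneg) auto
    ultimately have "(norm (F z))\<^sup>2 \<le> (norm (F z))\<^sup>2 * spatial_weight G f_inf (snd z) + (\<Sum>b\<in>Basis. (norm (D z b))\<^sup>2)" by linarith
    then show "(norm (F z))\<^sup>2 / rho (snd z) \<le> en z" unfolding en_def using rp by (intro divide_right_mono) (auto simp: less_imp_le)
  qed
  have Di: "set_integrable lborel (slab T) (\<lambda>z. D z j)" if j: "j \<in> Basis" for j
  proof (rule dom[OF Dm[OF j]])
    fix z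
    have "(norm (D z j))\<^sup>2 \<le> (\<Sum>b\<in>Basis. (norm (D z b))\<^sup>2)" using j by (intro member_le_sum) auto
    moreover have "0 \<le> (norm (F z))\<^sup>2 * spatial_weight G f_inf (snd z)" using w1[of "snd z"] by simp
    ultimately have "(norm (D z j))\<^sup>2 \<le> (norm (F z))\<^sup>2 * spatial_weight G f_inf (snd z) + (\<Sum>b\<in>Basis. (norm (D z b))\<^sup>2)" by linarith
    then show "(norm (D z j))\<^sup>2 / rho (snd z) \<le> en z" unfolding en_def using rp by (intro divide_right_mono) (auto simp: less_imp_le)
  qed
  define y1 where "y1 z = (LINT v|lborel. Kf (F z) (D z) (snd z) v * f (fst z) (snd z, v))" for z
  define y2 where "y2 z = (LINT v|lborel. Kr (F z) (snd z) v * R (fst z) (snd z, v))" for z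
  have KR: "integrable lborel (\<lambda>v. Kr F' x v * psi k (x, v))" "integrable lborel (\<lambda>v. Kr F' x v * A (psi k) (x, v))" for F' x k
    by (rule Kr_pair(1), rule v_mom_integrable[OF vtest_C1(5)], rule Cc_continuous[OF test_function_Cc[OF psi]])
      (rule Kr_pair(1), rule v_mom_integrable[OF vtest_C1(5)], rule A_cont[OF psi])
  have y12: "y1 z + y2 z = (\<Sum>k<n. p k (fst z) * (LINT v|lborel. Kf (F z) (D z) (snd z) v * psi k (snd z, v)) +
      (LINT v|lborel. Kr (F z) (snd z) v * (p' k (fst z) * psi k (snd z, v) - p k (fst z) * A (psi k) (snd z, v))))" for z
  proof -
    have "y1 z = (\<Sum>k<n. p k (fst z) * (LINT v|lborel. Kf (F z) (D z) (snd z) v * psi k (snd z, v)))"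
    proof -
      have "Kf (F z) (D z) (snd z) v * f (fst z) (snd z, v) = (\<Sum>k<n. p k (fst z) * (Kf (F z) (D z) (snd z) v * psi k (snd z, v)))" for v
        by (simp add: f_def sum_distrib_left mult.left_commute)
      then show ?thesis unfolding y1_def using Kf_pair(1)[OF test_admissible[OF psi]]
        by (simp add: Bochner_Integration.integral_sum)
    qed
    moreover have "y2 z = (\<Sum>k<n. LINT v|lborel. Kr (F z) (snd z) v * (p' k (fst z) * psi k (snd z, v) - p k (fst z) * A (psi k) (snd z, v)))"
    proof -
      have e: "Kr (F z) (snd z) v * (p' k (fst z) * psi k (snd z, v) - p k (fst z) * A (psi k) (snd z, v)) =
          p' k (fst z) * (Kr (F z) (snd z) v * psi k (snd z, v)) - p k (fst z) * (Kr (F z) (snd z) v * A (psi k) (snd z, v))" for k v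
        by (simp add: algebra_simps)
      have "Kr (F z) (snd z) v * R (fst z) (snd z, v) =
          (\<Sum>k<n. Kr (F z) (snd z) v * (p' k (fst z) * psi k (snd z, v) - p k (fst z) * A (psi k) (snd z, v)))" for v
        by (simp add: R_def sum_distrib_left sum_subtractf right_diff_distrib)
      then have "y2 z = (LINT v|lborel. (\<Sum>k<n. Kr (F z) (snd z) v * (p' k (fst z) * psi k (snd z, v) - p k (fst z) * A (psi k) (snd z, v))))"
        by (simp add: y2_def)
      also have "\<dots> = (\<Sum>k<n. LINT v|lborel. Kr (F z) (snd z) v * (p' k (fst z) * psi k (snd z, v) - p k (fst z) * A (psi k) (snd z, v)))"
        by (rule Bochner_Integration.integral_sum) (use KR in \<open>simp add: e\<close>)
      finally show ?thesis .
    qed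
    ultimately show ?thesis by (simp add: sum.distrib)
  qed
  define q where "q k z = p k (fst z) * (LINT v|lborel. Kf (F z) (D z) (snd z) v * psi k (snd z, v)) +
      (LINT v|lborel. Kr (F z) (snd z) v * (p' k (fst z) * psi k (snd z, v) - p k (fst z) * A (psi k) (snd z, v)))" for k z
  note wb = weak_balance[OF W tr T Fi Di psi p, unfolded set_integrable_def set_lebesgue_integral_def]
  have q: "integrable lborel (\<lambda>z. indicator (slab T) z *\<^sub>R q k z)" "(LINT z|lborel. indicator (slab T) z *\<^sub>R q k z) = 0" for k
    unfolding q_def by (rule wb(1), assumption) (rule wb(2), assumption)
  have y12': "y1 z + y2 z = (\<Sum>k<n. q k z)" for z unfolding q_def by (rule y12)
  have y: "set_integrable lborel (slab T) (\<lambda>z. y1 z + y2 z)" "(LINT z:slab T|lborel. y1 z + y2 z) = 0"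
    unfolding y12' set_integrable_def set_lebesgue_integral_def scaleR_sum_right
    by (intro Bochner_Integration.integrable_sum q(1))
      (subst Bochner_Integration.integral_sum, rule q(1), simp only: q(2) sum.neutral_const)
  define u where "u z = r z / rho (snd z)" for z
  define fp where "fp z v = f (fst z) (snd z, v) - r z * f_inf (snd z, v) / rho (snd z)" for z v
  have f_adm: "test_function UNIV (f t)" for t unfolding f_def by (intro test_function_sum psi)
  define yp where "yp z = (LINT v|lborel. Kf (F z) (D z) (snd z) v * fp z v)" for z
  \<comment> \<open>The splitting of f into its local equilibrium u f_inf and the defect
    \<open>fp\<close>; on the first part the kernel gives u div F.\<close>
  have y1: "y1 z = yp z + u z * (\<Sum>j\<in>Basis. D z j \<bullet> j)" for z
  proof -
    have "Kf (F z) (D z) (snd z) v * fp z v = Kf (F z) (D z) (snd z) v * f (fst z) (snd z, v) - u z * (Kf (F z) (D z) (snd z) v * f_inf (snd z, v))" for v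
      by (simp add: fp_def u_def algebra_simps)
    then have "yp z = y1 z - u z * (LINT v|lborel. Kf (F z) (D z) (snd z) v * f_inf (snd z, v))"
      unfolding yp_def y1_def using Kf_pair(1)[OF test_admissible[OF f_adm]] Kf_pair(1)[OF f_inf_admissible] by simp
    then show ?thesis by (simp add: Kf_f_inf)
  qed
  have uC: "Cc (\<lambda>z. rt z / rho (snd z))" by (rule Cc_divide[OF rtC rc rnz])
  have udi: "set_integrable lborel (slab T) (\<lambda>z. u z * (\<Sum>j\<in>Basis. D z j \<bullet> j))"
  proof -
    have "integrable lborel (\<lambda>z. \<Sum>j\<in>Basis. (indicator (slab T) z *\<^sub>R ((rt z / rho (snd z)) *\<^sub>R D z j)) \<bullet> j)"
      using set_integrable_Cc_scaleR[OF Di uC] unfolding set_integrable_def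
      by (intro Bochner_Integration.integrable_sum integrable_inner_left) auto
    moreover have "(\<lambda>z. \<Sum>j\<in>Basis. (indicator (slab T) z *\<^sub>R ((rt z / rho (snd z)) *\<^sub>R D z j)) \<bullet> j) =
        (\<lambda>z. indicator (slab T) z *\<^sub>R (u z * (\<Sum>j\<in>Basis. D z j \<bullet> j)))"
      using rt by (auto simp: indicator_def u_def sum_distrib_left)
    ultimately show ?thesis by (simp add: set_integrable_def)
  qed
  define Y where "Y z = yp z + y2 z" for z
  have Yeq: "Y z = (y1 z + y2 z) - u z * (\<Sum>j\<in>Basis. D z j \<bullet> j)" for z by (simp add: Y_def y1)
  have Yi: "set_integrable lborel (slab T) Y" unfolding Yeq[abs_def] by (rule set_integral_diff(1)[OF y(1) udi])
  have Yv: "(LINT z:slab T|lborel. Y z) = - (LINT z:slab T|lborel. u z * (\<Sum>j\<in>Basis. D z j \<bullet> j))"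
    unfolding Yeq using set_integral_diff(2)[OF y(1) udi] y(2) by simp
  \<comment> \<open>Since u = g / rho + m, one has u g = g^2 / rho + m g, and the second term
    integrates to 0.\<close>
  have "(LINT z:slab T|lborel. u z * (\<Sum>j\<in>Basis. D z j \<bullet> j)) = (LINT z:slab T|lborel. g z * g z / rho (snd z) + m * g z)"
    unfolding set_lebesgue_integral_def
  proof (rule integral_cong_AE)
    show "(\<lambda>z. indicator (slab T) z *\<^sub>R (u z * (\<Sum>j\<in>Basis. D z j \<bullet> j))) \<in> borel_measurable lborel"
      using udi unfolding set_integrable_def by (rule borel_measurable_integrable)
    show "(\<lambda>z. indicator (slab T) z *\<^sub>R (g z * g z / rho (snd z) + m * g z)) \<in> borel_measurable lborel"
      using gm by measurable
    show "AE z in lborel. indicator (slab T) z *\<^sub>R (u z * (\<Sum>j\<in>Basis. D z j \<bullet> j)) =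
        indicator (slab T) z *\<^sub>R (g z * g z / rho (snd z) + m * g z)"
      using dv
    proof eventually_elim
      case (elim z)
      have "u z * g z = g z * g z / rho (snd z) + m * g z"
        using rnz[of "snd z"] by (simp add: u_def g_def field_simps)
      then show ?case using elim by (auto simp: indicator_def)
    qed
  qed
  also have "\<dots> = X"
  proof -
    have a: "set_integrable lborel (slab T) (\<lambda>z. g z * g z / rho (snd z))" using g2i by (simp add: power2_eq_square)
    have b: "set_integrable lborel (slab T) (\<lambda>z. m * g z)" using gi by (rule set_integrable_mult_right)
    show ?thesis using set_integral_add(2)[OF a b] g0 by (simp add: X_def power2_eq_square)
  qed
  finally have XY: "X = - (LINT z:slab T|lborel. Y z)" using Yv by simp
  define La where "La = max lambda2 1"
  \<comment> \<open>This value makes the contribution of the energy of \<open>F\<close> equal to X /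
    2, which is absorbed on the left.\<close>
  define th where "th = 1 / (4 * cK * La)"
  have La: "1 \<le> La" by (simp add: La_def)
  have th: "0 < th" using cK_pos La by (simp add: th_def)
  define a2 where "a2 z = velocity_defect f_inf (snd z) (\<lambda>v. f (fst z) (snd z, v))" for z :: "'d spacetime"
  define b2 where "b2 z = (\<integral>\<^sup>+v. ennreal ((R (fst z) (snd z, v))\<^sup>2 / f_inf (snd z, v)) \<partial>lborel)" for z :: "'d spacetime"
  have a2: "a2 z = (\<integral>\<^sup>+v. ennreal ((fp z v)\<^sup>2 / f_inf (snd z, v)) \<partial>lborel)" for z
    by (simp add: a2_def velocity_defect_def fp_def r_def vavg_def)
  have fpc: "continuous_on UNIV (\<lambda>y :: 'd spacetime \<times> (real ^ 'd). fp (fst y) (snd y))"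
    unfolding fp_def f_def
    by (intro continuous_intros continuous_on_compose2[OF pc] continuous_on_compose2[OF Cc_continuous[OF test_function_Cc[OF psi]]]
        continuous_on_compose2[OF rcont] continuous_on_compose2[OF f_inf_cont] continuous_on_compose2[OF rho_cont]) (use rnz in auto)
  have Rc: "continuous_on UNIV (\<lambda>y :: 'd spacetime \<times> (real ^ 'd). R (fst (fst y)) (snd (fst y), snd y))"
    unfolding R_def
    by (intro continuous_intros continuous_on_compose2[OF pc] continuous_on_compose2[OF p(2)]
        continuous_on_compose2[OF Cc_continuous[OF test_function_Cc[OF psi]]]
        continuous_on_compose2[OF A_cont[OF psi]]) auto
  have [measurable]: "a2 \<in> borel_measurable borel" unfolding a2[abs_def] using defect_measurable[OF fpc] by simp
  have [measurable]: "b2 \<in> borel_measurable borel" unfolding b2_def[abs_def] using defect_measurable[OF Rc] by simp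
  have Yb: "ennreal \<bar>Y z\<bar> \<le> ennreal (2 * th * cK) * ennreal (en z) + ennreal (1 / (4 * th)) * (a2 z + b2 z)" for z
  proof -
    have fm: "(\<lambda>v. f_inf (snd z, v)) \<in> borel_measurable borel"
      by (rule borel_measurable_continuous_onI[OF continuous_slice[OF f_inf_cont]])
    have fpm: "fp z \<in> borel_measurable borel"
      using borel_measurable_continuous_onI[OF continuous_slice[OF fpc, of z]] by simp
    have Rm: "(\<lambda>v. R (fst z) (snd z, v)) \<in> borel_measurable borel"
      using borel_measurable_continuous_onI[OF continuous_slice[OF Rc, of z]] by simp
    have "ennreal \<bar>Y z\<bar> \<le> ennreal \<bar>yp z\<bar> + ennreal \<bar>y2 z\<bar>"
      unfolding Y_def ennreal_plus[OF abs_ge_zero abs_ge_zero, symmetric] by (intro ennreal_leI) linarith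
    also have "\<dots> \<le> (ennreal (th * (cK * en z)) + ennreal (1 / (4 * th)) * a2 z) + (ennreal (th * (cK * en z)) + ennreal (1 / (4 * th)) * b2 z)"
    proof (rule add_mono)
      have "ennreal \<bar>yp z\<bar> \<le> ennreal (th * (LINT v|lborel. (Kf (F z) (D z) (snd z) v)\<^sup>2 * f_inf (snd z, v))) + ennreal (1 / (4 * th)) * a2 z"
        unfolding yp_def a2
        by (rule Young_integral[OF borel_measurable_continuous_onI[OF Kf_cont] fpm fm f_inf_pos Kf_square(1) th])
      also have "\<dots> \<le> ennreal (th * (cK * en z)) + ennreal (1 / (4 * th)) * a2 z"
        using Kf_square(2)[of "F z" "D z" "snd z"] th unfolding en_def
        by (intro add_right_mono ennreal_leI mult_left_mono) auto
      finally show "ennreal \<bar>yp z\<bar> \<le> ennreal (th * (cK * en z)) + ennreal (1 / (4 * th)) * a2 z" .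
      have "ennreal \<bar>y2 z\<bar> \<le> ennreal (th * (LINT v|lborel. (Kr (F z) (snd z) v)\<^sup>2 * f_inf (snd z, v))) + ennreal (1 / (4 * th)) * b2 z"
        unfolding y2_def b2_def
        by (rule Young_integral[OF borel_measurable_continuous_onI[OF Kr_cont] Rm fm f_inf_pos Kr_square(1) th])
      also have "\<dots> \<le> ennreal (th * (cK * en z)) + ennreal (1 / (4 * th)) * b2 z"
      proof (intro add_right_mono ennreal_leI mult_left_mono)
        have "(norm (F z))\<^sup>2 * spatial_weight G f_inf (snd z) / rho (snd z) \<le> en z"
          unfolding en_def using rp[of "snd z"] by (intro divide_right_mono) (auto intro: sum_nonneg)
        then have "cK * ((norm (F z))\<^sup>2 * spatial_weight G f_inf (snd z) / rho (snd z)) \<le> cK * en z"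
          using cK_pos by (intro mult_left_mono) auto
        then show "(LINT v|lborel. (Kr (F z) (snd z) v)\<^sup>2 * f_inf (snd z, v)) \<le> cK * en z"
          using Kr_square(2)[of "F z" "snd z"] by linarith
      qed (use th in auto)
      finally show "ennreal \<bar>y2 z\<bar> \<le> ennreal (th * (cK * en z)) + ennreal (1 / (4 * th)) * b2 z" .
    qed
    also have "\<dots> = (ennreal (th * (cK * en z)) + ennreal (th * (cK * en z))) + ennreal (1 / (4 * th)) * (a2 z + b2 z)"
      by (simp add: distrib_left distrib_right ac_simps)
    also have "ennreal (th * (cK * en z)) + ennreal (th * (cK * en z)) = ennreal (2 * th * cK) * ennreal (en z)"
      using th cK_pos en0[of z] by (simp flip: ennreal_plus ennreal_mult')
    finally show ?thesis .
  qed
  have "ennreal X \<le> ennreal \<bar>LINT z:slab T|lborel. Y z\<bar>" unfolding XY by (intro ennreal_leI) simp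
  also have "\<dots> \<le> (\<integral>\<^sup>+z. ennreal (norm (indicator (slab T) z *\<^sub>R Y z)) \<partial>lborel)"
    using integral_norm_bound_ennreal[OF Yi[unfolded set_integrable_def]] by (simp add: set_lebesgue_integral_def)
  also have "\<dots> \<le> (\<integral>\<^sup>+z. ennreal (2 * th * cK) * (ennreal (en z) * indicator (slab T) z) +
      ennreal (1 / (4 * th)) * ((a2 z + b2 z) * indicator (slab T) z) \<partial>lborel)"
    using Yb by (intro nn_integral_mono) (auto simp: indicator_def)
  also have "\<dots> = ennreal (2 * th * cK) * (\<integral>\<^sup>+z\<in>slab T. ennreal (en z) \<partial>lborel) +
      ennreal (1 / (4 * th)) * (\<integral>\<^sup>+z\<in>slab T. (a2 z + b2 z) \<partial>lborel)"
    by (subst nn_integral_add) (auto simp: nn_integral_cmult)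
  also have "\<dots> \<le> ennreal (2 * th * cK) * (ennreal La * ennreal X) + ennreal (1 / (4 * th)) * ennreal Qr"
    using E' Q(1) unfolding La_def a2_def b2_def by (intro add_mono mult_left_mono) auto
  also have "\<dots> = ennreal (2 * th * cK * (La * X) + 1 / (4 * th) * Qr)"
    using th cK_pos La X0 Q(2) by (simp flip: ennreal_plus ennreal_mult')
  finally have "X \<le> 2 * th * cK * (La * X) + 1 / (4 * th) * Qr"
    using th cK_pos La X0 Q(2) by (subst (asm) ennreal_le_iff) auto
  moreover have "2 * th * cK * (La * X) = X / 2" using cK_pos La by (simp add: th_def)
  moreover have "1 / (4 * th) * Qr = cK * La * Qr" using cK_pos La by (simp add: th_def)
  ultimately have "X \<le> 2 * cK * La * Qr" by simp
  then show "(LINT z:slab T|lborel. (vavg (f (fst z)) (snd z))\<^sup>2 / rho (snd z)) - T * m\<^sup>2 \<le> 2 * cK * max lambda2 1 * Qr"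
    unfolding X La_def r_def .
qed

end

section \<open>Splines close to orbits\<close>

lemma nn_integral_slab:
  fixes k :: "real \<times> (real ^ 'd::finite) \<Rightarrow> ennreal"
  assumes [measurable]: "k \<in> borel_measurable borel"
  shows "(\<integral>\<^sup>+z\<in>slab T. k z \<partial>lborel) = (\<integral>\<^sup>+t\<in>{0..T}. (\<integral>\<^sup>+x. k (t, x) \<partial>lborel) \<partial>lborel)"
proof -
  have m: "(\<lambda>z. k z * indicator (slab T) z) \<in> borel_measurable (lborel \<Otimes>\<^sub>M lborel)"
    unfolding lborel_prod by measurable
  have mk: "(\<lambda>x. k (t, x)) \<in> borel_measurable borel" for t
    by (rule measurable_compose[OF _ assms]) (intro borel_measurable_continuous_onI continuous_intros)
  have "(\<integral>\<^sup>+z\<in>slab T. k z \<partial>lborel) = (\<integral>\<^sup>+t. (\<integral>\<^sup>+x. k (t, x) * indicator (slab T) (t, x) \<partial>lborel) \<partial>lborel)"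
    using lborel.nn_integral_fst[OF m] by (simp add: lborel_prod)
  also have "\<dots> = (\<integral>\<^sup>+t\<in>{0..T}. (\<integral>\<^sup>+x. k (t, x) \<partial>lborel) \<partial>lborel)"
    unfolding indicator_slab fst_conv using mk by (intro nn_integral_cong nn_integral_multc) simp
  finally show ?thesis .
qed

context weighted
begin

lemma ip_sum_sum:
  assumes "\<And>k. \<psi> k \<in> H"
  shows "ip (\<lambda>z. \<Sum>k<n. a k * \<psi> k z) (\<lambda>z. \<Sum>l<n. b l * \<psi> l z) = (\<Sum>k<(n::nat). \<Sum>l<n. a k * b l * ip (\<psi> k) (\<psi> l))"
proof -
  have S: "(\<lambda>z. \<Sum>l<n. b l * \<psi> l z) \<in> H" for b by (intro H_sum H_cmult assms)
  have L: "ip (\<lambda>z. \<Sum>k<n. a k * \<psi> k z) h = (\<Sum>k<n. a k * ip (\<psi> k) h)" if "h \<in> H" for h a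
    by (subst ip_sum_left) (simp_all add: ip_cmult_left H_cmult assms that)
  have "ip (\<psi> k) (\<lambda>z. \<Sum>l<n. b l * \<psi> l z) = (\<Sum>l<n. b l * ip (\<psi> k) (\<psi> l))" for k
    unfolding ip_commute[of "\<psi> k"] by (rule L[OF assms])
  then show ?thesis by (simp add: L[OF S] sum_distrib_left mult.assoc)
qed

end

context kinetic_data
begin

text \<open>Pythagoras in the space with weight dv / f_inf: the defect has zero average, that is, it
  is orthogonal to \<open>f_inf\<close>, and the local equilibrium has squared norm <f>^2 /
  <f_inf>.\<close>

lemma defect_decomposition:
  assumes f: "Cc f"
  shows "(\<integral>\<^sup>+v. ennreal ((f (x, v))\<^sup>2 / f_inf (x, v)) \<partial>lborel) =
    velocity_defect f_inf x (\<lambda>v. f (x, v)) + ennreal ((vavg f x)\<^sup>2 / vavg f_inf x)"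
proof -
  define g where "g v = f (x, v)" for v
  define h where "h v = f_inf (x, v)" for v
  define q where "q = vavg f_inf x"
  define r where "r = vavg f x"
  have q: "0 < q" unfolding q_def by (rule rho_pos)
  have h: "0 < h v" for v unfolding h_def by (rule f_inf_pos)
  have hc: "continuous_on UNIV h" unfolding h_def[abs_def] by (rule continuous_slice[OF f_inf_cont])
  have Cg: "Cc g" unfolding g_def[abs_def] by (rule Cc_slice_phase[OF f])
  have "Cc (\<lambda>v. g v * g v / h v)"
    by (rule Cc_divide[OF Cc_supported_mult(1)[OF Cg Cc_continuous[OF Cg]] hc]) (use h in \<open>simp add: less_imp_neq[symmetric]\<close>)
  then have i1: "integrable lborel (\<lambda>v. (g v)\<^sup>2 / h v)" using Cc_integrable by (simp add: power2_eq_square)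
  have i2: "integrable lborel g" "(LINT v|lborel. g v) = r"
    using Cc_integrable[OF Cg] by (simp_all add: r_def vavg_def g_def)
  have i3: "integrable lborel h" "(LINT v|lborel. h v) = q"
    using admissible_int[OF f_inf_admissible] by (simp_all add: q_def vavg_def h_def[abs_def])
  have e: "(g v - r * h v / q)\<^sup>2 / h v = (g v)\<^sup>2 / h v - 2 * r / q * g v + (r / q)\<^sup>2 * h v" for v
    using h[of v] q by (simp add: power2_eq_square field_simps)
  have i: "integrable lborel (\<lambda>v. (g v - r * h v / q)\<^sup>2 / h v)"
    unfolding e using i1 i2 i3 by (intro Bochner_Integration.integrable_add Bochner_Integration.integrable_diff integrable_mult_right)
  have "(LINT v|lborel. (g v - r * h v / q)\<^sup>2 / h v) = (LINT v|lborel. (g v)\<^sup>2 / h v) - 2 * r / q * r + (r / q)\<^sup>2 * q"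
    unfolding e using i1 i2 i3 by simp
  also have "\<dots> = (LINT v|lborel. (g v)\<^sup>2 / h v) - r\<^sup>2 / q" using q by (simp add: power2_eq_square field_simps)
  finally have v: "(LINT v|lborel. (g v)\<^sup>2 / h v) = (LINT v|lborel. (g v - r * h v / q)\<^sup>2 / h v) + r\<^sup>2 / q" by simp
  have "(\<integral>\<^sup>+v. ennreal ((g v)\<^sup>2 / h v) \<partial>lborel) = ennreal (LINT v|lborel. (g v)\<^sup>2 / h v)"
    using h by (intro nn_integral_eq_integral[OF i1]) (simp add: less_imp_le)
  also have "\<dots> = ennreal (LINT v|lborel. (g v - r * h v / q)\<^sup>2 / h v) + ennreal (r\<^sup>2 / q)"
    unfolding v using h q by (intro ennreal_plus Bochner_Integration.integral_nonneg) (auto simp: less_imp_le)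
  also have "ennreal (LINT v|lborel. (g v - r * h v / q)\<^sup>2 / h v) = (\<integral>\<^sup>+v. ennreal ((g v - r * h v / q)\<^sup>2 / h v) \<partial>lborel)"
    using h by (intro nn_integral_eq_integral[OF i, symmetric]) (simp add: less_imp_le)
  also have "\<dots> = velocity_defect f_inf x (\<lambda>v. f (x, v))"
    by (simp add: velocity_defect_def g_def h_def q_def r_def vavg_def)
  finally show ?thesis by (simp add: g_def h_def q_def r_def)
qed

end

locale kinetic_evolution = moment_data L G M f_inf c_inf c_coll N kap +
    generated_semigroup f_inf S "kinetic_op L G M"
  for L and G :: "'d::finite phase \<Rightarrow> real ^ 'd" and M f_inf c_inf c_coll N kap S +
  fixes lambda1 assumes local_coercivity: "local_coercivity L M f_inf lambda1"
begin

lemma lambda1_pos: "0 < lambda1" using local_coercivity by (cases L) simp_all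

lemma f_inf_H: "f_inf \<in> H" "nrm f_inf = 1" "ip f f_inf = (LINT z|lborel. f z)"
proof -
  have e: "(f_inf z)\<^sup>2 / f_inf z = f_inf z" for z using f_inf_pos[of z] by (simp add: power2_eq_square)
  show "f_inf \<in> H" using f_inf_integrable w_measurable by (simp add: L2_inf_def e)
  show "nrm f_inf = 1" by (simp add: norm_inf_def e f_inf_1)
  have "f z * f_inf z / f_inf z = f z" for z using f_inf_pos[of z] by simp
  then show "ip f f_inf = (LINT z|lborel. f z)" by (simp add: ip_inf_def)
qed

text \<open>The mass is the inner product with the unit vector \<open>f_inf\<close>. It is therefore
  continuous in the norm and passes to limits.\<close>

lemma mass_bound: "f \<in> H \<Longrightarrow> \<bar>LINT z|lborel. f z\<bar> \<le> nrm f"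
  using Cauchy_Schwarz[OF _ f_inf_H(1), of f] by (simp add: f_inf_H)

lemma mass_diff: "f \<in> H \<Longrightarrow> g \<in> H \<Longrightarrow> (LINT z|lborel. f z - g z) = (LINT z|lborel. f z) - (LINT z|lborel. g z)"
  using ip_diff_left[OF _ _ f_inf_H(1), of f g] by (simp add: f_inf_H)

section \<open>Estimates for a single spline\<close>

context
  fixes psi :: "nat \<Rightarrow> 'd phase \<Rightarrow> real" and p p' :: "nat \<Rightarrow> real \<Rightarrow> real" and n :: nat and T \<epsilon> C :: real and f f' R
  assumes psi: "\<And>k. test_function UNIV (psi k)"
    and p: "\<And>k t. (p k has_real_derivative p' k t) (at t)" "\<And>k. continuous_on UNIV (p' k)"
  defines "f \<equiv> \<lambda>t z. \<Sum>k<n. p k t * psi k z" and "f' \<equiv> \<lambda>t z. \<Sum>k<n. p' k t * psi k z"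
    and "R \<equiv> \<lambda>t z. (\<Sum>k<n. p' k t * psi k z) - (\<Sum>k<n. p k t * A (psi k) z)"
  assumes T: "0 < T" and R_le: "\<And>t. t \<in> {0..T} \<Longrightarrow> nrm (R t) \<le> \<epsilon>" and f_le: "\<And>t. t \<in> {0..T} \<Longrightarrow> nrm (f t) \<le> C"
begin

lemma spline_cont: "continuous_on UNIV (p k)"
  using DERIV_isCont[OF p(1)] by (auto intro: continuous_at_imp_continuous_on)

lemma spline_test: "test_function UNIV (f t)" unfolding f_def by (intro test_function_sum psi)

lemma spline_A: "A (f t) = (\<lambda>z. \<Sum>k<n. p k t * A (psi k) z)"
  unfolding f_def by (rule ext) (rule A_sum[OF psi])

lemma spline_H: "psi k \<in> H" "f t \<in> H" "f' t \<in> H" "R t \<in> H" "A (f t) \<in> H"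
proof -
  show p: "psi k \<in> H" for k by (rule test_function_H[OF psi])
  show "f t \<in> H" by (rule test_function_H[OF spline_test])
  show f': "f' t \<in> H" unfolding f'_def by (intro H_sum H_cmult p)
  show A: "A (f t) \<in> H" by (rule A_H[OF spline_test])
  show "R t \<in> H" using H_diff[OF f' A] unfolding R_def f'_def spline_A .
qed

lemma eps_C_nonneg: "0 \<le> \<epsilon>" "0 \<le> C"
  using R_le[of 0] f_le[of 0] nrm_nonneg[of "R 0"] nrm_nonneg[of "f 0"] T by auto

lemma spline_rate: "ip (f' t) (f t) = ip (R t) (f t) + ip (A (f t)) (f t)"
proof -
  have "R t = (\<lambda>z. f' t z - A (f t) z)" by (simp add: R_def f'_def spline_A)
  then show ?thesis using ip_diff_left[OF spline_H(3,5,2)] by simp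
qed

text \<open>The term \<epsilon> C t compensates the residual, whose pairing with the spline is at
  most \<epsilon> C: the derivative of this function is at least the dissipation, hence
  nonnegative.\<close>

definition Lyap :: "real \<Rightarrow> real" where "Lyap t = \<epsilon> * C * t - (nrm (f t))\<^sup>2 / 2"

definition Lyap' :: "real \<Rightarrow> real" where "Lyap' t = \<epsilon> * C - ip (f' t) (f t)"

lemma Lyap_DERIV: "(Lyap has_real_derivative Lyap' t) (at t)"
proof -
  have e: "(nrm (f t))\<^sup>2 = (\<Sum>k<n. \<Sum>l<n. p k t * p l t * ip (psi k) (psi l))" for t
    unfolding nrm_square f_def by (rule ip_sum_sum[OF spline_H(1)])
  have e': "ip (f' t) (f t) = (\<Sum>k<n. \<Sum>l<n. p' k t * p l t * ip (psi k) (psi l))" for t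
    unfolding f_def f'_def by (rule ip_sum_sum[OF spline_H(1)])
  have e'': "ip (f t) (f' t) = (\<Sum>k<n. \<Sum>l<n. p k t * p' l t * ip (psi k) (psi l))" for t
    unfolding f_def f'_def by (rule ip_sum_sum[OF spline_H(1)])
  have "((\<lambda>t. (nrm (f t))\<^sup>2) has_real_derivative
      (\<Sum>k<n. \<Sum>l<n. (p' k t * p l t + p k t * p' l t) * ip (psi k) (psi l))) (at t)"
    unfolding e by (intro DERIV_sum DERIV_cmult_right) (auto intro!: derivative_eq_intros p)
  moreover have "(\<Sum>k<n. \<Sum>l<n. (p' k t * p l t + p k t * p' l t) * ip (psi k) (psi l)) = ip (f' t) (f t) + ip (f t) (f' t)"
    unfolding e' e'' by (simp add: distrib_right sum.distrib)
  ultimately have "((\<lambda>t. (nrm (f t))\<^sup>2) has_real_derivative 2 * ip (f' t) (f t)) (at t)"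
    by (simp add: ip_commute)
  from DERIV_diff[OF DERIV_cmult_Id[of "\<epsilon> * C"] DERIV_cdivide[OF this, of 2]]
  show ?thesis unfolding Lyap_def[abs_def] Lyap'_def by simp
qed

lemma Lyap'_cont: "continuous_on UNIV Lyap'"
proof -
  have e': "ip (f' t) (f t) = (\<Sum>k<n. \<Sum>l<n. p' k t * p l t * ip (psi k) (psi l))" for t
    unfolding f_def f'_def by (rule ip_sum_sum[OF spline_H(1)])
  show ?thesis unfolding Lyap'_def[abs_def] e' by (intro continuous_intros p(2) spline_cont)
qed

lemma Lyap'_dissipation: assumes t: "t \<in> {0..T}" shows "- ip (A (f t)) (f t) \<le> Lyap' t" "0 \<le> Lyap' t"
proof -
  have "\<bar>ip (R t) (f t)\<bar> \<le> nrm (R t) * nrm (f t)" by (rule Cauchy_Schwarz[OF spline_H(4,2)])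
  also have "\<dots> \<le> \<epsilon> * C" using R_le[OF t] f_le[OF t] nrm_nonneg eps_C_nonneg by (intro mult_mono) auto
  finally show "- ip (A (f t)) (f t) \<le> Lyap' t" unfolding Lyap'_def spline_rate by linarith
  then show "0 \<le> Lyap' t" using dissipation_controls_defect(1)[OF spline_test local_coercivity, of t] by linarith
qed

text \<open>The increment of \<open>Lyap\<close> over [0, T].\<close>

definition Energy :: real where "Energy = ((nrm (f 0))\<^sup>2 - (nrm (f T))\<^sup>2) / 2 + T * (\<epsilon> * C)"

lemma spline_dissipation: "0 \<le> Energy" "(\<integral>\<^sup>+t\<in>{0..T}. ennreal (- ip (A (f t)) (f t)) \<partial>lborel) \<le> ennreal Energy"
proof -
  have E: "Energy = Lyap T - Lyap 0" by (simp add: Energy_def Lyap_def field_simps)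
  have i: "(\<integral>\<^sup>+t\<in>{0..T}. ennreal (Lyap' t) \<partial>lborel) = ennreal Energy" unfolding E
    using T Lyap'_dissipation(2) borel_measurable_continuous_onI[OF Lyap'_cont]
    by (intro nn_integral_FTC_Icc) (auto intro: has_field_derivative_at_within Lyap_DERIV)
  show "(\<integral>\<^sup>+t\<in>{0..T}. ennreal (- ip (A (f t)) (f t)) \<partial>lborel) \<le> ennreal Energy"
    unfolding i[symmetric] using Lyap'_dissipation(1)
    by (intro nn_integral_mono) (auto simp: indicator_def intro!: ennreal_leI)
  have "\<exists>z>0. z < T \<and> Lyap T - Lyap 0 = (T - 0) * Lyap' z" by (rule MVT2[OF T Lyap_DERIV])
  then show "0 \<le> Energy" unfolding E using Lyap'_dissipation(2) T by force
qed

text \<open>Monotonicity of \<open>Lyap\<close> on [t, T]; the loss is 2 (T - t) \<epsilon>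
  C.\<close>

lemma spline_decrease: assumes t: "t \<in> {0..T}" shows "(nrm (f T))\<^sup>2 - 2 * T * (\<epsilon> * C) \<le> (nrm (f t))\<^sup>2"
proof (cases "t = T")
  case True
  then show ?thesis using T eps_C_nonneg by simp
next
  case False
  then have tT: "t < T" "0 \<le> t" using t by auto
  have "\<exists>z>t. z < T \<and> Lyap T - Lyap t = (T - t) * Lyap' z" by (rule MVT2[OF tT(1) Lyap_DERIV])
  then obtain z where "t < z" "z < T" "Lyap T - Lyap t = (T - t) * Lyap' z" by blast
  then have "0 \<le> Lyap T - Lyap t" using Lyap'_dissipation(2)[of z] tT by simp
  moreover have "0 \<le> \<epsilon> * C * t" using eps_C_nonneg tT by simp
  ultimately show ?thesis by (simp add: Lyap_def field_simps)
qed

text \<open>The generator conserves mass, so the mass changes at the rate given by the mass of the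
  residual, which is at most its norm.\<close>

lemma spline_mass: assumes t: "t \<in> {0..T}" shows "\<bar>(LINT z|lborel. f t z) - (LINT z|lborel. f 0 z)\<bar> \<le> T * \<epsilon>"
proof (cases "t = 0")
  case True
  then show ?thesis using T eps_C_nonneg by simp
next
  case False
  then have t0: "0 < t" "t \<le> T" using t by auto
  let ?m = "\<lambda>t. \<Sum>k<n. p k t * (LINT z|lborel. psi k z)"
  let ?m' = "\<lambda>t. \<Sum>k<n. p' k t * (LINT z|lborel. psi k z)"
  have m: "(LINT z|lborel. f t z) = ?m t" for t
    unfolding f_def using Cc_integrable[OF test_function_Cc[OF psi]] by (simp add: Bochner_Integration.integral_sum)
  have m': "(LINT z|lborel. R t z) = ?m' t" for t
    unfolding R_def using Cc_integrable[OF test_function_Cc[OF psi]] A_integrable[OF psi] A_mass[OF psi]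
    by (simp add: Bochner_Integration.integral_sum)
  have "\<exists>z>0. z < t \<and> ?m t - ?m 0 = (t - 0) * ?m' z"
    by (rule MVT2[OF t0(1)]) (auto intro!: derivative_eq_intros p)
  then obtain z where z: "0 < z" "z < t" "?m t - ?m 0 = t * ?m' z" by auto
  have "\<bar>?m' z\<bar> \<le> \<epsilon>" using mass_bound[OF spline_H(4), of z] R_le[of z] z t0 by (simp add: m')
  then have "t * \<bar>?m' z\<bar> \<le> T * \<epsilon>" using t0 eps_C_nonneg by (intro mult_mono) auto
  then show ?thesis unfolding m z(3) using t0 by (simp add: abs_mult)
qed

lemma spline_defect_measurable:
  "(\<lambda>z. velocity_defect f_inf (snd z) (\<lambda>v. f (fst z) (snd z, v))) \<in> borel_measurable borel"
  "(\<lambda>z. \<integral>\<^sup>+v. ennreal ((f (fst z) (snd z, v))\<^sup>2 / f_inf (snd z, v)) \<partial>lborel) \<in> borel_measurable borel"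
  "(\<lambda>z. \<integral>\<^sup>+v. ennreal ((R (fst z) (snd z, v))\<^sup>2 / f_inf (snd z, v)) \<partial>lborel) \<in> borel_measurable borel"
proof -
  have rnz: "rho x \<noteq> 0" for x using rho_pos[of x] by simp
  have vf: "(LINT v|lborel. f t (x, v)) = (\<Sum>k<n. p k t * vavg (psi k) x)" for t x
    using vavg_sum[OF psi] unfolding vavg_def f_def .
  have c: "continuous_on UNIV (\<lambda>y :: 'd spacetime \<times> (real ^ 'd). f (fst (fst y)) (snd (fst y), snd y))"
    unfolding f_def
    by (intro continuous_intros continuous_on_compose2[OF spline_cont] continuous_on_compose2[OF Cc_continuous[OF test_function_Cc[OF psi]]]) auto
  have c': "continuous_on UNIV (\<lambda>y :: 'd spacetime \<times> (real ^ 'd). f (fst (fst y)) (snd (fst y), snd y) -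
      (LINT v|lborel. f (fst (fst y)) (snd (fst y), v)) * f_inf (snd (fst y), snd y) / vavg f_inf (snd (fst y)))"
    unfolding vf
    by (intro continuous_intros c continuous_on_compose2[OF spline_cont] continuous_on_compose2[OF Cc_continuous[OF Cc_vavg[OF test_function_Cc[OF psi]]]]
        continuous_on_compose2[OF f_inf_cont] continuous_on_compose2[OF rho_cont]) (use rnz in auto)
  have c'': "continuous_on UNIV (\<lambda>y :: 'd spacetime \<times> (real ^ 'd). R (fst (fst y)) (snd (fst y), snd y))"
    unfolding R_def
    by (intro continuous_intros continuous_on_compose2[OF spline_cont] continuous_on_compose2[OF p(2)]
        continuous_on_compose2[OF Cc_continuous[OF test_function_Cc[OF psi]]]
        continuous_on_compose2[OF A_cont[OF psi]]) auto
  show "(\<lambda>z. velocity_defect f_inf (snd z) (\<lambda>v. f (fst z) (snd z, v))) \<in> borel_measurable borel"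
    using defect_measurable[OF c'] by (simp add: velocity_defect_def)
  show "(\<lambda>z. \<integral>\<^sup>+v. ennreal ((f (fst z) (snd z, v))\<^sup>2 / f_inf (snd z, v)) \<partial>lborel) \<in> borel_measurable borel"
    using defect_measurable[OF c] by simp
  show "(\<lambda>z. \<integral>\<^sup>+v. ennreal ((R (fst z) (snd z, v))\<^sup>2 / f_inf (snd z, v)) \<partial>lborel) \<in> borel_measurable borel"
    using defect_measurable[OF c''] by simp
qed

lemma nrm_fibres:
  assumes "g \<in> H"
  shows "(\<integral>\<^sup>+x. (\<integral>\<^sup>+v. ennreal ((g (x, v))\<^sup>2 / f_inf (x, v)) \<partial>lborel) \<partial>lborel) = ennreal ((nrm g)\<^sup>2)"
proof -
  note H_measurable[OF assms, measurable]
  have "(\<lambda>z. ennreal ((g z)\<^sup>2 / f_inf z)) \<in> borel_measurable borel" by measurable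
  from nn_integral_phase[OF this] show ?thesis by (simp add: nn_nrm[OF assms])
qed

text \<open>The mean of the density over the slab is the time average of the mass, which stays close
  to its initial value.\<close>

lemma spline_mass_mean:
  "\<bar>(LINT z:slab T|lborel. vavg (f (fst z)) (snd z)) / T\<bar> \<le> \<bar>LINT z|lborel. f 0 z\<bar> + T * \<epsilon>"
proof -
  let ?m = "\<lambda>t. LINT z|lborel. f t z"
  have pi: "integrable lborel (\<lambda>t. indicator {0..T} t * p k t)" for k
    using borel_integrable_atLeastAtMost[of 0 T "p k"] spline_cont[of k]
    by (auto simp: continuous_on_eq_continuous_at mult.commute indicator_def if_distrib cong: if_cong)
  have vi: "integrable lborel (vavg (psi k))" "(LINT x|lborel. vavg (psi k) x) = (LINT z|lborel. psi k z)" for k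
    using integral_phase[OF Cc_integrable[OF test_function_Cc[OF psi]]] by (simp_all add: vavg_def[abs_def])
  have m: "?m t = (\<Sum>k<n. p k t * (LINT z|lborel. psi k z))" for t
    unfolding f_def using Cc_integrable[OF test_function_Cc[OF psi]] by (simp add: Bochner_Integration.integral_sum)
  have e: "indicator (slab T) z *\<^sub>R vavg (f (fst z)) (snd z) =
      (\<Sum>k<n. (indicator {0..T} (fst z) * p k (fst z)) * vavg (psi k) (snd z))" for z
    unfolding indicator_slab f_def by (simp add: vavg_sum[OF psi] sum_distrib_left mult.assoc)
  have "(LINT z:slab T|lborel. vavg (f (fst z)) (snd z)) =
      (\<Sum>k<n. (LINT t|lborel. indicator {0..T} t * p k t) * (LINT z|lborel. psi k z))"
    unfolding set_lebesgue_integral_def e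
    by (subst Bochner_Integration.integral_sum) (simp_all only: product_integrable[OF pi vi(1)] vi(2))
  also have "\<dots> = (LINT t|lborel. (\<Sum>k<n. (indicator {0..T} t * p k t) * (LINT z|lborel. psi k z)))"
    using pi by (subst Bochner_Integration.integral_sum) auto
  also have "\<dots> = (LINT t|lborel. indicator {0..T} t * ?m t)"
    unfolding m by (simp add: sum_distrib_left mult.assoc)
  finally have v: "(LINT z:slab T|lborel. vavg (f (fst z)) (snd z)) = (LINT t|lborel. indicator {0..T} t * ?m t)" .
  have i: "integrable lborel (\<lambda>t. indicator {0..T} t * ?m t)"
  proof -
    have "integrable lborel (\<lambda>t. \<Sum>k<n. (indicator {0..T} t * p k t) * (LINT z|lborel. psi k z))"
      using pi by (intro Bochner_Integration.integrable_sum integrable_mult_left)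
    then show ?thesis unfolding m by (simp add: sum_distrib_left mult.assoc)
  qed
  have c: "integrable lborel (\<lambda>t. indicator {0..T} t * (\<bar>?m 0\<bar> + T * \<epsilon>))"
    "(LINT t|lborel. indicator {0..T} t * (\<bar>?m 0\<bar> + T * \<epsilon>)) = T * (\<bar>?m 0\<bar> + T * \<epsilon>)"
    using T by (simp_all add: less_imp_le)
  have "\<bar>LINT t|lborel. indicator {0..T} t * ?m t\<bar> \<le> (LINT t|lborel. indicator {0..T} t * (\<bar>?m 0\<bar> + T * \<epsilon>))"
  proof (rule order_trans[OF integral_abs_bound])
    show "(LINT t|lborel. \<bar>indicator {0..T} t * ?m t\<bar>) \<le> (LINT t|lborel. indicator {0..T} t * (\<bar>?m 0\<bar> + T * \<epsilon>))"
    proof (rule integral_mono)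
      show "integrable lborel (\<lambda>t. \<bar>indicator {0..T} t * ?m t\<bar>)" using i by (rule integrable_abs)
      show "\<bar>indicator {0..T} t * ?m t\<bar> \<le> indicator {0..T} t * (\<bar>?m 0\<bar> + T * \<epsilon>)" for t
        using spline_mass[of t] by (cases "t \<in> {0..T}") (auto simp: indicator_def)
    qed (rule c)
  qed
  then show ?thesis unfolding v c(2) using T by (simp add: field_simps)
qed

text \<open>The norm is almost decreasing, so T |f(T)|^2 is, up to the error, at most the time
  integral of |f(t)|^2. By \<open>defect_decomposition\<close> this integral splits into the defect,
  at most lambda1 times \<open>Energy\<close>, and the density part, which
  \<open>spacetime_estimate\<close> reduces to the mass, the defect and the residual.\<close>

lemma spline_hypocoercive:
  assumes sc: "spatial_coercivity G f_inf T lambda2"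
  shows "T * ((nrm (f T))\<^sup>2 - 2 * T * (\<epsilon> * C)) \<le> T * (\<bar>LINT z|lborel. f 0 z\<bar> + T * \<epsilon>)\<^sup>2 +
    lambda1 * Energy + 2 * cK * max lambda2 1 * (lambda1 * Energy + T * \<epsilon>\<^sup>2)"
proof -
  define a2 where "a2 z = velocity_defect f_inf (snd z) (\<lambda>v. f (fst z) (snd z, v))" for z :: "'d spacetime"
  define b2 where "b2 z = (\<integral>\<^sup>+v. ennreal ((R (fst z) (snd z, v))\<^sup>2 / f_inf (snd z, v)) \<partial>lborel)" for z :: "'d spacetime"
  define f2 where "f2 z = (\<integral>\<^sup>+v. ennreal ((f (fst z) (snd z, v))\<^sup>2 / f_inf (snd z, v)) \<partial>lborel)" for z :: "'d spacetime"
  define r2 where "r2 z = (vavg (f (fst z)) (snd z))\<^sup>2 / rho (snd z)" for z :: "'d spacetime"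
  define m where "m = (LINT z:slab T|lborel. vavg (f (fst z)) (snd z)) / T"
  define Qr where "Qr = lambda1 * Energy + T * \<epsilon>\<^sup>2"
  note spline_defect_measurable[folded a2_def b2_def f2_def, measurable]
  have Qr: "0 \<le> Qr" unfolding Qr_def using lambda1_pos spline_dissipation(1) T by simp
  have a2: "(\<integral>\<^sup>+z\<in>slab T. a2 z \<partial>lborel) \<le> ennreal (lambda1 * Energy)"
  proof -
    have "(\<integral>\<^sup>+z\<in>slab T. a2 z \<partial>lborel) = (\<integral>\<^sup>+t\<in>{0..T}. (\<integral>\<^sup>+x. a2 (t, x) \<partial>lborel) \<partial>lborel)"
      by (rule nn_integral_slab) measurable
    also have "\<dots> \<le> (\<integral>\<^sup>+t. ennreal lambda1 * (ennreal (- ip (A (f t)) (f t)) * indicator {0..T} t) \<partial>lborel)"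
    proof (rule nn_integral_mono)
      fix t
      show "(\<integral>\<^sup>+x. a2 (t, x) \<partial>lborel) * indicator {0..T} t \<le> ennreal lambda1 * (ennreal (- ip (A (f t)) (f t)) * indicator {0..T} t)"
      proof -
        have "(\<integral>\<^sup>+x. a2 (t, x) \<partial>lborel) \<le> ennreal lambda1 * ennreal (- ip (A (f t)) (f t))"
          using dissipation_controls_defect(2)[OF spline_test local_coercivity, of t] lambda1_pos
          by (simp only: a2_def fst_conv snd_conv ennreal_mult'[OF less_imp_le])
        then show ?thesis unfolding mult.assoc[symmetric] by (rule mult_right_mono) simp
      qed
    qed
    also have "\<dots> = ennreal lambda1 * (\<integral>\<^sup>+t\<in>{0..T}. ennreal (- ip (A (f t)) (f t)) \<partial>lborel)"
    proof (rule nn_integral_cmult)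
      have "continuous_on UNIV (\<lambda>t. ip (A (f t)) (f t))"
      proof -
        have "ip (A (f t)) (f t) = (\<Sum>k<n. p k t * (\<Sum>l<n. p l t * ip (A (psi k)) (psi l)))" for t
        proof -
          have "ip (A (f t)) (f t) = (\<Sum>k<n. p k t * ip (A (psi k)) (f t))"
            unfolding spline_A by (subst ip_sum_left) (simp_all add: ip_cmult_left H_cmult A_H[OF psi] spline_H)
          moreover have "ip (A (psi k)) (f t) = (\<Sum>l<n. p l t * ip (A (psi k)) (psi l))" for k
            unfolding f_def ip_commute[of "A (psi k)"]
            by (subst ip_sum_left) (simp_all add: ip_cmult_left H_cmult A_H[OF psi] spline_H)
          ultimately show ?thesis by simp
        qed
        then show ?thesis by (simp only:) (intro continuous_intros spline_cont)
      qed
      from borel_measurable_continuous_onI[OF this]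
      show "(\<lambda>t. ennreal (- ip (A (f t)) (f t)) * indicator {0..T} t) \<in> borel_measurable lborel" by simp
    qed
    also have "\<dots> \<le> ennreal lambda1 * ennreal Energy" by (intro mult_left_mono spline_dissipation(2)) simp
    finally show ?thesis using lambda1_pos spline_dissipation(1) by (simp add: ennreal_mult)
  qed
  have b2: "(\<integral>\<^sup>+z\<in>slab T. b2 z \<partial>lborel) \<le> ennreal (T * \<epsilon>\<^sup>2)"
  proof -
    have "(\<integral>\<^sup>+z\<in>slab T. b2 z \<partial>lborel) = (\<integral>\<^sup>+t\<in>{0..T}. (\<integral>\<^sup>+x. b2 (t, x) \<partial>lborel) \<partial>lborel)"
      by (rule nn_integral_slab) measurable
    also have "\<dots> \<le> (\<integral>\<^sup>+t. ennreal (\<epsilon>\<^sup>2) * indicator {0..T} t \<partial>lborel)"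
      unfolding b2_def fst_conv snd_conv nrm_fibres[OF spline_H(4)] using R_le nrm_nonneg
      by (intro nn_integral_mono) (auto simp: indicator_def intro!: ennreal_leI power_mono)
    also have "\<dots> = ennreal (T * \<epsilon>\<^sup>2)"
      unfolding ennreal_mult'[OF less_imp_le[OF T]]
      by (subst nn_integral_cmult_indicator) (use less_imp_le[OF T] in \<open>simp_all add: mult.commute\<close>)
    finally show ?thesis .
  qed
  have "(\<integral>\<^sup>+z\<in>slab T. (a2 z + b2 z) \<partial>lborel) = (\<integral>\<^sup>+z\<in>slab T. a2 z \<partial>lborel) + (\<integral>\<^sup>+z\<in>slab T. b2 z \<partial>lborel)"
    unfolding distrib_right by (rule nn_integral_add) measurable
  also have "\<dots> \<le> ennreal (lambda1 * Energy) + ennreal (T * \<epsilon>\<^sup>2)" by (intro add_mono a2 b2)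
  also have "\<dots> = ennreal Qr" unfolding Qr_def using lambda1_pos spline_dissipation(1) T by (intro ennreal_plus[symmetric]) auto
  finally have Q: "(\<integral>\<^sup>+z\<in>slab T. (a2 z + b2 z) \<partial>lborel) \<le> ennreal Qr" .
  have st: "set_integrable lborel (slab T) r2" "(LINT z:slab T|lborel. r2 z) - T * m\<^sup>2 \<le> 2 * cK * max lambda2 1 * Qr"
    using spacetime_estimate[OF sc psi p, where n = n and Qr = Qr] Q Qr unfolding r2_def m_def a2_def b2_def f_def R_def by simp_all
  have r0: "0 \<le> r2 z" for z unfolding r2_def using rho_pos[of "snd z"] by (simp add: less_imp_le)
  have rn: "(\<integral>\<^sup>+z\<in>slab T. ennreal (r2 z) \<partial>lborel) = ennreal (LINT z:slab T|lborel. r2 z)"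
  proof -
    have "(\<integral>\<^sup>+z\<in>slab T. ennreal (r2 z) \<partial>lborel) = (\<integral>\<^sup>+z. ennreal (indicator (slab T) z *\<^sub>R r2 z) \<partial>lborel)"
      by (intro nn_integral_cong) (simp add: indicator_def)
    then show ?thesis unfolding set_lebesgue_integral_def
      using st(1) r0 by (subst (asm) nn_integral_eq_integral) (auto simp: set_integrable_def)
  qed
  have r2m: "(\<lambda>z. ennreal (r2 z) * indicator (slab T) z) \<in> borel_measurable lborel"
  proof -
    have "(\<lambda>z. ennreal (indicator (slab T) z *\<^sub>R r2 z)) \<in> borel_measurable lborel"
      using borel_measurable_integrable[OF st(1)[unfolded set_integrable_def]] by measurable
    moreover have "(\<lambda>z. ennreal (indicator (slab T) z *\<^sub>R r2 z)) = (\<lambda>z. ennreal (r2 z) * indicator (slab T) z)"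
      by (auto simp: indicator_def)
    ultimately show ?thesis by simp
  qed
  \<comment> \<open>If the left-hand side is negative, it is truncated to 0 here; the return to real
    numbers rests on the nonnegativity of the right-hand side.\<close>
  have "ennreal (T * ((nrm (f T))\<^sup>2 - 2 * T * (\<epsilon> * C))) = (\<integral>\<^sup>+t. ennreal ((nrm (f T))\<^sup>2 - 2 * T * (\<epsilon> * C)) * indicator {0..T} t \<partial>lborel)"
    unfolding ennreal_mult'[OF less_imp_le[OF T]]
    by (subst nn_integral_cmult_indicator) (use less_imp_le[OF T] in \<open>simp_all add: mult.commute\<close>)
  also have "\<dots> \<le> (\<integral>\<^sup>+t\<in>{0..T}. ennreal ((nrm (f t))\<^sup>2) \<partial>lborel)"
    using spline_decrease by (intro nn_integral_mono) (auto simp: indicator_def intro!: ennreal_leI)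
  also have "\<dots> = (\<integral>\<^sup>+z\<in>slab T. f2 z \<partial>lborel)"
    by (subst nn_integral_slab) (measurable, simp add: f2_def nrm_fibres[OF spline_H(2)])
  also have "\<dots> = (\<integral>\<^sup>+z. (a2 z * indicator (slab T) z + ennreal (r2 z) * indicator (slab T) z) \<partial>lborel)"
    unfolding f2_def defect_decomposition[OF test_function_Cc[OF spline_test]] a2_def r2_def distrib_right ..
  also have "\<dots> = (\<integral>\<^sup>+z\<in>slab T. a2 z \<partial>lborel) + (\<integral>\<^sup>+z\<in>slab T. ennreal (r2 z) \<partial>lborel)"
    by (rule nn_integral_add[OF _ r2m]) measurable
  also have "\<dots> \<le> ennreal (lambda1 * Energy) + ennreal (LINT z:slab T|lborel. r2 z)"
    unfolding rn by (intro add_mono a2 order_refl)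
  also have "\<dots> = ennreal (lambda1 * Energy + (LINT z:slab T|lborel. r2 z))"
    using lambda1_pos spline_dissipation(1) r0 unfolding set_lebesgue_integral_def
    by (intro ennreal_plus[symmetric] Bochner_Integration.integral_nonneg) auto
  finally have "T * ((nrm (f T))\<^sup>2 - 2 * T * (\<epsilon> * C)) \<le> lambda1 * Energy + (LINT z:slab T|lborel. r2 z)"
    using lambda1_pos spline_dissipation(1) r0 unfolding set_lebesgue_integral_def
    by (subst (asm) ennreal_le_iff) (auto intro!: add_nonneg_nonneg Bochner_Integration.integral_nonneg)
  then have "T * ((nrm (f T))\<^sup>2 - 2 * T * (\<epsilon> * C)) \<le> lambda1 * Energy + (T * m\<^sup>2 + 2 * cK * max lambda2 1 * Qr)"
    using st(2) by linarith
  moreover have "m\<^sup>2 \<le> (\<bar>LINT z|lborel. f 0 z\<bar> + T * \<epsilon>)\<^sup>2"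
    using spline_mass_mean unfolding m_def by (intro abs_le_square_iff[THEN iffD1]) auto
  then have "T * m\<^sup>2 \<le> T * (\<bar>LINT z|lborel. f 0 z\<bar> + T * \<epsilon>)\<^sup>2" using T by (intro mult_left_mono) auto
  ultimately show ?thesis unfolding Qr_def by linarith
qed

end

end

section \<open>Exponential decay\<close>

lemma tendsto_inverse_Suc:
  fixes X :: "nat \<Rightarrow> real"
  assumes "\<And>j. \<bar>X j - a\<bar> \<le> c * inverse (real (Suc j))" shows "X \<longlonglongrightarrow> a"
proof -
  have "(\<lambda>j. c * inverse (real (Suc j))) \<longlonglongrightarrow> c * 0" by (intro tendsto_intros LIMSEQ_inverse_real_of_nat)
  then have "(\<lambda>j. X j - a) \<longlonglongrightarrow> 0"
    using assms by (intro Lim_null_comparison[of "\<lambda>j. X j - a" "\<lambda>j. c * inverse (real (Suc j))"]) auto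
  then show ?thesis by (rule LIM_zero_cancel)
qed

lemma (in weighted) nrm_abs_diff:
  assumes "f \<in> H" "g \<in> H" shows "\<bar>nrm f - nrm g\<bar> \<le> nrm (\<lambda>z. f z - g z)"
  using nrm_le_diff[OF assms] nrm_le_diff[OF assms(2,1)] nrm_minus_commute[of f g] by linarith

context kinetic_evolution
begin

text \<open>The summand 1 stands for the defect itself, the other one for the density, which is
  controlled by the defect through \<open>spacetime_estimate\<close>.\<close>

definition K1 :: "real \<Rightarrow> real" where
  "K1 lambda2 = lambda1 * (1 + 2 * cK * max lambda2 1)"

lemma K1_pos: "0 < K1 lambda2"
  unfolding K1_def using lambda1_pos cK_pos by (intro mult_pos_pos add_pos_nonneg) auto

text \<open>Three real numbers are all that is kept of a spline: its norms at the two ends and its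
  initial mass. The limit in \<epsilon> then concerns sequences of real numbers.\<close>

lemma approximates_estimates:
  assumes ap: "approximates \<phi> T \<epsilon> C n p p' psi" and phi: "test_function UNIV \<phi>" and T: "0 < T"
  shows "\<exists>x y m. \<bar>x - nrm \<phi>\<bar> \<le> \<epsilon> \<and> \<bar>y - nrm (S T \<phi>)\<bar> \<le> \<epsilon> \<and>
    \<bar>m - (LINT z|lborel. \<phi> z)\<bar> \<le> \<epsilon> \<and> \<bar>m - (LINT z|lborel. S T \<phi> z)\<bar> \<le> (T + 1) * \<epsilon> \<and>
    0 \<le> (x\<^sup>2 - y\<^sup>2) / 2 + T * (\<epsilon> * C) \<and>
    (spatial_coercivity G f_inf T lambda2 \<longrightarrow>
      T * (y\<^sup>2 - 2 * T * (\<epsilon> * C)) \<le> T * (\<bar>m\<bar> + T * \<epsilon>)\<^sup>2 +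
        K1 lambda2 * ((x\<^sup>2 - y\<^sup>2) / 2 + T * (\<epsilon> * C)) + 2 * cK * max lambda2 1 * (T * \<epsilon>\<^sup>2))"
proof -
  define f where "f t z = (\<Sum>k<n. p k t * psi k z)" for t z
  have psi: "\<And>k. test_function UNIV (psi k)" and p: "\<And>k t. (p k has_real_derivative p' k t) (at t)"
    "\<And>k. continuous_on UNIV (p' k)"
    and R: "\<And>t. t \<in> {0..T} \<Longrightarrow> nrm (\<lambda>z. (\<Sum>k<n. p' k t * psi k z) - (\<Sum>k<n. p k t * A (psi k) z)) \<le> \<epsilon>"
    and C: "\<And>t. t \<in> {0..T} \<Longrightarrow> nrm (\<lambda>z. \<Sum>k<n. p k t * psi k z) \<le> C"
    and f0: "nrm (\<lambda>z. f 0 z - \<phi> z) \<le> \<epsilon>" and fT: "nrm (\<lambda>z. f T z - S T \<phi> z) \<le> \<epsilon>"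
    using ap unfolding approximates_def f_def by blast+
  have H: "f t \<in> H" for t unfolding f_def by (intro test_function_H test_function_sum psi)
  note H\<phi> = test_function_H[OF phi]
  note HS = S_H[OF less_imp_le[OF T] H\<phi>]
  let ?x = "nrm (f 0)" and ?y = "nrm (f T)" and ?m = "LINT z|lborel. f 0 z"
  have 1: "\<bar>?x - nrm \<phi>\<bar> \<le> \<epsilon>" using nrm_abs_diff[OF H[of 0] H\<phi>] f0 by linarith
  have 2: "\<bar>?y - nrm (S T \<phi>)\<bar> \<le> \<epsilon>" using nrm_abs_diff[OF H[of T] HS] fT by linarith
  have 3: "\<bar>?m - (LINT z|lborel. \<phi> z)\<bar> \<le> \<epsilon>"
    using mass_bound[OF H_diff[OF H[of 0] H\<phi>]] f0 unfolding mass_diff[OF H[of 0] H\<phi>] by linarith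
  have 4: "\<bar>(LINT z|lborel. f T z) - (LINT z|lborel. S T \<phi> z)\<bar> \<le> \<epsilon>"
    using mass_bound[OF H_diff[OF H[of T] HS]] fT unfolding mass_diff[OF H[of T] HS] by linarith
  have 5: "\<bar>(LINT z|lborel. f T z) - ?m\<bar> \<le> T * \<epsilon>"
    unfolding f_def by (rule spline_mass[OF psi p T R C], assumption, assumption) (use T in simp)
  have 6: "\<bar>?m - (LINT z|lborel. S T \<phi> z)\<bar> \<le> (T + 1) * \<epsilon>" using 4 5 by (simp add: distrib_right)
  define E where "E = Energy psi p n T \<epsilon> C"
  have E: "(?x\<^sup>2 - ?y\<^sup>2) / 2 + T * (\<epsilon> * C) = E" 
    unfolding E_def f_def by (rule sym, rule Energy_def[OF psi p T R C], assumption+)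
  have 7: "0 \<le> E" unfolding E_def by (rule spline_dissipation(1)[OF psi p T R C], assumption+)
  have 8: "T * (?y\<^sup>2 - 2 * T * (\<epsilon> * C)) \<le> T * (\<bar>?m\<bar> + T * \<epsilon>)\<^sup>2 +
        K1 lambda2 * E + 2 * cK * max lambda2 1 * (T * \<epsilon>\<^sup>2)"
    if sc: "spatial_coercivity G f_inf T lambda2"
  proof -
    have "T * (?y\<^sup>2 - 2 * T * (\<epsilon> * C)) \<le> T * (\<bar>?m\<bar> + T * \<epsilon>)\<^sup>2 +
        lambda1 * E + 2 * cK * max lambda2 1 * (lambda1 * E + T * \<epsilon>\<^sup>2)"
      unfolding f_def E_def by (rule spline_hypocoercive[OF psi p T R C sc], assumption+)
    also have "\<dots> = T * (\<bar>?m\<bar> + T * \<epsilon>)\<^sup>2 + K1 lambda2 * E + 2 * cK * max lambda2 1 * (T * \<epsilon>\<^sup>2)"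
      by (simp add: K1_def ring_distribs)
    finally show ?thesis .
  qed
  show ?thesis
    by (rule exI[of _ ?x], rule exI[of _ ?y], rule exI[of _ ?m], unfold E) (use 1 2 3 6 7 8 in blast)
qed

text \<open>The condition \<open>P\<close> will be spatial coercivity, which is assumed for one
  window length, whereas contraction and conservation of mass are wanted for every time. The lemma
  serves two limits: from splines to orbits of test functions and from these to all orbits.\<close>

lemma evolution_limit:
  fixes X Y Z W :: "nat \<Rightarrow> real"
  defines "e \<equiv> \<lambda>j. inverse (real (Suc j))"
  assumes X: "X \<longlonglongrightarrow> a" and Y: "Y \<longlonglongrightarrow> b" and Z: "Z \<longlonglongrightarrow> m0"
    and 1: "\<And>j. 0 \<le> ((X j)\<^sup>2 - (Y j)\<^sup>2) / 2 + T * (e j * C)"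
    and 2: "P \<Longrightarrow> (\<And>j. T * ((Y j)\<^sup>2 - 2 * T * (e j * C)) \<le> T * (\<bar>Z j\<bar> + T * e j)\<^sup>2 +
        K1 lambda2 * (((X j)\<^sup>2 - (Y j)\<^sup>2) / 2 + T * (e j * C)) + D * (T * (e j)\<^sup>2))"
  shows "b\<^sup>2 \<le> a\<^sup>2" "P \<Longrightarrow> T * b\<^sup>2 \<le> T * m0\<^sup>2 + K1 lambda2 * ((a\<^sup>2 - b\<^sup>2) / 2)"
proof -
  have e: "e \<longlonglongrightarrow> 0" unfolding e_def by (rule LIMSEQ_inverse_real_of_nat)
  have "(\<lambda>j. ((X j)\<^sup>2 - (Y j)\<^sup>2) / 2 + T * (e j * C)) \<longlonglongrightarrow> (a\<^sup>2 - b\<^sup>2) / 2 + T * (0 * C)"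
    by (intro tendsto_intros X Y e) simp
  then have "0 \<le> (a\<^sup>2 - b\<^sup>2) / 2 + T * (0 * C)" by (rule LIMSEQ_le_const) (use 1 in blast)
  then show "b\<^sup>2 \<le> a\<^sup>2" by simp
  show "T * b\<^sup>2 \<le> T * m0\<^sup>2 + K1 lambda2 * ((a\<^sup>2 - b\<^sup>2) / 2)" if P
  proof -
    have "(\<lambda>j. T * ((Y j)\<^sup>2 - 2 * T * (e j * C))) \<longlonglongrightarrow> T * (b\<^sup>2 - 2 * T * (0 * C))"
      by (intro tendsto_intros Y e)
    moreover have "(\<lambda>j. T * (\<bar>Z j\<bar> + T * e j)\<^sup>2 + K1 lambda2 * (((X j)\<^sup>2 - (Y j)\<^sup>2) / 2 + T * (e j * C)) + D * (T * (e j)\<^sup>2)) \<longlonglongrightarrow>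
        T * (\<bar>m0\<bar> + T * 0)\<^sup>2 + K1 lambda2 * ((a\<^sup>2 - b\<^sup>2) / 2 + T * (0 * C)) + D * (T * 0\<^sup>2)"
      by (intro tendsto_intros X Y Z e) simp
    ultimately have "T * (b\<^sup>2 - 2 * T * (0 * C)) \<le> T * (\<bar>m0\<bar> + T * 0)\<^sup>2 + K1 lambda2 * ((a\<^sup>2 - b\<^sup>2) / 2 + T * (0 * C)) + D * (T * 0\<^sup>2)"
      by (rule LIMSEQ_le) (use 2[OF that] in blast)
    then show ?thesis by simp
  qed
qed

lemma evolution_test:
  assumes phi: "test_function UNIV \<phi>" and T: "0 < T"
  shows "(nrm (S T \<phi>))\<^sup>2 \<le> (nrm \<phi>)\<^sup>2" "(LINT z|lborel. S T \<phi> z) = (LINT z|lborel. \<phi> z)"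
    "spatial_coercivity G f_inf T lambda2 \<Longrightarrow>
      T * (nrm (S T \<phi>))\<^sup>2 \<le> T * (LINT z|lborel. \<phi> z)\<^sup>2 + K1 lambda2 * (((nrm \<phi>)\<^sup>2 - (nrm (S T \<phi>))\<^sup>2) / 2)"
proof -
  \<comment> \<open>\<open>C\<close> is fixed before \<epsilon>, so the products \<epsilon> C vanish
    in the limit.\<close>
  obtain C where C: "\<And>\<epsilon>. 0 < \<epsilon> \<Longrightarrow> \<exists>n p p' psi. approximates \<phi> T \<epsilon> C n p p' psi"
    using orbit_approximation[OF phi T] by blast
  define e where "e j = inverse (real (Suc j))" for j
  have "\<forall>j. \<exists>x y m. \<bar>x - nrm \<phi>\<bar> \<le> e j \<and> \<bar>y - nrm (S T \<phi>)\<bar> \<le> e j \<and>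
    \<bar>m - (LINT z|lborel. \<phi> z)\<bar> \<le> e j \<and> \<bar>m - (LINT z|lborel. S T \<phi> z)\<bar> \<le> (T + 1) * e j \<and>
    0 \<le> (x\<^sup>2 - y\<^sup>2) / 2 + T * (e j * C) \<and>
    (spatial_coercivity G f_inf T lambda2 \<longrightarrow>
      T * (y\<^sup>2 - 2 * T * (e j * C)) \<le> T * (\<bar>m\<bar> + T * e j)\<^sup>2 +
        K1 lambda2 * ((x\<^sup>2 - y\<^sup>2) / 2 + T * (e j * C)) + 2 * cK * max lambda2 1 * (T * (e j)\<^sup>2))"
    (is "\<forall>j. ?P j")
  proof
    fix j
    have "0 < e j" by (simp add: e_def)
    from C[OF this] obtain n p p' psi where "approximates \<phi> T (e j) C n p p' psi" by blast
    from approximates_estimates[OF this phi T, of lambda2] show "?P j" .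
  qed
  then obtain X Y Z where XYZ: "\<And>j. \<bar>X j - nrm \<phi>\<bar> \<le> e j" "\<And>j. \<bar>Y j - nrm (S T \<phi>)\<bar> \<le> e j"
    "\<And>j. \<bar>Z j - (LINT z|lborel. \<phi> z)\<bar> \<le> e j" "\<And>j. \<bar>Z j - (LINT z|lborel. S T \<phi> z)\<bar> \<le> (T + 1) * e j"
    "\<And>j. 0 \<le> ((X j)\<^sup>2 - (Y j)\<^sup>2) / 2 + T * (e j * C)"
    "\<And>j. spatial_coercivity G f_inf T lambda2 \<Longrightarrow>
      T * ((Y j)\<^sup>2 - 2 * T * (e j * C)) \<le> T * (\<bar>Z j\<bar> + T * e j)\<^sup>2 +
        K1 lambda2 * (((X j)\<^sup>2 - (Y j)\<^sup>2) / 2 + T * (e j * C)) + 2 * cK * max lambda2 1 * (T * (e j)\<^sup>2)"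
    by metis
  have X: "X \<longlonglongrightarrow> nrm \<phi>" using XYZ(1) by (intro tendsto_inverse_Suc[of _ _ 1]) (simp add: e_def)
  have Y: "Y \<longlonglongrightarrow> nrm (S T \<phi>)" using XYZ(2) by (intro tendsto_inverse_Suc[of _ _ 1]) (simp add: e_def)
  have Z: "Z \<longlonglongrightarrow> (LINT z|lborel. \<phi> z)" using XYZ(3) by (intro tendsto_inverse_Suc[of _ _ 1]) (simp add: e_def)
  have "Z \<longlonglongrightarrow> (LINT z|lborel. S T \<phi> z)" using XYZ(4) unfolding e_def by (rule tendsto_inverse_Suc)
  with Z show "(LINT z|lborel. S T \<phi> z) = (LINT z|lborel. \<phi> z)" using LIMSEQ_unique by blast
  note lim = evolution_limit[OF X Y Z XYZ(5)[unfolded e_def] XYZ(6)[unfolded e_def]]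
  show "(nrm (S T \<phi>))\<^sup>2 \<le> (nrm \<phi>)\<^sup>2" by (rule lim(1))
  show "T * (nrm (S T \<phi>))\<^sup>2 \<le> T * (LINT z|lborel. \<phi> z)\<^sup>2 + K1 lambda2 * (((nrm \<phi>)\<^sup>2 - (nrm (S T \<phi>))\<^sup>2) / 2)"
    if "spatial_coercivity G f_inf T lambda2" by (rule lim(2)[OF _ that])
qed

text \<open>Norms and masses depend continuously on \<open>f\<close>, as \<open>S T\<close> is
  bounded; so the estimates extend from the dense set of test functions.\<close>

lemma evolution:
  assumes f: "f \<in> H" and T: "0 < T"
  shows "(nrm (S T f))\<^sup>2 \<le> (nrm f)\<^sup>2" "(LINT z|lborel. S T f z) = (LINT z|lborel. f z)"
    "spatial_coercivity G f_inf T lambda2 \<Longrightarrow>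
      T * (nrm (S T f))\<^sup>2 \<le> T * (LINT z|lborel. f z)\<^sup>2 + K1 lambda2 * (((nrm f)\<^sup>2 - (nrm (S T f))\<^sup>2) / 2)"
proof -
  obtain B where B: "1 \<le> B" "\<And>g. g \<in> H \<Longrightarrow> nrm (S T g) \<le> B * nrm g"
    using opn_locally_bounded[of T] T by force
  define e where "e j = inverse (real (Suc j))" for j
  have e: "0 < e j" for j by (simp add: e_def)
  have "\<forall>j. \<exists>\<phi>. test_function UNIV \<phi> \<and> nrm (\<lambda>z. \<phi> z - f z) < e j"
    using test_functions_dense[OF f e] by blast
  then obtain \<phi> where phi: "\<And>j. test_function UNIV (\<phi> j)" and d: "\<And>j. nrm (\<lambda>z. \<phi> j z - f z) < e j" by metis
  note H = test_function_H[OF phi] and T' = less_imp_le[OF T]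
  note HS = S_H[OF T' H] S_H[OF T' f]
  have dS: "nrm (\<lambda>z. S T (\<phi> j) z - S T f z) \<le> B * e j" for j
  proof -
    have "nrm (\<lambda>z. S T (\<phi> j) z - S T f z) \<le> B * nrm (\<lambda>z. \<phi> j z - f z)"
      using B(2)[OF H_diff[OF H[of j] f]] unfolding nrm_S_diff[OF T' H f] .
    also have "\<dots> \<le> B * e j" using d[of j] B(1) by (intro mult_left_mono) auto
    finally show ?thesis .
  qed
  have X: "(\<lambda>j. nrm (\<phi> j)) \<longlonglongrightarrow> nrm f"
  proof (rule tendsto_inverse_Suc)
    show "\<bar>nrm (\<phi> j) - nrm f\<bar> \<le> 1 * inverse (real (Suc j))" for j
      using nrm_abs_diff[OF H[of j] f] d[of j] by (simp add: e_def)
  qed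
  have Y: "(\<lambda>j. nrm (S T (\<phi> j))) \<longlonglongrightarrow> nrm (S T f)"
  proof (rule tendsto_inverse_Suc)
    show "\<bar>nrm (S T (\<phi> j)) - nrm (S T f)\<bar> \<le> B * inverse (real (Suc j))" for j
      using nrm_abs_diff[OF HS(1)[of j] HS(2)] dS[of j] by (simp add: e_def)
  qed
  have Z: "(\<lambda>j. LINT z|lborel. \<phi> j z) \<longlonglongrightarrow> (LINT z|lborel. f z)"
  proof (rule tendsto_inverse_Suc)
    show "\<bar>(LINT z|lborel. \<phi> j z) - (LINT z|lborel. f z)\<bar> \<le> 1 * inverse (real (Suc j))" for j
      using mass_bound[OF H_diff[OF H[of j] f]] d[of j] unfolding mass_diff[OF H[of j] f] by (simp add: e_def)
  qed
  have "(\<lambda>j. LINT z|lborel. S T (\<phi> j) z) \<longlonglongrightarrow> (LINT z|lborel. S T f z)"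
  proof (rule tendsto_inverse_Suc)
    show "\<bar>(LINT z|lborel. S T (\<phi> j) z) - (LINT z|lborel. S T f z)\<bar> \<le> B * inverse (real (Suc j))" for j
      using mass_bound[OF H_diff[OF HS(1)[of j] HS(2)]] dS[of j] unfolding mass_diff[OF HS(1)[of j] HS(2)] by (simp add: e_def)
  qed
  then show "(LINT z|lborel. S T f z) = (LINT z|lborel. f z)"
    unfolding evolution_test(2)[OF phi T] using Z LIMSEQ_unique by blast
  note ev = evolution_test[OF phi T]
  \<comment> \<open>The estimates for test functions are exact, so \<open>evolution_limit\<close> is
    applied with both error constants equal to 0.\<close>
  have 1: "0 \<le> ((nrm (\<phi> j))\<^sup>2 - (nrm (S T (\<phi> j)))\<^sup>2) / 2 + T * (inverse (real (Suc j)) * 0)" for j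
    using ev(1)[of j] by simp
  have 2: "T * ((nrm (S T (\<phi> j)))\<^sup>2 - 2 * T * (inverse (real (Suc j)) * 0)) \<le> T * (\<bar>LINT z|lborel. \<phi> j z\<bar> + T * inverse (real (Suc j)))\<^sup>2 +
      K1 lambda2 * (((nrm (\<phi> j))\<^sup>2 - (nrm (S T (\<phi> j)))\<^sup>2) / 2 + T * (inverse (real (Suc j)) * 0)) + 0 * (T * (inverse (real (Suc j)))\<^sup>2)"
    if sc: "spatial_coercivity G f_inf T lambda2" for j
  proof -
    have "(LINT z|lborel. \<phi> j z)\<^sup>2 \<le> (\<bar>LINT z|lborel. \<phi> j z\<bar> + T * inverse (real (Suc j)))\<^sup>2"
      using T by (intro abs_le_square_iff[THEN iffD1]) auto
    then have "T * (LINT z|lborel. \<phi> j z)\<^sup>2 \<le> T * (\<bar>LINT z|lborel. \<phi> j z\<bar> + T * inverse (real (Suc j)))\<^sup>2"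
      using T by (intro mult_left_mono) auto
    then show ?thesis using ev(3)[OF sc, of j] by (simp only: mult_zero_right mult_zero_left add_0_right diff_zero)
  qed
  note lim = evolution_limit[OF X Y Z 1 2]
  show "(nrm (S T f))\<^sup>2 \<le> (nrm f)\<^sup>2" by (rule lim(1))
  show "T * (nrm (S T f))\<^sup>2 \<le> T * (LINT z|lborel. f z)\<^sup>2 + K1 lambda2 * (((nrm f)\<^sup>2 - (nrm (S T f))\<^sup>2) / 2)"
    if "spatial_coercivity G f_inf T lambda2" by (rule lim(2)[OF _ that])
qed

section \<open>Iteration over time windows\<close>

lemma contraction: assumes f: "f \<in> H" and t: "0 \<le> t" shows "nrm (S t f) \<le> nrm f"
proof (cases "t = 0")
  case True
  then show ?thesis using nrm_cong_H[OF S_H[OF order_refl f] f S_0_AE[OF f]] by simp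
next
  case False
  then have "0 < t" using t by simp
  show ?thesis by (rule power2_le_imp_le[OF evolution(1)[OF f \<open>0 < t\<close>] nrm_nonneg])
qed

text \<open>For zero mass, T b \<le> K (a - b) / 2 gives b \<le> a / X with X = 1 + 2 T / K, where a
  and b are the squared norms at the ends of a window. The mass stays zero, so this can be iterated;
  passing from squares to norms halves the rate ln X / T.\<close>

lemma exponential_decay:
  assumes sc: "spatial_coercivity G f_inf T lambda2" and K: "K1 lambda2 \<le> K"
    and f: "f \<in> H" and f0: "(LINT z|lborel. f z) = 0" and t: "0 \<le> t"
  defines "X \<equiv> (K + 2 * T) / K"
  shows "nrm (S t f) \<le> sqrt X * exp (- (ln X / (2 * T)) * t) * nrm f"
proof -
  have T: "0 < T" using sc by (simp add: spatial_coercivity_def)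
  have K0: "0 < K" using K1_pos[of lambda2] K by linarith
  have X: "1 < X" using T K0 by (simp add: X_def)
  have step: "(nrm (S T g))\<^sup>2 \<le> (nrm g)\<^sup>2 / X" if g: "g \<in> H" "(LINT z|lborel. g z) = 0" for g
  proof -
    let ?a = "(nrm g)\<^sup>2" and ?b = "(nrm (S T g))\<^sup>2"
    have "K1 lambda2 * ((?a - ?b) / 2) \<le> K * ((?a - ?b) / 2)"
      using evolution(1)[OF g(1) T] K by (intro mult_right_mono) auto
    then have "T * ?b \<le> K * ((?a - ?b) / 2)" using evolution(3)[OF g(1) T sc] g(2) by simp
    then have "?b * (K + 2 * T) \<le> ?a * K" by (simp add: field_simps)
    then show ?thesis using K0 T by (simp add: X_def pos_le_divide_eq)
  qed
  have it: "(nrm (S (real n * T) f))\<^sup>2 \<le> (nrm f)\<^sup>2 / X ^ n \<and> (LINT z|lborel. S (real n * T) f z) = 0" for n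
  proof (induction n)
    case 0
    have "(LINT z|lborel. S 0 f z) = (LINT z|lborel. f z)"
      using S_0_AE[OF f] H_measurable[OF S_H[OF order_refl f]] H_measurable[OF f] by (intro integral_cong_AE) auto
    then show ?case using nrm_cong_H[OF S_H[OF order_refl f] f S_0_AE[OF f]] f0 by simp
  next
    case (Suc n)
    have n: "0 \<le> real n * T" using T by simp
    let ?g = "S (real n * T) f"
    have g: "?g \<in> H" by (rule S_H[OF n f])
    have eq: "real (Suc n) * T = T + real n * T" by (simp add: distrib_right)
    have ae: "AE z in lborel. S (real (Suc n) * T) f z = S T ?g z"
      unfolding eq by (rule S_add_AE[OF less_imp_le[OF T] n f])
    have SH: "S (real (Suc n) * T) f \<in> H" using T by (intro S_H f) simp
    have Sg: "S T ?g \<in> H" by (rule S_H[OF less_imp_le[OF T] g])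
    have "(nrm (S (real (Suc n) * T) f))\<^sup>2 \<le> (nrm ?g)\<^sup>2 / X"
      unfolding nrm_cong_H[OF SH Sg ae] using step[OF g] Suc by blast
    also have "\<dots> \<le> ((nrm f)\<^sup>2 / X ^ n) / X" using Suc X by (intro divide_right_mono) auto
    finally have "(nrm (S (real (Suc n) * T) f))\<^sup>2 \<le> (nrm f)\<^sup>2 / X ^ Suc n" by (simp add: mult.commute)
    moreover have "(LINT z|lborel. S (real (Suc n) * T) f z) = (LINT z|lborel. S T ?g z)"
      using ae H_measurable[OF SH] H_measurable[OF Sg] by (intro integral_cong_AE) auto
    ultimately show ?case using evolution(2)[OF g T] Suc by simp
  qed
  \<comment> \<open>t is n full windows plus a remainder s, and contraction disposes of the
    remainder.\<close>
  define n where "n = nat \<lfloor>t / T\<rfloor>"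
  define s where "s = t - real n * T"
  have tT: "0 \<le> t / T" using t T by simp
  have n: "real n \<le> t / T" "t / T < real n + 1" using tT by (simp_all add: n_def)
  have s: "0 \<le> s" using n(1) T by (simp add: s_def pos_le_divide_eq)
  have nT: "0 \<le> real n * T" using T by simp
  have ae: "AE z in lborel. S t f z = S s (S (real n * T) f) z" using S_add_AE[OF s nT f] by (simp add: s_def)
  have "nrm (S t f) = nrm (S s (S (real n * T) f))"
    by (rule nrm_cong_H[OF S_H[OF t f] S_H[OF s S_H[OF nT f]] ae])
  also have "\<dots> \<le> nrm (S (real n * T) f)" by (rule contraction[OF S_H[OF nT f] s])
  finally have "(nrm (S t f))\<^sup>2 \<le> (nrm (S (real n * T) f))\<^sup>2" by (intro power_mono nrm_nonneg)
  also have "\<dots> \<le> (nrm f)\<^sup>2 / X ^ n" using it by blast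
  also have "\<dots> \<le> (nrm f)\<^sup>2 * (X * exp (- (ln X * (t / T))))"
  proof -
    \<comment> \<open>Since t / T < n + 1, replacing n by t / T in the exponent costs one factor X,
      whose square root is the constant in front of the exponential.\<close>
    have "inverse (X ^ n) = exp (- (real n * ln X))" using X by (simp add: exp_minus exp_of_nat_mult)
    also have "\<dots> \<le> exp (ln X - ln X * (t / T))"
    proof -
      have "ln X * (t / T) \<le> ln X * (real n + 1)" using n(2) X by (intro mult_left_mono) auto
      then show ?thesis by (simp add: algebra_simps)
    qed
    also have "\<dots> = X * exp (- (ln X * (t / T)))" using X by (simp add: exp_diff exp_minus field_simps)
    finally show ?thesis unfolding divide_inverse by (intro mult_left_mono) auto
  qed
  also have "\<dots> = (sqrt X * exp (- (ln X / (2 * T)) * t) * nrm f)\<^sup>2"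
  proof -
    have "(exp (- (ln X / (2 * T)) * t))\<^sup>2 = exp (- (ln X * (t / T)))" using T by (simp add: power2_eq_square flip: exp_add)
    then show ?thesis using X by (simp add: power_mult_distrib)
  qed
  finally show ?thesis
    by (rule power2_le_imp_le) (use X in \<open>simp add: nrm_nonneg\<close>)
qed

end

text \<open>The first factor of \<open>cK\<close> is a real number depending on the dimension alone,
  while a \<open>const_expr\<close> has rational literals; it is rounded up to the natural number
  \<open>N0\<close>.\<close>

lemma (in moment_data) cK_le:
  assumes "5 * real DIM('d spacetime) * (2 * real DIM('d spacetime) ^ 5 * (1 + N)\<^sup>2 * (1 + 1 / kap)\<^sup>2)\<^sup>2 \<le> real N0"
  shows "cK \<le> real N0 * ((1 + 1 / c_inf) * (1 + 1 / c_inf) * (1 + c_coll) * ((1 + 1 / c_inf) * (1 + 1 / c_inf) * (1 + c_coll)))"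
proof -
  have "cK = (5 * real DIM('d spacetime) * (2 * real DIM('d spacetime) ^ 5 * (1 + N)\<^sup>2 * (1 + 1 / kap)\<^sup>2)\<^sup>2) *
      ((1 + 1 / c_inf) * (1 + 1 / c_inf) * (1 + c_coll) * ((1 + 1 / c_inf) * (1 + 1 / c_inf) * (1 + c_coll)))"
    unfolding cK_def qK_def nE_def power2_eq_square by (simp only: mult.assoc mult.left_commute mult.commute)
  then show ?thesis using assms c_inf_pos c_coll_nonneg by (simp only:) (intro mult_right_mono, auto)
qed

text \<open>An infimum of real numbers is a lower bound only for families bounded below; positivity
  of \<open>f_inf\<close> and of its average supplies the bound 0 for both infima.\<close>

lemma stationary_state_lower_bound:
  assumes reg: "regular_data L M f_inf" and st: "stationary_state L G M f_inf c_inf c_coll" and v: "norm v \<le> 1"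
  shows "c_inf * vavg f_inf x \<le> f_inf (x, v)"
proof -
  have pos: "0 < f_inf z" "0 < vavg f_inf y" for z y using reg unfolding regular_data_def by blast+
  have ge: "0 \<le> f_inf (y, u) / vavg f_inf y" for y u using pos by (simp add: less_imp_le)
  have ne: "cball (0 :: real ^ 'a) 1 \<noteq> {}" by simp
  have "c_inf \<le> (INF v\<in>cball 0 1. f_inf (x, v) / vavg f_inf x)"
  proof -
    have "(INF x. INF v\<in>cball 0 1. f_inf (x, v) / vavg f_inf x) \<le> (INF v\<in>cball 0 1. f_inf (x, v) / vavg f_inf x)"
      by (rule cINF_lower[OF bdd_belowI[of _ 0]]) (auto intro!: cINF_greatest ge simp: ne)
    then show ?thesis using st by (simp add: stationary_state_def)
  qed
  also have "\<dots> \<le> f_inf (x, v) / vavg f_inf x"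
    using v by (intro cINF_lower bdd_belowI[of _ 0]) (auto intro: ge)
  finally show ?thesis using pos(2)[of x] by (simp add: pos_le_divide_eq)
qed

lemma Fokker_Planck_mlog_bound:
  assumes reg: "regular_data Fokker_Planck M f_inf" and st: "stationary_state Fokker_Planck G M f_inf c_inf c_coll"
    and v: "norm v \<le> 1" and b: "b \<in> Basis"
  shows "\<bar>mlog M b (x, v)\<bar> \<le> c_coll"
proof -
  have M: "C2_in_v M" "0 < M z" for z using reg unfolding regular_data_def by blast+
  have "ennreal (norm (grad_v M (x, v)) / M (x, v)) \<le> collision_bound Fokker_Planck M f_inf"
    unfolding collision_bound.simps using v by (intro SUP_upper2[of x] SUP_upper) auto
  then have "norm (grad_v M (x, v)) / M (x, v) \<le> c_coll" using st by (simp add: stationary_state_def ennreal_le_iff)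
  moreover have "dd M (0, b) (x, v) = grad_v M (x, v) \<bullet> b"
    using grad_v_inner[OF C2_in_v_props(2)[OF M(1)] C1_dder[OF C2_in_v_props(3)[OF M(1), of b]] b] by simp
  moreover have "\<bar>grad_v M (x, v) \<bullet> b\<bar> / M (x, v) \<le> norm (grad_v M (x, v)) / M (x, v)"
    using Basis_le_norm[OF b] M(2)[of "(x, v)"] by (intro divide_right_mono) auto
  ultimately show ?thesis using M(2)[of "(x, v)"] by (simp add: mlog_def abs_divide abs_of_pos)
qed

theorem theorem1:
  fixes L :: collision
  shows "\<exists>e_rate e_const. \<forall>(c :: hyp_const \<Rightarrow> real)
      (G :: 'd::finite phase \<Rightarrow> real ^ 'd) (M :: 'd phase \<Rightarrow> real) (f_inf :: 'd phase \<Rightarrow> real)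
      (S :: real \<Rightarrow> ('d phase \<Rightarrow> real) \<Rightarrow> ('d phase \<Rightarrow> real)).
    smooth G \<and> velocity_densities M \<and> regular_data L M f_inf \<and>
    stationary_state L G M f_inf (c C_inf) (c C_coll) \<and>
    local_coercivity L M f_inf (c Lambda1) \<and>
    spatial_coercivity G f_inf (c Time) (c Lambda2) \<and>
    kinetic_semigroup L G M f_inf S \<longrightarrow>
      0 < const_val c e_rate \<and> 0 < const_val c e_const \<and>
      (\<forall>f_in\<in>L2_inf f_inf. (LINT z|lborel. f_in z) = 0 \<longrightarrow>
        (\<forall>t>0. norm_inf f_inf (S t f_in)
                \<le> const_val c e_const * exp (- const_val c e_rate * t) * norm_inf f_inf f_in))"
proof -
  \<comment> \<open>\<open>N\<close>, \<open>kap\<close> and \<open>N0\<close> are chosen before the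
    data of the equation, so that the expressions built from them depend on the dimension
    only.\<close>
  obtain N where N: "0 < N" "\<And>l j b v. l \<in> Basis \<Longrightarrow> j \<in> Basis \<Longrightarrow> b \<in> Basis \<Longrightarrow>
      \<bar>vtest l (v :: real ^ 'd)\<bar> \<le> N \<and> \<bar>vmm l j v\<bar> \<le> N \<and> \<bar>dd (vtest l) b v\<bar> \<le> N \<and> \<bar>dd (dd (vtest l) b) b v\<bar> \<le> N"
    using vtest_bounds[where 'd = 'd] by blast
  obtain kap where kap: "0 < kap" "\<And>y :: 'd spacetime. kap * (norm y)\<^sup>2 \<le> (LINT v|lborel. eta v * (vmon y v)\<^sup>2)"
    using vtest_coercive[where 'd = 'd] by blast
  obtain N0 where N0: "5 * real DIM('d spacetime) * (2 * real DIM('d spacetime) ^ 5 * (1 + N)\<^sup>2 * (1 + 1 / kap)\<^sup>2)\<^sup>2 \<le> real N0"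
    using real_arch_simple by blast
  \<comment> \<open>The value of \<open>eK\<close> is \<open>K1\<close> with \<open>cK\<close>
    replaced by its bound from \<open>cK_le\<close>: \<open>ea\<close> is 1 + 1 / c_inf and
    \<open>eb\<close> is ea^2 (1 + c_coll). \<open>eX\<close> is the factor by which the squared
    norm drops over a window, so its root is the constant and its logarithm gives the rate.\<close>
  define ea where "ea = Plus (Rational 1) (Divide (Rational 1) (Const C_inf))"
  define eb where "eb = Times (Times ea ea) (Plus (Rational 1) (Const C_coll))"
  define eK where "eK = Times (Const Lambda1) (Plus (Rational 1)
      (Times (Rational 2) (Times (Times (Rational (of_nat N0)) (Times eb eb)) (Maximum (Const Lambda2) (Rational 1)))))"
  define eX where "eX = Divide (Plus eK (Times (Rational 2) (Const Time))) eK"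
  define e_rate where "e_rate = Divide (Logarithm eX) (Times (Rational 2) (Const Time))"
  have main: "0 < const_val c e_rate \<and> 0 < const_val c (Root eX) \<and>
      (\<forall>f_in\<in>L2_inf f_inf. (LINT z|lborel. f_in z) = 0 \<longrightarrow>
        (\<forall>t>0. norm_inf f_inf (S t f_in)
                \<le> const_val c (Root eX) * exp (- const_val c e_rate * t) * norm_inf f_inf f_in))"
    if G: "smooth G" and M: "velocity_densities M" and reg: "regular_data L M f_inf"
      and st: "stationary_state L G M f_inf (c C_inf) (c C_coll)"
      and lc: "local_coercivity L M f_inf (c Lambda1)"
      and sc: "spatial_coercivity G f_inf (c Time) (c Lambda2)" and sg: "kinetic_semigroup L G M f_inf S"
    for c and G :: "'d phase \<Rightarrow> real ^ 'd" and M f_inf S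
  proof -
    interpret kinetic_data L G M f_inf
      by unfold_locales (use G M reg st[unfolded stationary_state_def] in blast)+
    interpret moment_data L G M f_inf "c C_inf" "c C_coll" N kap
    proof
      show "c C_inf * vavg f_inf x \<le> f_inf (x, v)" if "norm v \<le> 1" for x v
        by (rule stationary_state_lower_bound[OF reg st that])
      show "\<bar>mlog M b (x, v)\<bar> \<le> c C_coll" if "L = Fokker_Planck" "norm v \<le> 1" "b \<in> Basis" for b x v
        using Fokker_Planck_mlog_bound that reg st by blast
    qed (use st N kap in \<open>auto simp: stationary_state_def\<close>)
    interpret kinetic_evolution L G M f_inf "c C_inf" "c C_coll" N kap S "c Lambda1"
    proof unfold_locales
      show "in_generator f_inf S \<phi> (kinetic_op L G M \<phi>)" if "test_function UNIV \<phi>" for \<phi>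
        using sg that by (simp add: kinetic_semigroup_def)
      show "kinetic_op L G M (\<lambda>z. \<phi> z - \<psi> z) z = kinetic_op L G M \<phi> z - kinetic_op L G M \<psi> z"
        if "test_function UNIV \<phi>" "test_function UNIV \<psi>" for \<phi> \<psi> z
        using A_lin[OF that, of 1 "-1"] by simp
    qed (use sg lc f_inf_pos f_inf_cont in \<open>auto simp: kinetic_semigroup_def\<close>)
    define K where "K = const_val c eK"
    have T: "0 < c Time" using sc by (simp add: spatial_coercivity_def)
    have K: "K1 (c Lambda2) \<le> K"
    proof -
      have "K = c Lambda1 * (1 + 2 * (real N0 * ((1 + 1 / c C_inf) * (1 + 1 / c C_inf) * (1 + c C_coll) *
          ((1 + 1 / c C_inf) * (1 + 1 / c C_inf) * (1 + c C_coll))) * max (c Lambda2) 1))"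
        by (simp add: K_def eK_def eb_def ea_def)
      then show ?thesis unfolding K1_def mult.assoc[of 2 cK] using lambda1_pos cK_le[OF N0]
        by (simp only:) (intro mult_left_mono add_left_mono mult_right_mono, auto)
    qed
    have K0: "0 < K" using K1_pos[of "c Lambda2"] K by linarith
    have X: "const_val c eX = (K + 2 * c Time) / K" by (simp add: eX_def K_def)
    have X1: "1 < (K + 2 * c Time) / K" using K0 T by simp
    have rate: "const_val c e_rate = ln ((K + 2 * c Time) / K) / (2 * c Time)" by (simp add: e_rate_def X)
    have const: "const_val c (Root eX) = sqrt ((K + 2 * c Time) / K)" by (simp add: X)
    show ?thesis
      unfolding rate const using exponential_decay[OF sc K] X1 T by (auto simp: ln_gt_zero)
  qed
  show ?thesis
    by (rule exI[of _ e_rate], rule exI[of _ "Root eX"], intro allI impI, elim conjE) (rule main)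
qed

end
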